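(* Let $k\subset\mathbb{C}$ be a subfield, let $X$ and $Y$ be smooth projective varieties of dimension $\ge 1$ defined over $k$, and let $f\colon X\times Y\to X\times Y$ be an endomorphism defined over $k$. Assume that at least one of $X$ or $Y$ is of general type. Then for every $P\in(X\times Y)(\overline{k})$, the forward orbit $\mathcal{O}_f(P)=\{f^m(P):m\ge 0\}$ is not Zariski dense in $X\times Y$.
   Context: Varieties are geometrically integral schemes of finite type over $k$. *)

theory Defs
  imports
    "HOL-Analysis.Analysis"
    "HOL-Library.Poly_Mapping"
    "HOL-Library.Extended_Real"
    "HOL-Combinatorics.Permutations"
    "HOL-Computational_Algebra.Polynomial"
    "HOL-Algebra.Algebraic_Closure_Type"
begin

section \<open>Polynomials\<close>

type_synonym 'v mpoly = "('v \<Rightarrow>\<^sub>0 nat) \<Rightarrow>\<^sub>0 complex"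

definition alg_closure_in_C :: "complex set \<Rightarrow> complex set" where
  "alg_closure_in_C k =
     {z. \<exists>p :: complex poly. p \<noteq> 0 \<and> (\<forall>i. Polynomial.coeff p i \<in> k) \<and> poly p z = 0}"

definition mpoly_ring :: "complex set \<Rightarrow> 'v set \<Rightarrow> 'v mpoly ring" where
  "mpoly_ring k N =
     \<lparr>carrier = {F. \<forall>m\<in>Poly_Mapping.keys F. Poly_Mapping.lookup F m \<in> k \<and>
                          Poly_Mapping.keys m \<subseteq> N},
      mult = (*), one = 1, zero = 0, add = (+)\<rparr>"

definition mconst :: "complex \<Rightarrow> 'v mpoly" where
  "mconst c = Poly_Mapping.single 0 c"

definition mvar :: "'v \<Rightarrow> 'v mpoly" where
  "mvar v = Poly_Mapping.single (Poly_Mapping.single v 1) 1"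

definition meval :: "('v \<Rightarrow> complex) \<Rightarrow> 'v mpoly \<Rightarrow> complex" where
  "meval x F = (\<Sum>m\<in>Poly_Mapping.keys F.
     Poly_Mapping.lookup F m * (\<Prod>v\<in>Poly_Mapping.keys m. x v ^ Poly_Mapping.lookup m v))"

definition msubst :: "('v \<Rightarrow> 'w mpoly) \<Rightarrow> 'v mpoly \<Rightarrow> 'w mpoly" where
  "msubst h F = (\<Sum>m\<in>Poly_Mapping.keys F.
     mconst (Poly_Mapping.lookup F m) * (\<Prod>v\<in>Poly_Mapping.keys m. h v ^ Poly_Mapping.lookup m v))"

definition mderiv :: "'v \<Rightarrow> 'v mpoly \<Rightarrow> 'v mpoly" where
  "mderiv v F =
     (\<Sum>m\<in>Poly_Mapping.keys F. Poly_Mapping.single (m - Poly_Mapping.single v 1)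
                                   (of_nat (Poly_Mapping.lookup m v) * Poly_Mapping.lookup F m))"

definition mdeg :: "('v \<Rightarrow>\<^sub>0 nat) \<Rightarrow> nat" where
  "mdeg m = (\<Sum>v\<in>Poly_Mapping.keys m. Poly_Mapping.lookup m v)"

definition homogeneous_of_degree :: "nat \<Rightarrow> 'v mpoly \<Rightarrow> bool" where
  "homogeneous_of_degree e F \<longleftrightarrow> (\<forall>m\<in>Poly_Mapping.keys F. mdeg m = e)"

definition homogeneous_part :: "nat \<Rightarrow> 'v mpoly \<Rightarrow> 'v mpoly" where
  "homogeneous_part e F = (\<Sum>m | m \<in> Poly_Mapping.keys F \<and> mdeg m = e.
     Poly_Mapping.single m (Poly_Mapping.lookup F m))"

section \<open>Projective varieties over a subfield of the complex numbers\<close>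

text \<open>
  A closed subscheme of the projective space over \<open>k\<close> with homogeneous coordinates indexed by
  the finite set \<open>coords V\<close> is given by its homogeneous ideal \<open>hom_ideal V\<close>, i.e.
  \<open>V = Proj (k[coords V] / hom_ideal V)\<close>.
\<close>

record 'v proj_subscheme =
  coords :: "'v set"
  hom_ideal :: "'v mpoly set"

text \<open>
  Geometric integrality: the base change of \<open>V\<close> to the algebraic closure of \<open>k\<close> is
  the \<open>Proj\<close> of a domain, and it is nonempty (the ideal does not contain the irrelevant
  ideal).  A prime ideal of this kind is saturated, so such ideals correspond bijectively to the
  geometrically integral closed subschemes of projective space.
\<close>

definition projective_variety :: "complex set \<Rightarrow> 'v proj_subscheme \<Rightarrow> bool" where
  "projective_variety k V \<longleftrightarrow>
     finite (coords V) \<and>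
     ideal (hom_ideal V) (mpoly_ring k (coords V)) \<and>
     (\<forall>F\<in>hom_ideal V. \<forall>e. homogeneous_part e F \<in> hom_ideal V) \<and>
     primeideal (genideal (mpoly_ring (alg_closure_in_C k) (coords V)) (hom_ideal V))
       (mpoly_ring (alg_closure_in_C k) (coords V)) \<and>
     \<not> mvar ` coords V \<subseteq> hom_ideal V"

text \<open>
  Points with values in the algebraic closure \<open>K\<close> of \<open>k\<close>: a point is the set of all its
  homogeneous coordinate vectors in \<open>K\<close>, extended by \<open>0\<close> outside \<open>coords V\<close>.
\<close>

definition hom_vectors :: "complex set \<Rightarrow> 'v proj_subscheme \<Rightarrow> ('v \<Rightarrow> complex) set" where
  "hom_vectors k V =
     {x. (\<forall>v. x v \<in> alg_closure_in_C k) \<and> (\<forall>v. v \<notin> coords V \<longrightarrow> x v = 0) \<and>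
         (\<exists>v. x v \<noteq> 0) \<and> (\<forall>F\<in>hom_ideal V. meval x F = 0)}"

definition proj_point :: "complex set \<Rightarrow> ('v \<Rightarrow> complex) \<Rightarrow> ('v \<Rightarrow> complex) set" where
  "proj_point k x = {(\<lambda>v. c * x v) | c. c \<in> alg_closure_in_C k \<and> c \<noteq> 0}"

definition points :: "complex set \<Rightarrow> 'v proj_subscheme \<Rightarrow> ('v \<Rightarrow> complex) set set" where
  "points k V = proj_point k ` hom_vectors k V"

text \<open>
  The Zariski topology of the \<open>k\<close>-scheme \<open>V\<close>, induced on its geometric points: the basic open
  sets are the nonvanishing loci of homogeneous polynomials with coefficients in \<open>k\<close>.
\<close>

definition zariski :: "complex set \<Rightarrow> 'v proj_subscheme \<Rightarrow> ('v \<Rightarrow> complex) set topology" where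
  "zariski k V = topology_generated_by
     {{proj_point k x | x. x \<in> hom_vectors k V \<and> meval x F \<noteq> 0} | F.
        F \<in> carrier (mpoly_ring k (coords V)) \<and> (\<exists>e. homogeneous_of_degree e F)}"

text \<open>
  Morphisms over \<open>k\<close>, as maps on geometric points: locally for the Zariski topology over \<open>k\<close>
  they are given by homogeneous polynomials of equal degree with coefficients in \<open>k\<close>.
\<close>

definition morphism_over ::
  "complex set \<Rightarrow> 'v proj_subscheme \<Rightarrow> 'w proj_subscheme \<Rightarrow>
     (('v \<Rightarrow> complex) set \<Rightarrow> ('w \<Rightarrow> complex) set) \<Rightarrow> bool" where
  "morphism_over k V W f \<longleftrightarrow>
     f \<in> points k V \<rightarrow> points k W \<and>
     (\<forall>x\<in>hom_vectors k V. \<exists>e F.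
        (\<forall>w\<in>coords W. F w \<in> carrier (mpoly_ring k (coords V)) \<and>
                       homogeneous_of_degree e (F w)) \<and>
        (\<exists>w\<in>coords W. meval x (F w) \<noteq> 0) \<and>
        (\<forall>y\<in>hom_vectors k V. (\<exists>w\<in>coords W. meval y (F w) \<noteq> 0) \<longrightarrow>
           f (proj_point k y) =
             proj_point k (\<lambda>w. if w \<in> coords W then meval y (F w) else 0)))"

text \<open>
  The fibre product over \<open>k\<close>, embedded by the Segre embedding: its homogeneous ideal is the
  kernel of the map from \<open>k[z\<^sub>v\<^sub>w]\<close> to the tensor product over \<open>k\<close> of the two homogeneous
  coordinate rings that sends \<open>z\<^sub>v\<^sub>w\<close> to \<open>x\<^sub>v \<otimes> y\<^sub>w\<close>.
\<close>

definition product_variety ::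
  "complex set \<Rightarrow> 'v proj_subscheme \<Rightarrow> 'w proj_subscheme \<Rightarrow> ('v \<times> 'w) proj_subscheme" where
  "product_variety k V W =
     \<lparr>coords = coords V \<times> coords W,
      hom_ideal =
        {F \<in> carrier (mpoly_ring k (coords V \<times> coords W)).
           msubst (\<lambda>(v, w). mvar (Inl v) * mvar (Inr w)) F \<in>
             genideal (mpoly_ring k (Inl ` coords V \<union> Inr ` coords W))
               (msubst (\<lambda>v. mvar (Inl v)) ` hom_ideal V \<union>
                msubst (\<lambda>w. mvar (Inr w)) ` hom_ideal W)}\<rparr>"

section \<open>Function field, dimension and smoothness\<close>

text \<open>
  Rational functions on \<open>V\<close> are classes of fractions \<open>A / B\<close> of homogeneous polynomials over
  \<open>k\<close> of the same degree, with \<open>B\<close> not in the ideal of \<open>V\<close>.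
\<close>

type_synonym 'v ratfun = "('v mpoly \<times> 'v mpoly) set"

definition fractions :: "complex set \<Rightarrow> 'v proj_subscheme \<Rightarrow> ('v mpoly \<times> 'v mpoly) set" where
  "fractions k V =
     {(A, B). A \<in> carrier (mpoly_ring k (coords V)) \<and> B \<in> carrier (mpoly_ring k (coords V)) \<and>
        (\<exists>e. homogeneous_of_degree e A \<and> homogeneous_of_degree e B) \<and> B \<notin> hom_ideal V}"

definition fraction_rel ::
  "complex set \<Rightarrow> 'v proj_subscheme \<Rightarrow> (('v mpoly \<times> 'v mpoly) \<times> ('v mpoly \<times> 'v mpoly)) set" where
  "fraction_rel k V =
     {((A, B), (C, D)). (A, B) \<in> fractions k V \<and> (C, D) \<in> fractions k V \<and>
        A * D - C * B \<in> hom_ideal V}"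

definition function_field :: "complex set \<Rightarrow> 'v proj_subscheme \<Rightarrow> 'v ratfun ring" where
  "function_field k V =
     \<lparr>carrier = fractions k V // fraction_rel k V,
      mult = (\<lambda>r s. \<Union>(A, B)\<in>r. \<Union>(C, D)\<in>s. fraction_rel k V `` {(A * C, B * D)}),
      one = fraction_rel k V `` {(1, 1)},
      zero = fraction_rel k V `` {(0, 1)},
      add = (\<lambda>r s. \<Union>(A, B)\<in>r. \<Union>(C, D)\<in>s. fraction_rel k V `` {(A * D + C * B, B * D)})\<rparr>"

definition ff_const :: "complex set \<Rightarrow> 'v proj_subscheme \<Rightarrow> complex \<Rightarrow> 'v ratfun" where
  "ff_const k V c = fraction_rel k V `` {(mconst c, 1)}"

text \<open>The local ring of \<open>V\<close> at the closed point below the geometric point with coordinates \<open>x\<close>.\<close>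

definition local_ring_at :: "complex set \<Rightarrow> 'v proj_subscheme \<Rightarrow> ('v \<Rightarrow> complex) \<Rightarrow> 'v ratfun set"
  where
  "local_ring_at k V x =
     {r \<in> carrier (function_field k V). \<exists>(A, B)\<in>r. meval x B \<noteq> 0}"

text \<open>Polynomials here have the rational functions themselves as their variables.\<close>

definition ff_eval :: "complex set \<Rightarrow> 'v proj_subscheme \<Rightarrow> 'v ratfun mpoly \<Rightarrow> 'v ratfun" where
  "ff_eval k V p =
     finsum (function_field k V)
       (\<lambda>m. ff_const k V (Poly_Mapping.lookup p m) \<otimes>\<^bsub>function_field k V\<^esub>
            finprod (function_field k V)
              (\<lambda>q. q [^]\<^bsub>function_field k V\<^esub> Poly_Mapping.lookup m q) (Poly_Mapping.keys m))
       (Poly_Mapping.keys p)"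

definition alg_independent :: "complex set \<Rightarrow> 'v proj_subscheme \<Rightarrow> 'v ratfun set \<Rightarrow> bool" where
  "alg_independent k V T \<longleftrightarrow>
     (\<forall>p\<in>carrier (mpoly_ring k T). ff_eval k V p = \<zero>\<^bsub>function_field k V\<^esub> \<longrightarrow> p = 0)"

text \<open>The transcendence degree over \<open>k\<close> of the subfield \<open>k(Q)\<close> of the function field.\<close>

definition trans_degree :: "complex set \<Rightarrow> 'v proj_subscheme \<Rightarrow> 'v ratfun set \<Rightarrow> nat" where
  "trans_degree k V Q = Max {card T | T. T \<subseteq> Q \<and> finite T \<and> alg_independent k V T}"

definition variety_dim :: "complex set \<Rightarrow> 'v proj_subscheme \<Rightarrow> nat" where
  "variety_dim k V = trans_degree k V (carrier (function_field k V))"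

text \<open>
  Smoothness over \<open>k\<close>: at every geometric point the Jacobian matrix has rank equal to the
  codimension of \<open>V\<close> in projective space, which is \<open>card (coords V) - 1 - dim V\<close>.
\<close>

definition jacobian_rank :: "'v proj_subscheme \<Rightarrow> ('v \<Rightarrow> complex) \<Rightarrow> nat" where
  "jacobian_rank V x =
     vector_space.dim (\<lambda>(c :: complex) (u :: 'v \<Rightarrow>\<^sub>0 complex). Poly_Mapping.map ((*) c) u)
       {(\<Sum>v\<in>coords V. Poly_Mapping.single v (meval x (mderiv v F))) | F. F \<in> hom_ideal V}"

definition smooth_variety :: "complex set \<Rightarrow> 'v proj_subscheme \<Rightarrow> bool" where
  "smooth_variety k V \<longleftrightarrow>
     (\<forall>x\<in>hom_vectors k V. jacobian_rank V x + variety_dim k V + 1 = card (coords V))"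

section \<open>Pluricanonical forms, Kodaira dimension and general type\<close>

definition derivations :: "complex set \<Rightarrow> 'v proj_subscheme \<Rightarrow> ('v ratfun \<Rightarrow> 'v ratfun) set" where
  "derivations k V =
     (let K = function_field k V in
      {D \<in> carrier K \<rightarrow>\<^sub>E carrier K.
         (\<forall>a\<in>carrier K. \<forall>b\<in>carrier K. D (a \<oplus>\<^bsub>K\<^esub> b) = D a \<oplus>\<^bsub>K\<^esub> D b) \<and>
         (\<forall>a\<in>carrier K. \<forall>b\<in>carrier K.
            D (a \<otimes>\<^bsub>K\<^esub> b) = (a \<otimes>\<^bsub>K\<^esub> D b) \<oplus>\<^bsub>K\<^esub> (b \<otimes>\<^bsub>K\<^esub> D a)) \<and>
         (\<forall>c\<in>k. D (ff_const k V c) = \<zero>\<^bsub>K\<^esub>)})"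

definition derivation_frames ::
  "complex set \<Rightarrow> 'v proj_subscheme \<Rightarrow> (nat \<Rightarrow> 'v ratfun \<Rightarrow> 'v ratfun) set" where
  "derivation_frames k V = {..<variety_dim k V} \<rightarrow>\<^sub>E derivations k V"

definition ring_det :: "('a, 'b) ring_scheme \<Rightarrow> nat \<Rightarrow> (nat \<Rightarrow> nat \<Rightarrow> 'a) \<Rightarrow> 'a" where
  "ring_det R n a =
     finsum R (\<lambda>p. (if evenperm p then \<one>\<^bsub>R\<^esub> else \<ominus>\<^bsub>R\<^esub> \<one>\<^bsub>R\<^esub>) \<otimes>\<^bsub>R\<^esub>
                   finprod R (\<lambda>i. a i (p i)) {..<n})
       {p. p permutes {..<n}}"

text \<open>
  Let \<open>d = dim V\<close>.  The derivations of the function field \<open>k(V)\<close> over \<open>k\<close> are the dual of the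
  module of Kaehler differentials, so a rational \<open>d\<close>-form is an alternating form on
  \<open>d\<close>-tuples of derivations; \<open>dt\<^sub>0 \<and> \<dots> \<and> dt\<^sub>d\<^sub>-\<^sub>1\<close> is \<open>(D\<^sub>i) \<mapsto> det (D\<^sub>i t\<^sub>j)\<close>.  Rational \<open>d\<close>-forms
  are a one-dimensional space, hence their \<open>m\<close>-th tensor power embeds into functions
  of \<open>(D\<^sub>i)\<close>, with \<open>g (dt\<^sub>0 \<and> \<dots> \<and> dt\<^sub>d\<^sub>-\<^sub>1)\<^sup>m\<close> being \<open>(D\<^sub>i) \<mapsto> g det (D\<^sub>i t\<^sub>j)\<^sup>m\<close>.
\<close>

definition pluri_form ::
  "complex set \<Rightarrow> 'v proj_subscheme \<Rightarrow> nat \<Rightarrow> 'v ratfun \<Rightarrow> (nat \<Rightarrow> 'v ratfun) \<Rightarrow>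
     (nat \<Rightarrow> 'v ratfun \<Rightarrow> 'v ratfun) \<Rightarrow> 'v ratfun" where
  "pluri_form k V m g t =
     (\<lambda>D\<in>derivation_frames k V.
        g \<otimes>\<^bsub>function_field k V\<^esub>
        (ring_det (function_field k V) (variety_dim k V) (\<lambda>i j. D i (t j)))
          [^]\<^bsub>function_field k V\<^esub> m)"

text \<open>
  The space of global sections of the \<open>m\<close>-th power of the canonical sheaf of a smooth \<open>V\<close>.  At
  each point \<open>x\<close> the stalk of this invertible sheaf is generated over the local ring by
  \<open>(dt\<^sub>0 \<and> \<dots> \<and> dt\<^sub>d\<^sub>-\<^sub>1)\<^sup>m\<close> for suitable \<open>t\<^sub>j\<close> in the local ring, so its elements are exactly the forms
  \<open>g (dt\<^sub>0 \<and> \<dots> \<and> dt\<^sub>d\<^sub>-\<^sub>1)\<^sup>m\<close> with \<open>g\<close> and all \<open>t\<^sub>j\<close> in the local ring.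
\<close>

definition pluricanonical_sections ::
  "complex set \<Rightarrow> 'v proj_subscheme \<Rightarrow> nat \<Rightarrow>
     ((nat \<Rightarrow> 'v ratfun \<Rightarrow> 'v ratfun) \<Rightarrow> 'v ratfun) set" where
  "pluricanonical_sections k V m =
     {\<omega>. \<forall>x\<in>hom_vectors k V.
        \<exists>g\<in>local_ring_at k V x. \<exists>t\<in>{..<variety_dim k V} \<rightarrow> local_ring_at k V x.
          \<omega> = pluri_form k V m g t}"

definition nonzero_sections ::
  "complex set \<Rightarrow> 'v proj_subscheme \<Rightarrow> nat \<Rightarrow>
     ((nat \<Rightarrow> 'v ratfun \<Rightarrow> 'v ratfun) \<Rightarrow> 'v ratfun) set" where
  "nonzero_sections k V m =
     {\<omega> \<in> pluricanonical_sections k V m.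
        \<exists>D\<in>derivation_frames k V. \<omega> D \<noteq> \<zero>\<^bsub>function_field k V\<^esub>}"

text \<open>
  The quotients of sections generate over \<open>k\<close> the function field of the image of the \<open>m\<close>-th
  pluricanonical map, so the dimension of that image is the transcendence degree of the quotients.
\<close>

definition section_quotients :: "complex set \<Rightarrow> 'v proj_subscheme \<Rightarrow> nat \<Rightarrow> 'v ratfun set" where
  "section_quotients k V m =
     {q \<in> carrier (function_field k V).
        \<exists>\<omega>\<in>pluricanonical_sections k V m. \<exists>\<eta>\<in>nonzero_sections k V m.
          \<forall>D\<in>derivation_frames k V. \<omega> D = q \<otimes>\<^bsub>function_field k V\<^esub> \<eta> D}"

definition pluricanonical_image_dim :: "complex set \<Rightarrow> 'v proj_subscheme \<Rightarrow> nat \<Rightarrow> nat" where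
  "pluricanonical_image_dim k V m = trans_degree k V (section_quotients k V m)"

text \<open>The supremum of the empty set is \<open>-\<infinity>\<close>: this is the case where all plurigenera vanish.\<close>

definition kodaira_dim :: "complex set \<Rightarrow> 'v proj_subscheme \<Rightarrow> ereal" where
  "kodaira_dim k V =
     (SUP m\<in>{m. m \<ge> 1 \<and> nonzero_sections k V m \<noteq> {}}.
        ereal (real (pluricanonical_image_dim k V m)))"

definition general_type :: "complex set \<Rightarrow> 'v proj_subscheme \<Rightarrow> bool" where
  "general_type k V \<longleftrightarrow> kodaira_dim k V = ereal (real (variety_dim k V))"

definition forward_orbit :: "('a \<Rightarrow> 'a) \<Rightarrow> 'a \<Rightarrow> 'a set" where
  "forward_orbit f P = {(f ^^ m) P | m. True}"

end

theory Submission
  imports Defs "Jordan_Normal_Form.Determinant"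
begin

text \<open>
  Suppose that the orbit of \<open>P\<close> is dense and, say, \<open>V\<close> is of general type.  Then all \<open>g\<^sub>n = pr \<circ> f\<^sup>n\<close> are dominant
  morphisms from the product \<open>Z\<close> to \<open>V\<close>, and an algebraic version of the finiteness theorem of Kobayashi and Ochiai applies.
  Pluricanonical forms of \<open>V\<close> pull back along \<open>g\<^sub>n\<close> to sections over \<open>Z\<close> whose poles are bounded independently of \<open>n\<close>,
  so they and suitably scaled coordinates of \<open>g\<^sub>n\<close> at a generic point of \<open>Z\<close> lie in one finite-dimensional space.
  The coefficients of the pulled back forms in a basis define a nonstandard constant; if it were not standard, some
  place would send it to infinity, but the limit of \<open>g\<^sub>n\<close> at this place is again a point of \<open>V\<close>, where the forms are regular.
  Hence a transcendental quotient \<open>A / B\<close> of forms has finitely many pullbacks under the \<open>g\<^sub>n\<close>.  Its values along the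
  projected orbit are finitely many algebraic numbers, which puts the orbit on a proper closed subset defined over \<open>k\<close>.

  A generic point is an ultralimit of geometric points, and varieties are only evaluated at such points.
\<close>

hide_const (open) Module.smult UnivPoly.up_ring.coeff UnivPoly.up_ring.monom UnivPoly.deg Poly_Mapping.degree Polynomials.lead_coeff Polynomials.degree

text \<open>The obstacle is uniformity in n: the polynomials defining \<open>f\<close> iterated n
  times may have unbounded degree, so no pole bound can be read off from them. It comes from the
  points instead. A place specializes the generic point of Z to a geometric point of Z, where some
  representation of g_n is defined; the only denominators left are those of derivatives of ratios of
  coordinates of Z, and these do not involve n. Forms are evaluated on derivations of one ambient
  field. Thus all g_n are tested on the same derivations, and a change of frame costs only a
  determinant. These derivations also vanish on the nonstandard constants, so a place of the
  constants extends to the ambient ultrapower without producing poles in derivatives. Constants are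
  taken in the algebraic closure of \<open>k\<close>, whereas the equations of the orbit must have
  coefficients in \<open>k\<close>. The passage back replaces a value of A / B by a polynomial over
  \<open>k\<close> that has it as a root.\<close>

abbreviation "hv \<equiv> hom_vectors"
abbreviation "kbar \<equiv> alg_closure_in_C"
abbreviation "ppt \<equiv> proj_point"
abbreviation "hpt \<equiv> homogeneous_part"
abbreviation "psec \<equiv> pluricanonical_sections"
abbreviation "cof \<equiv> poly.coeff"


section \<open>Polynomials over subrings\<close>

text \<open>Subrings are sets with closure properties, because polynomial rings, subfields and
  valuation rings inside one type have to be compared by inclusion.\<close>

definition srg :: "'a::comm_ring_1 set => bool" where
 "srg A \<longleftrightarrow> 1 : A & (ALL x:A. ALL y:A. x + y : A & x * y : A) & (ALL x:A. - x : A)"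

definition sfd :: "'a::field set => bool" where
 "sfd A \<longleftrightarrow> srg A & (ALL x:A. inverse x : A)"

lemma srgD:
 assumes "srg A"
 shows "1 : A" "0 : A" "x : A ==> y : A ==> x + y : A" "x : A ==> y : A ==> x * y : A"
 "x : A ==> - x : A" "x : A ==> y : A ==> x - y : A" "x : A ==> x ^ n : A"
proof -
 show 1: "1 : A" and 2: "x : A ==> y : A ==> x + y : A" and 3: "x : A ==> y : A ==> x * y : A"
 and 4: "x : A ==> - x : A" for x y
 using assms by (auto simp: srg_def)
 show "0 : A" using 2[OF 1 4[OF 1]] by simp
 show "x : A ==> y : A ==> x - y : A" for x y using 2[of x "- y"] 4 by simp
 show "x : A ==> x ^ n : A" by (induct n) (auto simp: 1 3)
qed

lemma srg_sum: "srg A ==> (!!i. i : I ==> f i : A) ==> sum f I : A"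
 by (induct I rule: infinite_finite_induct) (auto simp: srgD)

lemma srg_prod: "srg A ==> (!!i. i : I ==> f i : A) ==> prod f I : A"
 by (induct I rule: infinite_finite_induct) (auto simp: srgD)

lemma srg_of_nat: "srg A ==> of_nat n : A"
 by (induct n) (auto simp: srgD)

lemma sfdD:
 assumes "sfd A"
 shows "srg A" "x : A ==> inverse x : A" "x : A ==> y : A ==> x / y : A"
 using assms by (auto simp: sfd_def divide_inverse srgD)

lemma srg_UNIV: "srg UNIV" by (simp add: srg_def)

definition PA :: "'a::comm_ring_1 set => 'a poly set" where
 "PA A = {p. ALL i. cof p i : A}"

lemma PA_D: "p : PA A ==> cof p i : A" by (simp add: PA_def)

lemma PA_mono: "A \<subseteq> B ==> PA A \<subseteq> PA B" by (auto simp: PA_def)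

lemma PA_pCons: "srg A ==> pCons a p : PA A \<longleftrightarrow> a : A & p : PA A"
 by (auto simp: PA_def coeff_pCons split: nat.splits)

lemma PA_0: "srg A ==> 0 : PA A" by (simp add: PA_def srgD)

lemma PA_1: "srg A ==> 1 : PA A" by (simp add: PA_def srgD coeff_1)

lemma PA_ops:
 assumes "srg A"
 shows "p : PA A ==> q : PA A ==> p + q : PA A" "p : PA A ==> q : PA A ==> p - q : PA A"
 "p : PA A ==> - p : PA A"
 "p : PA A ==> q : PA A ==> p * q : PA A" "a : A ==> p : PA A ==> smult a p : PA A"
 "a : A ==> Polynomial.monom a n : PA A"
 using assms by (auto simp: PA_def srgD coeff_mult srg_sum coeff_monom)

lemma PA_pderiv: "srg A ==> p : PA A ==> pderiv (p :: 'a::idom poly) : PA A"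
 by (auto simp: PA_def coeff_pderiv srgD srg_of_nat simp del: of_nat_Suc)

lemma poly_in_srg: "srg A ==> p : PA A ==> x : A ==> poly p x : A"
 by (simp add: poly_altdef srg_sum srgD PA_D)

lemma srg_poly_image:
 assumes "srg A" shows "srg {poly p x |p. p : PA A}"
 unfolding srg_def
proof (intro conjI ballI)
 show "1 : {poly p x |p. p : PA A}" using PA_1[OF assms] by force
next
 fix a b assume "a : {poly p x |p. p : PA A}" "b : {poly p x |p. p : PA A}"
 then obtain p q where "p : PA A" "q : PA A" "a = poly p x" "b = poly q x" by auto
 thus "a + b : {poly p x |p. p : PA A}" "a * b : {poly p x |p. p : PA A}"
 using PA_ops(1,4)[OF assms, of p q] by (auto intro: exI[of _ "p + q"] exI[of _ "p * q"])
next
 fix a assume "a : {poly p x |p. p : PA A}"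
 then obtain p where "p : PA A" "a = poly p x" by auto
 thus "- a : {poly p x |p. p : PA A}" 
 using PA_ops(3)[OF assms, of p] by (auto intro: exI[of _ "- p"])
qed

text \<open>Each cancellation of a leading term costs one factor \<open>lead_coeff p0\<close>, so
  nothing has to be inverted. The coefficient sets in question include domains and ranges of partial
  homomorphisms, which need not be fields.\<close>

lemma pseudo_division:
 assumes A: "srg A" and p0: "p0 : PA A" and p: "p : PA A"
 shows "EX k Q R. Q : PA A & R : PA A & smult (lead_coeff p0 ^ k) p = Q * p0 + R &
 (R = 0 \<or> degree R < degree p0)"
 using p
proof (induct "degree p" arbitrary: p rule: less_induct)
 case (less p)
 show ?case
 proof (cases "p = 0 \<or> degree p < degree p0")
 case True
 show ?thesis
 by (rule exI[of _ 0], rule exI[of _ 0], rule exI[of _ p]) (use True less(2) PA_0[OF A] in auto)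
 next
 case False
 let ?n = "degree p" and ?m = "degree p0"
 define h where "h = Polynomial.monom (lead_coeff p) (?n - ?m)"
 define p1 where "p1 = smult (lead_coeff p0) p - h * p0"
 have h: "h : PA A" unfolding h_def using less(2) by (auto intro!: PA_ops A PA_D)
 have p1A: "p1 : PA A" unfolding p1_def using less(2) h by (auto intro!: PA_ops A PA_D p0)
 have nm: "?m <= ?n" using False by simp
 have deg: "degree p1 <= ?n"
 proof -
 have "degree (h * p0) <= ?n"
 using degree_mult_le[of h p0] degree_monom_le[of "lead_coeff p" "?n - ?m"] nm
 unfolding h_def by linarith
 thus ?thesis unfolding p1_def by (intro degree_diff_le degree_smult_le)
 qed
 have "cof (h * p0) ?n = lead_coeff p * lead_coeff p0"
 unfolding h_def using nm by (simp add: coeff_monom_mult)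
 hence c: "cof p1 ?n = 0" unfolding p1_def by (simp add: mult.commute)
 have "p1 = 0 \<or> degree p1 < ?n"
 using deg c by (metis leading_coeff_0_iff le_neq_implies_less)
 then obtain k Q R where kQR: "Q : PA A" "R : PA A" "smult (lead_coeff p0 ^ k) p1 = Q * p0 + R"
 "R = 0 \<or> degree R < degree p0"
 proof
 assume "p1 = 0"
 thus ?thesis using that[of 0 0 0] PA_0[OF A] by auto
 next
 assume "degree p1 < ?n"
 thus ?thesis using less(1)[OF _ p1A] that by blast
 qed
 have "smult (lead_coeff p0 ^ Suc k) p = smult (lead_coeff p0 ^ k) (p1 + h * p0)"
 unfolding p1_def by (simp add: mult.commute)
 also have "\<dots> = (Q + smult (lead_coeff p0 ^ k) h) * p0 + R"
 using kQR by (simp add: smult_add_right algebra_simps)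
 finally show ?thesis
 by (rule_tac exI[of _ "Suc k"], rule_tac exI[of _ "Q + smult (lead_coeff p0 ^ k) h"], rule_tac exI[of _ R])
 (use kQR h PA_ops[OF A] srgD(7)[OF A PA_D[OF p0]] in auto)
 qed
qed

section \<open>Derivations and algebraic dependence\<close>

definition der :: "('a::field => 'a) => bool" where
 "der D \<longleftrightarrow> (ALL x y. D (x + y) = D x + D y) & (ALL x y. D (x * y) = x * D y + y * D x)"

definition algb :: "'a::field set => 'a => bool" where
 "algb S x \<longleftrightarrow> (EX p:PA S. p ~= 0 & poly p x = 0)"

lemma derD:
 assumes "der D"
 shows "D (x + y) = D x + D y" "D (x * y) = x * D y + y * D x" "D 0 = 0" "D 1 = 0" "D (- x) = - D x"
 "D (x - y) = D x - D y"
proof -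
 show 1: "D (x + y) = D x + D y" and 2: "D (x * y) = x * D y + y * D x" for x y
 using assms by (auto simp: der_def)
 show 3: "D 0 = 0" using 1[of 0 0] by (metis add_cancel_right_right add_0)
 show "D 1 = 0" using 2[of 1 1] by (metis add_cancel_right_right mult_1)
 show 4: "D (- x) = - D x" for x using 1[of x "- x"] 3 by (simp add: eq_neg_iff_add_eq_0 add.commute)
 show "D (x - y) = D x - D y" using 1[of x "- y"] 4[of y] by simp
qed

lemma der_sum: "der D ==> D (sum f I) = (SUM i:I. D (f i))"
 by (induct I rule: infinite_finite_induct) (auto simp: derD)

lemma der_inverse: 
 assumes "der D" shows "D (inverse x) = - D x / x\<^sup>2"
proof (cases "x = 0")
 case False
 have "D (x * inverse x) = 0" using False derD(4)[OF assms] by simp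
 hence "x * D (inverse x) + inverse x * D x = 0" using derD(2)[OF assms] by simp
 hence "D (inverse x) = - (inverse x * D x) / x" using False
 by (metis add_eq_0_iff2 nonzero_mult_div_cancel_left)
 thus ?thesis using False by (simp add: field_simps power2_eq_square)
qed (simp add: derD(3)[OF assms])

lemma der_power: "der D ==> D (x ^ n) = of_nat n * x ^ (n - 1) * D x"
proof (induct n)
 case (Suc n)
 have "D (x ^ Suc n) = x * (of_nat n * x ^ (n - 1) * D x) + x ^ n * D x"
 using Suc by (simp add: derD)
 also have "\<dots> = of_nat (Suc n) * x ^ n * D x"
 by (cases n) (auto simp: algebra_simps)
 finally show ?case by simp
qed (auto simp: derD)

lemma der_poly: "der D ==> D (poly p x) = poly (map_poly D p) x + poly (pderiv p) x * D x"
proof (induct p)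
 case (pCons a p)
 have "map_poly D (pCons a p) = pCons (D a) (map_poly D p)"
 using derD(3)[OF pCons(3)] by (metis map_poly_pCons)
 thus ?case using pCons by (simp add: derD pderiv_pCons algebra_simps)
qed (auto simp: derD)

lemma der_poly_const:
 assumes "der D" "!!s. s : S ==> D s = 0" "p : PA S"
 shows "D (poly p x) = poly (pderiv p) x * D x"
proof -
 have "map_poly D p = 0" using assms by (intro poly_eqI) (simp add: coeff_map_poly derD PA_D)
 thus ?thesis using der_poly[OF assms(1)] by simp
qed

lemma der_comb: "der D ==> der D' ==> der (%x. a * D x + b * D' x)"
 by (auto simp: der_def algebra_simps)

lemma der_bracket: "der D ==> der D' ==> der (%x. D (D' x) - D' (D x))"
 by (auto simp: der_def algebra_simps)

lemma der_lincomb: "finite I ==> (!!i. i : I ==> der (D i)) ==> der (%x. SUM i:I. a i * D i x)"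
 unfolding der_def by (auto simp: sum.distrib sum_distrib_left algebra_simps intro!: sum.cong)

lemma algb_mono: "S \<subseteq> T ==> algb S x ==> algb T x" by (auto simp: algb_def PA_def)

lemma algb_self: "srg S ==> x : S ==> algb S x"
 unfolding algb_def by (rule bexI[of _ "[:- x, 1:]"]) (auto simp: PA_pCons PA_0 srgD)

lemma algb_minimal:
 assumes "algb S x"
 obtains p where "p : PA S" "p ~= 0" "poly p x = 0"
 "ALL q:PA S. q ~= 0 --> poly q x = 0 --> degree p <= degree q"
proof -
 obtain p0 where "p0 : PA S & p0 ~= 0 & poly p0 x = 0" using assms by (auto simp: algb_def)
 from arg_min_natI[of "%p. p : PA S & p ~= 0 & poly p x = 0", OF this, of degree]
 arg_min_nat_le[of "%p. p : PA S & p ~= 0 & poly p x = 0" _ degree]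
 show ?thesis using that by blast
qed

text \<open>In characteristic 0 the derivative of a nonconstant relation of least degree is a
  nonzero polynomial of smaller degree, so it cannot be a relation again.\<close>

lemma min_pderiv_nz:
 fixes x :: "'a::field_char_0"
 assumes "srg S" "p : PA S" "p ~= 0" "poly p x = 0"
 "ALL q:PA S. q ~= 0 --> poly q x = 0 --> degree p <= degree q"
 shows "poly (pderiv p) x ~= 0"
proof
 assume "poly (pderiv p) x = 0"
 moreover have "degree p ~= 0"
 proof
 assume "degree p = 0"
 then obtain c where "p = [:c:]" by (auto elim: degree_eq_zeroE)
 thus False using assms(3,4) by simp
 qed
 hence "pderiv p ~= 0" "degree (pderiv p) < degree p"
 by (auto simp: pderiv_eq_0_iff degree_pderiv)
 ultimately show False using assms(5) PA_pderiv[OF assms(1,2)] by fastforce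
qed

lemma der_algb_zero:
 fixes x :: "'a::field_char_0"
 assumes S: "srg S" and D: "der D" and z: "!!s. s : S ==> D s = 0" and x: "algb S x"
 shows "D x = 0"
proof -
 obtain p where p: "p : PA S" "p ~= 0" "poly p x = 0"
 "ALL q:PA S. q ~= 0 --> poly q x = 0 --> degree p <= degree q"
 using algb_minimal[OF x] by blast
 have "D (poly p x) = 0" by (simp only: p(3) derD(3)[OF D])
 hence "poly (pderiv p) x * D x = 0" by (simp only: der_poly_const[OF D z p(1)])
 moreover have "poly (pderiv p) x ~= 0" by (rule min_pderiv_nz[OF S p(1-3)]) (rule p(4))
 ultimately show ?thesis by simp
qed

text \<open>A derivation on a subring is handled through its graph, a subring of the dual numbers.\<close>

definition dgraph :: "('a::field \<times> 'a) set => bool" where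
 "dgraph G \<longleftrightarrow> (1, 0) : G & (ALL (x, u):G. ALL (y, v):G. (x + y, u + v) : G & (x * y, x * v + y * u) : G)
 & (ALL (x, u):G. (- x, - u) : G) & (ALL u. (0, u) : G --> u = 0)"

lemma dgraphI:
 assumes "(1, 0) : G" "!!x u y v. (x, u) : G ==> (y, v) : G ==> (x + y, u + v) : G & (x * y, x * v + y * u) : G"
 "!!x u. (x, u) : G ==> (- x, - u) : G" "!!u. (0, u) : G ==> u = 0"
 shows "dgraph G"
 using assms unfolding dgraph_def by blast

lemma dgraphD:
 assumes "dgraph G"
 shows "(1, 0) : G" "(x, u) : G ==> (y, v) : G ==> (x + y, u + v) : G"
 "(x, u) : G ==> (y, v) : G ==> (x * y, x * v + y * u) : G" "(x, u) : G ==> (- x, - u) : G"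
 "(0, u) : G ==> u = 0" "(0, 0) : G" "(x, u) : G ==> (x, v) : G ==> u = v"
proof -
 show 1: "(1, 0) : G" and 2: "(x, u) : G ==> (y, v) : G ==> (x + y, u + v) : G"
 and "(x, u) : G ==> (y, v) : G ==> (x * y, x * v + y * u) : G"
 and 4: "(x, u) : G ==> (- x, - u) : G" and 5: "(0, u) : G ==> u = 0" for x y u v
 using assms by (auto simp: dgraph_def)
 show "(0, 0) : G" using 2[OF 1 4[OF 1]] by simp
 show "(x, u) : G ==> (x, v) : G ==> u = v" using 2[OF _ 4, of x u x v] 5 by fastforce
qed

lemma dgraph_sum:
 "dgraph G ==> (!!i. i : I ==> (f i, g i) : G) ==> (sum f I, sum g I) : G"
 by (induct I rule: infinite_finite_induct) (auto simp: dgraphD)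

lemma dgraph_dom: "dgraph G ==> srg (Domain G)"
 unfolding srg_def by (auto intro: dgraphD)

definition PG :: "('a::zero \<times> 'b::zero) set => ('a poly \<times> 'b poly) set" where
 "PG G = {(p, q). ALL i. (cof p i, cof q i) : G}"

lemma PG_lift:
 assumes "(0, 0) : G" "p : PA (Domain G)" obtains q where "(p, q) : PG G"
proof -
 obtain f where f: "!!i. (cof p i, f i) : G"
 using assms(2) by (auto simp: PA_def Domain_iff) metis
 define g where "g i = (if i <= degree p then f i else 0)" for i
 have "ALL i. (cof p i, g i) : G" using f assms(1) by (auto simp: g_def coeff_eq_0)
 moreover have "g = cof (Abs_poly g)"
 by (rule coeff_Abs_poly[symmetric, of "degree p"]) (auto simp: g_def)
 ultimately show ?thesis using that[of "Abs_poly g"] by (auto simp: PG_def)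
qed

text \<open>When z is algebraic over the domain, its derivative w is forced by a relation p0 of
  least degree; otherwise there is no constraint and 0 is taken. The point to check is that a
  polynomial vanishing at z has derivative 0 there, which pseudo-division reduces to p0.\<close>

lemma dgraph_extend:
 fixes z :: "'a::field_char_0"
 assumes G: "dgraph G"
 shows "EX G'. dgraph G' & G \<subseteq> G' & z : Domain G'"
proof -
 let ?S = "Domain G"
 have S: "srg ?S" using dgraph_dom[OF G] .
 have PG0: "(p, q) : PG G ==> p : PA ?S" for p q by (auto simp: PG_def PA_def)
 have PGz: "(0, q) : PG G ==> q = 0" for q
 using dgraphD(5)[OF G] by (auto simp: PG_def intro!: poly_eqI)
 have PGa: "(p + p', q + q') : PG G" if "(p, q) : PG G" "(p', q') : PG G" for p q p' q'
 using that dgraphD(2)[OF G] by (auto simp: PG_def)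
 have PGn: "(- p, - q) : PG G" if "(p, q) : PG G" for p q
 using that dgraphD(4)[OF G] by (auto simp: PG_def)
 have PGm: "(p * p', p * q' + p' * q) : PG G" if "(p, q) : PG G" "(p', q') : PG G" for p q p' q'
 proof -
 have "(cof (p * p') n, cof (p * q' + p' * q) n) : G" for n
 proof -
 have "cof (p' * q) n = (SUM i<=n. cof p' (n - i) * cof q i)"
 by (subst mult.commute) (simp add: coeff_mult mult.commute[of "cof q _"])
 hence "cof (p * q' + p' * q) n = 
 (SUM i<=n. cof p i * cof q' (n - i) + cof p' (n - i) * cof q i)"
 by (simp add: coeff_mult sum.distrib)
 thus ?thesis unfolding coeff_mult using that
 by (auto intro!: dgraph_sum[OF G] dgraphD(3)[OF G] simp: PG_def)
 qed
 thus ?thesis by (simp add: PG_def)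
 qed
 define d where "d w p q = poly q z + poly (pderiv p) z * w" for w p q
 have dm: "d w (p * p') (p * q' + p' * q) = poly p z * d w p' q' + poly p' z * d w p q" for w p q p' q'
 by (simp add: d_def pderiv_mult algebra_simps)
 have da: "d w (p + p') (q + q') = d w p q + d w p' q'" for w p q p' q'
 by (simp add: d_def pderiv_add algebra_simps)
 have dn: "d w (- p) (- q) = - d w p q" for w p q
 by (simp add: d_def pderiv_minus)
 obtain w where w: "!!p q. (p, q) : PG G ==> poly p z = 0 ==> d w p q = 0"
 proof (cases "algb ?S z")
 case False
 hence "p = 0" if "(p, q) : PG G" "poly p z = 0" for p q
 using that PG0 by (auto simp: algb_def)
 thus ?thesis using that[of 0] PGz by (auto simp: d_def)
 next
 case True
 obtain p0 where p0: "p0 : PA ?S" "p0 ~= 0" "poly p0 z = 0"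
 "ALL q:PA ?S. q ~= 0 --> poly q z = 0 --> degree p0 <= degree q"
 using algb_minimal[OF True] by blast
 have nz: "poly (pderiv p0) z ~= 0" by (rule min_pderiv_nz[OF S p0(1-3)]) (rule p0(4))
 obtain q0 where q0: "(p0, q0) : PG G" using PG_lift[OF dgraphD(6)[OF G] p0(1)] .
 define w where "w = - poly q0 z / poly (pderiv p0) z"
 have d0: "d w p0 q0 = 0" using nz by (simp add: d_def w_def)
 show ?thesis
 proof (rule that[of w])
 fix p q assume pq: "(p, q) : PG G" "poly p z = 0"
 obtain k Q R where QR: "Q : PA ?S" "R : PA ?S" "smult (lead_coeff p0 ^ k) p = Q * p0 + R"
 "R = 0 \<or> degree R < degree p0" using pseudo_division[OF S p0(1) PG0[OF pq(1)]] by blast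
 have "poly R z = 0" using arg_cong[OF QR(3), of "%p. poly p z"] p0(3) pq(2) by simp
 hence R: "R = 0" using p0(4) QR(2,4) by fastforce
 \<comment> \<open>The multiplier from pseudo-division is treated as a constant polynomial with its
   own derivative \<open>c'\<close>. The terms with \<open>c'\<close> and \<open>Q'\<close> carry
   the factors \<open>poly p z\<close> and \<open>poly p0 z\<close>, which are 0.\<close>
 define c where "c = [:lead_coeff p0 ^ k:]"
 have cA: "c : PA ?S" unfolding c_def using srgD(7)[OF S PA_D[OF p0(1)]] by (simp add: PA_pCons S PA_0)
 obtain c' where c': "(c, c') : PG G" using PG_lift[OF dgraphD(6)[OF G] cA] .
 obtain Q' where Q': "(Q, Q') : PG G" using PG_lift[OF dgraphD(6)[OF G] QR(1)] .
 have e: "c * p = Q * p0" using QR(3) R by (simp add: c_def)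
 have "(c * p, c * q + p * c') : PG G" "(Q * p0, Q * q0 + p0 * Q') : PG G"
 using PGm[OF c' pq(1)] PGm[OF Q' q0] by auto
 from PGa[OF this(1) PGn[OF this(2)]] have "c * q + p * c' + - (Q * q0 + p0 * Q') = 0"
 using PGz e by simp
 hence "c * q + p * c' = Q * q0 + p0 * Q'" by (simp only: add_uminus_conv_diff right_minus_eq)
 hence "d w (c * p) (c * q + p * c') = d w (Q * p0) (Q * q0 + p0 * Q')" using e by simp
 hence "poly c z * d w p q = 0" using dm d0 p0(3) pq(2) by simp
 thus "d w p q = 0" using p0(2) by (simp add: c_def)
 qed
 qed
 define G' where "G' = {(poly p z, d w p q) |p q. (p, q) : PG G}"
 have dg: "dgraph G'"
 proof (rule dgraphI)
 have "(1, 0) : PG G" using dgraphD(1,6)[OF G] by (auto simp: PG_def coeff_1)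
 moreover have "(1, 0) = (poly 1 z, d w 1 0)" by (simp add: d_def)
 ultimately show "(1, 0) : G'" unfolding G'_def by blast
 next
 fix x u y v assume "(x, u) : G'" "(y, v) : G'"
 then obtain p q p' q' where "(p, q) : PG G" "(p', q') : PG G" "x = poly p z" "u = d w p q"
 "y = poly p' z" "v = d w p' q'" by (auto simp: G'_def)
 with da[of w p p' q q'] dm[of w p p' q' q] PGa[OF this(1,2)] PGm[OF this(1,2)]
 have "(x + y, u + v) = (poly (p + p') z, d w (p + p') (q + q'))"
 "(x * y, x * v + y * u) = (poly (p * p') z, d w (p * p') (p * q' + p' * q))"
 "(p + p', q + q') : PG G" "(p * p', p * q' + p' * q) : PG G" by auto
 thus "(x + y, u + v) : G' & (x * y, x * v + y * u) : G'" unfolding G'_def by blast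
 next
 fix x u assume "(x, u) : G'"
 then obtain p q where "(p, q) : PG G" "x = poly p z" "u = d w p q" by (auto simp: G'_def)
 with PGn[OF this(1)] dn[of w p q] have "(- x, - u) = (poly (- p) z, d w (- p) (- q))" "(- p, - q) : PG G" by auto
 thus "(- x, - u) : G'" unfolding G'_def by blast
 next
 fix u assume "(0, u) : G'"
 thus "u = 0" using w unfolding G'_def by auto
 qed
 have sub: "G <= G'"
 proof clarify
 fix a b assume "(a, b) : G"
 hence "([:a:], [:b:]) : PG G" using dgraphD(6)[OF G] by (auto simp: PG_def coeff_pCons split: nat.splits)
 moreover have "(a, b) = (poly [:a:] z, d w [:a:] [:b:])" by (simp add: d_def)
 ultimately show "(a, b) : G'" unfolding G'_def by blast
 qed
 have "([:0, 1:], 0) : PG G" using dgraphD(1,6)[OF G] by (auto simp: PG_def coeff_pCons split: nat.splits)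
 moreover have "(z, d w [:0, 1:] 0) = (poly [:0, 1:] z, d w [:0, 1:] 0)" by simp
 ultimately have "(z, d w [:0, 1:] 0) : G'" unfolding G'_def by blast
 thus ?thesis using dg sub by blast
qed

theorem derivation_extend:
 fixes G0 :: "('a::field_char_0 \<times> 'a) set"
 assumes G0: "dgraph G0"
 obtains D where "der D" "ALL x u. (x, u) : G0 --> D x = u"
proof -
 define \<A> where "\<A> = {G. dgraph G & G0 \<subseteq> G}"
 have "EX M:\<A>. ALL XX:\<A>. M <= XX --> XX = M"
 proof (rule subset_Zorn_nonempty)
 show "\<A> ~= {}" using G0 by (auto simp: \<A>_def)
 fix C assume C: "C ~= {}" "subset.chain \<A> C"
 have sub: "XX : C ==> dgraph XX" "XX : C ==> G0 \<subseteq> XX" for XX using C by (auto simp: \<A>_def subset.chain_def)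
 have two: "EX XX:C. a : XX & b : XX" if ab: "a : \<Union>C" "b : \<Union>C" for a b
 proof -
 obtain Y Z where YZ: "Y : C" "a : Y" "Z : C" "b : Z" using ab by blast
 have "Y <= Z \<or> Z <= Y" using C(2) YZ(1,3) unfolding subset.chain_def by blast
 thus ?thesis using YZ by blast
 qed
 have "dgraph (\<Union>C)"
 proof (rule dgraphI)
 show "(1, 0) : \<Union>C" using C(1) sub dgraphD(1) by blast
 next
 fix a u b v assume "(a, u) : \<Union>C" "(b, v) : \<Union>C"
 then obtain Z where "Z : C" "(a, u) : Z" "(b, v) : Z" using two by blast
 thus "(a + b, u + v) : \<Union>C & (a * b, a * v + b * u) : \<Union>C" using sub dgraphD(2,3) by blast
 next
 fix a u assume "(a, u) : \<Union>C"
 thus "(- a, - u) : \<Union>C" using sub dgraphD(4) by blast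
 next
 fix u assume "(0, u) : \<Union>C"
 thus "u = 0" using sub dgraphD(5) by blast
 qed
 thus "\<Union>C : \<A>" using C(1) sub by (auto simp: \<A>_def)
 qed
 then obtain M where "M : \<A>" and max: "ALL XX:\<A>. M \<subseteq> XX --> XX = M" by blast
 hence M1: "dgraph M" "G0 <= M" unfolding \<A>_def by simp_all
 have M3: "XX = M" if "dgraph XX" "M \<subseteq> XX" for XX
 using max that M1(2) unfolding \<A>_def by blast
 note M = M1 M3
 have tot: "z : Domain M" for z using dgraph_extend[OF M(1), of z] M(3) by blast
 define D where "D z = (THE u. (z, u) : M)" for z
 have Duniq: "D z = u" if "(z, u) : M" for z u 
 unfolding D_def using that dgraphD(7)[OF M(1)] by blast
 have DM: "(z, D z) : M" for z using tot[of z] Duniq by blast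
 show ?thesis
 proof
 show "der D" unfolding der_def
 using Duniq dgraphD(2,3)[OF M(1) DM DM] by blast
 show "ALL z u. (z, u) : G0 --> D z = u" using Duniq M(2) by blast
 qed
qed

text \<open>Formal differentiation on S[x] is well defined precisely because x satisfies no relation
  over S; its graph is then extended to the whole field.\<close>

theorem derivation_exists:
 fixes x :: "'a::field_char_0"
 assumes S: "srg S" and x: "\<not> algb S x"
 obtains D where "der D" "ALL s:S. D s = 0" "D x = 1"
proof -
 define G0 where "G0 = {(poly p x, poly (pderiv p) x) |p. p : PA S}"
 have G0: "dgraph G0"
 proof (rule dgraphI)
 show "(1, 0) : G0" using PA_1[OF S] unfolding G0_def by force
 next
 fix a u b v assume "(a, u) : G0" "(b, v) : G0"
 then obtain p q where "p : PA S" "q : PA S" "a = poly p x" "u = poly (pderiv p) x"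
 "b = poly q x" "v = poly (pderiv q) x" by (auto simp: G0_def)
 hence "(a + b, u + v) = (poly (p + q) x, poly (pderiv (p + q)) x)" "p + q : PA S"
 "(a * b, a * v + b * u) = (poly (p * q) x, poly (pderiv (p * q)) x)" "p * q : PA S"
 using PA_ops(1,4)[OF S, of p q] by (auto simp: pderiv_add pderiv_mult)
 thus "(a + b, u + v) : G0 & (a * b, a * v + b * u) : G0" unfolding G0_def by blast
 next
 fix a u assume "(a, u) : G0"
 then obtain p where "p : PA S" "a = poly p x" "u = poly (pderiv p) x" by (auto simp: G0_def)
 thus "(- a, - u) : G0"
 unfolding G0_def using PA_ops(3)[OF S, of p] by (auto simp: pderiv_minus intro!: exI[of _ "- p"])
 next
 fix u assume "(0, u) : G0"
 thus "u = 0" using x unfolding G0_def algb_def by fastforce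
 qed
 obtain D where D: "der D" "ALL z u. (z, u) : G0 --> D z = u" by (rule derivation_extend[OF G0])
 show ?thesis
 proof
 show "der D" by (rule D(1))
 have "(s, 0) : G0" if "s : S" for s
 unfolding G0_def using that by (auto simp: PA_pCons PA_0 S intro!: exI[of _ "[:s:]"])
 thus "ALL s:S. D s = 0" using D(2) by blast
 next
 have "(x, 1) : G0" unfolding G0_def
 by (auto simp: PA_pCons PA_0 S srgD pderiv_pCons intro!: exI[of _ "[:0, 1:]"])
 thus "D x = 1" using D(2) by blast
 qed
qed

text \<open>Algebraic dependence becomes a linear condition. That algebraic elements form a field
  and that algebraicity is transitive follow without any degree count.\<close>

lemma algb_iff_der:
 fixes x :: "'a::field_char_0"
 assumes "srg S"
 shows "algb S x \<longleftrightarrow> (ALL D. der D --> (ALL s:S. D s = 0) --> D x = 0)"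
 using der_algb_zero[OF assms] derivation_exists[OF assms, of x] by (metis zero_neq_one)

lemma algb_trans:
 fixes x :: "'a::field_char_0"
 assumes "srg S" "srg T" "!!t. t : T ==> algb S t" "algb T x"
 shows "algb S x"
 using assms algb_iff_der[OF assms(1)] algb_iff_der[OF assms(2)] by blast

lemma sfd_algb:
 fixes S :: "'a::field_char_0 set"
 assumes "srg S" shows "sfd {x. algb S x}"
 unfolding sfd_def srg_def using algb_iff_der[OF assms]
 by (auto simp: derD der_inverse)

section \<open>Places\<close>

definition acl :: "'b::field set => bool" where
 "acl K \<longleftrightarrow> sfd K & (ALL p:PA K. degree p > 0 --> (EX x:K. poly p x = 0))"

text \<open>A homomorphism from a subring into \<open>K\<close> is encoded by its graph, so that
  extension is inclusion and chains have unions.\<close>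

definition hgraph :: "'b::field set => ('a::field \<times> 'b) set => bool" where
 "hgraph K G \<longleftrightarrow> (1, 1) : G & (ALL (x, u):G. ALL (y, v):G. (x + y, u + v) : G & (x * y, u * v) : G)
 & (ALL (x, u):G. (- x, - u) : G) & (ALL u. (0, u) : G --> u = 0) & Range G \<subseteq> K"

lemma hgraphI:
 assumes "(1, 1) : G" "!!x u y v. (x, u) : G ==> (y, v) : G ==> (x + y, u + v) : G & (x * y, u * v) : G"
 "!!x u. (x, u) : G ==> (- x, - u) : G" "!!u. (0, u) : G ==> u = 0" "!!x u. (x, u) : G ==> u : K"
 shows "hgraph K G"
 using assms unfolding hgraph_def by blast

lemma hgraphD:
 assumes "hgraph K G"
 shows "(1, 1) : G" "(x, u) : G ==> (y, v) : G ==> (x + y, u + v) : G"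
 "(x, u) : G ==> (y, v) : G ==> (x * y, u * v) : G" "(x, u) : G ==> (- x, - u) : G"
 "(0, u) : G ==> u = 0" "(0, 0) : G" "(x, u) : G ==> (x, v) : G ==> u = v" "(x, u) : G ==> u : K"
proof -
 show 1: "(1, 1) : G" and 2: "(x, u) : G ==> (y, v) : G ==> (x + y, u + v) : G"
 and "(x, u) : G ==> (y, v) : G ==> (x * y, u * v) : G"
 and 4: "(x, u) : G ==> (- x, - u) : G" and 5: "(0, u) : G ==> u = 0" 
 and "(x, u) : G ==> u : K" for x y u v
 using assms by (auto simp: hgraph_def)
 show "(0, 0) : G" using 2[OF 1 4[OF 1]] by simp
 show "(x, u) : G ==> (x, v) : G ==> u = v" using 2[OF _ 4, of x u x v] 5 by fastforce
qed

lemma hgraph_sum: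
 "hgraph K G ==> (!!i. i : I ==> (f i, g i) : G) ==> (sum f I, sum g I) : G"
 by (induct I rule: infinite_finite_induct) (auto simp: hgraphD)

lemma hgraph_pow: "hgraph K G ==> (x, u) : G ==> (x ^ n, u ^ n) : G"
 by (induct n) (auto simp: hgraphD)

lemma poly_sum_le: "degree (p :: 'a::comm_ring_1 poly) <= N ==> poly p x = (SUM i<=N. cof p i * x ^ i)"
 unfolding poly_altdef by (rule sum.mono_neutral_left) (auto simp: coeff_eq_0)

lemma hgraph_dom: "hgraph K G ==> srg (Domain G)"
 unfolding srg_def by (auto intro: hgraphD)

lemma hgraph_ran: "hgraph K G ==> srg (Range G)"
 unfolding srg_def by (auto intro: hgraphD)

lemma PG_lift_ran:
 assumes "(0, 0) : G" "q : PA (Range G)" obtains p where "(p, q) : PG G"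
proof -
 have "(0, 0) : G\<inverse>" "q : PA (Domain (G\<inverse>))" using assms by auto
 then obtain p where "(q, p) : PG (G\<inverse>)" using PG_lift by blast
 thus ?thesis using that by (auto simp: PG_def)
qed

lemma PG_hom:
 assumes G: "hgraph K G"
 shows "(p, q) : PG G ==> (p', q') : PG G ==> (p + p', q + q') : PG G"
 "(p, q) : PG G ==> (- p, - q) : PG G"
 "(p, q) : PG G ==> (p', q') : PG G ==> (p * p', q * q') : PG G"
 "(a, u) : G ==> (p, q) : PG G ==> (smult a p, smult u q) : PG G"
 "(0, q) : PG G ==> q = 0" "(1, 1) : PG G" "(a, u) : G ==> ([:a:], [:u:]) : PG G"
 "([:0, 1:], [:0, 1:]) : PG G" "(Polynomial.monom 1 n, Polynomial.monom 1 n) : PG G"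
 using G by (auto simp: PG_def coeff_mult coeff_1 coeff_pCons poly_eq_iff intro!: hgraph_sum intro: hgraphD
 split: nat.splits)

text \<open>The reductions of the relations of x form an ideal, and x may be sent to any common root
  r of it in K. An element of least degree in this ideal has a root unless it is a nonzero constant,
  and \<open>nc\<close> excludes that.\<close>

lemma hgraph_adjoin:
 assumes G: "hgraph K G" and K: "acl K"
 and nc: "!!p q. (p, q) : PG G ==> poly p x = 0 ==> q = 0 \<or> degree q > 0"
 shows "EX G'. hgraph K G' & G \<subseteq> G' & x : Domain G'"
proof -
 define I where "I = {q. EX p. (p, q) : PG G & poly p x = 0}"
 have K0: "srg K" using K by (auto simp: acl_def sfd_def)
 obtain r where r: "r : K" "!!q. q : I ==> poly q r = 0"
 proof (cases "EX q:I. q ~= 0")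
 case False
 thus ?thesis using that[of 0] srgD(2)[OF K0] by force
 next
 case True
 then obtain q1 where q1: "q1 : I & q1 ~= 0" by blast
 define q0 where "q0 = arg_min degree (%q. q : I & q ~= 0)"
 have q0: "q0 : I" "q0 ~= 0" "!!q. q : I ==> q ~= 0 ==> degree q0 <= degree q"
 using arg_min_natI[of "%q. q : I & q ~= 0", OF q1, of degree]
 arg_min_nat_le[of "%q. q : I & q ~= 0" _ degree] unfolding q0_def by auto
 obtain p0 where p0: "(p0, q0) : PG G" "poly p0 x = 0" using q0(1) by (auto simp: I_def)
 have "degree q0 > 0" using nc p0 q0(2) by blast
 moreover have "q0 : PA K" using p0(1) hgraphD(8)[OF G] by (auto simp: PG_def PA_def)
 ultimately obtain r where r: "r : K" "poly q0 r = 0" using K by (auto simp: acl_def)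
 have "poly q r = 0" if q: "q : I" for q
 proof -
 obtain p where p: "(p, q) : PG G" "poly p x = 0" using q by (auto simp: I_def)
 have "q0 : PA (Range G)" "q : PA (Range G)" using p(1) p0(1) by (auto simp: PG_def PA_def)
 then obtain k Q R where QR: "Q : PA (Range G)" "R : PA (Range G)" 
 "smult (lead_coeff q0 ^ k) q = Q * q0 + R" "R = 0 \<or> degree R < degree q0"
 using pseudo_division[OF hgraph_ran[OF G]] by blast
 obtain P where P: "(P, Q) : PG G" using PG_lift_ran[OF hgraphD(6)[OF G] QR(1)] .
 have "lead_coeff q0 ^ k : Range G"
 by (rule srgD(7)[OF hgraph_ran[OF G]]) (use p0(1) in \<open>auto simp: PG_def\<close>)
 then obtain c where c: "(c, lead_coeff q0 ^ k) : G" by blast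
 have "(smult c p + - (P * p0), smult (lead_coeff q0 ^ k) q + - (Q * q0)) : PG G"
 by (intro PG_hom[OF G] c p P p0)
 hence "(smult c p + - (P * p0), R) : PG G" using QR(3) by simp
 hence "R : I" unfolding I_def using p p0 by auto
 hence "R = 0" using q0(3) QR(4) by fastforce
 hence "lead_coeff q0 ^ k * poly q r = 0" using arg_cong[OF QR(3), of "%p. poly p r"] r(2) by simp
 thus ?thesis using q0(2) by simp
 qed
 thus ?thesis using that r by blast
 qed
 define G' where "G' = {(poly p x, poly q r) |p q. (p, q) : PG G}"
 have "hgraph K G'"
 proof (rule hgraphI)
 show "(1, 1) : G'" unfolding G'_def using PG_hom(6)[OF G] by force
 next
 fix a u b v assume "(a, u) : G'" "(b, v) : G'"
 then obtain p q p' q' where "(p, q) : PG G" "(p', q') : PG G" "a = poly p x" "u = poly q r"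
 "b = poly p' x" "v = poly q' r" by (auto simp: G'_def)
 with PG_hom(1,3)[OF G this(1,2)]
 have "(a + b, u + v) = (poly (p + p') x, poly (q + q') r)" "(a * b, u * v) = (poly (p * p') x, poly (q * q') r)"
 "(p + p', q + q') : PG G" "(p * p', q * q') : PG G" by auto
 thus "(a + b, u + v) : G' & (a * b, u * v) : G'" unfolding G'_def by blast
 next
 fix a u assume "(a, u) : G'"
 then obtain p q where "(p, q) : PG G" "a = poly p x" "u = poly q r" by (auto simp: G'_def)
 with PG_hom(2)[OF G this(1)]
 have "(- a, - u) = (poly (- p) x, poly (- q) r)" "(- p, - q) : PG G" by auto
 thus "(- a, - u) : G'" unfolding G'_def by blast
 next
 fix u assume "(0, u) : G'"
 thus "u = 0" using r unfolding G'_def I_def by auto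
 next
 fix a u assume "(a, u) : G'"
 then obtain p q where "(p, q) : PG G" "u = poly q r" by (auto simp: G'_def)
 moreover have "q : PA K" using calculation(1) hgraphD(8)[OF G] by (auto simp: PG_def PA_def)
 ultimately show "u : K" using poly_in_srg[OF K0] r(1) by blast
 qed
 moreover have "G <= G'"
 proof clarify
 fix a b assume "(a, b) : G"
 hence "([:a:], [:b:]) : PG G" using PG_hom(7)[OF G] by blast
 moreover have "(a, b) = (poly [:a:] x, poly [:b:] r)" by simp
 ultimately show "(a, b) : G'" unfolding G'_def by blast
 qed
 moreover have "(x, r) : G'" unfolding G'_def using PG_hom(8)[OF G] by force
 ultimately show ?thesis by blast
qed

text \<open>A valuation ring \<open>A\<close> with its residue map into \<open>K\<close>. The last
  clause says that the elements outside \<open>A\<close> go to infinity; values of \<open>ph\<close>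
  there carry no meaning.\<close>

definition place :: "'b::field set => 'a::field set => ('a => 'b) => bool" where
 "place K A ph \<longleftrightarrow> srg A & ph 1 = 1 & (ALL x:A. ALL y:A. ph (x + y) = ph x + ph y & ph (x * y) = ph x * ph y) &
 ph ` A \<subseteq> K & (ALL x. x ~: A --> inverse x : A & ph (inverse x) = 0)"

text \<open>If both \<open>y\<close> and \<open>z = 1/y\<close> obstruct an extension, combining the two relations lowers the degree of the larger.\<close>

lemma hgraph_obs_step:
 assumes G: "hgraph K G" and yz: "y * z = 1"
 and p: "(p, q) : PG G" "poly p y = 0" "q ~= 0" "degree q = 0"
 and p': "(p', q') : PG G" "poly p' z = 0" "q' ~= 0" "degree q' = 0"
 and le: "degree p' <= degree p"
 shows "EX p2 q2. (p2, q2) : PG G & poly p2 y = 0 & q2 ~= 0 & degree q2 = 0 & degree p2 < degree p"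
proof -
 let ?n = "degree p" and ?l = "degree p'"
 have n0: "?n > 0"
 proof (rule ccontr)
 assume "\<not> ?n > 0"
 then obtain a where "p = [:a:]" by (auto elim: degree_eq_zeroE)
 hence "p = 0" using p(2) by simp
 thus False using p(1,3) PG_hom(5)[OF G] by blast
 qed
 obtain c' where c': "q' = [:c':]" "c' ~= 0" using p'(3,4) by (auto elim: degree_eq_zeroE)
 obtain c where c: "q = [:c:]" "c ~= 0" using p(3,4) by (auto elim: degree_eq_zeroE)
 define b where "b = cof p' 0"
 have b: "(b, c') : G" using p'(1) c' by (auto simp: PG_def b_def dest: spec[of _ 0])
 hence b0: "b ~= 0" using c'(2) hgraphD(5)[OF G] by blast
 have an: "(lead_coeff p, 0) : G"
 proof -
 have "(cof p ?n, cof q ?n) : G" using p(1) by (simp add: PG_def)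
 thus ?thesis using c(1) n0 by (simp add: coeff_pCons split: nat.splits)
 qed
 have "reflect_poly p' : PA (Domain G)"
 using p'(1) hgraphD(6)[OF G] by (auto simp: PA_def PG_def coeff_reflect_poly)
 then obtain q3 where q3: "(reflect_poly p', q3) : PG G" using PG_lift[OF hgraphD(6)[OF G]] by blast
 define p2 where "p2 = smult b p + - smult (lead_coeff p) (Polynomial.monom 1 (?n - ?l) * reflect_poly p')"
 have "(p2, smult c' q + - smult 0 (Polynomial.monom 1 (?n - ?l) * q3)) : PG G"
 unfolding p2_def by (intro PG_hom[OF G] b an p(1) q3)
 hence pg: "(p2, smult c' q) : PG G" by simp
 have y: "y ~= 0" using yz by auto
 have "z = inverse y" using yz by (metis inverse_unique)
 hence "poly (reflect_poly p') y = 0" using poly_reflect_poly_nz[OF y, of p'] p'(2) by simp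
 hence v: "poly p2 y = 0" using p(2) by (simp add: p2_def)
 have rd: "degree (reflect_poly p') <= ?l" by (rule degree_reflect_poly_le)
 have "degree (Polynomial.monom 1 (?n - ?l) * reflect_poly p') <= (?n - ?l) + ?l"
 by (rule order_trans[OF degree_mult_le]) (intro add_mono degree_monom_le rd)
 hence "degree (Polynomial.monom 1 (?n - ?l) * reflect_poly p') <= ?n" using le by simp
 hence d: "degree p2 <= ?n" unfolding p2_def
 by (intro degree_add_le) (auto intro: degree_smult_le le_trans[OF degree_smult_le])
 have "cof (reflect_poly p') ?l = b" by (simp add: coeff_reflect_poly b_def)
 hence "cof (Polynomial.monom 1 (?n - ?l) * reflect_poly p') ?n = b"
 using le by (simp add: coeff_monom_mult)
 hence "cof p2 ?n = 0" by (simp add: p2_def)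
 hence "degree p2 < ?n" using d n0 by (metis degree_0 leading_coeff_0_iff le_neq_implies_less)
 thus ?thesis using pg v c c' by (intro exI[of _ p2] exI[of _ "smult c' q"]) auto
qed

text \<open>Descent on the sum of the two degrees: the relation of larger degree is the one
  replaced, the roles of y and z being exchanged when necessary.\<close>

lemma hgraph_obs:
 assumes G: "hgraph K G" and yz: "y * z = 1"
 and p: "(p, q) : PG G" "poly p y = 0" "q ~= 0" "degree q = 0"
 and p': "(p', q') : PG G" "poly p' z = 0" "q' ~= 0" "degree q' = 0"
 shows False
 using p p' yz
proof (induct "degree p + degree p'" arbitrary: p q p' q' y z rule: less_induct)
 case less
 show ?case
 proof (cases "degree p' <= degree p")
 case True
 obtain p2 q2 where "(p2, q2) : PG G" "poly p2 y = 0" "q2 ~= 0" "degree q2 = 0" "degree p2 < degree p"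
 using hgraph_obs_step[OF G less(10) less(2-9) True] by blast
 thus False using less(1)[of p2 p' q2 y q' z] less(6-10) by auto
 next
 case False
 hence "degree p <= degree p'" "z * y = 1" using less(10) by (auto simp: mult.commute)
 then obtain p2 q2 where "(p2, q2) : PG G" "poly p2 z = 0" "q2 ~= 0" "degree q2 = 0" "degree p2 < degree p'"
 using hgraph_obs_step[OF G _ less(6-9) less(2-5)] by blast
 thus False using less(1)[of p p2 q y q2 z] less(2-5,10) by auto
 qed
qed

text \<open>A maximal partial homomorphism is a place: an element outside its domain has an
  obstruction by \<open>hgraph_adjoin\<close>, and an element and its inverse cannot both have one
  by \<open>hgraph_obs\<close>.\<close>

theorem place_extension:
 fixes G0 :: "('a::field \<times> 'b::field) set"
 assumes G0: "hgraph K G0" and K: "acl K"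
 obtains A ph where "place K A ph" "ALL x u. (x, u) : G0 --> x : A & ph x = u"
proof -
 define \<A> where "\<A> = {G. hgraph K G & G0 \<subseteq> G}"
 have "EX M:\<A>. ALL XX:\<A>. M <= XX --> XX = M"
 proof (rule subset_Zorn_nonempty)
 show "\<A> ~= {}" using G0 by (auto simp: \<A>_def)
 fix C assume C: "C ~= {}" "subset.chain \<A> C"
 have sub: "XX : C ==> hgraph K XX" "XX : C ==> G0 \<subseteq> XX" for XX using C by (auto simp: \<A>_def subset.chain_def)
 have two: "EX XX:C. a : XX & b : XX" if ab: "a : \<Union>C" "b : \<Union>C" for a b
 proof -
 obtain Y Z where YZ: "Y : C" "a : Y" "Z : C" "b : Z" using ab by blast
 have "Y <= Z \<or> Z <= Y" using C(2) YZ(1,3) unfolding subset.chain_def by blast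
 thus ?thesis using YZ by blast
 qed
 have "hgraph K (\<Union>C)"
 proof (rule hgraphI)
 show "(1, 1) : \<Union>C" using C(1) sub hgraphD(1) by blast
 next
 fix a u b v assume "(a, u) : \<Union>C" "(b, v) : \<Union>C"
 then obtain Z where "Z : C" "(a, u) : Z" "(b, v) : Z" using two by blast
 thus "(a + b, u + v) : \<Union>C & (a * b, u * v) : \<Union>C" using sub hgraphD(2,3) by blast
 next
 fix a u assume "(a, u) : \<Union>C"
 thus "(- a, - u) : \<Union>C" using sub hgraphD(4) by blast
 next
 fix u assume "(0, u) : \<Union>C"
 thus "u = 0" using sub hgraphD(5) by blast
 next
 fix a u assume "(a, u) : \<Union>C"
 thus "u : K" using sub hgraphD(8) by blast
 qed
 thus "\<Union>C : \<A>" using C(1) sub by (auto simp: \<A>_def)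
 qed
 then obtain M where "M : \<A>" and max: "ALL XX:\<A>. M \<subseteq> XX --> XX = M" by blast
 hence M1: "hgraph K M" "G0 <= M" unfolding \<A>_def by simp_all
 have M3: "XX = M" if "hgraph K XX" "M \<subseteq> XX" for XX
 using max that M1(2) unfolding \<A>_def by blast
 note M = M1 M3
 have ob: "EX p q. (p, q) : PG M & poly p x = 0 & q ~= 0 & degree q = 0" if "x ~: Domain M" for x
 using hgraph_adjoin[OF M(1) K, of x] M(3) that by (metis not_gr_zero)
 \<comment> \<open>An obstruction for 1/s, multiplied by s^n, is the element 0 with image c u^n,
   which is not 0. So elements with nonzero image are invertible in the domain, and the inverse of
   an excluded element must map to 0.\<close>
 have unit: "inverse s : Domain M" if s: "(s, u) : M" "u ~= 0" for s u
 proof (rule ccontr)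
 assume "inverse s ~: Domain M"
 then obtain p q where pq: "(p, q) : PG M" "poly p (inverse s) = 0" "q ~= 0" "degree q = 0"
 using ob by blast
 have s0: "s ~= 0" using s hgraphD(5)[OF M(1)] by blast
 define n where "n = degree p"
 define r where "r = (SUM i<=n. Polynomial.monom (cof p i) (n - i))"
 define r' where "r' = (SUM i<=n. Polynomial.monom (cof q i) (n - i))"
 obtain c where c: "q = [:c:]" "c ~= 0" using pq(3,4) by (auto elim: degree_eq_zeroE)
 have "(poly r s, poly r' u) : M"
 unfolding r_def r'_def poly_sum poly_monom
 by (intro hgraph_sum[OF M(1)] hgraphD(3)[OF M(1)] hgraph_pow[OF M(1)] s) (use pq(1) in \<open>auto simp: PG_def\<close>)
 moreover have "poly r s = s ^ n * poly p (inverse s)"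
 unfolding r_def poly_sum poly_monom poly_altdef[of p] n_def sum_distrib_left
 by (intro sum.cong refl) (simp add: power_diff s0 field_simps)
 moreover have "poly r' u = c * u ^ n"
 proof -
 have "poly r' u = (SUM i<=n. if i = 0 then c * u ^ n else 0)"
 unfolding r'_def poly_sum poly_monom c by (intro sum.cong refl) (auto simp: coeff_pCons split: nat.splits)
 thus ?thesis by simp
 qed
 ultimately show False using pq(2) hgraphD(5)[OF M(1), of "c * u ^ n"] c(2) s(2) by simp
 qed
 define ph where "ph z = (THE u. (z, u) : M)" for z
 have Fu: "ph z = u" if "(z, u) : M" for z u 
 unfolding ph_def using that hgraphD(7)[OF M(1)] by blast
 have FM: "(z, ph z) : M" if "z : Domain M" for z using that Fu by blast
 show ?thesis
 proof
 show "place K (Domain M) ph"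
 unfolding place_def
 proof (intro conjI ballI allI impI)
 show "srg (Domain M)" using hgraph_dom[OF M(1)] .
 show "ph 1 = 1" using Fu hgraphD(1)[OF M(1)] .
 show "ph ` Domain M <= K" using FM hgraphD(8)[OF M(1)] by blast
 fix x assume x: "x ~: Domain M"
 hence x0: "x ~= 0" using hgraphD(6)[OF M(1)] by blast
 obtain p q where pq: "(p, q) : PG M" "poly p x = 0" "q ~= 0" "degree q = 0" using ob x by blast
 show 1: "inverse x : Domain M"
 proof (rule ccontr)
 assume "inverse x ~: Domain M"
 then obtain p' q' where pq': "(p', q') : PG M" "poly p' (inverse x) = 0" "q' ~= 0" "degree q' = 0"
 using ob by blast
 show False using hgraph_obs[OF M(1) _ pq pq'] x0 by simp
 qed
 show "ph (inverse x) = 0" using unit[OF FM[OF 1]] x by fastforce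
 next
 fix x y assume "x : Domain M" "y : Domain M"
 hence "(x, ph x) : M" "(y, ph y) : M" using FM by auto
 thus "ph (x + y) = ph x + ph y" "ph (x * y) = ph x * ph y"
 using Fu[OF hgraphD(2)[OF M(1)]] Fu[OF hgraphD(3)[OF M(1)]] by auto
 qed
 show "ALL x u. (x, u) : G0 --> x : Domain M & ph x = u" using M(2) Fu by blast
 qed
qed

lemma placeD:
 assumes "place K A ph"
 shows "srg A" "ph 1 = 1" "x : A ==> y : A ==> ph (x + y) = ph x + ph y"
 "x : A ==> y : A ==> ph (x * y) = ph x * ph y" "x : A ==> ph x : K"
 "x ~: A ==> inverse x : A" "x ~: A ==> ph (inverse x) = 0" "ph 0 = 0" "x : A ==> ph (- x) = - ph x"
 "x : A ==> ph x ~= 0 ==> inverse x : A"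
proof -
 show 1: "srg A" and "ph 1 = 1" and 3: "x : A ==> y : A ==> ph (x + y) = ph x + ph y" and
 4: "x : A ==> y : A ==> ph (x * y) = ph x * ph y" and "x : A ==> ph x : K" and
 5: "x ~: A ==> inverse x : A" and 6: "x ~: A ==> ph (inverse x) = 0" for x y
 using assms by (auto simp: place_def)
 show 7: "ph 0 = 0" using 3[of 0 0] srgD(2)[OF 1] by (metis add_cancel_right_right add_0)
 show "ph (- x) = - ph x" if "x : A" using 3[of x "- x"] that srgD(5)[OF 1] 7 by (simp add: eq_neg_iff_add_eq_0 add.commute)
 show "inverse x : A" if x: "x : A" "ph x ~= 0"
 proof (rule ccontr)
 assume "inverse x ~: A"
 thus False using 6[of "inverse x"] x(2) by simp
 qed
qed

lemma place_sum: "place K A ph ==> (!!i. i : I ==> f i : A) ==> ph (sum f I) = (SUM i:I. ph (f i))"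
 by (induct I rule: infinite_finite_induct) (auto simp: placeD srg_sum)

lemma place_power: "place K A ph ==> x : A ==> ph (x ^ n) = ph x ^ n"
 by (induct n) (auto simp: placeD srgD)

text \<open>Outside A the inverse of x would reduce to 0, and the monic relation divided by x^n
  would reduce to 1 = 0.\<close>

lemma place_integral:
 assumes P: "place K A ph" and p: "p : PA A" "lead_coeff p = 1" "poly p x = 0"
 shows "x : A"
proof (rule ccontr)
 assume x: "x ~: A"
 let ?y = "inverse x" and ?n = "degree p"
 have A: "srg A" using placeD(1)[OF P] .
 have x0: "x ~= 0" using x srgD(2)[OF A] by auto
 have y: "?y : A" "ph ?y = 0" using placeD(6,7)[OF P x] by auto
 have "0 = ?y ^ ?n * poly p x" using p(3) by simp
 also have "\<dots> = (SUM i<=?n. cof p i * ?y ^ (?n - i))"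
 unfolding poly_altdef sum_distrib_left
 by (intro sum.cong refl) (simp add: power_diff x0 field_simps)
 finally have s: "0 = (SUM i<=?n. cof p i * ?y ^ (?n - i))" .
 have "ph (cof p i * ?y ^ (?n - i)) = (if i = ?n then 1 else 0)" if "i <= ?n" for i
 using that p(2) placeD(2,4)[OF P] place_power[OF P y(1)] y PA_D[OF p(1)] srgD(7)[OF A y(1)] by auto
 hence "ph (SUM i<=?n. cof p i * ?y ^ (?n - i)) = (SUM i<=?n. if i = ?n then 1 else 0)"
 by (subst place_sum[OF P]) (auto intro!: srgD(4)[OF A] srgD(7)[OF A] y PA_D[OF p(1)] sum.cong)
 thus False using s placeD(8)[OF P] by simp
qed

text \<open>Divisibility in a valuation ring is a total order, so a finite family has a member
  dividing all others. Homogeneous coordinates are divided by such a member before they are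
  reduced.\<close>

lemma place_max:
 assumes P: "place K A ph" and I: "finite I" "EX i:I. f i ~= 0"
 shows "EX i:I. f i ~= 0 & (ALL j:I. f j / f i : A)"
 using I
proof (induct I)
 case (insert a I)
 have A: "srg A" using placeD(1)[OF P] .
 show ?case
 proof (cases "EX i:I. f i ~= 0")
 case False
 thus ?thesis using insert(4) srgD(1,2)[OF A] by (intro bexI[of _ a]) auto
 next
 case True
 then obtain i where i: "i : I" "f i ~= 0" "!!j. j : I ==> f j / f i : A" using insert(3) by blast
 show ?thesis
 proof (cases "f a / f i : A")
 case True
 thus ?thesis using i by (intro bexI[of _ i]) auto
 next
 case False
 hence fa: "f a ~= 0" using srgD(2)[OF A] by auto
 have "f i / f a : A" using placeD(6)[OF P False] by simp
 moreover have "f j / f a = (f j / f i) * (f i / f a)" for j using i(2) by simp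
 ultimately have "f j / f a : A" if "j : I" for j using i(3)[OF that] srgD(4)[OF A] by metis
 thus ?thesis using fa srgD(1)[OF A] by (intro bexI[of _ a]) auto
 qed
 qed
qed auto

section \<open>Ultrapowers over the finite subsets of a type\<close>

definition fip :: "'x set set => bool" where
 "fip F \<longleftrightarrow> (ALL XX. finite XX --> XX \<subseteq> F --> \<Inter>XX ~= {})"

text \<open>With these sets in the ultrafilter every fixed \<open>x\<close> belongs to almost every
  index \<open>S\<close>. Conditions attached to the \<open>x\<close> can then be met finitely many
  at a time, and all of them hold in the limit.\<close>

definition tails :: "'i set set set" where
 "tails = {{S. finite S & x : S} |x. True}"

lemma fip_tails: "fip (insert {S. finite S} (tails :: 'i set set set))"
 unfolding fip_def
proof (intro allI impI)
 fix XX :: "'i set set set" assume XX: "finite XX" "XX \<subseteq> insert {S. finite S} tails"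
 have "EX S. finite S & S : \<Inter>XX & (ALL T. finite T --> S <= T --> T : \<Inter>XX)"
 using XX
 proof (induct XX)
 case (insert A XX)
 then obtain S where S: "finite S" "!!T. finite T ==> S \<subseteq> T ==> T : \<Inter>XX" by auto
 show ?case
 proof (cases "A = {S. finite S}")
 case True
 thus ?thesis using S by (intro exI[of _ S]) auto
 next
 case False
 then obtain x where x: "A = {S. finite S & x : S}" using insert(4) by (auto simp: tails_def)
 show ?thesis by (rule exI[of _ "Set.insert x S"]) (use S x in auto)
 qed
 qed auto
 thus "\<Inter>XX ~= {}" by blast
qed

definition ultraf :: "'x set set => bool" where
 "ultraf F \<longleftrightarrow> UNIV : F & {} ~: F & (ALL A:F. ALL B:F. A Int B : F) & (ALL A:F. ALL B. A \<subseteq> B --> B : F) &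
 (ALL A. A : F \<or> - A : F)"

lemma ultrafilter_exists:
 assumes B: "fip B" obtains F where "B \<subseteq> F" "ultraf F"
proof -
 define \<A> where "\<A> = {F. B \<subseteq> F & fip F}"
 have "EX M:\<A>. ALL XX:\<A>. M <= XX --> XX = M"
 proof (rule subset_Zorn_nonempty)
 show "\<A> ~= {}" using B by (auto simp: \<A>_def)
 fix C assume C: "C ~= {}" "subset.chain \<A> C"
 have "fip (\<Union>C)" unfolding fip_def
 proof (intro allI impI)
 fix XX assume XX: "finite XX" "XX \<subseteq> \<Union>C"
 have "EX Y:C. XX <= Y" using XX
 proof (induct XX)
 case empty thus ?case using C(1) by auto
 next
 case (insert a XX)
 then obtain Y Z where "Y : C" "XX \<subseteq> Y" "Z : C" "a : Z" by auto
 moreover have "Y <= Z \<or> Z <= Y" using C(2) calculation unfolding subset.chain_def by blast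
 ultimately show ?case by (metis insert_subset subset_trans in_mono)
 qed
 thus "\<Inter>XX ~= {}" using C(2) XX(1) unfolding subset.chain_def \<A>_def fip_def by blast
 qed
 moreover obtain Y where "Y : C" using C(1) by blast
 hence "B <= \<Union>C" using C(2) unfolding \<A>_def subset.chain_def by blast
 ultimately show "\<Union>C : \<A>" by (simp add: \<A>_def)
 qed
 then obtain M where "M : \<A>" and max: "ALL XX:\<A>. M \<subseteq> XX --> XX = M" by blast
 hence M1: "B <= M" "fip M" unfolding \<A>_def by simp_all
 have M3: "XX = M" if "M \<subseteq> XX" "fip XX" for XX
 using max that M1(1) unfolding \<A>_def by blast
 note M = M1 M3
 have meet: "A : M" if "!!XX. finite XX ==> XX \<subseteq> M ==> \<Inter>XX Int A ~= {}" for A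
 proof -
 have "fip (Set.insert A M)" unfolding fip_def
 proof (intro allI impI)
 fix XX assume XX: "finite XX" "XX \<subseteq> Set.insert A M"
 have "\<Inter>(XX - {A}) Int A ~= {}" using that[of "XX - {A}"] XX by auto
 thus "\<Inter>XX ~= {}" by blast
 qed
 thus ?thesis using M(3)[of "Set.insert A M"] by blast
 qed
 have ne: "XX \<subseteq> M ==> finite XX ==> \<Inter>XX ~= {}" for XX using M(2) by (auto simp: fip_def)
 have "ultraf M" unfolding ultraf_def
 proof (intro conjI ballI allI impI)
 show "UNIV : M" by (rule meet) (use ne in auto)
 show "{} ~: M" using ne[of "{{}}"] by auto
 show "A Int B : M" if "A : M" "B : M" for A B
 proof (rule meet)
 fix XX assume "finite XX" "XX \<subseteq> M"
 thus "\<Inter>XX Int (A Int B) ~= {}" using ne[of "Set.insert A (Set.insert B XX)"] that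
 by (simp add: Int_commute Int_left_commute)
 qed
 show "B : M" if "A : M" "A \<subseteq> B" for A B
 proof (rule meet)
 fix XX assume "finite XX" "XX \<subseteq> M"
 thus "\<Inter>XX Int B ~= {}" using ne[of "Set.insert A XX"] that by auto
 qed
 show "A : M \<or> - A : M" for A
 proof (rule disjCI, rule meet)
 fix XX assume nA: "- A ~: M" and XX: "finite XX" "XX \<subseteq> M"
 then obtain Y where "finite Y" "Y \<subseteq> M" "\<Inter>Y Int - A = {}" using meet[of "- A"] by blast
 thus "\<Inter>XX Int A ~= {}" using ne[of "XX Un Y"] XX by blast
 qed
 qed
 thus ?thesis using that M(1) by blast
qed

definition uf :: "'i set set set" where
 "uf = (SOME F. insert {S. finite S} tails \<subseteq> F & ultraf F)"

definition uev :: "('i set => bool) => bool" where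
 "uev P \<longleftrightarrow> {S. P S} : uf"

lemma uf_props: "insert {S. finite S} tails \<subseteq> uf" "ultraf uf"
proof -
 have "EX F. insert {S. finite S} tails <= F & ultraf F" by (rule ultrafilter_exists[OF fip_tails]) blast
 from someI_ex[OF this] show "insert {S. finite S} tails \<subseteq> uf" "ultraf uf" unfolding uf_def by auto
qed

lemma ultrafD:
 assumes "ultraf F"
 shows "UNIV : F" "{} ~: F" "A : F ==> B : F ==> A Int B : F" "A : F ==> A \<subseteq> B ==> B : F" "A : F \<or> - A : F"
 using assms unfolding ultraf_def by blast+

lemma uf_triv [simp]: "UNIV : uf" "{} ~: uf"
 by (rule ultrafD[OF uf_props(2)])+

lemma uev_mono: "uev P ==> (!!S. P S ==> Q S) ==> uev Q"
 unfolding uev_def by (erule ultrafD(4)[OF uf_props(2)]) blast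

lemma uev_conj: "uev P ==> uev Q ==> uev (%S. P S & Q S)"
 unfolding uev_def Collect_conj_eq by (rule ultrafD(3)[OF uf_props(2)])

lemma uev_mp2: "uev P ==> uev Q ==> (!!S. P S ==> Q S ==> R S) ==> uev R"
 using uev_mono[OF uev_conj] by blast

lemma uev_not: "uev (%S. \<not> P S) \<longleftrightarrow> \<not> uev P"
proof -
 have "- {S. P S} = {S. \<not> P S}" by auto
 hence "uev (%S. \<not> P S) \<or> uev P" using ultrafD(5)[OF uf_props(2), of "{S. P S}"] unfolding uev_def by auto
 moreover have False if "uev (%S. \<not> P S)" "uev P"
 proof -
 have "uev (%S. \<not> P S & P S)" by (rule uev_conj[OF that])
 thus False by (simp add: uev_def)
 qed
 ultimately show ?thesis by blast
qed

lemma uev_True: "(!!S. P S) ==> uev P"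
 by (simp add: uev_def)

lemma uev_const [simp]: "uev (%S. c) \<longleftrightarrow> c"
 by (cases c) (auto simp: uev_def)

lemma uev_finite: "uev finite"
 using uf_props(1) by (auto simp: uev_def)

lemma uev_mem: "uev (%S. x : S)"
proof -
 have "uev (%S. finite S & x : S)" using uf_props(1) by (auto simp: uev_def tails_def)
 thus ?thesis by (rule uev_mono) auto
qed

lemma uev_ball: "finite I ==> (!!i. i : I ==> uev (P i)) ==> uev (%S. ALL i:I. P i S)"
proof (induct I rule: finite_induct)
 case (insert a I)
 show ?case by (rule uev_mp2[OF insert(4)[of a] insert(3)]) (use insert(4) in auto)
qed auto

quotient_type ('i, 'a) ultra = "'i set => 'a" / "%f g. uev (%S. f S = g S)"
proof (rule equivpI)
 show "reflp (%f g. uev (%S. f S = g S))" by (auto simp: reflp_def)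
 show "symp (%f g. uev (%S. f S = g S))" by (auto simp: symp_def eq_commute)
 show "transp (%f g. uev (%S. f S = g S))" by (rule transpI) (erule (1) uev_mp2, simp)
qed

instantiation ultra :: (type, field) field
begin
lift_definition zero_ultra :: "('a, 'b) ultra" is "%_. 0" .
lift_definition one_ultra :: "('a, 'b) ultra" is "%_. 1" .
lift_definition plus_ultra :: "('a, 'b) ultra => ('a, 'b) ultra => ('a, 'b) ultra" is "%f g S. f S + g S"
 by (erule (1) uev_mp2) simp
lift_definition minus_ultra :: "('a, 'b) ultra => ('a, 'b) ultra => ('a, 'b) ultra" is "%f g S. f S - g S"
 by (erule (1) uev_mp2) simp
lift_definition times_ultra :: "('a, 'b) ultra => ('a, 'b) ultra => ('a, 'b) ultra" is "%f g S. f S * g S"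
 by (erule (1) uev_mp2) simp
lift_definition divide_ultra :: "('a, 'b) ultra => ('a, 'b) ultra => ('a, 'b) ultra" is "%f g S. f S / g S"
 by (erule (1) uev_mp2) simp
lift_definition uminus_ultra :: "('a, 'b) ultra => ('a, 'b) ultra" is "%f S. - f S"
 by (erule uev_mono) auto
lift_definition inverse_ultra :: "('a, 'b) ultra => ('a, 'b) ultra" is "%f S. inverse (f S)"
 by (erule uev_mono) auto
instance
proof
 fix a b c :: "('a, 'b) ultra"
 show "a * b * c = a * (b * c)" by transfer (auto intro: uev_True simp: algebra_simps)
 show "a * b = b * a" by transfer (auto intro: uev_True simp: algebra_simps)
 show "1 * a = a" by transfer (auto intro: uev_True)
 show "a + b + c = a + (b + c)" by transfer (auto intro: uev_True simp: algebra_simps)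
 show "a + b = b + a" by transfer (auto intro: uev_True simp: algebra_simps)
 show "0 + a = a" by transfer (auto intro: uev_True)
 show "- a + a = 0" by transfer (auto intro: uev_True)
 show "a - b = a + - b" by transfer (auto intro: uev_True)
 show "(a + b) * c = a * c + b * c" by transfer (auto intro: uev_True simp: algebra_simps)
 show "(0 :: ('a, 'b) ultra) ~= 1" by transfer simp
 show "a ~= 0 ==> inverse a * a = 1"
 by transfer (subst (asm) uev_not[symmetric], erule uev_mono, auto)
 show "a div b = a * inverse b" by transfer (simp add: divide_inverse)
 show "inverse (0 :: ('a, 'b) ultra) = 0" by transfer (auto intro: uev_True)
qed
end

lift_definition uabs :: "('i set => 'a) => ('i, 'a) ultra" is "%f. f" .

definition ucn :: "'a => ('i, 'a) ultra" where "ucn c = uabs (%_. c)"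

lemma uabs_eq: "uabs f = uabs g \<longleftrightarrow> uev (%S. f S = g S)" by transfer simp

lemma uabs_ex: "EX f. x = uabs f" by transfer (rule exI, rule uev_True, rule refl)

lemma uabs_ops:
 "uabs f + uabs g = uabs (%S. f S + g S)" "uabs f * uabs g = uabs (%S. f S * g S)"
 "uabs f - uabs g = uabs (%S. f S - g S)" "- uabs f = uabs (%S. - f S)" 
 "uabs f / uabs g = uabs (%S. f S / g S)" "inverse (uabs f) = uabs (%S. inverse (f S))"
 by (transfer, simp)+

lemma uabs_01: "0 = uabs (%_. 0)" "1 = uabs (%_. 1)" by (transfer, simp)+

lemma uabs_sum: "(SUM i:I. uabs (f i)) = uabs (%S. SUM i:I. f i S)"
 by (induct I rule: infinite_finite_induct) (auto simp: uabs_ops uabs_01)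

lemma uabs_prod: "(PROD i:I. uabs (f i)) = uabs (%S. PROD i:I. f i S)"
 by (induct I rule: infinite_finite_induct) (auto simp: uabs_ops uabs_01)

lemma uabs_power: "uabs f ^ n = uabs (%S. f S ^ n)"
 by (induct n) (auto simp: uabs_ops uabs_01)

lemma ucn_hom: "ucn (a + b) = ucn a + ucn b" "ucn (a * b) = ucn a * ucn b" "ucn 0 = 0" "ucn 1 = 1"
 "ucn (- a) = - ucn a" "ucn (a - b) = ucn a - ucn b" "ucn (inverse a) = inverse (ucn a)" 
 "ucn (a / b) = ucn a / ucn b"
 by (auto simp: ucn_def uabs_ops uabs_01)

lemma ucn_eq [simp]: "ucn a = ucn b \<longleftrightarrow> a = b" by (simp add: ucn_def uabs_eq)

lemma uabs_of_nat: "of_nat n = uabs (%_. of_nat n)"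
 by (induct n) (auto simp: uabs_ops uabs_01)

instance ultra :: (type, field_char_0) field_char_0
proof
 show "inj (of_nat :: nat => ('a, 'b) ultra)" by (auto simp: inj_def uabs_of_nat uabs_eq)
qed

instance ultra :: (type, alg_closed_field) alg_closed_field
proof
 fix p :: "('a, 'b) ultra poly" assume p: "degree p > 0" "lead_coeff p = 1"
 define n f where "n = degree p" and "f = cof p"
 have n: "n > 0" "f n ~= 0" using p by (auto simp: n_def f_def)
 obtain g where g: "f i = uabs (g i)" for i using choice[of "%i g. f i = uabs g"] uabs_ex by blast
 have "uev (%S. g n S ~= 0)" using n(2) by (simp add: g uabs_01 uabs_eq uev_not)
 \<comment> \<open>Roots are chosen index by index. Only the indices with nonzero leading
   coefficient matter, and these are almost all.\<close>
 have "ALL S. EX x. g n S ~= 0 --> (SUM k<=n. g k S * x ^ k) = 0" using alg_closed[of n "%k. g k _"] n(1) by auto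
 then obtain x where x: "ALL S. g n S ~= 0 --> (SUM k<=n. g k S * x S ^ k) = 0" by metis
 have "(SUM k<=n. f k * uabs x ^ k) = 0"
 unfolding g uabs_power uabs_ops uabs_sum unfolding uabs_01 uabs_eq
 by (rule uev_mono[OF \<open>uev (%S. g n S ~= 0)\<close>]) (use x in auto)
 thus "EX x. poly p x = 0" unfolding poly_altdef n_def f_def by blast
qed

lift_definition umap :: "('a => 'b) => ('i, 'a) ultra => ('i, 'b) ultra" is "%h f S. h (f S)"
 by (erule uev_mono) auto

lemma umap_uabs: "umap h (uabs f) = uabs (%S. h (f S))" by transfer simp

section \<open>Evaluation of multivariate polynomials\<close>

abbreviation lkp where "lkp \<equiv> Poly_Mapping.lookup"
abbreviation kys where "kys \<equiv> Poly_Mapping.keys"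
abbreviation sgl where "sgl \<equiv> Poly_Mapping.single"
abbreviation MP where "MP k N \<equiv> carrier (mpoly_ring k N)"

text \<open>Only the behaviour on the subring \<open>A\<close> is prescribed. Residue maps,
  embeddings of subfields and evaluations are all instances.\<close>

definition phom :: "'r::comm_ring_1 set => ('r => 'c::comm_ring_1) => bool" where
 "phom A f \<longleftrightarrow> srg A & f 1 = 1 & (ALL x:A. ALL y:A. f (x + y) = f x + f y & f (x * y) = f x * f y)"

lemma phomD:
 assumes "phom A f"
 shows "srg A" "f 1 = 1" "x : A ==> y : A ==> f (x + y) = f x + f y"
 "x : A ==> y : A ==> f (x * y) = f x * f y" "f 0 = 0" "x : A ==> f (- x) = - f x"
 "x : A ==> y : A ==> f (x - y) = f x - f y" "x : A ==> f (x ^ n) = f x ^ n"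
proof -
 show 1: "srg A" and 2: "f 1 = 1" and 3: "x : A ==> y : A ==> f (x + y) = f x + f y"
 and 4: "x : A ==> y : A ==> f (x * y) = f x * f y" for x y using assms by (auto simp: phom_def)
 show 5: "f 0 = 0" using 3[of 0 0] srgD(2)[OF 1] by (metis add_cancel_right_right add_0)
 show 6: "f (- x) = - f x" if "x : A" for x
 using 3[of x "- x"] that srgD(5)[OF 1] 5 by (simp add: eq_neg_iff_add_eq_0 add.commute)
 show "f (x - y) = f x - f y" if "x : A" "y : A"
 using 3[of x "- y"] that srgD(5)[OF 1] 6[of y] by simp
 show "f (x ^ n) = f x ^ n" if "x : A"
 by (induct n) (auto simp: 2 4 that srgD[OF 1])
qed

lemma phom_sum: "phom A f ==> (!!i. i : I ==> g i : A) ==> f (sum g I) = (SUM i:I. f (g i))"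
 by (induct I rule: infinite_finite_induct) (auto simp: phomD srg_sum)

lemma phom_prod: "phom A f ==> (!!i. i : I ==> g i : A) ==> f (prod g I) = (PROD i:I. f (g i))"
 by (induct I rule: infinite_finite_induct) (auto simp: phomD srg_prod)

lemma place_phom: "place K A ph ==> phom A ph"
 by (auto simp: place_def phom_def)

lemma phom_inverse:
 fixes f :: "'a::field => 'b::field"
 assumes "phom A f" "x : A" "inverse x : A" shows "f (inverse x) = inverse (f x)"
proof (cases "x = 0")
 case False
 hence "f x * f (inverse x) = 1" using phomD(2,4)[OF assms(1)] assms(2,3) by (metis right_inverse)
 thus ?thesis by (metis inverse_unique)
qed (use phomD(5)[OF assms(1)] in simp)

abbreviation chom :: "(complex => 'a::comm_ring_1) => bool" where "chom h \<equiv> phom UNIV h"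

definition mval :: "('v => 'a::comm_ring_1) => ('v \<Rightarrow>\<^sub>0 nat) => 'a" where
 "mval x m = (PROD v:kys m. x v ^ lkp m v)"

text \<open>One evaluation serves several purposes: geometric values have \<open>h\<close> the
  identity, substitution of polynomials has \<open>h = mconst\<close>, and values at generic points
  have \<open>h\<close> an embedding of the complex numbers.\<close>

definition ins :: "(complex => 'a::comm_ring_1) => ('v => 'a) => 'v mpoly => 'a" where
 "ins h x F = (SUM m:kys F. h (lkp F m) * mval x m)"

lemma meval_ins: "meval x F = ins (%c. c) x F"
 by (simp add: meval_def ins_def mval_def)

lemma msubst_ins: "msubst g F = ins mconst g F"
 by (simp add: msubst_def ins_def mval_def)

lemma chom_id: "chom (%c. c)" by (auto simp: phom_def srg_UNIV)

lemma chom_mconst: "chom mconst"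
 by (auto simp: phom_def srg_UNIV mconst_def single_add mult_single)

lemma mval_superset: "finite A ==> kys m \<subseteq> A ==> mval x m = (PROD v:A. x v ^ lkp m v)"
 unfolding mval_def by (rule prod.mono_neutral_left) (auto simp: in_keys_iff)

lemma mval_add: "mval x (m + m') = mval x m * mval x m'"
proof -
 let ?A = "kys m Un kys m'"
 have "kys (m + m') <= ?A" by (rule Poly_Mapping.keys_add)
 thus ?thesis
 by (simp add: mval_superset[of ?A] lookup_add power_add prod.distrib)
qed

lemma mval_0 [simp]: "mval x 0 = 1" by (simp add: mval_def)

lemma ins_superset: "chom h ==> finite A ==> kys F \<subseteq> A ==> ins h x F = (SUM m:A. h (lkp F m) * mval x m)"
 unfolding ins_def by (rule sum.mono_neutral_left) (auto simp: in_keys_iff phomD)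

lemma ins_add: "chom h ==> ins h x (F + G) = ins h x F + ins h x G"
proof -
 assume h: "chom h"
 let ?A = "kys F Un kys G"
 have "kys (F + G) <= ?A" by (rule Poly_Mapping.keys_add)
 thus ?thesis
 using h by (simp add: ins_superset[of h ?A] lookup_add phomD(3)[OF h] distrib_right sum.distrib)
qed

lemma ins_0 [simp]: "ins h x 0 = 0" by (simp add: ins_def)

lemma ins_sum: "chom h ==> ins h x (sum G I) = (SUM i:I. ins h x (G i))"
 by (induct I rule: infinite_finite_induct) (auto simp: ins_add)

lemma ins_single: "chom h ==> ins h x (sgl m c) = h c * mval x m"
 by (simp add: ins_def phomD(5))

lemma mpoly_sum_single: "F = (SUM m:kys F. sgl m (lkp F m))"
proof (rule poly_mapping_eqI)
 fix k
 have "lkp (SUM m:kys F. sgl m (lkp F m)) k = (SUM m:kys F. if m = k then lkp F k else 0)"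
 unfolding lookup_sum lookup_single when_def by (rule sum.cong) auto
 also have "\<dots> = lkp F k" by (simp add: in_keys_iff)
 finally show "lkp F k = lkp (SUM m:kys F. sgl m (lkp F m)) k" by simp
qed

lemma ins_mult: assumes h: "chom h" shows "ins h x (F * G) = ins h x F * ins h x G"
proof -
 have "F * G = (SUM m:kys F. sgl m (lkp F m)) * (SUM m:kys G. sgl m (lkp G m))"
 using mpoly_sum_single[of F] mpoly_sum_single[of G] by simp
 also have "\<dots> = (SUM m:kys F. SUM m':kys G. sgl (m + m') (lkp F m * lkp G m'))"
 by (simp add: sum_product mult_single)
 finally have "ins h x (F * G) = (SUM m:kys F. SUM m':kys G. ins h x (sgl (m + m') (lkp F m * lkp G m')))"
 by (simp add: ins_sum[OF h])
 also have "\<dots> = (SUM m:kys F. SUM m':kys G. (h (lkp F m) * mval x m) * (h (lkp G m') * mval x m'))"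
 by (intro sum.cong refl) (simp add: ins_single[OF h] phomD(4)[OF h] mval_add mult_ac)
 also have "\<dots> = ins h x F * ins h x G" unfolding ins_def sum_product by simp
 finally show ?thesis .
qed

lemma ins_1: "chom h ==> ins h x 1 = 1"
 using ins_single[of h x 0 1] by (simp add: phomD)

lemma ins_hom: "chom h ==> phom UNIV (ins h x)"
 by (auto simp: phom_def srg_UNIV ins_1 ins_add ins_mult)

lemma ins_ops:
 assumes h: "chom h"
 shows "ins h x (F - G) = ins h x F - ins h x G" "ins h x (- F) = - ins h x F"
 "ins h x (F ^ n) = ins h x F ^ n" "ins h x (prod f I) = (PROD i:I. ins h x (f i))"
 using phomD(6,7,8)[OF ins_hom[OF h]] phom_prod[OF ins_hom[OF h], of I f] by auto

lemma ins_const: "chom h ==> ins h x (mconst c) = h c"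
 by (simp add: mconst_def ins_single)

lemma ins_var: "chom h ==> ins h x (mvar v) = x v"
 by (simp add: mvar_def ins_single phomD mval_def)

lemma MP_iff: "F : MP k N \<longleftrightarrow> (ALL m:kys F. lkp F m : k & kys m \<subseteq> N)"
 by (simp add: mpoly_ring_def)

lemma MP_mono: "k \<subseteq> k' ==> N \<subseteq> N' ==> MP k N \<subseteq> MP k' N'"
 by (rule subsetI, unfold MP_iff) blast

lemma mvar_power: "mvar v ^ n = sgl (sgl v n) 1"
 by (induct n) (auto simp: mvar_def mult_single simp flip: single_add)

lemma prod_single_one: "finite A ==> (PROD v:A. sgl (f v) (1::complex)) = sgl (SUM v:A. f v) 1"
 by (induct A rule: finite_induct) (auto simp: mult_single)

lemma single_eq: "sgl m c = mconst c * mval mvar m"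
proof -
 have "mval mvar m = sgl (SUM v:kys m. sgl v (lkp m v)) 1"
 unfolding mval_def mvar_power by (rule prod_single_one) simp
 thus ?thesis using mpoly_sum_single[of m] by (simp add: mconst_def mult_single)
qed

lemma MP_single: "c : k ==> kys m \<subseteq> N ==> sgl m c : MP k N"
 by (auto simp: MP_iff lookup_single when_def)

lemma MP_add: "srg k ==> F : MP k N ==> G : MP k N ==> F + G : MP k N"
proof -
 assume a: "srg k" "F : MP k N" "G : MP k N"
 have "lkp F m : k" "lkp G m : k" for m
 using a srgD(2)[OF a(1)] by (cases "m : kys F"; cases "m : kys G"; simp add: MP_iff in_keys_iff)+
 moreover have "kys (F + G) <= kys F Un kys G" by (rule Poly_Mapping.keys_add)
 ultimately show ?thesis using a(2,3) srgD(3)[OF a(1)] unfolding MP_iff lookup_add by blast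
qed

lemma MP_sum: "srg k ==> (!!i. i : I ==> G i : MP k N) ==> sum G I : MP k N"
 by (induct I rule: infinite_finite_induct) (auto simp: MP_add, auto simp: MP_iff)

lemma MP_mult: assumes k: "srg k" and F: "F : MP k N" and G: "G : MP k N" shows "F * G : MP k N"
proof -
 have "F * G = (SUM m:kys F. sgl m (lkp F m)) * (SUM m:kys G. sgl m (lkp G m))"
 using mpoly_sum_single[of F] mpoly_sum_single[of G] by simp
 also have "\<dots> = (SUM m:kys F. SUM m':kys G. sgl (m + m') (lkp F m * lkp G m'))"
 by (simp add: sum_product mult_single)
 also have "\<dots> : MP k N"
 proof (intro MP_sum[OF k] MP_single srgD(4)[OF k])
 fix m m' assume "m : kys F" "m' : kys G"
 thus "kys (m + m') <= N" "lkp F m : k" "lkp G m' : k"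
 using F G Poly_Mapping.keys_add[of m m'] unfolding MP_iff by blast+
 qed
 finally show ?thesis .
qed

lemma MP_neg: "srg k ==> F : MP k N ==> - F : MP k N"
 by (auto simp: MP_iff srgD in_keys_iff)

lemma MP_const: "c : k ==> mconst c : MP k N"
 unfolding mconst_def by (rule MP_single) auto

lemma MP_var: "srg k ==> v : N ==> mvar v : MP k N"
 unfolding mvar_def by (rule MP_single) (auto simp: srgD)

lemma MP_srg: "srg k ==> srg (MP k N)"
 unfolding srg_def[of "MP k N"]
 using MP_const[of 1 k N] by (auto simp: MP_add MP_mult MP_neg srgD mconst_def)

lemma mval_in: "srg A ==> (!!v. v : kys m ==> x v : A) ==> mval x m : A"
 unfolding mval_def by (intro srg_prod srgD(7)) auto

lemma ins_in: "srg A ==> F : MP k N ==> (!!c. c : k ==> h c : A) ==> (!!v. v : N ==> x v : A) ==> ins h x F : A"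
 unfolding ins_def by (intro srg_sum srgD(4) mval_in) (auto simp: MP_iff)

lemma phom_ins:
 assumes f: "phom A f" and F: "F : MP k N" and h: "!!c. c : k ==> h c : A" and x: "!!v. v : N ==> x v : A"
 shows "f (ins h x F) = ins (%c. f (h c)) (%v. f (x v)) F"
proof -
 note A = phomD(1)[OF f]
 have m: "mval x m : A & f (mval x m) = mval (%v. f (x v)) m" if km: "kys m \<subseteq> N" for m
 proof
 have xA: "x v : A" if "v : kys m" for v using that km x by blast
 show "mval x m : A" by (rule mval_in[OF A]) (rule xA)
 have "f (mval x m) = (PROD v:kys m. f (x v ^ lkp m v))"
 unfolding mval_def by (rule phom_prod[OF f]) (rule srgD(7)[OF A xA])
 thus "f (mval x m) = mval (%v. f (x v)) m"
 unfolding mval_def using phomD(8)[OF f] xA by simp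
 qed
 show ?thesis unfolding ins_def using F m h
 by (subst phom_sum[OF f]) (auto intro!: srgD(4)[OF A] sum.cong simp: MP_iff phomD(4)[OF f])
qed

lemma ins_cong:
 assumes "F : MP k N" "!!c. c : k ==> h c = h' c" "!!v. v : N ==> x v = y v"
 shows "ins h x F = ins h' y F"
 unfolding ins_def
proof (rule sum.cong[OF refl])
 fix m assume "m : kys F"
 hence m: "lkp F m : k" "kys m <= N" using assms(1) by (auto simp: MP_iff)
 have "mval x m = mval y m" unfolding mval_def using m(2) assms(3) by (intro prod.cong) auto
 thus "h (lkp F m) * mval x m = h' (lkp F m) * mval y m" using assms(2)[OF m(1)] by simp
qed

lemma MP_UNIV: "F : MP UNIV UNIV" by (simp add: MP_iff)

lemma ins_msubst:
 assumes h: "chom h" shows "ins h x (msubst g F) = ins h (%v. ins h x (g v)) F"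
 unfolding msubst_ins using phom_ins[OF ins_hom[OF h] MP_UNIV[of F], of mconst g x]
 by (simp add: ins_const[OF h])

lemma MP_msubst: "srg k ==> F : MP k N ==> (!!v. v : N ==> g v : MP k M) ==> msubst g F : MP k M"
 unfolding msubst_ins by (rule ins_in[OF MP_srg]) (auto intro: MP_const)

lemma ins_mvar: "ins mconst mvar F = F"
proof -
 have "ins mconst mvar F = (SUM m:kys F. sgl m (lkp F m))" unfolding ins_def single_eq[symmetric] ..
 thus ?thesis using mpoly_sum_single[of F] by simp
qed

lemma mdeg_superset: "finite A ==> kys m \<subseteq> A ==> mdeg m = (SUM v:A. lkp m v)"
 unfolding mdeg_def by (rule sum.mono_neutral_left) (auto simp: in_keys_iff)

lemma mdeg_add: "mdeg (m + m') = mdeg m + mdeg m'"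
proof -
 let ?A = "kys m Un kys m'"
 have "kys (m + m') <= ?A" by (rule Poly_Mapping.keys_add)
 thus ?thesis by (simp add: mdeg_superset[of ?A] lookup_add sum.distrib)
qed

abbreviation hmg where "hmg \<equiv> homogeneous_of_degree"

lemma hmg_add: "hmg e F ==> hmg e G ==> hmg e (F + G)"
 unfolding homogeneous_of_degree_def using Poly_Mapping.keys_add[of F G] by blast

lemma hmg_0: "hmg e 0" by (simp add: homogeneous_of_degree_def)

lemma hmg_neg: "hmg e F ==> hmg e (- F)"
 by (auto simp: homogeneous_of_degree_def in_keys_iff)

lemma hmg_diff: "hmg e F ==> hmg e G ==> hmg e (F - G)"
 using hmg_add[of e F "- G"] hmg_neg[of e G] by simp

lemma hmg_sum: "(!!i. i : I ==> hmg e (G i)) ==> hmg e (sum G I)"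
 by (induct I rule: infinite_finite_induct) (auto simp: hmg_add hmg_0)

lemma hmg_mult: "hmg e F ==> hmg e' G ==> hmg (e + e') (F * G)"
 unfolding homogeneous_of_degree_def using keys_mult[of F G] by (fastforce simp: mdeg_add)

lemma hmg_const: "hmg 0 (mconst c)"
 by (auto simp: homogeneous_of_degree_def mconst_def mdeg_def)

lemma hmg_1: "hmg 0 1" using hmg_const[of 1] by (simp add: mconst_def)

lemma hmg_var: "hmg 1 (mvar v)"
 by (auto simp: homogeneous_of_degree_def mvar_def mdeg_def)

lemma hmg_power: "hmg e F ==> hmg (e * n) (F ^ n)"
proof (induct n)
 case (Suc n)
 thus ?case using hmg_mult[of e F "e * n" "F ^ n"] by simp
qed (simp add: hmg_1)

lemma hmg_prod: "finite I ==> (!!i. i : I ==> hmg (d i) (G i)) ==> hmg (SUM i:I. d i) (prod G I)"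
proof (induct I rule: finite_induct)
 case (insert a I)
 thus ?case using hmg_mult[of "d a" "G a" "SUM i:I. d i" "prod G I"] by simp
qed (simp add: hmg_1)

lemma hmg_msubst:
 assumes F: "hmg e F" "F : MP k N" and g: "!!v. v : N ==> hmg a (g v)"
 shows "hmg (a * e) (msubst g F)"
 unfolding msubst_ins ins_def
proof (rule hmg_sum)
 fix m assume m: "m : kys F"
 have "hmg (SUM v:kys m. a * lkp m v) (mval g m)"
 unfolding mval_def by (rule hmg_prod) (use m F(2) g in \<open>auto intro!: hmg_power simp: MP_iff subset_iff\<close>)
 moreover have "(SUM v:kys m. a * lkp m v) = a * e"
 using m F(1) by (simp add: homogeneous_of_degree_def mdeg_def sum_distrib_left[symmetric])
 ultimately show "hmg (a * e) (mconst (lkp F m) * mval g m)" using hmg_mult[OF hmg_const] by fastforce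
qed

lemma ins_hmg:
 assumes "hmg e F" shows "ins h (%v. c * x v) F = c ^ e * ins h x F"
 unfolding ins_def sum_distrib_left
proof (rule sum.cong[OF refl])
 fix m assume "m : kys F"
 hence "mdeg m = e" using assms by (simp add: homogeneous_of_degree_def)
 hence "mval (%v. c * x v) m = c ^ e * mval x m"
 by (auto simp: mval_def power_mult_distrib prod.distrib mdeg_def power_sum)
 thus "h (lkp F m) * mval (%v. c * x v) m = c ^ e * (h (lkp F m) * mval x m)" by (simp add: mult_ac)
qed

lemma lookup_hpart: "lkp (hpt e F) m = (if mdeg m = e then lkp F m else 0)"
proof -
 have "lkp (hpt e F) m = (SUM n | n : kys F & mdeg n = e. if n = m then lkp F m else 0)"
 unfolding homogeneous_part_def lookup_sum lookup_single when_def by (rule sum.cong) auto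
 also have "\<dots> = (if mdeg m = e then lkp F m else 0)"
 by (simp add: in_keys_iff)
 finally show ?thesis .
qed

lemma hmg_hpart: "hmg e (hpt e F)"
 by (auto simp: homogeneous_of_degree_def in_keys_iff lookup_hpart split: if_splits)

lemma MP_hpart: "F : MP k N ==> hpt e F : MP k N"
 by (auto simp: MP_iff in_keys_iff lookup_hpart split: if_splits)

lemma sum_hparts: "F = (SUM e:mdeg ` kys F. hpt e F)"
proof (rule poly_mapping_eqI)
 fix m
 have "lkp (SUM e:mdeg ` kys F. hpt e F) m = (SUM e:mdeg ` kys F. if e = mdeg m then lkp F m else 0)"
 unfolding lookup_sum lookup_hpart by (rule sum.cong) auto
 also have "\<dots> = lkp F m" by (cases "m : kys F") (auto simp: in_keys_iff image_iff)
 finally show "lkp F m = lkp (SUM e:mdeg ` kys F. hpt e F) m" by simp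
qed

lemma mpoly_as_univariate:
 assumes k: "srg k" and F: "F : MP k (insert v N)"
 shows "EX p:PA (MP k N). F = poly p (mvar v)"
proof -
 let ?B = "{poly p (mvar v) |p. p : PA (MP k N)}"
 have A: "srg (MP k N)" by (rule MP_srg[OF k])
 have B: "srg ?B" by (rule srg_poly_image[OF A])
 have c: "a : ?B" if "a : MP k N" for a
 using that by (auto intro!: exI[of _ "[:a:]"] simp: PA_pCons[OF A] PA_0[OF A])
 have x: "mvar v : ?B"
 by (auto intro!: exI[of _ "[:0, 1:]"] simp: PA_pCons[OF A] PA_0[OF A] srgD[OF A])
 have "ins mconst mvar F : ?B"
 proof (rule ins_in[OF B F])
 show "mconst c : ?B" if "c : k" for c using c[OF MP_const[OF that]] .
 show "mvar u : ?B" if "u : insert v N" for u using that x c[OF MP_var[OF k]] by blast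
 qed
 thus ?thesis unfolding ins_mvar by auto
qed

section \<open>Nullstellensatz\<close>

definition prm :: "'r::comm_ring_1 set => 'r set => bool" where
 "prm M I \<longleftrightarrow> I \<subseteq> M & 0 : I & 1 ~: I & (ALL a:I. ALL b:I. a + b : I) & (ALL a:M. ALL b:I. a * b : I) &
 (ALL a:M. ALL b:M. a * b : I --> a : I \<or> b : I)"

lemma prmD:
 assumes "prm M I"
 shows "I \<subseteq> M" "0 : I" "1 ~: I" "a : I ==> b : I ==> a + b : I" "a : M ==> b : I ==> a * b : I"
 "a : M ==> b : M ==> a * b : I ==> a : I \<or> b : I"
 using assms unfolding prm_def by blast+

lemma prm_more:
 assumes "prm M I" "srg M"
 shows "a : I ==> - a : I" "a : I ==> b : I ==> a - b : I" "a : M ==> a ^ n : I ==> a : I"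
 "(!!i. i : X' ==> f i : I) ==> sum f X' : I" "a : I ==> b : M ==> a * b : I"
proof -
 show 1: "a : I ==> - a : I" for a
 using prmD(5)[OF assms(1), of "- 1" a] srgD(1,5)[OF assms(2)] by simp
 show "a : I ==> b : I ==> a - b : I" using prmD(4)[OF assms(1), of a "- b"] 1 by simp
 show "a : M ==> a ^ n : I ==> a : I"
 by (induct n) (use prmD(3,6)[OF assms(1)] srgD(7)[OF assms(2)] in auto)
 show "(!!i. i : X' ==> f i : I) ==> sum f X' : I"
 by (induct X' rule: infinite_finite_induct) (auto simp: prmD[OF assms(1)])
 show "a : I ==> b : M ==> a * b : I" using prmD(5)[OF assms(1), of b a] by (simp add: mult.commute)
qed

lemma map_poly_phom:
 assumes f: "phom A f" and pq: "p : PA A" "q : PA A"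
 shows "map_poly f (p + q) = map_poly f p + map_poly f q" "map_poly f (p * q) = map_poly f p * map_poly f q"
 "map_poly f (p - q) = map_poly f p - map_poly f q" "a : A ==> map_poly f (smult a p) = smult (f a) (map_poly f p)"
 using pq by (auto intro!: poly_eqI simp: coeff_map_poly phomD[OF f] PA_D coeff_mult phom_sum[OF f] srgD[OF phomD(1)[OF f]])

lemma poly_map_in:
 "phom A f ==> srg K ==> f ` A \<subseteq> K ==> p : PA A ==> r : K ==> poly (map_poly f p) r : K"
 by (rule poly_in_srg) (auto simp: PA_def coeff_map_poly phomD)

lemma acl_infinite:
 assumes K: "acl (K :: 'c::field_char_0 set)" and q: "q ~= 0"
 shows "EX r:K. poly q r ~= 0"
proof (rule ccontr)
 assume "\<not> ?thesis"
 hence "range (of_nat :: nat => 'c) <= {x. poly q x = 0}"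
 using srg_of_nat[of K] K by (auto simp: acl_def sfd_def)
 hence "finite (range (of_nat :: nat => 'c))" using poly_roots_finite[OF q] finite_subset by blast
 thus False by (simp add: range_inj_infinite inj_of_nat)
qed

text \<open>Points of \<open>A\<close> over \<open>K\<close> that kill the part of \<open>I\<close>
  in \<open>A\<close> detect every element of \<open>A\<close> outside \<open>I\<close>. In the
  induction only \<open>A\<close> grows, while the prime \<open>I\<close> stays in the full
  ring.\<close>

definition pts :: "'c::field_char_0 set => ('c => 'r::comm_ring_1) => 'r set => 'r set => bool" where
 "pts K j I A \<longleftrightarrow> (ALL g:A. g ~: I --> (EX ps. phom A ps & ps ` A \<subseteq> K & (ALL a:A. a : I --> ps a = 0) &
 ps g ~= 0 & (ALL c:K. ps (j c) = c)))"

text \<open>Modulo the prime I, x is transcendental or algebraic over A. In the first case a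
  coefficient of g is kept nonzero and x gets a general value. In the second, one element of A
  outside I has to be found whose nonvanishing guarantees both a root of the relation and that g is
  nonzero at this root.\<close>

lemma pts_adjoin:
 fixes K :: "'c::field_char_0 set" and M I A :: "'r::comm_ring_1 set"
 assumes K: "acl K" and M: "srg M" and I: "prm M I" and A: "srg A" "A \<subseteq> M" and x: "x : M"
 and j: "!!c. c : K ==> j c : A" and H: "pts K j I A"
 shows "pts K j I {poly p x |p. p : PA A}"
 unfolding pts_def
proof (intro ballI impI)
 let ?B = "{poly p x |p. p : PA A}"
 have Ks: "srg K" using K by (auto simp: acl_def sfd_def)
 have B: "srg ?B" by (rule srg_poly_image[OF A(1)])
 have PM: "poly p x : M" if "p : PA A" for p
 using poly_in_srg[OF M _ x] that PA_mono[OF A(2)] by blast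
 have PI: "poly p x : I" if "p : PA I" for p
 unfolding poly_altdef using that x
 by (intro prm_more(4)[OF I M] prm_more(5)[OF I M] srgD(7)[OF M]) (auto simp: PA_D)
 have PIops: "p + q : PA I" "p - q : PA I" if "p : PA I" "q : PA I" for p q
 using that prmD(4)[OF I] prm_more(2)[OF I M] by (auto simp: PA_def)
 have PImult: "p * q : PA I" if "p : PA A" "q : PA I" for p q
 using that A(2) by (auto simp: PA_def coeff_mult intro!: prm_more(4)[OF I M] prmD(5)[OF I])
 have PIsm: "p : PA I" if "smult a p : PA I" "a : A" "a ~: I" "p : PA A" for a p
 using that A(2) prmD(6)[OF I] by (auto simp: PA_def) blast
 \<comment> \<open>Leading terms with coefficient in I are discarded until the leading coefficient
   lies outside I; degrees modulo the prime then behave as over a domain.\<close>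
 have trunc: "EX p':PA A. p - p' : PA I & lead_coeff p' ~: I & p' ~: PA I" if p: "p : PA A" "p ~: PA I" for p
 using p
 proof (induct "degree p" arbitrary: p rule: less_induct)
 case (less p)
 show ?case
 proof (cases "lead_coeff p : I")
 case False
 thus ?thesis using less(2,3) prmD(2)[OF I] by (intro bexI[of _ p]) (auto simp: PA_def)
 next
 case True
 define p1 where "p1 = p - Polynomial.monom (lead_coeff p) (degree p)"
 have m: "Polynomial.monom (lead_coeff p) (degree p) : PA I"
 using True prmD(2)[OF I] by (auto simp: PA_def coeff_monom)
 have p1: "p1 : PA A" unfolding p1_def using less(2) by (intro PA_ops(2,6)[OF A(1)]) (auto simp: PA_D)
 have n1: "p1 ~: PA I" using PIops(1)[OF _ m, of p1] less(3) by (auto simp: p1_def)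
 have "degree p1 <= degree p" unfolding p1_def by (intro degree_diff_le) (auto simp: degree_monom_le)
 moreover have "cof p1 (degree p) = 0" by (simp add: p1_def)
 moreover have "p1 ~= 0" using n1 prmD(2)[OF I] by (auto simp: PA_def)
 ultimately have "degree p1 < degree p" by (metis leading_coeff_0_iff le_neq_implies_less)
 then obtain p' where p': "p' : PA A" "p1 - p' : PA I" "lead_coeff p' ~: I" "p' ~: PA I"
 using less(1)[OF _ p1 n1] by blast
 have "p - p' = (p1 - p') + Polynomial.monom (lead_coeff p) (degree p)" by (simp add: p1_def)
 hence "p - p' : PA I" using PIops(1)[OF p'(2) m] by metis
 thus ?thesis using p' by blast
 qed
 qed
 fix g assume "g : ?B" and gI: "g ~: I"
 then obtain q where q: "q : PA A" "g = poly q x" by auto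
 have qI: "q ~: PA I" using PI gI q(2) by blast
 \<comment> \<open>It remains to find a homomorphism \<open>ps\<close> on A and a value r for x that
   respects all relations of x modulo I and does not annihilate q.\<close>
 have fin: "EX ps'. phom ?B ps' & ps' ` ?B <= K & (ALL a:?B. a : I --> ps' a = 0) & ps' g ~= 0 & (ALL c:K. ps' (j c) = c)"
 if ps: "phom A ps" "ps ` A \<subseteq> K" "ALL c:K. ps (j c) = c" and r: "r : K" "poly (map_poly ps q) r ~= 0"
 and z: "ALL p:PA A. poly p x : I --> poly (map_poly ps p) r = 0" for ps r
 proof -
 define ps' where "ps' b = poly (map_poly ps (SOME p. p : PA A & poly p x = b)) r" for b
 have e: "ps' (poly p x) = poly (map_poly ps p) r" if p: "p : PA A" for p
 proof -
 define s where "s = (SOME s. s : PA A & poly s x = poly p x)"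
 have s: "s : PA A & poly s x = poly p x" unfolding s_def by (rule someI[of _ p]) (use p in auto)
 hence "s - p : PA A" "poly (s - p) x : I" using p PA_ops(2)[OF A(1)] prmD(2)[OF I] by auto
 hence "poly (map_poly ps (s - p)) r = 0" using z by blast
 thus ?thesis using map_poly_phom(3)[OF ps(1), of s p] s p by (simp add: ps'_def s_def)
 qed
 have "phom ?B ps'"
 unfolding phom_def
 proof (intro conjI ballI)
 have "ps' (poly 1 x) = 1" by (subst e) (auto simp: PA_1[OF A(1)] map_poly_1' phomD[OF ps(1)])
 thus "ps' 1 = 1" by simp
 fix a b assume "a : ?B" "b : ?B"
 then obtain p p' where pp: "p : PA A" "p' : PA A" "a = poly p x" "b = poly p' x" by auto
 show "ps' (a + b) = ps' a + ps' b" using e[OF PA_ops(1)[OF A(1) pp(1,2)]] e[OF pp(1)] e[OF pp(2)] pp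
 map_poly_phom(1)[OF ps(1) pp(1,2)] by simp
 show "ps' (a * b) = ps' a * ps' b" using e[OF PA_ops(4)[OF A(1) pp(1,2)]] e[OF pp(1)] e[OF pp(2)] pp
 map_poly_phom(2)[OF ps(1) pp(1,2)] by simp
 qed (rule B)
 moreover have "ps' ` ?B <= K" using e poly_map_in[OF ps(1) Ks ps(2) _ r(1)] by auto
 moreover have "ALL a:?B. a : I --> ps' a = 0" using e z by auto
 moreover have "ps' g ~= 0" using e[OF q(1)] q(2) r(2) by simp
 moreover have "ps' (j c) = c" if "c : K" for c
 using e[of "[:j c:]"] j[OF that] ps(3) that by (simp add: PA_pCons[OF A(1)] PA_0[OF A(1)] map_poly_pCons phomD(5)[OF ps(1)])
 ultimately show ?thesis by blast
 qed
 show "EX ps'. phom ?B ps' & ps' ` ?B <= K & (ALL a:?B. a : I --> ps' a = 0) & ps' g ~= 0 & (ALL c:K. ps' (j c) = c)"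
 proof (cases "EX p. p : PA A & poly p x : I & p ~: PA I")
 case False
 obtain i where i: "cof q i ~: I" using qI by (auto simp: PA_def)
 then obtain ps where ps: "phom A ps" "ps ` A \<subseteq> K" "ALL a:A. a : I --> ps a = 0" "ps (cof q i) ~= 0" "ALL c:K. ps (j c) = c"
 using H PA_D[OF q(1)] unfolding pts_def by blast
 have "cof (map_poly ps q) i ~= 0" using ps(4) by (simp add: coeff_map_poly phomD(5)[OF ps(1)])
 hence "map_poly ps q ~= 0" by auto
 then obtain r where r: "r : K" "poly (map_poly ps q) r ~= 0" using acl_infinite[OF K] by blast
 have "map_poly ps p = 0" if "p : PA A" "poly p x : I" for p
 proof -
 have "p : PA I" using that False by blast
 thus ?thesis using that(1) ps(3) by (intro poly_eqI) (simp add: coeff_map_poly phomD(5)[OF ps(1)] PA_D)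
 qed
 thus ?thesis using fin[OF ps(1,2,5) r] by simp
 next
 case True
 define Q where "Q p \<longleftrightarrow> p : PA A & poly p x : I & lead_coeff p ~: I" for p
 have Qex: "EX p'. Q p' & p - p' : PA I & p' : PA A" if p: "p : PA A" "poly p x : I" "p ~: PA I" for p
 proof -
 obtain p' where p': "p' : PA A" "p - p' : PA I" "lead_coeff p' ~: I" using trunc[OF p(1,3)] by blast
 have "poly p' x = poly p x - poly (p - p') x" by simp
 hence "poly p' x : I" using prm_more(2)[OF I M p(2) PI[OF p'(2)]] by simp
 thus ?thesis using p' by (auto simp: Q_def)
 qed
 obtain pp where "Q pp" using True Qex by blast
 define p0 where "p0 = arg_min degree Q"
 have p0: "Q p0" "!!p. Q p ==> degree p0 <= degree p"
 using arg_min_natI[of Q, OF \<open>Q pp\<close>, of degree] arg_min_nat_le[of Q _ degree] unfolding p0_def by auto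
 have p0A: "p0 : PA A" "poly p0 x : I" "lead_coeff p0 ~: I" using p0(1) by (auto simp: Q_def)
 have low: "R : PA I" if R: "R : PA A" "poly R x : I" "R = 0 \<or> degree R < degree p0" for R
 proof (rule ccontr)
 assume nR: "R ~: PA I"
 have "R : PA I" using R nR
 proof (induct "degree R" arbitrary: R rule: less_induct)
 case (less R)
 show ?case
 proof (cases "lead_coeff R : I")
 case False
 hence "Q R" using less by (auto simp: Q_def)
 hence "degree p0 <= degree R" using p0(2) by blast
 thus ?thesis using less(4,5) prmD(2)[OF I] by (auto simp: PA_def)
 next
 case True
 define R1 where "R1 = R - Polynomial.monom (lead_coeff R) (degree R)"
 have m: "Polynomial.monom (lead_coeff R) (degree R) : PA I"
 using True prmD(2)[OF I] by (auto simp: PA_def coeff_monom)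
 have R1: "R1 : PA A" unfolding R1_def using less(2) by (intro PA_ops(2,6)[OF A(1)]) (auto simp: PA_D)
 have v: "poly R1 x : I" unfolding R1_def using prm_more(2)[OF I M less(3) PI[OF m]] by simp
 have R0: "R ~= 0" using less(5) prmD(2)[OF I] by (auto simp: PA_def)
 have d1: "degree R1 <= degree R" unfolding R1_def by (intro degree_diff_le) (auto simp: degree_monom_le)
 have c0: "cof R1 (degree R) = 0" by (simp add: R1_def)
 have d2: "R1 = 0 \<or> degree R1 < degree R" using d1 c0 by (metis leading_coeff_0_iff le_neq_implies_less)
 have "R1 : PA I"
 proof (rule ccontr)
 assume n: "R1 ~: PA I"
 hence "R1 ~= 0" using prmD(2)[OF I] by (auto simp: PA_def)
 hence "R1 : PA I" using less(1)[of R1] d2 R1 v n R0 less(4) by auto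
 thus False using n by blast
 qed
 thus ?thesis using PIops(1)[OF _ m, of R1] by (simp add: R1_def)
 qed
 qed
 thus False using nR by blast
 qed
 \<comment> \<open>The ideal generated by the relation \<open>p0\<close> and by \<open>q\<close>,
   modulo I. Its element \<open>s\<close> of least degree acts as their greatest common
   divisor.\<close>
 define S where "S = {s : PA A. EX a:PA A. EX b:PA A. s - (a * p0 + b * q) : PA I}"
 have Sdiff: "smult c s - d * s' : S" if s: "s : S" "s' : S" and c: "c : A" "d : PA A" for s s' c d
 proof -
 obtain a b a' b' where ab: "a : PA A" "b : PA A" "s - (a * p0 + b * q) : PA I"
 "a' : PA A" "b' : PA A" "s' - (a' * p0 + b' * q) : PA I" using s by (auto simp: S_def)
 have cA: "[:c:] : PA A" using c(1) by (simp add: PA_pCons[OF A(1)] PA_0[OF A(1)])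
 have "[:c:] * (s - (a * p0 + b * q)) - d * (s' - (a' * p0 + b' * q)) : PA I"
 by (intro PIops(2) PImult cA c ab)
 moreover have "[:c:] * (s - (a * p0 + b * q)) - d * (s' - (a' * p0 + b' * q)) =
 (smult c s - d * s') - (([:c:] * a - d * a') * p0 + ([:c:] * b - d * b') * q)"
 by (simp add: algebra_simps)
 ultimately have "(smult c s - d * s') - (([:c:] * a - d * a') * p0 + ([:c:] * b - d * b') * q) : PA I" by metis
 moreover have "smult c s - d * s' : PA A" using s by (auto simp: S_def intro!: PA_ops[OF A(1)] c)
 moreover have "[:c:] * a - d * a' : PA A" "[:c:] * b - d * b' : PA A" by (intro PA_ops[OF A(1)] c ab cA)+
 ultimately show ?thesis unfolding S_def by blast
 qed
 have zI: "0 : PA I" using prmD(2)[OF I] by (auto simp: PA_def)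
 have "p0 - (1 * p0 + 0 * q) : PA I" "q - (0 * p0 + 1 * q) : PA I" using zI by auto
 hence p0S: "p0 : S" and qS: "q : S"
 unfolding S_def using p0A(1) q(1) PA_0[OF A(1)] PA_1[OF A(1)] by blast+
 define T where "T s \<longleftrightarrow> s : S & lead_coeff s ~: I" for s
 have T0: "T p0" using p0S p0A(3) by (simp add: T_def)
 define s where "s = arg_min degree T"
 have s: "T s" "!!s'. T s' ==> degree s <= degree s'"
 using arg_min_natI[of T, OF T0, of degree] arg_min_nat_le[of T _ degree] unfolding s_def by auto
 have sA: "s : PA A" "s : S" "lead_coeff s ~: I" using s(1) by (auto simp: T_def S_def)
 have lowS: "R : PA I" if R: "R : S" "R = 0 \<or> degree R < degree s" for R
 using R
 proof (induct "degree R" arbitrary: R rule: less_induct)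
 case (less R)
 have RA: "R : PA A" using less(2) by (simp add: S_def)
 show ?case
 proof (cases "R = 0")
 case True thus ?thesis using zI by simp
 next
 case R0: False
 have lR: "lead_coeff R : I" using s(2)[of R] less(2,3) R0 by (auto simp: T_def)
 define R1 where "R1 = R - Polynomial.monom (lead_coeff R) (degree R)"
 have m: "Polynomial.monom (lead_coeff R) (degree R) : PA I"
 using lR prmD(2)[OF I] by (auto simp: PA_def coeff_monom)
 have R1A: "R1 : PA A" unfolding R1_def using RA by (intro PA_ops(2,6)[OF A(1)]) (auto simp: PA_D)
 obtain a b where ab: "a : PA A" "b : PA A" "R - (a * p0 + b * q) : PA I" using less(2) by (auto simp: S_def)
 have "R1 - (a * p0 + b * q) = (R - (a * p0 + b * q)) - Polynomial.monom (lead_coeff R) (degree R)"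
 by (simp add: R1_def)
 hence "R1 - (a * p0 + b * q) : PA I" using PIops(2)[OF ab(3) m] by metis
 hence R1S: "R1 : S" using R1A ab(1,2) by (auto simp: S_def)
 have d1: "degree R1 <= degree R" unfolding R1_def by (intro degree_diff_le) (auto simp: degree_monom_le)
 have c0: "cof R1 (degree R) = 0" by (simp add: R1_def)
 have d2: "R1 = 0 \<or> degree R1 < degree R" using d1 c0 by (metis leading_coeff_0_iff le_neq_implies_less)
 have "R1 : PA I"
 using less(1)[OF _ R1S] d2 less(3) R0 zI by auto
 thus ?thesis using PIops(1)[OF _ m, of R1] by (simp add: R1_def)
 qed
 qed
 define l where "l = lead_coeff s"
 have lA: "l : A" using PA_D[OF sA(1)] by (simp add: l_def)
 have lM: "l ^ n : M" "l ^ n ~: I" "l ^ n : A" for n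
 using prm_more(3)[OF I M, of l n] lA A(2) sA(3) srgD(7)[OF M] srgD(7)[OF A(1) lA] by (auto simp: l_def)
 obtain k1 Q1 R1 where d1: "Q1 : PA A" "R1 : PA A" "smult (l ^ k1) p0 = Q1 * s + R1" "R1 = 0 \<or> degree R1 < degree s"
 using pseudo_division[OF A(1) sA(1) p0A(1)] unfolding l_def by blast
 obtain k2 Q2 R2 where d2: "Q2 : PA A" "R2 : PA A" "smult (l ^ k2) q = Q2 * s + R2" "R2 = 0 \<or> degree R2 < degree s"
 using pseudo_division[OF A(1) sA(1) q(1)] unfolding l_def by blast
 have R1: "R1 : PA I" using lowS[of R1] Sdiff[OF p0S sA(2) lM(3) d1(1), of k1] d1(3,4) by simp
 have R2: "R2 : PA I" using lowS[of R2] Sdiff[OF qS sA(2) lM(3) d2(1), of k2] d2(3,4) by simp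
 have sx: "poly s x ~: I"
 proof
 assume a: "poly s x : I"
 have "l ^ k2 * poly q x = poly Q2 x * poly s x + poly R2 x"
 using arg_cong[OF d2(3), of "%p. poly p x"] by simp
 also have "\<dots> : I" by (intro prmD(4)[OF I] prmD(5)[OF I] PM d2 a PI R2)
 finally show False using prmD(6)[OF I lM(1) PM[OF q(1)]] lM(2) gI q(2) by blast
 qed
 have "poly Q1 x * poly s x = l ^ k1 * poly p0 x - poly R1 x"
 using arg_cong[OF d1(3), of "%p. poly p x"] by simp
 also have "\<dots> : I" by (intro prm_more(2)[OF I M] prmD(5)[OF I] lM p0A PI R1)
 finally have Q1x: "poly Q1 x : I" using prmD(6)[OF I PM[OF d1(1)] PM[OF sA(1)]] sx by blast
 have Q1n: "Q1 ~: PA I"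
 proof
 assume "Q1 : PA I"
 hence "s * Q1 + R1 : PA I" by (intro PIops(1) PImult sA R1)
 hence "smult (l ^ k1) p0 : PA I" using d1(3) by (simp add: mult.commute)
 hence "p0 : PA I" using PIsm lM p0A(1) by blast
 thus False using p0A(3) PA_D by blast
 qed
 obtain Qt where Qt: "Q Qt" "Q1 - Qt : PA I" "Qt : PA A" using Qex[OF d1(1) Q1x Q1n] by blast
 have ge: "degree p0 <= degree Qt" using p0(2)[OF Qt(1)] .
 \<comment> \<open>Up to a power of l, \<open>p0\<close> is \<open>Q1 * s\<close> modulo I. As s(x)
   is not in I, \<open>Q1\<close> is itself a relation of x and has at least the degree of
   \<open>p0\<close> modulo I, so no degree is left for s. Its constant \<open>h0\<close> is the
   element to be kept nonzero.\<close>
 have "degree s = 0"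
 proof (rule ccontr)
 assume ds: "degree s ~= 0"
 let ?n = "degree Qt + degree s"
 have "Qt * s - smult (l ^ k1) p0 = - (s * (Q1 - Qt)) - R1" using d1(3) by (simp add: algebra_simps)
 also have "\<dots> = (0 - s * (Q1 - Qt)) - R1" by simp
 also have "\<dots> : PA I" by (intro PIops(2) PImult sA zI Qt R1)
 finally have "cof (Qt * s - smult (l ^ k1) p0) ?n : I" by (rule PA_D)
 moreover have "cof p0 ?n = 0" using ge ds by (intro coeff_eq_0) auto
 ultimately have "lead_coeff Qt * lead_coeff s : I" by (simp add: coeff_mult_degree_sum)
 thus False using prmD(6)[OF I, of "lead_coeff Qt" "lead_coeff s"] Qt(1) sA PA_D[OF Qt(3)] A(2)
 by (auto simp: Q_def PA_D subset_iff)
 qed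
 then obtain h0 where h0: "s = [:h0:]" by (auto elim: degree_eq_zeroE)
 have h0A: "h0 : A" "h0 ~: I" using sA h0 PA_D[OF sA(1), of 0] by auto
 have l0A: "lead_coeff p0 : A" using PA_D[OF p0A(1)] .
 have "lead_coeff p0 * h0 ~: I" using prmD(6)[OF I, of "lead_coeff p0" h0] p0A(3) h0A l0A A(2) by blast
 then obtain ps where ps: "phom A ps" "ps ` A \<subseteq> K" "ALL a:A. a : I --> ps a = 0" "ps (lead_coeff p0 * h0) ~= 0" "ALL c:K. ps (j c) = c"
 using H srgD(4)[OF A(1) l0A h0A(1)] unfolding pts_def by blast
 have nz: "ps (lead_coeff p0) ~= 0" "ps h0 ~= 0" using ps(4) phomD(4)[OF ps(1) l0A h0A(1)] by auto
 have PsiI: "map_poly ps p = 0" if "p : PA A" "p : PA I" for p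
 using that ps(3) by (intro poly_eqI) (simp add: coeff_map_poly phomD(5)[OF ps(1)] PA_D)
 have dp0: "degree p0 > 0"
 proof (rule ccontr)
 assume "\<not> degree p0 > 0"
 then obtain c where "p0 = [:c:]" by (auto elim: degree_eq_zeroE)
 thus False using p0A(2,3) by simp
 qed
 have "cof (map_poly ps p0) (degree p0) ~= 0" using nz(1) by (simp add: coeff_map_poly phomD(5)[OF ps(1)])
 hence "degree (map_poly ps p0) > 0" using dp0 le_degree by fastforce
 moreover have "map_poly ps p0 : PA K" using ps(2) p0A(1) by (auto simp: PA_def coeff_map_poly phomD(5)[OF ps(1)])
 ultimately obtain r where r: "r : K" "poly (map_poly ps p0) r = 0" using K by (auto simp: acl_def)
 have z: "ALL p:PA A. poly p x : I --> poly (map_poly ps p) r = 0"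
 proof (intro ballI impI)
 fix p assume p: "p : PA A" "poly p x : I"
 obtain k3 Q3 R3 where d3: "Q3 : PA A" "R3 : PA A" "smult (lead_coeff p0 ^ k3) p = Q3 * p0 + R3" "R3 = 0 \<or> degree R3 < degree p0"
 using pseudo_division[OF A(1) p0A(1) p(1)] by blast
 have l3: "lead_coeff p0 ^ k3 : A" using srgD(7)[OF A(1) l0A] .
 have "poly R3 x = lead_coeff p0 ^ k3 * poly p x - poly Q3 x * poly p0 x"
 using arg_cong[OF d3(3), of "%p. poly p x"] by simp
 also have "\<dots> : I" using l3 A(2) by (intro prm_more(2)[OF I M] prmD(5)[OF I] p PM d3 p0A) auto
 finally have "R3 : PA I" using low[OF d3(2) _ d3(4)] by blast
 hence "map_poly ps R3 = 0" using PsiI d3(2) by blast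
 hence "smult (ps (lead_coeff p0 ^ k3)) (map_poly ps p) = map_poly ps Q3 * map_poly ps p0"
 using arg_cong[OF d3(3), of "map_poly ps"] map_poly_phom(4)[OF ps(1) p(1) p(1) l3]
 map_poly_phom(1)[OF ps(1) PA_ops(4)[OF A(1) d3(1) p0A(1)] d3(2)] map_poly_phom(2)[OF ps(1) d3(1) p0A(1)] by simp
 from arg_cong[OF this, of "%p. poly p r"] have "ps (lead_coeff p0) ^ k3 * poly (map_poly ps p) r = 0"
 using r(2) phomD(8)[OF ps(1) l0A] by simp
 thus "poly (map_poly ps p) r = 0" using nz(1) by simp
 qed
 obtain a b where ab: "a : PA A" "b : PA A" "s - (a * p0 + b * q) : PA I" using sA(2) by (auto simp: S_def)
 have abA: "a * p0 : PA A" "b * q : PA A" "a * p0 + b * q : PA A" by (intro PA_ops[OF A(1)] ab p0A q)+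
 have "map_poly ps (s - (a * p0 + b * q)) = 0" by (intro PsiI PA_ops(2)[OF A(1)] sA abA ab)
 hence "map_poly ps s = map_poly ps a * map_poly ps p0 + map_poly ps b * map_poly ps q"
 using map_poly_phom(3)[OF ps(1) sA(1) abA(3)] map_poly_phom(1)[OF ps(1) abA(1,2)]
 map_poly_phom(2)[OF ps(1) ab(1) p0A(1)] map_poly_phom(2)[OF ps(1) ab(2) q(1)] by simp
 from arg_cong[OF this, of "%p. poly p r"] have "ps h0 = poly (map_poly ps b) r * poly (map_poly ps q) r"
 using r(2) h0 by (simp add: map_poly_pCons phomD(5)[OF ps(1)])
 hence "poly (map_poly ps q) r ~= 0" using nz(2) by auto
 thus ?thesis using fin[OF ps(1,2,5) r(1) _ z] by blast
 qed
qed

text \<open>The variables are adjoined one at a time below a fixed prime I. In the base case a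
  nonzero constant cannot lie in I, since it would be a unit there.\<close>

theorem nullstellensatz:
 assumes K: "acl K" and N: "finite N" and I: "prm (MP K N) I" and G: "G : MP K N" "G ~: I"
 obtains x where "ALL v. x v : K" "ALL F:I. meval x F = 0" "meval x G ~= 0"
proof -
 have Ks: "srg K" using K by (auto simp: acl_def sfd_def)
 have M: "srg (MP K N)" by (rule MP_srg[OF Ks])
 have "pts K mconst I (MP K N')" if "N' \<subseteq> N" for N'
 using finite_subset[OF that N] that
 proof (induct N' rule: finite_induct)
 case empty
 have e: "F : MP K {} ==> F = mconst (lkp F 0)" for F :: "'a mpoly"
 proof -
 assume F: "F : MP K {}"
 hence "kys F <= {0}" by (auto simp: MP_iff)
 thus ?thesis by (intro poly_mapping_eqI) (auto simp: mconst_def lookup_single when_def in_keys_iff subset_iff)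
 qed
 have lk: "lkp F 0 : K" if "F : MP K {}" for F :: "'a mpoly"
 using that srgD(2)[OF Ks] by (cases "0 : kys F") (auto simp: MP_iff in_keys_iff)
 have ch: "lkp (mconst c :: 'a mpoly) 0 = c" for c :: complex by (simp add: mconst_def)
 have 1: "phom (MP K {}) (%F :: 'a mpoly. lkp F 0)" unfolding phom_def
 proof (intro conjI ballI)
 fix F G :: "'a mpoly" assume "F : MP K {}" "G : MP K {}"
 hence "F * G = mconst (lkp F 0 * lkp G 0)"
 using e[of F] e[of G] phomD(4)[OF chom_mconst, of "lkp F 0" "lkp G 0"] UNIV_I by metis
 thus "lkp (F * G) 0 = lkp F 0 * lkp G 0" by (simp add: ch)
 qed (auto simp: lookup_add MP_srg[OF Ks])
 have 2: "(%F :: 'a mpoly. lkp F 0) ` MP K {} <= K" using lk by auto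
 have 3: "lkp g 0 ~= 0" if g: "g : MP K {}" "g ~: I" for g
 using e[OF g(1)] g(2) prmD(2)[OF I] by (metis single_zero mconst_def)
 have 4: "ALL c:K. lkp (mconst c :: 'a mpoly) 0 = c" by (simp add: ch)
 have 5: "ALL a:MP K {}. a : I --> lkp a 0 = 0"
 proof (intro ballI impI)
 fix a assume a: "a : MP K {}" "a : I"
 show "lkp a 0 = 0"
 proof (rule ccontr)
 assume n: "lkp a 0 ~= 0"
 have "mconst (inverse (lkp a 0)) : MP K N"
 using lk[OF a(1)] K by (intro MP_const) (auto simp: acl_def sfd_def)
 hence "mconst (inverse (lkp a 0)) * a : I" using prmD(5)[OF I] a(2) by blast
 moreover have "mconst (inverse (lkp a 0)) * a = 1"
 proof -
 define c where "c = lkp a 0"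
 have ac: "a = mconst c" unfolding c_def by (rule e[OF a(1)])
 have "mconst (inverse c) * mconst c = (mconst (inverse c * c) :: 'a mpoly)"
 by (rule phomD(4)[OF chom_mconst, symmetric]) auto
 hence "mconst (inverse c) * mconst c = (1 :: 'a mpoly)"
 using n by (simp add: c_def) (simp add: mconst_def)
 thus ?thesis by (subst (2) ac) (simp only: c_def)
 qed
 ultimately show False using prmD(3)[OF I] by simp
 qed
 qed
 show ?case unfolding pts_def
 proof (rule ballI, rule impI)
 fix g :: "'a mpoly" assume "g : MP K {}" "g ~: I"
 thus "EX ps. phom (MP K {}) ps & ps ` MP K {} <= K & (ALL a:MP K {}. a : I --> ps a = 0) &
 ps g ~= 0 & (ALL c:K. ps (mconst c) = c)"
 by (rule_tac exI[of _ "%F. lkp F 0"]) (rule conjI[OF 1 conjI[OF 2 conjI[OF 5 conjI[OF 3 4]]]])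
 qed
 next
 case (insert v N')
 have sub: "MP K N' <= MP K N" using insert(4) by (intro MP_mono) auto
 have "MP K (insert v N') = {poly p (mvar v) |p. p : PA (MP K N')}"
 proof
 show "MP K (insert v N') <= {poly p (mvar v) |p. p : PA (MP K N')}" using mpoly_as_univariate[OF Ks] by fast
 have "poly p (mvar v) : MP K (insert v N')" if "p : PA (MP K N')" for p
 proof -
 have "p : PA (MP K (insert v N'))" using that PA_mono[OF MP_mono[of K K N' "insert v N'"]] by blast
 thus ?thesis by (intro poly_in_srg[OF MP_srg[OF Ks]] MP_var[OF Ks]) auto
 qed
 thus "{poly p (mvar v) |p. p : PA (MP K N')} <= MP K (insert v N')" by blast
 qed
 moreover have "pts K mconst I {poly p (mvar v) |p. p : PA (MP K N')}"
 by (rule pts_adjoin[OF K M I MP_srg[OF Ks] sub])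
 (use insert in \<open>auto intro!: MP_var[OF Ks] MP_const\<close>)
 ultimately show ?case by simp
 qed
 from this[OF order_refl] obtain ps where ps: "phom (MP K N) ps" "ps ` MP K N \<subseteq> K" "ALL a:MP K N. a : I --> ps a = 0"
 "ps G ~= 0" "ALL c:K. ps (mconst c) = c" using G unfolding pts_def by blast
 define x where "x v = (if v : N then ps (mvar v) else 0)" for v
 have e: "meval x F = ps F" if F: "F : MP K N" for F
 proof -
 have "ps (ins mconst mvar F) = ins (%c. ps (mconst c)) (%v. ps (mvar v)) F"
 by (rule phom_ins[OF ps(1) F]) (auto intro: MP_const MP_var[OF Ks])
 also have "\<dots> = ins (%c. c) x F" by (rule ins_cong[OF F]) (auto simp: ps(5) x_def)
 finally show ?thesis by (simp add: ins_mvar meval_ins)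
 qed
 show ?thesis
 proof (rule that[of x])
 have "x v : K" for v using ps(2) MP_var[OF Ks, of v N] srgD(2)[OF Ks] by (auto simp: x_def)
 thus "ALL v. x v : K" by blast
 show "ALL F:I. meval x F = 0" using e prmD(1)[OF I] ps(3) by (metis subsetD)
 show "meval x G ~= 0" using e G ps(4) by simp
 qed
qed

section \<open>Generated subfields and primitive elements\<close>

definition sfg :: "'a::field set => 'a set" where "sfg S = \<Inter>{T. sfd T & S \<subseteq> T}"
definition srgn :: "'a::comm_ring_1 set => 'a set" where "srgn S = \<Inter>{T. srg T & S \<subseteq> T}"

lemma sfd_sfg: "sfd (sfg S)"
 unfolding sfg_def sfd_def srg_def by blast

lemma srg_sfg: "srg (sfg S)" using sfd_sfg[of S] by (simp add: sfd_def)

lemma sfg_super: "S \<subseteq> sfg S" unfolding sfg_def by blast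

lemma sfg_least: "sfd T ==> S \<subseteq> T ==> sfg S \<subseteq> T" unfolding sfg_def by blast

lemma sfg_mono: "S \<subseteq> T ==> sfg S \<subseteq> sfg T" by (meson order_trans sfd_sfg sfg_least sfg_super)

lemma srg_srgn: "srg (srgn S)" unfolding srgn_def srg_def by blast

lemma srgn_super: "S \<subseteq> srgn S" unfolding srgn_def by blast

lemma srgn_least: "srg T ==> S \<subseteq> T ==> srgn S \<subseteq> T" unfolding srgn_def by blast

lemma srgn_sfg: "srgn S \<subseteq> sfg S" by (rule srgn_least[OF srg_sfg sfg_super])

lemma sfd_der_ker: "der D ==> sfd {x. D x = 0}"
 unfolding sfd_def srg_def by (auto simp: derD der_inverse)

lemma der_zero_sfg: "der D ==> (!!s. s : S ==> D s = 0) ==> x : sfg S ==> D x = 0"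
 using sfg_least[OF sfd_der_ker, of D S] by blast

lemma sfg_frac:
 assumes "c : sfg S" shows "EX a:srgn S. EX b:srgn S. b ~= 0 & c = a / b"
proof -
 let ?R = "srgn S" and ?T = "{a / b |a b. a : srgn S & b : srgn S & b ~= 0}"
 have R: "srg ?R" by (rule srg_srgn)
 have m: "a / b : ?T" if "a : ?R" "b : ?R" "b ~= 0" for a b using that by blast
 have "sfd ?T"
 unfolding sfd_def srg_def
 proof (intro conjI ballI)
 show "1 : ?T" using m[of 1 1] srgD(1)[OF R] by simp
 fix x assume "x : ?T"
 then obtain a b where ab: "x = a / b" "a : ?R" "b : ?R" "b ~= 0" by blast
 show "- x : ?T" using m[of "- a" b] ab srgD(5)[OF R] by simp
 show "inverse x : ?T"
 proof (cases "a = 0")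
 case True thus ?thesis using m[of 0 1] ab srgD(1,2)[OF R] by simp
 next
 case False thus ?thesis using m[of b a] ab by simp
 qed
 fix y assume "y : ?T"
 then obtain c d where cd: "y = c / d" "c : ?R" "d : ?R" "d ~= 0" by blast
 have "x + y = (a * d + c * b) / (b * d)" "x * y = (a * c) / (b * d)"
 using ab cd by (auto simp: field_simps)
 moreover have "(a * d + c * b) / (b * d) : ?T" by (rule m) (use ab cd in \<open>auto intro!: srgD[OF R]\<close>)
 moreover have "(a * c) / (b * d) : ?T" by (rule m) (use ab cd in \<open>auto intro!: srgD[OF R]\<close>)
 ultimately show "x + y : ?T" "x * y : ?T" by simp_all
 qed
 moreover have "S <= ?T"
 proof
 fix s assume "s : S" thus "s : ?T" using m[of s 1] srgn_super[of S] srgD(1)[OF R] by fastforce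
 qed
 ultimately have "c : ?T" using sfg_least[of ?T S] assms by blast
 thus ?thesis by blast
qed

text \<open>Minimality, divisibility and remainders are bundled, so that F can remain a set of
  elements instead of becoming a coefficient type.\<close>

definition minp :: "'a::field set => 'a => 'a poly => bool" where
 "minp F y m \<longleftrightarrow> m : PA F & lead_coeff m = 1 & poly m y = 0 & degree m > 0 &
 (ALL p:PA F. poly p y = 0 --> p = 0 \<or> degree m <= degree p) &
 (ALL p:PA F. poly p y = 0 --> (EX q:PA F. p = q * m)) &
 (ALL p:PA F. EX r:PA F. degree r < degree m & poly r y = poly p y & (EX q:PA F. p = q * m + r))"

lemma minpD:
 assumes "minp F y m"
 shows "m : PA F" "lead_coeff m = 1" "poly m y = 0" "degree m > 0"
 "ALL p:PA F. poly p y = 0 --> p = 0 \<or> degree m <= degree p"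
 "ALL p:PA F. poly p y = 0 --> (EX q:PA F. p = q * m)"
 "ALL p:PA F. EX r:PA F. degree r < degree m & poly r y = poly p y & (EX q:PA F. p = q * m + r)"
 using assms unfolding minp_def by blast+

lemma algb_monic:
 assumes F: "sfd F" and y: "algb F y"
 shows "EX m. minp F y m"
proof -
 note S = sfdD(1)[OF F]
 obtain p where p: "p : PA F" "p ~= 0" "poly p y = 0" "ALL q:PA F. q ~= 0 --> poly q y = 0 --> degree p <= degree q"
 using algb_minimal[OF y] by blast
 define m where "m = smult (inverse (lead_coeff p)) p"
 have m: "m : PA F" "lead_coeff m = 1" "poly m y = 0" "degree m = degree p"
 unfolding m_def using p PA_ops(5)[OF S sfdD(2)[OF F PA_D[OF p(1)]] p(1)] by auto
 have d0: "degree m > 0"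
 proof (rule ccontr)
 assume "\<not> degree m > 0"
 then obtain c where "m = [:c:]" by (auto elim: degree_eq_zeroE)
 thus False using m(2,3) by simp
 qed
 have min: "ALL p:PA F. poly p y = 0 --> p = 0 \<or> degree m <= degree p" using p(4) m(4) by auto
 have div: "ALL p:PA F. EX r:PA F. degree r < degree m & poly r y = poly p y & (EX q:PA F. p = q * m + r)"
 proof
 fix s assume s: "s : PA F"
 obtain k Q R where "Q : PA F" "R : PA F" "smult (lead_coeff m ^ k) s = Q * m + R" "R = 0 \<or> degree R < degree m"
 using pseudo_division[OF S m(1) s] by blast
 hence QR: "Q : PA F" "R : PA F" "s = Q * m + R" "degree R < degree m" using m(2) d0 by auto
 moreover have "poly R y = poly s y" using QR(3) m(3) by simp
 ultimately show "EX r:PA F. degree r < degree m & poly r y = poly s y & (EX q:PA F. s = q * m + r)" by blast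
 qed
 have dvd: "ALL p:PA F. poly p y = 0 --> (EX q:PA F. p = q * m)"
 proof (intro ballI impI)
 fix s assume s: "s : PA F" "poly s y = 0"
 from bspec[OF div s(1)] obtain r q where r: "r : PA F" "degree r < degree m" "poly r y = poly s y" "q : PA F" "s = q * m + r" by blast
 have "poly r y = 0" by (simp only: r(3) s(2))
 hence "r = 0 \<or> degree m <= degree r" using min r(1) by blast
 hence "r = 0" using r(2) by simp
 thus "EX q:PA F. s = q * m" using r by auto
 qed
 show ?thesis unfolding minp_def using m(1-3) d0 min dvd div by blast
qed

lemma algb_poly: 
 fixes x :: "'a::field_char_0"
 assumes "srg F" "algb F x" "p : PA F" shows "algb F (poly p x)"
proof -
 have "PA F <= PA {x. algb F x}" by (rule PA_mono) (auto intro: algb_self assms)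
 thus ?thesis using poly_in_srg[of "{x. algb F x}" p x] sfd_algb[OF assms(1)] assms by (auto simp: sfd_def)
qed

lemma algb_sfg:
 fixes x :: "'a::field_char_0"
 assumes "srg F" "!!s. s : S ==> algb F s" "x : sfg (F Un S)" shows "algb F x"
 using sfg_least[OF sfd_algb[OF assms(1)], of "F Un S"] assms algb_self[OF assms(1)] by blast

text \<open>The inverse of an element is read off from its minimal polynomial, whose constant term
  is nonzero by minimality.\<close>

lemma simple_extension:
 fixes y :: "'a::field_char_0"
 assumes F: "sfd F" and y: "algb F y"
 shows "sfg (F Un {y}) = {poly p y |p. p : PA F}"
proof
 note S = sfdD(1)[OF F]
 let ?B = "{poly p y |p. p : PA F}"
 have B: "srg ?B" by (rule srg_poly_image[OF S])
 have inv: "inverse z : ?B" if z: "z : ?B" for z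
 proof (cases "z = 0")
 case True thus ?thesis using srgD(2)[OF B] by simp
 next
 case z0: False
 have FB: "F <= ?B"
 proof
 fix a assume "a : F"
 hence "[:a:] : PA F" "a = poly [:a:] y" by (auto simp: PA_pCons[OF S] PA_0[OF S])
 thus "a : ?B" by blast
 qed
 have "algb F z" using z algb_poly[OF S y] by auto
 then obtain m where "minp F z m" using algb_monic[OF F] by blast
 note m = minpD(1,3,4,5)[OF this]
 obtain a p where ap: "m = pCons a p" by (cases m) auto
 have pF: "p : PA F" "a : F" using m(1) ap PA_pCons[OF S] by auto
 have a0: "a ~= 0"
 proof
 assume "a = 0"
 hence "poly p z = 0" using m(2) ap z0 by simp
 moreover have "p ~= 0" using m(3) ap by auto
 ultimately show False using m(4) pF ap by fastforce
 qed
 have "z * poly p z = - a" using m(2) ap by (simp add: eq_neg_iff_add_eq_0 add.commute)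
 hence "inverse z = - poly p z * inverse a" using z0 a0 by (simp add: field_simps)
 moreover have "poly p z : ?B" using poly_in_srg[OF B _ z] pF(1) PA_mono[OF FB] by blast
 moreover have "inverse a : ?B" using FB sfdD(2)[OF F pF(2)] by blast
 ultimately show ?thesis using srgD(4,5)[OF B] by simp
 qed
 hence "sfd ?B" using B by (simp add: sfd_def)
 moreover have "F Un {y} <= ?B"
 proof
 fix a assume "a : F Un {y}"
 moreover have "[:a:] : PA F & a = poly [:a:] y" if "a : F" using that by (auto simp: PA_pCons[OF S] PA_0[OF S])
 moreover have "[:0, 1:] : PA F & y = poly [:0, 1:] y" by (auto simp: PA_pCons[OF S] PA_0[OF S] srgD[OF S])
 ultimately show "a : ?B" by blast
 qed
 ultimately show "sfg (F Un {y}) <= ?B" by (rule sfg_least)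
 have "F <= sfg (F Un {y})" using sfg_super[of "F Un {y}"] by blast
 hence "PA F <= PA (sfg (F Un {y}))" by (rule PA_mono)
 moreover have "y : sfg (F Un {y})" using sfg_super[of "F Un {y}"] by blast
 ultimately have "poly p y : sfg (F Un {y})" if "p : PA F" for p
 using poly_in_srg[OF srg_sfg[of "F Un {y}"], of p y] that by blast
 thus "?B <= sfg (F Un {y})" by blast
qed

text \<open>The root r is arbitrary because all conjugates of y must be distinct. A root shared with
  the derivative would make the minimal polynomial of r a proper factor of m, and y would be a root
  of one of two factors of smaller degree.\<close>

lemma minpoly_separable:
 fixes y :: "'a::field_char_0"
 assumes F: "sfd F" and m: "m : PA F" "lead_coeff m = 1" "poly m y = 0" "degree m > 0"
 "ALL p:PA F. poly p y = 0 --> p = 0 \<or> degree m <= degree p" and r: "poly m r = 0"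
 shows "poly (pderiv m) r ~= 0"
proof
 assume d: "poly (pderiv m) r = 0"
 note S = sfdD(1)[OF F]
 have "algb F r" unfolding algb_def using m(1,2) r by (intro bexI[of _ m]) auto
 then obtain n where "minp F r n" using algb_monic[OF F] by blast
 note n = minpD(1,2,4,6)[OF this]
 have pd: "pderiv m ~= 0" "degree (pderiv m) < degree m" using m(4) by (auto simp: pderiv_eq_0_iff degree_pderiv)
 obtain q1 where q1: "pderiv m = q1 * n" using n(4) PA_pderiv[OF S m(1)] d by blast
 hence "degree n <= degree (pderiv m)" using pd(1) by (auto simp: degree_mult_eq)
 hence nm: "degree n < degree m" using pd(2) by simp
 obtain q where q: "q : PA F" "m = q * n" using n(4) m(1) r by blast
 have nz: "q ~= 0" "n ~= 0" using q(2) m(2) by auto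
 hence "degree q < degree m" using q(2) n(3) by (auto simp: degree_mult_eq)
 moreover have "poly q y = 0 \<or> poly n y = 0" using m(3) q(2) by simp
 ultimately show False using m(5) q(1) n(1) nm nz by fastforce
qed

lemma primitive_element2:
 fixes a :: "'a::{field_char_0,alg_closed_field}"
 assumes F: "sfd F" and a: "algb F a" and b: "algb F b"
 shows "EX y:sfg (F Un {a, b}). a : sfg (F Un {y}) & b : sfg (F Un {y})"
proof -
 note S = sfdD(1)[OF F]
 obtain f where "minp F a f" using algb_monic[OF F a] by blast
 note f = minpD(1,2,3)[OF this]
 obtain g where "minp F b g" using algb_monic[OF F b] by blast
 note g = minpD(1-5)[OF this]
 \<comment> \<open>The values l for which a + l b equals s + l t for a root s of f and a root t of g
   other than b. The set is finite, so some natural number avoids it.\<close>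
 define Bad where "Bad = (%(s, t). (s - a) / (b - t)) ` ({x. poly f x = 0} \<times> {x. poly g x = 0})"
 have "finite Bad" unfolding Bad_def using f(2) g(2) by (intro finite_imageI finite_cartesian_product poly_roots_finite) auto
 moreover have "infinite (range (of_nat :: nat => 'a))" by (simp add: range_inj_infinite inj_of_nat)
 ultimately have "\<not> range (of_nat :: nat => 'a) <= Bad" using finite_subset[of "range (of_nat :: nat => 'a)" Bad] by blast
 then obtain l where l: "l : range (of_nat :: nat => 'a)" "l ~: Bad" by blast
 have lF: "l : F" using l(1) srg_of_nat[OF S] by auto
 define y where "y = a + l * b"
 let ?M = "sfg (F Un {y})"
 have M: "sfd ?M" "srg ?M" by (rule sfd_sfg, rule srg_sfg)
 have FM: "F <= ?M" "y : ?M" using sfg_super[of "F Un {y}"] by auto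
 \<comment> \<open>\<open>k\<close> is f(y - l X). It vanishes at b, and since l is not in
   \<open>Bad\<close> it shares no other root with g.\<close>
 define k where "k = pcompose f [:y, - l:]"
 have kM: "k : PA ?M"
 proof -
 have "f : PA ?M" using f(1) PA_mono[OF FM(1)] by blast
 thus ?thesis unfolding k_def
 proof (induct f)
 case (pCons c f)
 have "- l : ?M" using FM(1) lF srgD(5)[OF M(2)] by blast
 hence "[:y, - l:] : PA ?M" using FM(2) PA_pCons[OF M(2)] PA_0[OF M(2)] by blast
 moreover have "c : ?M" "f : PA ?M" using pCons(3) PA_pCons[OF M(2)] by blast+
 moreover have "[:c:] : PA ?M" using calculation PA_pCons[OF M(2)] PA_0[OF M(2)] by blast
 ultimately show ?case unfolding pcompose_pCons using pCons(2) PA_ops(1,4)[OF M(2)] by blast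
 qed (simp add: PA_0[OF M(2)])
 qed
 have kb: "poly k b = 0" using f(3) by (simp add: k_def poly_pcompose y_def)
 have gM: "g : PA ?M" using g(1) PA_mono[OF FM(1)] by blast
 have "algb ?M b" unfolding algb_def using gM g(2,3) by (intro bexI[of _ g]) auto
 then obtain n where "minp ?M b n" using algb_monic[OF M(1)] by blast
 note n = minpD(1-6)[OF this]
 obtain q1 where q1: "g = q1 * n" using n(6) gM g(3) by blast
 obtain q2 where q2: "k = q2 * n" using n(6) kM kb by blast
 have uniq: "t = b" if t: "poly n t = 0" for t
 proof (rule ccontr)
 assume tb: "t ~= b"
 have "poly g t = 0" "poly k t = 0" using t q1 q2 by auto
 hence "poly g t = 0" "poly f (y - l * t) = 0" by (auto simp: k_def poly_pcompose mult.commute)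
 moreover have "l = (y - l * t - a) / (b - t)" using tb by (simp add: y_def field_simps)
 ultimately have "l : Bad" unfolding Bad_def by (auto intro!: image_eqI[of _ _ "(y - l * t, t)"])
 thus False using l(2) by blast
 qed
 have "degree n = 1"
 proof (rule ccontr)
 assume "degree n ~= 1"
 obtain q where q: "n = [:- b, 1:] * q" using n(3) unfolding poly_eq_0_iff_dvd by (elim dvdE)
 have q0: "q ~= 0" using q n(4) by auto
 hence "degree ([:- b, 1:] * q) = degree [:- b, 1:] + degree q" by (intro degree_mult_eq) auto
 hence "degree n = 1 + degree q" by (simp only: q) simp
 hence "degree q > 0" using \<open>degree n ~= 1\<close> n(4) by simp
 then obtain t where t: "poly q t = 0" using alg_closed_imp_poly_has_root by blast
 hence "t = b" using uniq[of t] q by simp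
 have "pderiv n = [:- b, 1:] * pderiv q + q * pderiv [:- b, 1:]" by (simp only: q pderiv_mult)
 hence "poly (pderiv n) b = 0" using t \<open>t = b\<close> by (simp only: poly_add poly_mult) simp
 thus False using minpoly_separable[OF M(1) n(1-5) n(3)] by blast
 qed
 define c0 c1 where "c0 = cof n 0" and "c1 = cof n 1"
 have c: "n = [:c0, c1:]" using \<open>degree n = 1\<close> 
 by (intro poly_eqI) (auto simp: c0_def c1_def coeff_pCons coeff_eq_0 split: nat.splits)
 hence "c1 = 1" using n(2) \<open>degree n = 1\<close> c1_def by simp
 hence "b = - c0" using n(3) c by (simp add: eq_neg_iff_add_eq_0 add.commute)
 moreover have "c0 : ?M" unfolding c0_def by (rule PA_D[OF n(1)])
 ultimately have bM: "b : ?M" using srgD(5)[OF M(2)] by blast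
 have "a = y - l * b" by (simp add: y_def)
 hence "a : ?M" using bM FM lF srgD(4,6)[OF M(2)] by blast
 moreover have "y : sfg (F Un {a, b})" unfolding y_def
 using sfg_super[of "F Un {a, b}"] lF by (intro srgD(3,4)[OF srg_sfg]) auto
 ultimately show ?thesis using bM by blast
qed

lemma primitive_element:
 fixes F :: "'a::{field_char_0,alg_closed_field} set"
 assumes F: "sfd F" and Z: "finite Z" "!!z. z : Z ==> algb F z"
 shows "EX y:sfg (F Un Z). Z \<subseteq> sfg (F Un {y})"
 using Z
proof (induct Z rule: finite_induct)
 case empty
 thus ?case using srgD(2)[OF srg_sfg] by blast
next
 case (insert z Z)
 then obtain y where y: "y : sfg (F Un Z)" "Z \<subseteq> sfg (F Un {y})" by auto
 have "algb F y" using algb_sfg[OF sfdD(1)[OF F] _ y(1)] insert(4) by blast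
 then obtain w where w: "w : sfg (F Un {y, z})" "y : sfg (F Un {w})" "z : sfg (F Un {w})"
 using primitive_element2[OF F, of y z] insert(4) by blast
 have "sfg (F Un {y}) <= sfg (F Un {w})" using w(2) sfg_super[of "F Un {w}"] by (intro sfg_least[OF sfd_sfg]) auto
 hence "insert z Z <= sfg (F Un {w})" using w(3) y(2) by blast
 moreover have "sfg (F Un {y, z}) <= sfg (F Un insert z Z)"
 using y(1) sfg_mono[of "F Un Z" "F Un insert z Z"] sfg_super[of "F Un insert z Z"] by (intro sfg_least[OF sfd_sfg]) blast
 ultimately show ?case using w(1) by blast
qed

lemma card_roots_minpoly:
 fixes m :: "'a::{field_char_0,alg_closed_field} poly"
 assumes m: "m ~= 0" and sep: "!!r. poly m r = 0 ==> poly (pderiv m) r ~= 0"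
 shows "card {r. poly m r = 0} = degree m"
proof -
 obtain A where A: "size A = degree m" "m = smult (lead_coeff m) (\<Prod>x\<in>#A. [:-x, 1:])"
 using alg_closed_imp_factorization[OF m] by blast
 have lc: "lead_coeff m ~= 0" using m by simp
 have set: "{r. poly m r = 0} = set_mset A"
 proof -
 have "poly m r = lead_coeff m * (\<Prod>x\<in>#A. r - x)" for r
 by (subst A(2)) (simp add: poly_prod_mset image_mset.compositionality o_def)
 thus ?thesis using lc by (auto simp: prod_mset_zero_iff)
 qed
 have "count A x <= 1" for x
 proof (rule ccontr)
 assume "\<not> count A x <= 1"
 hence "x \<in># A" by (simp add: not_in_iff[symmetric] flip: count_greater_zero_iff)
 then obtain C where C: "A = add_mset x C" by (metis insert_DiffM)
 hence "x \<in># C" using \<open>\<not> count A x <= 1\<close> by (simp flip: count_greater_zero_iff)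
 then obtain B where B: "A = add_mset x (add_mset x B)" using C by (metis insert_DiffM)
 define q where "q = smult (lead_coeff m) (\<Prod>x\<in>#B. [:-x, 1:])"
 have e: "m = [:-x, 1:] * ([:-x, 1:] * q)" by (subst A(2)) (simp add: B q_def)
 have "poly m x = 0" by (subst e) simp
 moreover have "poly (pderiv m) x = 0" proof -
 have "pderiv m = [:-x, 1:] * pderiv ([:-x, 1:] * q) + ([:-x, 1:] * q) * pderiv [:-x, 1:]" by (subst e) (rule pderiv_mult)
 thus ?thesis by (simp only: poly_add poly_mult) simp
 qed
 ultimately show False using sep by blast
 qed
 hence "count A x = 1" if "x \<in># A" for x using that by (metis count_greater_eq_one_iff le_antisym)
 hence "size A = card (set_mset A)" unfolding size_multiset_overloaded_eq by simp
 thus ?thesis using A(1) set by simp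
qed

text \<open>The numbers \<open>lam r l\<close> are the coefficients of the Lagrange basis
  polynomials. They recover the coefficients of a polynomial linearly from its values, which later
  are conjugates of a field element.\<close>

lemma lagrange_coeff:
 fixes R :: "'a::field set"
 assumes "finite R"
 obtains lam where "ALL p. degree p < card R --> (ALL l. cof p l = (SUM r:R. poly p r * lam r l))"
 "ALL r:R. ALL l. lam r l : sfg R"
proof -
 define L where "L r = (PROD s:R - {r}. smult (inverse (r - s)) [:- s, 1:])" for r
 have Lr: "poly (L r) t = (if t = r then 1 else 0)" if "r : R" "t : R" for r t
 proof -
 have "poly (L r) t = (PROD s:R - {r}. inverse (r - s) * (t - s))" unfolding L_def poly_prod by (intro prod.cong) (auto simp: algebra_simps)
 moreover have "(PROD s:R - {r}. inverse (r - s) * (t - s)) = 1" if "t = r"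
 proof (rule prod.neutral, rule ballI)
 fix s assume "s : R - {r}"
 hence "r - s ~= 0" by auto
 thus "inverse (r - s) * (t - s) = 1" using that by simp
 qed
 moreover have "(PROD s:R - {r}. inverse (r - s) * (t - s)) = 0" if "t ~= r"
 using that \<open>t : R\<close> assms by (subst prod_zero_iff) (auto intro!: bexI[of _ t])
 ultimately show ?thesis by simp
 qed
 have Ldeg: "degree (L r) <= card R - 1" if "r : R" for r
 proof -
 have "degree (L r) <= sum (degree \<circ> (%s. smult (inverse (r - s)) [:- s, 1:])) (R - {r})"
 unfolding L_def by (rule degree_prod_sum_le) (use assms in auto)
 also have "\<dots> <= (SUM s:R - {r}. 1)" by (intro sum_mono) simp
 finally show ?thesis using that assms by simp
 qed
 have 1: "cof p l = (SUM r:R. poly p r * cof (L r) l)" if p: "degree p < card R" for p l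
 proof -
 define q where "q = (SUM r:R. smult (poly p r) (L r))"
 have qp: "poly q t = poly p t" if t: "t : R" for t
 proof -
 have "poly q t = (SUM r:R. if r = t then poly p t else 0)"
 unfolding q_def poly_sum
 proof (rule sum.cong[OF refl])
 fix r assume "r : R"
 thus "poly (smult (poly p r) (L r)) t = (if r = t then poly p t else 0)" using Lr[of r t] t by auto
 qed
 thus ?thesis using assms t by simp
 qed
 hence sub: "R <= {t. poly (p - q) t = 0}" by auto
 have dq: "degree q <= card R - 1" unfolding q_def
 using Ldeg by (intro degree_sum_le) (auto intro: order_trans[OF degree_smult_le] simp: assms)
 have "degree (p - q) < card R" using degree_diff_le_max[of p q] p dq by linarith
 have "p - q = 0"
 proof (rule ccontr)
 assume nz: "p - q ~= 0"
 have "card R <= card {t. poly (p - q) t = 0}" by (intro card_mono poly_roots_finite nz sub)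
 also have "\<dots> <= degree (p - q)" by (rule card_poly_roots_bound[OF nz])
 finally show False using \<open>degree (p - q) < card R\<close> by simp
 qed
 hence "p = q" by simp
 hence "cof p l = cof q l" by simp
 thus ?thesis by (simp add: q_def coeff_sum)
 qed
 have 2: "cof (L r) l : sfg R" if "r : R" for r l
 proof -
 have "L r : PA (sfg R)" unfolding L_def
 proof (rule srg_prod)
 show "srg (PA (sfg R))" unfolding srg_def using PA_ops(1,3,4)[OF srg_sfg[of R]] PA_1[OF srg_sfg[of R]] by blast
 fix s assume "s : R - {r}"
 hence "s : sfg R" "r : sfg R" using that sfg_super[of R] by auto
 hence i: "inverse (r - s) : sfg R" and n: "- s : sfg R" and o: "1 : sfg R"
 using sfdD(2)[OF sfd_sfg srgD(6)[OF srg_sfg], of r R s] srgD(5)[OF srg_sfg, of s R] srgD(1)[OF srg_sfg, of R] by auto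
 have "[:- s, 1:] : PA (sfg R)" using PA_pCons[OF srg_sfg[of R]] PA_0[OF srg_sfg[of R]] n o by auto
 thus "smult (inverse (r - s)) [:- s, 1:] : PA (sfg R)" using PA_ops(5)[OF srg_sfg i] by blast
 qed
 thus ?thesis by (rule PA_D)
 qed
 show ?thesis by (rule that[of "%r l. cof (L r) l"]) (use 1 2 in auto)
qed

section \<open>Linear algebra over a subfield\<close>

definition lspan :: "'a::field set => 'a set => 'a set" where
 "lspan K B = {SUM b:B. c b * b |c. ALL b:B. c b : K}"

definition lind :: "'a::field set => 'a set => bool" where
 "lind K B \<longleftrightarrow> (ALL c. (ALL b:B. c b : K) --> (SUM b:B. c b * b) = 0 --> (ALL b:B. c b = 0))"

lemma lspan_add: "srg K ==> x : lspan K B ==> y : lspan K B ==> x + y : lspan K B"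
proof -
 assume K: "srg K" and "x : lspan K B" "y : lspan K B"
 then obtain c d where "x = (SUM b:B. c b * b)" "y = (SUM b:B. d b * b)" "ALL b:B. c b : K" "ALL b:B. d b : K"
 by (auto simp: lspan_def)
 hence "x + y = (SUM b:B. (c b + d b) * b)" "ALL b:B. c b + d b : K"
 using srgD(3)[OF K] by (auto simp: sum.distrib distrib_right)
 thus ?thesis unfolding lspan_def by (intro CollectI exI[of _ "%b. c b + d b"]) simp
qed

lemma lspan_scale: "srg K ==> a : K ==> x : lspan K B ==> a * x : lspan K B"
proof -
 assume K: "srg K" "a : K" and "x : lspan K B"
 then obtain c where "x = (SUM b:B. c b * b)" "ALL b:B. c b : K" by (auto simp: lspan_def)
 hence "a * x = (SUM b:B. (a * c b) * b)" "ALL b:B. a * c b : K"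
 using srgD(4)[OF K(1) K(2)] by (auto simp: sum_distrib_left mult.assoc)
 thus ?thesis unfolding lspan_def by (intro CollectI exI[of _ "%b. a * c b"]) simp
qed

lemma lspan_sum: "srg K ==> (!!i. i : I ==> f i : lspan K B) ==> sum f I : lspan K B"
proof (induct I rule: infinite_finite_induct)
 case (infinite A)
 have "0 = (SUM b:B. 0 * b)" by simp
 thus ?case using infinite(1) srgD(2)[OF infinite(2)] by (auto simp: lspan_def intro!: exI[of _ "%_. 0"])
next
 case empty
 thus ?case using srgD(2)[OF empty(1)] by (auto simp: lspan_def intro!: exI[of _ "%_. 0"])
qed (auto intro: lspan_add)

lemma lspan_self: "srg K ==> finite B ==> b : B ==> b : lspan K B"
proof -
 assume K: "srg K" and B: "finite B" "b : B"
 have "(SUM b':B. (if b' = b then 1 else 0) * b') = (SUM b':B. if b' = b then b else 0)" by (intro sum.cong) auto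
 hence "b = (SUM b':B. (if b' = b then 1 else 0) * b')" using B by simp
 moreover have "ALL b':B. (if b' = b then 1 else 0) : K" using srgD(1,2)[OF K] by simp
 ultimately show ?thesis unfolding lspan_def mem_Collect_eq
 by (intro exI[of _ "%b'. if b' = b then 1 else 0"]) blast
qed

lemma lspan_trans: "srg K ==> finite B ==> A \<subseteq> lspan K B ==> lspan K A \<subseteq> lspan K B"
proof
 fix x assume K: "srg K" and B: "finite B" "A \<subseteq> lspan K B" and "x : lspan K A"
 then obtain c where c: "x = (SUM b:A. c b * b)" "ALL b:A. c b : K" by (auto simp: lspan_def)
 show "x : lspan K B" unfolding c(1) by (rule lspan_sum[OF K], rule lspan_scale[OF K]) (use c B in auto)
qed

lemma lbasis:
 assumes K: "sfd K" and A: "finite A"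
 shows "\<exists>B\<subseteq>A. lind K B & A \<subseteq> lspan K B"
 using A
proof (induct A rule: finite_induct)
 case empty
 show ?case by (intro exI[of _ "{}"]) (auto simp: lind_def)
next
 case (insert a A)
 note S = sfdD(1)[OF K]
 obtain B where B: "B \<subseteq> A" "lind K B" "A \<subseteq> lspan K B" using insert(3) by blast
 have fB: "finite B" using B(1) insert(1) finite_subset by blast
 show ?case
 proof (cases "a : lspan K B")
 case True
 thus ?thesis using B by (intro exI[of _ B]) auto
 next
 case False
 have aB: "a ~: B" using False lspan_self[OF S fB] by blast
 have "lind K (insert a B)"
 unfolding lind_def
 proof (intro allI impI)
 fix c assume c: "ALL b:insert a B. c b : K" "(SUM b:insert a B. c b * b) = 0"
 hence s: "c a * a = - (SUM b:B. c b * b)" using fB aB by (simp add: eq_neg_iff_add_eq_0)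
 have ca: "c a = 0"
 proof (rule ccontr)
 assume n: "c a ~= 0"
 have "a = inverse (c a) * (c a * a)" using n by simp
 also have "\<dots> = (- inverse (c a)) * (SUM b:B. c b * b)" unfolding s by simp
 also have "\<dots> : lspan K B"
 proof (rule lspan_scale[OF S])
 show "- inverse (c a) : K" using c(1) srgD(5)[OF S] sfdD(2)[OF K] by blast
 show "(SUM b:B. c b * b) : lspan K B" using c(1) unfolding lspan_def by blast
 qed
 finally show False using False by blast
 qed
 hence "(SUM b:B. c b * b) = 0" using s by simp
 hence "ALL b:B. c b = 0" using B(2) c(1) unfolding lind_def by blast
 thus "ALL b:insert a B. c b = 0" using ca by blast
 qed
 moreover have "lspan K B <= lspan K (insert a B)"
 using fB lspan_self[OF S, of "insert a B"] by (intro lspan_trans[OF S]) auto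
 hence "insert a A <= lspan K (insert a B)" using B(3) lspan_self[OF S, of "insert a B" a] fB by auto
 ultimately show ?thesis using B(1) by (intro exI[of _ "insert a B"]) auto
 qed
qed

lemma underdetermined:
 fixes f :: "'i => 'n => 'a::field"
 assumes "finite N" "finite I" "card N < card I"
 shows "EX a. (EX i:I. a i ~= 0) & (ALL n:N. (SUM i:I. a i * f i n) = 0)"
 using assms
proof (induct N arbitrary: I f rule: finite_induct)
 case empty
 hence "I ~= {}" by auto
 thus ?case by (intro exI[of _ "%_. 1"]) auto
next
 case (insert n N)
 show ?case
 proof (cases "EX j:I. f j n ~= 0")
 case False
 have "card N < card I" using insert by simp
 from insert(3)[OF insert(4) this, of f] obtain a where "(EX i:I. a i ~= 0)" "ALL n:N. (SUM i:I. a i * f i n) = 0" by blast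
 thus ?thesis using False by (intro exI[of _ a]) auto
 next
 case True
 then obtain j where j: "j : I" "f j n ~= 0" by blast
 define g where "g i m = f i m - f i n / f j n * f j m" for i m
 have "card N < card (I - {j})" using insert j(1) by simp
 from insert(3)[OF _ this, of g] obtain a where a: "EX i:I - {j}. a i ~= 0" "ALL m:N. (SUM i:I - {j}. a i * g i m) = 0"
 using insert(4) by auto
 define b where "b i = (if i = j then - (SUM i:I - {j}. a i * f i n) / f j n else a i)" for i
 have e: "(SUM i:I. b i * f i m) = (SUM i:I - {j}. a i * g i m)" for m
 proof -
 have "(SUM i:I. b i * f i m) = b j * f j m + (SUM i:I - {j}. a i * f i m)"
 using insert(4) j(1) by (subst sum.remove[of _ j]) (auto simp: b_def intro!: sum.cong)
 also have "b j * f j m = - (SUM i:I - {j}. a i * (f i n / f j n * f j m))"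
 by (simp add: b_def sum_distrib_right sum_divide_distrib sum_negf[symmetric] mult.assoc)
 finally show ?thesis by (simp add: g_def algebra_simps sum_subtractf)
 qed
 have "g i n = 0" for i using j(2) by (simp add: g_def)
 hence "ALL m:insert n N. (SUM i:I. b i * f i m) = 0" using e a(2) by auto
 moreover have "EX i:I. b i ~= 0" using a(1) by (auto simp: b_def)
 ultimately show ?thesis by blast
 qed
qed

section \<open>Determinants\<close>

text \<open>The Leibniz formula in the shape of \<open>ring_det\<close>, to be compared with it term
  by term under evaluation; matrix theory enters only through \<open>dt_det\<close>.\<close>

definition dt :: "nat => (nat => nat => 'a::comm_ring_1) => 'a" where
 "dt d a = (SUM p | p permutes {..<d}. (if evenperm p then 1 else - 1) * (PROD i<d. a i (p i)))"

lemma dt_det: "dt d a = det (mat d d (%(i, j). a i j))"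
proof -
 have "det (mat d d (%(i, j). a i j)) = (SUM p | p permutes {0..<d}. signof p * (PROD i = 0..<d. mat d d (%(i, j). a i j) $$ (i, p i)))"
 by (rule det_def') simp
 also have "\<dots> = dt d a" unfolding dt_def atLeast0LessThan
 proof (rule sum.cong[OF refl])
 fix p assume "p : {p. p permutes {..<d}}"
 hence "p i < d" if "i < d" for i using that permutes_in_image[of p "{..<d}" i] by auto
 hence "(PROD i<d. mat d d (%(i, j). a i j) $$ (i, p i)) = (PROD i<d. a i (p i))" by (intro prod.cong) auto
 thus "signof p * (PROD i<d. mat d d (%(i, j). a i j) $$ (i, p i)) = (if evenperm p then 1 else - 1) * (PROD i<d. a i (p i))"
 by (simp add: sign_def)
 qed
 finally show ?thesis by simp
qed

lemma dt_cong: "(!!i j. i < d ==> j < d ==> a i j = b i j) ==> dt d a = dt d b"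
 unfolding dt_det by (intro arg_cong[of _ _ det] eq_matI) auto

lemma dt_mult: "dt d (%i j. SUM l<d. a i l * b l j) = dt d a * dt d b"
proof -
 let ?A = "mat d d (%(i, j). a i j)" and ?B = "mat d d (%(i, j). b i j)"
 have "mat d d (%(i, j). SUM l<d. a i l * b l j) = ?A * ?B"
 by (rule eq_matI) (auto simp: scalar_prod_def atLeast0LessThan)
 thus ?thesis unfolding dt_det by (simp add: det_mult[of ?A d ?B])
qed

lemma dt_one: "dt d (%i j. if i = j then 1 else 0) = (1 :: 'a::comm_ring_1)"
proof -
 have "mat d d (%(i, j). if i = j then 1 else (0::'a)) = 1\<^sub>m d" by (rule eq_matI) auto
 thus ?thesis unfolding dt_det by simp
qed

lemma dt_zero_kernel:
 fixes a :: "nat => nat => 'a::field"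
 assumes "dt d a = 0"
 shows "EX c. (EX i<d. c i ~= 0) & (ALL j<d. (SUM i<d. c i * a i j) = 0)"
proof -
 let ?A = "mat d d (%(i, j). a j i)"
 have "?A = transpose_mat (mat d d (%(i, j). a i j))" by (rule eq_matI) auto
 hence "det ?A = 0" using assms det_transpose[of "mat d d (%(i, j). a i j)" d] unfolding dt_det by simp
 then obtain v where v: "v : carrier_vec d" "v ~= 0\<^sub>v d" "?A *\<^sub>v v = 0\<^sub>v d"
 using det_0_iff_vec_prod_zero_field[of ?A d] by auto
 have "EX i<d. v $ i ~= 0"
 proof (rule ccontr)
 assume "\<not> ?thesis"
 hence "v = 0\<^sub>v d" using v(1) by (intro eq_vecI) auto
 thus False using v(2) by simp
 qed
 moreover have "(SUM i<d. v $ i * a i j) = 0" if "j < d" for j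
 proof -
 have "(?A *\<^sub>v v) $ j = 0" using v(3) that by simp
 thus ?thesis using that v(1) by (simp add: scalar_prod_def atLeast0LessThan mult.commute)
 qed
 ultimately show ?thesis by (intro exI[of _ "%i. v $ i"]) auto
qed

lemma dt_kernel_zero:
 fixes a :: "nat => nat => 'a::field"
 assumes "i0 < d" "c i0 ~= 0" "!!j. j < d ==> (SUM i<d. c i * a i j) = 0"
 shows "dt d a = 0"
proof -
 let ?A = "mat d d (%(i, j). a j i)" and ?v = "vec d c"
 have "?A *\<^sub>v ?v = 0\<^sub>v d"
 using assms(3) by (intro eq_vecI) (auto simp: scalar_prod_def atLeast0LessThan mult.commute)
 moreover have "?v ~= 0\<^sub>v d" using assms(1,2) by (metis index_vec index_zero_vec(1))
 moreover have "?v : carrier_vec d" "?A : carrier_mat d d" by auto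
 ultimately have "det ?A = 0" using det_0_iff_vec_prod_zero_field[of ?A d] by blast
 moreover have "?A = transpose_mat (mat d d (%(i, j). a i j))" by (rule eq_matI) auto
 ultimately show ?thesis using det_transpose[of "mat d d (%(i, j). a i j)" d] unfolding dt_det by simp
qed

lemma dt_solve:
 fixes a b :: "nat => nat => 'a::field"
 assumes "dt d b ~= 0"
 shows "EX c. ALL i<d. ALL j<d. a i j = (SUM l<d. c i l * b l j)"
proof -
 let ?A = "mat d d (%(i, j). a i j)" and ?B = "mat d d (%(i, j). b i j)"
 have "?B : Units (ring_mat TYPE('a) d ())" using det_non_zero_imp_unit[of ?B d] assms unfolding dt_det by simp
 then obtain C where C: "C : carrier_mat d d" "C * ?B = 1\<^sub>m d" unfolding Units_def ring_mat_def by auto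
 define c where "c i l = (?A * C) $$ (i, l)" for i l
 have "?A = (?A * C) * ?B" using C by (subst assoc_mult_mat[of _ d d _ d _ d]) auto
 hence "a i j = (SUM l<d. c i l * b l j)" if "i < d" "j < d" for i j
 proof -
 have "a i j = ?A $$ (i, j)" using that by simp
 also have "\<dots> = ((?A * C) * ?B) $$ (i, j)" using \<open>?A = (?A * C) * ?B\<close> by simp
 also have "\<dots> = (SUM l<d. c i l * b l j)"
 using that C(1) by (simp add: scalar_prod_def atLeast0LessThan c_def)
 finally show ?thesis .
 qed
 thus ?thesis by blast
qed

lemma dt_row_sum:
 fixes a r :: "_ => nat => 'a::comm_ring_1"
 assumes s: "s < d" and f: "finite J"
 shows "dt d (%i j. if i = s then (SUM t:J. c t * r t j) else a i j) = (SUM t:J. c t * dt d (%i j. if i = s then r t j else a i j))"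
proof -
 have p: "(PROD i<d. if i = s then g (p i) else a i (p i)) = g (p s) * (PROD i:{..<d} - {s}. a i (p i))" for g :: "nat => 'a" and p
 using s by (subst prod.remove[of _ s]) (auto intro!: prod.cong)
 show ?thesis
 unfolding dt_def p[of "%j. SUM t:J. c t * r t j"] p[of "%j. r _ j"] 
 by (simp add: sum_distrib_left sum_distrib_right sum.swap[of _ _ J] mult_ac)
qed

section \<open>The function field at a generic point\<close>

text \<open>Genericity is demanded for homogeneous polynomials over \<open>k\<close> only.
  Homogeneous coordinates are determined up to a factor, and the notion has to survive
  rescaling.\<close>

locale gpoint =
 fixes k :: "complex set" and V :: "'v proj_subscheme" and h :: "complex => 'a::{field_char_0,alg_closed_field}"
 and xi :: "'v => 'a"
 assumes kf: "sfd k" and ch: "chom h" and finN: "finite (coords V)"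
 and gen: "!!e A. A : MP k (coords V) ==> hmg e A ==> ins h xi A = 0 \<longleftrightarrow> A : hom_ideal V"
begin

abbreviation "K \<equiv> function_field k V"
abbreviation "vl \<equiv> ins h xi"
abbreviation "fr \<equiv> fractions k V"
definition rat :: "'v mpoly \<times> 'v mpoly => 'a" where "rat p = vl (fst p) / vl (snd p)"
definition cls :: "'v mpoly \<times> 'v mpoly => 'v ratfun" where "cls p = fraction_rel k V `` {p}"
text \<open>On the carrier the choice of representative is immaterial, and \<open>ev\<close> is the
  embedding of the function field into the ambient field given by the generic point.\<close>

definition ev :: "'v ratfun => 'a" where "ev r = rat (SOME p. p : r)"

lemma ks: "srg k" using kf by (simp add: sfd_def)

lemma hops: "h (a + b) = h a + h b" "h (a * b) = h a * h b" "h 0 = 0" "h 1 = 1" "h (- a) = - h a"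
 using phomD[OF ch] by auto

lemma h_inverse: "h (inverse c) = inverse (h c)"
 by (rule phom_inverse[OF ch]) auto

lemma h_inj: "h a = h b \<longleftrightarrow> a = b"
proof
 assume "h a = h b"
 hence z: "h (a - b) = 0" using phomD(7)[OF ch] by simp
 show "a = b"
 proof (rule ccontr)
 assume "a ~= b"
 hence "h ((a - b) * inverse (a - b)) = 1" using hops(4) by simp
 thus False using z hops(2) by simp
 qed
qed simp

lemma sfd_hk: "sfd (h ` k)"
 unfolding sfd_def srg_def
proof (intro conjI ballI)
 show "1 : h ` k" using hops(4) srgD(1)[OF ks] by (metis imageI)
 fix x y assume "x : h ` k" "y : h ` k"
 then obtain a b where "a : k" "b : k" "x = h a" "y = h b" by auto
 thus "x + y : h ` k" "x * y : h ` k" using hops(1,2) srgD(3,4)[OF ks] by (metis imageI)+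
next
 fix x assume "x : h ` k"
 then obtain a where "a : k" "x = h a" by auto
 thus "- x : h ` k" "inverse x : h ` k" using hops(5) h_inverse srgD(5)[OF ks] sfdD(2)[OF kf] by (metis imageI)+
qed

lemma fr_iff: "(A, B) : fr \<longleftrightarrow> A : MP k (coords V) & B : MP k (coords V) & (EX e. hmg e A & hmg e B) & vl B ~= 0"
 unfolding fractions_def using gen by auto

text \<open>The difference of cross products is homogeneous, hence lies in the ideal exactly when it
  vanishes at the generic point. Equality of rational functions is therefore equality of values, and
  every field identity is inherited from the ambient field.\<close>

lemma rel_iff: "(p, q) : fraction_rel k V \<longleftrightarrow> p : fr & q : fr & rat p = rat q"
proof -
 obtain A B C D where pq: "p = (A, B)" "q = (C, D)" by (cases p, cases q) auto
 show ?thesis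
 proof (cases "p : fr & q : fr")
 case True
 then obtain e e' where e: "A : MP k (coords V)" "B : MP k (coords V)" "hmg e A" "hmg e B" "vl B ~= 0"
 "C : MP k (coords V)" "D : MP k (coords V)" "hmg e' C" "hmg e' D" "vl D ~= 0"
 unfolding pq fr_iff by auto
 have "A * D - C * B : MP k (coords V)" using e by (intro srgD[OF MP_srg[OF ks]]) auto
 moreover have "hmg (e + e') (C * B)" using hmg_mult[OF e(8) e(4)] by (simp add: add.commute)
 hence "hmg (e + e') (A * D - C * B)" using hmg_mult[OF e(3) e(9)] hmg_diff by blast
 ultimately have "A * D - C * B : hom_ideal V \<longleftrightarrow> vl (A * D - C * B) = 0" using gen by blast
 also have "\<dots> \<longleftrightarrow> rat p = rat q"
 using e(5,10) by (simp add: pq rat_def ins_ops(1)[OF ch] ins_mult[OF ch] field_simps)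
 finally show ?thesis using True unfolding fraction_rel_def pq by auto
 next
 case False
 thus ?thesis unfolding fraction_rel_def pq by auto
 qed
qed

lemma cls_eq: "p : fr ==> cls p = {q : fr. rat q = rat p}"
 unfolding cls_def by (auto simp: rel_iff)

lemma ev_cls: "p : fr ==> ev (cls p) = rat p"
proof -
 assume p: "p : fr"
 hence "p : cls p" by (simp add: cls_eq)
 hence "(SOME q. q : cls p) : cls p" by (rule someI)
 thus ?thesis using p by (simp add: cls_eq ev_def)
qed

lemma carrier_K: "carrier K = cls ` fr"
 unfolding function_field_def quotient_def cls_def by auto

lemma carrierE: assumes "r : carrier K" obtains A B where "(A, B) : fr" "r = cls (A, B)" "ev r = vl A / vl B"
 using assms ev_cls unfolding carrier_K by (auto simp: rat_def)

lemma ev_rep: "r : carrier K ==> (A, B) : r ==> (A, B) : fr & ev r = vl A / vl B"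
 by (erule carrierE) (auto simp: cls_eq rat_def)

lemma ev_inj: "r : carrier K ==> s : carrier K ==> ev r = ev s \<longleftrightarrow> r = s"
proof -
 assume "r : carrier K" "s : carrier K"
 then obtain p q where pq: "p : fr" "q : fr" "r = cls p" "s = cls q" unfolding carrier_K by blast
 show ?thesis unfolding pq(3,4) ev_cls[OF pq(1)] ev_cls[OF pq(2)]
 proof
 assume "rat p = rat q" thus "cls p = cls q" unfolding cls_eq[OF pq(1)] cls_eq[OF pq(2)] by simp
 next
 assume "cls p = cls q" thus "rat p = rat q" using ev_cls[OF pq(1)] ev_cls[OF pq(2)] by simp
 qed
qed

lemma ev_eqI: "r : carrier K ==> s : carrier K ==> ev r = ev s ==> r = s"
 using ev_inj by blast

lemma UN_const2: "(a0, b0) : A ==> (!!a b. (a, b) : A ==> f a b = c) ==> (UN (a, b):A. f a b) = c"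
 by fastforce

lemma fr_mult: "(A, B) : fr ==> (C, D) : fr ==> (A * C, B * D) : fr"
proof -
 assume "(A, B) : fr" "(C, D) : fr"
 then obtain e e' where e: "A : MP k (coords V)" "B : MP k (coords V)" "hmg e A" "hmg e B" "vl B ~= 0"
 "C : MP k (coords V)" "D : MP k (coords V)" "hmg e' C" "hmg e' D" "vl D ~= 0"
 unfolding fr_iff by auto
 have "hmg (e + e') (A * C)" "hmg (e + e') (B * D)" using hmg_mult[OF e(3) e(8)] hmg_mult[OF e(4) e(9)] by auto
 thus ?thesis unfolding fr_iff using e by (auto simp: ins_mult[OF ch] MP_mult[OF ks])
qed

lemma fr_add: "(A, B) : fr ==> (C, D) : fr ==> (A * D + C * B, B * D) : fr"
proof -
 assume "(A, B) : fr" "(C, D) : fr"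
 then obtain e e' where e: "A : MP k (coords V)" "B : MP k (coords V)" "hmg e A" "hmg e B" "vl B ~= 0"
 "C : MP k (coords V)" "D : MP k (coords V)" "hmg e' C" "hmg e' D" "vl D ~= 0"
 unfolding fr_iff by auto
 have "hmg (e + e') (C * B)" using hmg_mult[OF e(8) e(4)] by (simp add: add.commute)
 hence "hmg (e + e') (A * D + C * B)" "hmg (e + e') (B * D)" using hmg_mult[OF e(3) e(9)] hmg_mult[OF e(4) e(9)] hmg_add by auto
 thus ?thesis unfolding fr_iff using e by (auto simp: ins_mult[OF ch] MP_mult[OF ks] MP_add[OF ks])
qed

lemma K_mult: assumes "r : carrier K" "s : carrier K"
 shows "r \<otimes>\<^bsub>K\<^esub> s : carrier K & ev (r \<otimes>\<^bsub>K\<^esub> s) = ev r * ev s"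
proof -
 obtain A B where AB: "(A, B) : fr" "r = cls (A, B)" "ev r = vl A / vl B" using assms(1) by (rule carrierE)
 obtain C D where CD: "(C, D) : fr" "s = cls (C, D)" "ev s = vl C / vl D" using assms(2) by (rule carrierE)
 have "cls (A' * C', B' * D') = cls (A * C, B * D)" if "(A', B') : r" "(C', D') : s" for A' B' C' D'
 proof -
 have 1: "(A', B') : fr" "(C', D') : fr" "rat (A', B') = rat (A, B)" "rat (C', D') = rat (C, D)"
 using that AB(1,2) CD(1,2) by (auto simp: cls_eq)
 have "rat (a * c, b * d) = rat (a, b) * rat (c, d)" for a b c d by (simp add: rat_def ins_mult[OF ch])
 hence "rat (A' * C', B' * D') = rat (A * C, B * D)" by (simp only: 1)
 thus ?thesis using fr_mult[OF 1(1,2)] fr_mult[OF AB(1) CD(1)] by (simp add: cls_eq)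
 qed
 moreover have "(A, B) : r" "(C, D) : s" using AB CD by (auto simp: cls_eq)
 ultimately have "(UN (A', B'):r. UN (C', D'):s. cls (A' * C', B' * D')) = cls (A * C, B * D)"
 by (intro UN_const2)
 hence "r \<otimes>\<^bsub>K\<^esub> s = cls (A * C, B * D)"
 unfolding function_field_def cls_def by simp
 thus ?thesis using fr_mult[OF AB(1) CD(1)] AB(3) CD(3) by (auto simp: carrier_K ev_cls rat_def ins_mult[OF ch])
qed

lemma K_add: assumes "r : carrier K" "s : carrier K"
 shows "r \<oplus>\<^bsub>K\<^esub> s : carrier K & ev (r \<oplus>\<^bsub>K\<^esub> s) = ev r + ev s"
proof -
 obtain A B where AB: "(A, B) : fr" "r = cls (A, B)" "ev r = vl A / vl B" using assms(1) by (rule carrierE)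
 obtain C D where CD: "(C, D) : fr" "s = cls (C, D)" "ev s = vl C / vl D" using assms(2) by (rule carrierE)
 have ra: "rat (A' * D' + C' * B', B' * D') = rat (A', B') + rat (C', D')" if "(A', B') : fr" "(C', D') : fr" for A' B' C' D'
 using that by (simp add: rat_def fr_iff ins_mult[OF ch] ins_add[OF ch] add_frac_eq)
 have "cls (A' * D' + C' * B', B' * D') = cls (A * D + C * B, B * D)" if "(A', B') : r" "(C', D') : s" for A' B' C' D'
 proof -
 have 1: "(A', B') : fr" "(C', D') : fr" "rat (A', B') = rat (A, B)" "rat (C', D') = rat (C, D)"
 using that AB(1,2) CD(1,2) by (auto simp: cls_eq)
 thus ?thesis using fr_add[OF 1(1,2)] fr_add[OF AB(1) CD(1)] ra[OF 1(1,2)] ra[OF AB(1) CD(1)] by (simp add: cls_eq)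
 qed
 moreover have "(A, B) : r" "(C, D) : s" using AB CD by (auto simp: cls_eq)
 ultimately have "(UN (A', B'):r. UN (C', D'):s. cls (A' * D' + C' * B', B' * D')) = cls (A * D + C * B, B * D)"
 by (intro UN_const2)
 hence "r \<oplus>\<^bsub>K\<^esub> s = cls (A * D + C * B, B * D)"
 unfolding function_field_def cls_def by simp
 thus ?thesis using fr_add[OF AB(1) CD(1)] AB(3) CD(3) ra[OF AB(1) CD(1)] by (auto simp: carrier_K ev_cls rat_def)
qed

lemma fr_const: "c : k ==> (mconst c, 1) : fr"
 unfolding fr_iff using hmg_const hmg_1 srgD(1)[OF MP_srg[OF ks]] by (auto intro!: MP_const simp: ins_1[OF ch])

lemma K_const: "c : k ==> ff_const k V c : carrier K & ev (ff_const k V c) = h c"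
 using fr_const[of c] ev_cls[of "(mconst c, 1)"]
 by (auto simp: ff_const_def cls_def[symmetric] carrier_K rat_def ins_const[OF ch] ins_1[OF ch])

lemma K_one: "\<one>\<^bsub>K\<^esub> : carrier K" "ev \<one>\<^bsub>K\<^esub> = 1"
 using K_const[of 1] srgD(1)[OF ks] hops by (auto simp: ff_const_def function_field_def mconst_def)

lemma K_zero: "\<zero>\<^bsub>K\<^esub> : carrier K" "ev \<zero>\<^bsub>K\<^esub> = 0"
 using K_const[of 0] srgD(2)[OF ks] hops by (auto simp: ff_const_def function_field_def mconst_def)

lemma K_neg: "r : carrier K ==> EX s:carrier K. ev s = - ev r"
proof -
 assume r: "r : carrier K"
 have c: "ff_const k V (- 1) : carrier K" "ev (ff_const k V (- 1)) = - 1" using K_const[of "- 1"] srgD(1,5)[OF ks] hops by auto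
 thus ?thesis using K_mult[OF c(1) r] by (intro bexI[of _ "ff_const k V (- 1) \<otimes>\<^bsub>K\<^esub> r"]) auto
qed

lemma K_cring: "cring K"
proof (rule cringI)
 show "abelian_group K"
 proof (rule abelian_groupI)
 fix x assume "x : carrier K"
 then obtain y where "y : carrier K" "ev y = - ev x" using K_neg by blast
 thus "EX y:carrier K. y \<oplus>\<^bsub>K\<^esub> x = \<zero>\<^bsub>K\<^esub>"
 using \<open>x : carrier K\<close> by (intro bexI[of _ y] ev_eqI) (simp_all add: K_add K_zero)
 qed ((rule ev_eqI; simp add: K_add K_zero algebra_simps) | simp add: K_add K_zero)+
 show "Group.comm_monoid K"
 by (rule comm_monoidI) ((rule ev_eqI; simp add: K_mult K_one algebra_simps) | simp add: K_mult K_one)+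
qed (rule ev_eqI; simp add: K_add K_mult algebra_simps)

lemma ev_finsum:
 assumes "finite A" "!!a. a : A ==> f a : carrier K"
 shows "finsum K f A : carrier K & ev (finsum K f A) = (SUM a:A. ev (f a))"
proof -
 interpret cring K by (rule K_cring)
 show ?thesis using assms
 proof (induct A rule: finite_induct)
 case (insert a A)
 have "finsum K f (insert a A) = f a \<oplus>\<^bsub>K\<^esub> finsum K f A"
 using insert by (intro finsum_insert) auto
 thus ?case using insert K_add by simp
 qed (simp add: K_zero)
qed

lemma ev_finprod:
 assumes "finite A" "!!a. a : A ==> f a : carrier K"
 shows "finprod K f A : carrier K & ev (finprod K f A) = (PROD a:A. ev (f a))"
proof -
 interpret cring K by (rule K_cring)
 show ?thesis using assms
 proof (induct A rule: finite_induct)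
 case (insert a A)
 have "finprod K f (insert a A) = f a \<otimes>\<^bsub>K\<^esub> finprod K f A"
 using insert by (intro finprod_insert) auto
 thus ?case using insert K_mult by simp
 qed (simp add: K_one)
qed

lemma ev_pow: "r : carrier K ==> r [^]\<^bsub>K\<^esub> (n::nat) : carrier K & ev (r [^]\<^bsub>K\<^esub> n) = ev r ^ n"
proof (induct n)
 case (Suc n)
 interpret cring K by (rule K_cring)
 show ?case using Suc K_mult by (simp add: mult.commute)
next
 case 0
 interpret cring K by (rule K_cring)
 show ?case by (simp add: K_one)
qed

lemma ev_uminus: "r : carrier K ==> \<ominus>\<^bsub>K\<^esub> r : carrier K & ev (\<ominus>\<^bsub>K\<^esub> r) = - ev r"
proof -
 interpret cring K by (rule K_cring)
 assume r: "r : carrier K"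
 have "ev (\<ominus>\<^bsub>K\<^esub> r) + ev r = 0" using K_add[of "\<ominus>\<^bsub>K\<^esub> r" r] r K_zero(2) by (simp add: l_neg)
 thus ?thesis using r by (simp add: eq_neg_iff_add_eq_0)
qed

lemma ev_ring_det:
 assumes "!!i j. i < d ==> j < d ==> a i j : carrier K"
 shows "ring_det K d a : carrier K & ev (ring_det K d a) = dt d (%i j. ev (a i j))"
proof -
 let ?t = "%p. (if evenperm p then \<one>\<^bsub>K\<^esub> else \<ominus>\<^bsub>K\<^esub> \<one>\<^bsub>K\<^esub>) \<otimes>\<^bsub>K\<^esub> finprod K (%i. a i (p i)) {..<d}"
 have t: "?t p : carrier K & ev (?t p) = (if evenperm p then 1 else - 1) * (PROD i<d. ev (a i (p i)))" if p: "p permutes {..<d}" for p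
 proof -
 have pi: "p i < d" if "i < d" for i using permutes_in_image[OF p, of i] that by simp
 have "finprod K (%i. a i (p i)) {..<d} : carrier K & ev (finprod K (%i. a i (p i)) {..<d}) = (PROD i<d. ev (a i (p i)))"
 by (rule ev_finprod) (use pi assms in auto)
 thus ?thesis by (cases "evenperm p") (simp_all add: K_mult K_one ev_uminus)
 qed
 have "finsum K ?t {p. p permutes {..<d}} : carrier K & ev (finsum K ?t {p. p permutes {..<d}}) = (SUM p | p permutes {..<d}. ev (?t p))"
 by (rule ev_finsum) (use t finite_permutations[of "{..<d}"] in auto)
 moreover have "(SUM p | p permutes {..<d}. ev (?t p)) = dt d (%i j. ev (a i j))"
 unfolding dt_def using t by (intro sum.cong) auto
 ultimately show ?thesis unfolding ring_det_def by simp
qed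

lemma ev_ff_eval:
 assumes T: "T \<subseteq> carrier K" and p: "p : MP k T"
 shows "ff_eval k V p : carrier K & ev (ff_eval k V p) = ins h ev p"
proof -
 have m: "finprod K (%q. q [^]\<^bsub>K\<^esub> lkp m q) (kys m) : carrier K &
 ev (finprod K (%q. q [^]\<^bsub>K\<^esub> lkp m q) (kys m)) = mval ev m" if "kys m \<subseteq> T" for m
 proof -
 have c: "q : carrier K" if "q : kys m" for q using that \<open>kys m \<subseteq> T\<close> T by blast
 thus ?thesis unfolding mval_def
 using ev_finprod[of "kys m" "%q. q [^]\<^bsub>K\<^esub> lkp m q"] ev_pow by simp
 qed
 let ?t = "%m. ff_const k V (lkp p m) \<otimes>\<^bsub>K\<^esub> finprod K (%q. q [^]\<^bsub>K\<^esub> lkp m q) (kys m)"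
 have t: "?t n : carrier K & ev (?t n) = h (lkp p n) * mval ev n" if "n : kys p" for n
 proof -
 have "lkp p n : k" "kys n <= T" using p that unfolding MP_iff by auto
 thus ?thesis using m K_const K_mult by simp
 qed
 have "finsum K ?t (kys p) : carrier K & ev (finsum K ?t (kys p)) = (SUM n:kys p. ev (?t n))"
 by (rule ev_finsum) (use t in auto)
 thus ?thesis unfolding ff_eval_def ins_def using t by simp
qed

lemma alg_indep_iff:
 assumes T: "T \<subseteq> carrier K"
 shows "alg_independent k V T \<longleftrightarrow> (ALL p:MP k T. ins h ev p = 0 --> p = 0)"
proof -
 have "ff_eval k V p = \<zero>\<^bsub>K\<^esub> \<longleftrightarrow> ins h ev p = 0" if "p : MP k T" for p
 using ev_ff_eval[OF T that] ev_inj[of "ff_eval k V p" "\<zero>\<^bsub>K\<^esub>"] K_zero by simp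
 thus ?thesis unfolding alg_independent_def by blast
qed

end

section \<open>Transcendence degree and pluricanonical forms\<close>

lemma common_denominator:
 assumes "finite I" "!!i. i : I ==> c i : sfg S"
 shows "EX b:srgn S. b ~= 0 & (ALL i:I. b * c i : srgn S)"
 using assms
proof (induct I rule: finite_induct)
 case empty
 show ?case using srgD(1)[OF srg_srgn[of S]] by (intro bexI[of _ 1]) auto
next
 case (insert j I)
 have "EX b:srgn S. b ~= 0 & (ALL i:I. b * c i : srgn S)" by (rule insert(3)) (simp add: insert(4))
 then obtain b where b: "b : srgn S" "b ~= 0" "ALL i:I. b * c i : srgn S" by blast
 have "c j : sfg S" by (simp add: insert(4))
 then obtain u v where uv: "u : srgn S" "v : srgn S" "v ~= 0" "c j = u / v" using sfg_frac[of "c j" S] by blast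
 have "v * b * c i : srgn S" if "i : insert j I" for i
 proof (cases "i = j")
 case True
 hence "v * b * c i = b * u" using uv by (simp add: field_simps)
 thus ?thesis by (simp only: srgD(4)[OF srg_srgn b(1) uv(1)])
 next
 case False
 hence "b * c i : srgn S" using that b(3) by blast
 thus ?thesis using srgD(4)[OF srg_srgn uv(2), of "b * c i"] by (simp add: mult.assoc)
 qed
 thus ?case using srgD(4)[OF srg_srgn uv(2) b(1)] uv(3) b(2) by (intro bexI[of _ "v * b"]) auto
qed

lemma algb_clear:
 assumes "algb (sfg S) x" shows "algb (srgn S) x"
proof -
 obtain p where p: "p : PA (sfg S)" "p ~= 0" "poly p x = 0" using assms by (auto simp: algb_def)
 have c: "!!i. i : {..degree p} ==> cof p i : sfg S" using PA_D[OF p(1)] by blast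
 obtain b where b: "b : srgn S" "b ~= 0" "ALL i:{..degree p}. b * cof p i : srgn S"
 using common_denominator[of "{..degree p}" "cof p" S, OF _ c] by auto
 have "b * cof p i : srgn S" for i
 using b(3) srgD(2)[OF srg_srgn[of S]] by (cases "i <= degree p") (auto simp: coeff_eq_0)
 hence "smult b p : PA (srgn S)" by (simp add: PA_def)
 thus ?thesis unfolding algb_def using p b(2) by (intro bexI[of _ "smult b p"]) auto
qed

text \<open>Sending the variable t to the indeterminate of a univariate polynomial ring, and fixing
  the other variables, separates the powers of \<open>mvar t\<close>.\<close>

lemma mpoly_univ_unique:
 assumes t: "t ~: N" and F: "!!i. i <= n ==> F i : MP k N" and z: "(SUM i<=n. F i * mvar t ^ i) = 0" and j: "j <= n"
 shows "F j = 0"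
proof -
 define hh :: "complex => 'a mpoly poly" where "hh c = [:mconst c:]" for c
 define xx :: "'a => 'a mpoly poly" where "xx v = (if v = t then [:0, 1:] else [:mvar v:])" for v
 have "hh (a * b) = hh a * hh b" "hh (a + b) = hh a + hh b" "hh 1 = 1" for a b
 by (simp_all add: hh_def phomD(2,3,4)[OF chom_mconst] one_pCons mult.commute)
 hence hh: "chom hh" unfolding phom_def by (simp add: srg_UNIV)
 have ph: "phom UNIV (%a :: 'a mpoly. [:a:])" by (auto simp: phom_def srg_UNIV one_pCons)
 have EF: "ins hh xx G = [:G:]" if "G : MP k N" for G
 proof -
 have "[:G:] = [:ins mconst mvar G:]" by (simp add: ins_mvar)
 also have "\<dots> = ins (%c. [:mconst c:]) (%v. [:mvar v:]) G" by (rule phom_ins[OF ph that]) auto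
 also have "\<dots> = ins hh xx G" by (rule ins_cong[OF that]) (use t in \<open>auto simp: hh_def xx_def\<close>)
 finally show ?thesis by simp
 qed
 have "0 = ins hh xx (SUM i<=n. F i * mvar t ^ i)" using z by simp
 also have "\<dots> = (SUM i<=n. [:F i:] * [:0, 1:] ^ i)"
 unfolding ins_sum[OF hh] by (intro sum.cong refl) (simp add: ins_mult[OF hh] ins_ops(3)[OF hh] ins_var[OF hh] EF F, simp add: xx_def)
 also have "\<dots> = (SUM i<=n. Polynomial.monom (F i) i)"
 by (intro sum.cong refl) (simp add: monom_altdef)
 finally have "cof (SUM i<=n. Polynomial.monom (F i) i) j = 0" by (metis coeff_0)
 thus ?thesis using j by (simp add: coeff_sum coeff_monom)
qed

lemma MP_empty: "F : MP k {} ==> F = mconst (lkp F 0)"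
proof -
 assume "F : MP k {}"
 hence "kys F <= {0}" by (auto simp: MP_iff)
 thus ?thesis by (intro poly_mapping_eqI) (auto simp: mconst_def lookup_single when_def in_keys_iff subset_iff)
qed

context gpoint
begin

abbreviation "d \<equiv> variety_dim k V"
abbreviation "lder D \<equiv> der D & (ALL c:k. D (h c) = 0)"

lemma ev_in_sfg: "r : carrier K ==> ev r : sfg (h ` k Un xi ` coords V)"
proof (erule carrierE)
 fix A B assume AB: "(A, B) : fr" "ev r = vl A / vl B"
 have "vl A : sfg (h ` k Un xi ` coords V)" "vl B : sfg (h ` k Un xi ` coords V)"
 using AB(1) sfg_super[of "h ` k Un xi ` coords V"] by (auto simp: fr_iff intro!: ins_in[OF srg_sfg])
 thus ?thesis using AB(2) sfdD(3)[OF sfd_sfg] by simp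
qed

lemma evT_srgn: "srgn (h ` k Un ev ` T) \<subseteq> {ins h ev F |F. F : MP k T}"
proof (rule srgn_least)
 let ?R = "{ins h ev F |F. F : MP k T}"
 show "srg ?R" unfolding srg_def
 proof (intro conjI ballI)
 show "1 : ?R" using ins_1[OF ch] srgD(1)[OF MP_srg[OF ks]] by (metis (mono_tags, lifting) mem_Collect_eq)
 fix a b assume "a : ?R" "b : ?R"
 then obtain F G where "F : MP k T" "G : MP k T" "a = ins h ev F" "b = ins h ev G" by auto
 hence "a + b = ins h ev (F + G)" "a * b = ins h ev (F * G)" "F + G : MP k T" "F * G : MP k T"
 using MP_add[OF ks] MP_mult[OF ks] by (auto simp: ins_add[OF ch] ins_mult[OF ch])
 thus "a + b : ?R" "a * b : ?R" by blast+
 next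
 fix a assume "a : ?R"
 then obtain F where "F : MP k T" "a = ins h ev F" by auto
 hence "- a = ins h ev (- F)" "- F : MP k T" using MP_neg[OF ks] by (auto simp: ins_ops(2)[OF ch])
 thus "- a : ?R" by blast
 qed
 show "h ` k Un ev ` T <= ?R"
 proof
 fix a assume "a : h ` k Un ev ` T"
 then consider c where "c : k" "a = h c" | t where "t : T" "a = ev t" by auto
 thus "a : ?R"
 proof cases
 case 1 hence "a = ins h ev (mconst c)" "mconst c : MP k T" by (auto simp: ins_const[OF ch] intro: MP_const)
 thus ?thesis by blast
 next
 case 2 hence "a = ins h ev (mvar t)" "mvar t : MP k T" by (auto simp: ins_var[OF ch] intro: MP_var[OF ks])
 thus ?thesis by blast
 qed
 qed
qed

lemma indep_not_algb:
 assumes T: "T \<subseteq> carrier K" "alg_independent k V T" and t: "t : T"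
 shows "\<not> algb (sfg (h ` k Un ev ` (T - {t}))) (ev t)"
proof
 assume "algb (sfg (h ` k Un ev ` (T - {t}))) (ev t)"
 hence "algb (srgn (h ` k Un ev ` (T - {t}))) (ev t)" by (rule algb_clear)
 then obtain P where P: "P : PA (srgn (h ` k Un ev ` (T - {t})))" "P ~= 0" "poly P (ev t) = 0" by (auto simp: algb_def)
 have "ALL i. EX F. F : MP k (T - {t}) & cof P i = ins h ev F"
 using PA_D[OF P(1)] evT_srgn[of "T - {t}"] by blast
 then obtain F where F: "ALL i. F i : MP k (T - {t}) & cof P i = ins h ev (F i)" by metis
 define p where "p = (SUM i<=degree P. F i * mvar t ^ i)"
 have "MP k (T - {t}) <= MP k T" by (intro MP_mono) auto
 hence "p : MP k T" unfolding p_def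
 using F t by (intro MP_sum[OF ks] MP_mult[OF ks] srgD(7)[OF MP_srg[OF ks]] MP_var[OF ks]) auto
 moreover have "ins h ev p = poly P (ev t)"
 unfolding p_def ins_sum[OF ch] poly_altdef using F by (intro sum.cong) (auto simp: ins_mult[OF ch] ins_ops(3)[OF ch] ins_var[OF ch])
 ultimately have "p = 0" using alg_indep_iff[OF T(1)] T(2) P(3) by simp
 hence "F (degree P) = 0" unfolding p_def using F
 by (intro mpoly_univ_unique[where N = "T - {t}" and n = "degree P" and k = k]) auto
 hence "lead_coeff P = 0" using F by simp
 thus False using P(2) by simp
qed

text \<open>Each member of an independent set is transcendental over the field generated by the
  others, so a derivation may be prescribed to kill those and to be 1 on it. Such dual families take
  the place of an exchange lemma.\<close>

lemma dual_derivation: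
 assumes T: "T \<subseteq> carrier K" "alg_independent k V T" and t: "t : T"
 shows "EX D. lder D & D (ev t) = 1 & (ALL s:T - {t}. D (ev s) = 0)"
proof -
 let ?S = "sfg (h ` k Un ev ` (T - {t}))"
 obtain D where D: "der D" "ALL s:?S. D s = 0" "D (ev t) = 1"
 by (rule derivation_exists[OF srg_sfg indep_not_algb[OF T t]])
 thus ?thesis using sfg_super[of "h ` k Un ev ` (T - {t})"] by (intro exI[of _ D]) auto
qed

text \<open>With more independent functions than coordinates, some nontrivial combination of their
  dual derivations would kill all coordinates, hence the whole function field. The bound makes the
  maximum in \<open>trans_degree\<close> one over a finite set.\<close>

lemma card_indep_le:
 assumes T: "T \<subseteq> carrier K" "finite T" "alg_independent k V T"
 shows "card T <= card (coords V)"
proof (rule ccontr)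
 assume "\<not> ?thesis"
 hence c: "card (coords V) < card T" by simp
 have "ALL t:T. EX D. lder D & D (ev t) = 1 & (ALL s:T - {t}. D (ev s) = 0)"
 using dual_derivation[OF T(1,3)] by blast
 then obtain D where D: "ALL t:T. lder (D t) & D t (ev t) = 1 & (ALL s:T - {t}. D t (ev s) = 0)" by (rule bchoice[THEN exE])
 obtain a where a: "EX t:T. a t ~= 0" "ALL v:coords V. (SUM t:T. a t * D t (xi v)) = 0"
 using underdetermined[OF finN T(2) c, of "%t v. D t (xi v)"] by blast
 define E where "E x = (SUM t:T. a t * D t x)" for x
 have dE: "der E" unfolding E_def using D by (intro der_lincomb T(2)) auto
 have zE: "E s = 0" if "s : h ` k Un xi ` coords V" for s using that a(2) D unfolding E_def by auto
 obtain t where t: "t : T" "a t ~= 0" using a(1) by blast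
 have "E (ev t) = 0" by (rule der_zero_sfg[OF dE zE ev_in_sfg]) (use t T in auto)
 moreover have "E (ev t) = (SUM s:T. if s = t then a t else 0)" unfolding E_def using D t(1) by (intro sum.cong) auto
 ultimately show False using t T(2) by simp
qed

lemma indep_empty: "alg_independent k V {}"
proof -
 have "p = 0" if "p : MP k {}" "ins h ev p = 0" for p
 proof -
 define c where "c = lkp p 0"
 have p: "p = mconst c" unfolding c_def by (rule MP_empty[OF that(1)])
 have "ins h ev (mconst c) = 0" using that(2) by (simp only: p)
 hence "h c = h 0" using ins_const[OF ch, of ev c] hops(3) by simp
 thus ?thesis using p h_inj by (simp add: mconst_def)
 qed
 thus ?thesis using alg_indep_iff[of "{}"] by blast
qed

lemma trans_degree_props:
 assumes Q: "Q \<subseteq> carrier K"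
 shows "EX T. T \<subseteq> Q & finite T & alg_independent k V T & card T = trans_degree k V Q"
 "T \<subseteq> Q ==> finite T ==> alg_independent k V T ==> card T <= trans_degree k V Q"
proof -
 let ?C = "{card T |T. T \<subseteq> Q & finite T & alg_independent k V T}"
 have "?C <= {..card (coords V)}" using card_indep_le Q by auto
 hence f: "finite ?C" using finite_subset by blast
 have "card {} : ?C" using indep_empty by (intro CollectI exI[of _ "{}"]) simp
 hence "Max ?C : ?C" using f by (intro Max_in) auto
 thus "EX T. T <= Q & finite T & alg_independent k V T & card T = trans_degree k V Q" unfolding trans_degree_def by auto
 show "card T <= trans_degree k V Q" if "T <= Q" "finite T" "alg_independent k V T"
 unfolding trans_degree_def by (rule Max_ge[OF f]) (use that in auto)
qed

lemma max_indep_algb: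
 assumes T: "T \<subseteq> carrier K" "finite T" "alg_independent k V T" "card T = d" and r: "r : carrier K"
 shows "algb (sfg (h ` k Un ev ` T)) (ev r)"
proof (cases "r : T")
 case True
 thus ?thesis using sfg_super[of "h ` k Un ev ` T"] by (intro algb_self srg_sfg) auto
next
 case False
 have "\<not> alg_independent k V (insert r T)"
 proof
 assume "alg_independent k V (insert r T)"
 hence "card (insert r T) <= d" unfolding variety_dim_def using trans_degree_props(2)[of "carrier K" "insert r T"] T r by auto
 thus False using T False by simp
 qed
 then obtain p where p: "p : MP k (insert r T)" "ins h ev p = 0" "p ~= 0"
 using alg_indep_iff[of "insert r T"] T r by auto
 obtain P where P: "P : PA (MP k T)" "p = poly P (mvar r)" using mpoly_as_univariate[OF ks p(1)] by blast
 define q where "q = map_poly (ins h ev) P"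
 have cq: "cof q i = ins h ev (cof P i)" for i by (simp add: q_def coeff_map_poly)
 have "P ~= 0" using P(2) p(3) by auto
 hence "lead_coeff P ~= 0" by simp
 hence "cof q (degree P) ~= 0" unfolding cq using alg_indep_iff[OF T(1)] T(3) PA_D[OF P(1)] by blast
 hence q0: "q ~= 0" by auto
 have qA: "q : PA (sfg (h ` k Un ev ` T))" unfolding PA_def cq mem_Collect_eq
 proof
 fix i show "ins h ev (cof P i) : sfg (h ` k Un ev ` T)"
 using sfg_super[of "h ` k Un ev ` T"] PA_D[OF P(1), of i] by (intro ins_in[OF srg_sfg]) auto
 qed
 have "poly q (ev r) = ins h ev (poly P (mvar r))"
 proof -
 have "degree q <= degree P" by (rule degree_le) (simp add: cq coeff_eq_0)
 hence "poly q (ev r) = (SUM i<=degree P. cof q i * ev r ^ i)" by (rule poly_sum_le)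
 thus ?thesis unfolding cq poly_altdef[of P] by (simp add: ins_sum[OF ch] ins_mult[OF ch] ins_ops(3)[OF ch] ins_var[OF ch])
 qed
 hence "poly q (ev r) = 0" using p(2) P(2) by simp
 thus ?thesis unfolding algb_def using q0 qA by blast
qed

section \<open>Derivations from the function field into the ambient field\<close>

definition kder :: "('v ratfun => 'a) => bool" where
 "kder dl \<longleftrightarrow> (ALL r:carrier K. ALL s:carrier K. dl (r \<oplus>\<^bsub>K\<^esub> s) = dl r + dl s & dl (r \<otimes>\<^bsub>K\<^esub> s) = ev r * dl s + ev s * dl r) &
 (ALL c:k. dl (ff_const k V c) = 0)"

lemma kder_extend:
 assumes "kder dl" shows "EX D. lder D & (ALL r:carrier K. D (ev r) = dl r)"
proof -
 define G where "G = (%r. (ev r, dl r)) ` carrier K"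
 have kd: "dl (r \<oplus>\<^bsub>K\<^esub> s) = dl r + dl s" "dl (r \<otimes>\<^bsub>K\<^esub> s) = ev r * dl s + ev s * dl r" if "r : carrier K" "s : carrier K" for r s
 using assms that by (auto simp: kder_def)
 have kc: "dl (ff_const k V c) = 0" if "c : k" for c using assms that by (auto simp: kder_def)
 have "dgraph G"
 proof (rule dgraphI)
 have "(ev (ff_const k V 1), dl (ff_const k V 1)) : G" unfolding G_def using K_const srgD(1)[OF ks] by blast
 thus "(1, 0) : G" using K_const[of 1] kc srgD(1)[OF ks] hops(4) by simp
 next
 fix x u y v assume "(x, u) : G" "(y, v) : G"
 then obtain r s where rs: "r : carrier K" "s : carrier K" "x = ev r" "u = dl r" "y = ev s" "v = dl s" by (auto simp: G_def)
 have "(ev (r \<oplus>\<^bsub>K\<^esub> s), dl (r \<oplus>\<^bsub>K\<^esub> s)) : G" "(ev (r \<otimes>\<^bsub>K\<^esub> s), dl (r \<otimes>\<^bsub>K\<^esub> s)) : G"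
 unfolding G_def using K_add[OF rs(1,2)] K_mult[OF rs(1,2)] by blast+
 thus "(x + y, u + v) : G & (x * y, x * v + y * u) : G"
 using K_add[OF rs(1,2)] K_mult[OF rs(1,2)] kd[OF rs(1,2)] rs by simp
 next
 fix x u assume "(x, u) : G"
 then obtain r where r: "r : carrier K" "x = ev r" "u = dl r" by (auto simp: G_def)
 have m1: "- 1 : k" using srgD(1,5)[OF ks] by blast
 let ?c = "ff_const k V (- 1)"
 have "(ev (?c \<otimes>\<^bsub>K\<^esub> r), dl (?c \<otimes>\<^bsub>K\<^esub> r)) : G" unfolding G_def using K_mult[of ?c r] K_const[OF m1] r(1) by blast
 thus "(- x, - u) : G" using K_mult[of ?c r] K_const[OF m1] kd(2)[of ?c r] kc[OF m1] r hops by simp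
 next
 fix u assume "(0, u) : G"
 then obtain r where r: "r : carrier K" "ev r = 0" "u = dl r" by (auto simp: G_def)
 hence "r = ff_const k V 0" using K_const[of 0] srgD(2)[OF ks] hops(3) by (intro ev_eqI) auto
 thus "u = 0" using kc srgD(2)[OF ks] r(3) by simp
 qed
 then obtain D where D: "der D" "ALL x u. (x, u) : G --> D x = u" by (rule derivation_extend)
 hence e: "ALL r:carrier K. D (ev r) = dl r" by (auto simp: G_def)
 moreover have "D (h c) = 0" if "c : k" for c using e K_const[OF that] kc[OF that] by metis
 ultimately show ?thesis using D(1) by blast
qed

lemma kder_zero:
 assumes T: "T \<subseteq> carrier K" "finite T" "alg_independent k V T" "card T = d" and dl: "kder dl" "!!t. t : T ==> dl t = 0"
 and r: "r : carrier K"
 shows "dl r = 0"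
proof -
 obtain D where D: "lder D" "ALL r:carrier K. D (ev r) = dl r" using kder_extend[OF dl(1)] by blast
 have dD: "der D" using D(1) by blast
 have z: "D s = 0" if "s : h ` k Un ev ` T" for s using that D dl(2) T(1) by auto
 have "D (ev r) = 0"
 by (rule der_algb_zero[OF srg_sfg dD der_zero_sfg[OF dD z] max_indep_algb[OF T r]])
 thus ?thesis using D(2) r by simp
qed

lemma kder_of_der: "lder D ==> kder (%r. D (ev r))"
 unfolding kder_def using K_add K_mult K_const by (auto simp: derD)

lemma kder_of_derivation: "E : derivations k V ==> kder (%r. ev (E r))"
proof -
 assume E: "E : derivations k V"
 hence E1: "E r : carrier K" if "r : carrier K" for r using that unfolding derivations_def Let_def by (auto simp: PiE_def)
 have E2: "E (r \<oplus>\<^bsub>K\<^esub> s) = E r \<oplus>\<^bsub>K\<^esub> E s" "E (r \<otimes>\<^bsub>K\<^esub> s) = (r \<otimes>\<^bsub>K\<^esub> E s) \<oplus>\<^bsub>K\<^esub> (s \<otimes>\<^bsub>K\<^esub> E r)"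
 if "r : carrier K" "s : carrier K" for r s using E that unfolding derivations_def Let_def by auto
 have E3: "E (ff_const k V c) = \<zero>\<^bsub>K\<^esub>" if "c : k" for c using E that unfolding derivations_def Let_def by auto
 show ?thesis unfolding kder_def using E1 E2 E3 K_zero by (auto simp: K_add K_mult)
qed

lemma kder_lincomb: "finite I ==> (!!i. i : I ==> kder (dl i)) ==> kder (%r. SUM i:I. a i * dl i r)"
 unfolding kder_def by (auto simp: sum.distrib sum_distrib_left algebra_simps intro!: sum.cong)

lemma kder_diff: "kder dl ==> kder dl' ==> kder (%r. dl r - dl' r)"
 unfolding kder_def by (auto simp: algebra_simps)

text \<open>These derivations form a space of dimension d over the ambient field, so two d-tuples
  are related by a matrix c. All Jacobian determinants change by the same factor, whichever
  functions t they are taken of.\<close>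

lemma kder_frame:
 assumes T: "q ` {..<d} \<subseteq> carrier K" "alg_independent k V (q ` {..<d})" "inj_on q {..<d}"
 and E: "!!i. i < d ==> kder (E i)" and nz: "dt d (%i l. E i (q l)) ~= 0"
 and dl: "!!i. i < d ==> kder (dl i)"
 shows "EX c. ALL t. (ALL l<d. t l : carrier K) --> dt d (%i l. dl i (t l)) = dt d c * dt d (%i l. E i (t l))"
proof -
 obtain c where c: "ALL i<d. ALL l<d. dl i (q l) = (SUM j<d. c i j * E j (q l))" using dt_solve[OF nz, of "%i l. dl i (q l)"] by blast
 have T2: "finite (q ` {..<d})" "card (q ` {..<d}) = d" using T(3) by (auto simp: card_image)
 have e: "dl i r = (SUM j<d. c i j * E j r)" if i: "i < d" and r: "r : carrier K" for i r
 proof -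
 have "kder (%r. dl i r - (SUM j:{..<d}. c i j * E j r))" by (intro kder_diff kder_lincomb E dl i) auto
 hence "dl i r - (SUM j:{..<d}. c i j * E j r) = 0"
 by (rule kder_zero[OF T(1) T2(1) T(2) T2(2) _ _ r]) (use c i in auto)
 thus ?thesis by simp
 qed
 show ?thesis
 proof (intro exI[of _ c] allI impI)
 fix t assume t: "ALL l<d. t l : carrier K"
 have "dt d (%i l. dl i (t l)) = dt d (%i l. SUM j<d. c i j * E j (t l))" by (rule dt_cong) (use e t in auto)
 thus "dt d (%i l. dl i (t l)) = dt d c * dt d (%i l. E i (t l))" by (simp add: dt_mult)
 qed
qed

lemma frame_mem: "E : derivation_frames k V ==> i < d ==> E i : derivations k V"
 unfolding derivation_frames_def by auto

lemma derivation_carrier: "E : derivations k V ==> r : carrier K ==> E r : carrier K"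
 unfolding derivations_def Let_def by (auto simp: PiE_def)

lemma pluri_form_eval:
 assumes E: "E : derivation_frames k V" and g: "g : carrier K" and t: "ALL l<d. t l : carrier K"
 shows "pluri_form k V m g t E : carrier K & ev (pluri_form k V m g t E) = ev g * dt d (%i l. ev (E i (t l))) ^ m"
proof -
 have "ring_det K d (%i j. E i (t j)) : carrier K & ev (ring_det K d (%i j. E i (t j))) = dt d (%i l. ev (E i (t l)))"
 by (rule ev_ring_det) (use E t frame_mem derivation_carrier in auto)
 thus ?thesis unfolding pluri_form_def using E g K_mult ev_pow by simp
qed

lemma local_rep:
 assumes "om : psec k V m" "x : hv k V"
 shows "EX g t. g : local_ring_at k V x & (ALL l<d. t l : local_ring_at k V x) & g : carrier K & (ALL l<d. t l : carrier K) & om = pluri_form k V m g t"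
proof -
 obtain g t where gt: "g : local_ring_at k V x" "t : {..<d} \<rightarrow> local_ring_at k V x" "om = pluri_form k V m g t"
 using assms unfolding pluricanonical_sections_def by blast
 moreover have "local_ring_at k V x <= carrier K" unfolding local_ring_at_def by blast
 ultimately show ?thesis by (intro exI[of _ g] exI[of _ t]) auto
qed

end

text \<open>One exponent m, independent quotients \<open>q l\<close> of sections \<open>om l\<close>
  by \<open>et l\<close>, and one frame \<open>E\<close> on which neither the Jacobian of
  \<open>q\<close> nor any \<open>et l\<close> vanishes. Everything lives in the function field, so
  the same data can be evaluated at every generic point.\<close>

definition gt_data :: "complex set => 'v proj_subscheme => nat => (nat => 'v ratfun) => (nat => 'v ratfun => 'v ratfun) =>
 (nat => (nat => 'v ratfun => 'v ratfun) => 'v ratfun) => (nat => (nat => 'v ratfun => 'v ratfun) => 'v ratfun) => bool" where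
 "gt_data k V m q E om et \<longleftrightarrow> (let K = function_field k V; d = variety_dim k V in
 q ` {..<d} \<subseteq> carrier K & alg_independent k V (q ` {..<d}) & inj_on q {..<d} &
 E : derivation_frames k V & ring_det K d (%i l. E i (q l)) ~= \<zero>\<^bsub>K\<^esub> &
 (ALL l<d. om l : psec k V m & et l : psec k V m & et l E ~= \<zero>\<^bsub>K\<^esub> &
 om l E = q l \<otimes>\<^bsub>K\<^esub> et l E))"

context gpoint
begin

text \<open>A frame on which one section is nonzero consists of independent derivations. No nonzero
  section can vanish on such a frame, because passing to any other frame only multiplies values by a
  power of a determinant.\<close>

lemma general_type_data:
 assumes gt: "general_type k V" and d: "d >= 1" and x: "x : hv k V"
 shows "EX m q E om et. gt_data k V m q E om et"
proof -
 let ?M = "{m. m >= 1 & nonzero_sections k V m ~= {}}"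
 let ?f = "%m. ereal (real (pluricanonical_image_dim k V m))"
 have sup: "(SUP m\<in>?M. ?f m) = ereal (real d)" using gt unfolding general_type_def kodaira_dim_def .
 \<comment> \<open>A supremum equal to the integer d is attained: if all image dimensions were at
   most d - 1, so would be the supremum. Here d is at least 1.\<close>
 obtain m where m: "m : ?M" "pluricanonical_image_dim k V m >= d"
 proof -
 have "EX m:?M. pluricanonical_image_dim k V m >= d"
 proof (rule ccontr)
 assume a: "\<not> ?thesis"
 have "?f m <= ereal (real (d - 1))" if "m : ?M" for m
 proof -
 have "pluricanonical_image_dim k V m <= d - 1" using a that by force
 thus ?thesis by simp
 qed
 hence "(SUP m\<in>?M. ?f m) <= ereal (real (d - 1))" by (intro SUP_least) auto
 hence "real d <= real (d - 1)" unfolding sup by simp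
 thus False using d by simp
 qed
 thus ?thesis using that by blast
 qed
 have m1: "m >= 1" using m(1) by simp
 have Q: "section_quotients k V m <= carrier K" unfolding section_quotients_def by blast
 obtain T0 where T0: "T0 \<subseteq> section_quotients k V m" "finite T0" "alg_independent k V T0" "card T0 = pluricanonical_image_dim k V m"
 using trans_degree_props(1)[OF Q] unfolding pluricanonical_image_dim_def by blast
 have "card T0 <= d" unfolding variety_dim_def using T0 Q by (intro trans_degree_props(2)) auto
 hence cT: "card T0 = d" using T0(4) m(2) by simp
 obtain q where q: "bij_betw q {..<d} T0" using ex_bij_betw_nat_finite[OF T0(2)] cT by (auto simp: atLeast0LessThan)
 have qT: "q ` {..<d} = T0" "inj_on q {..<d}" using q by (auto simp: bij_betw_def)
 have qK: "q ` {..<d} <= carrier K" using qT T0(1) Q by blast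
 have qi: "alg_independent k V (q ` {..<d})" using qT T0(3) by simp
 have "ALL l:{..<d}. EX om et. om : psec k V m & et : nonzero_sections k V m & (ALL D:derivation_frames k V. om D = q l \<otimes>\<^bsub>K\<^esub> et D)"
 using T0(1) qT(1) unfolding section_quotients_def by blast
 then obtain om et where oe: "ALL l:{..<d}. om l : psec k V m & et l : nonzero_sections k V m & (ALL D:derivation_frames k V. om l D = q l \<otimes>\<^bsub>K\<^esub> et l D)"
 by metis
 have eta: "et l : psec k V m" "EX D:derivation_frames k V. et l D ~= \<zero>\<^bsub>K\<^esub>" if "l < d" for l
 using oe that unfolding nonzero_sections_def by auto
 have d0: "0 < d" using d by simp
 obtain E where E: "E : derivation_frames k V" "et 0 E ~= \<zero>\<^bsub>K\<^esub>" using eta(2)[OF d0] by blast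
 have kE: "kder (%r. ev (E' i r))" if "E' : derivation_frames k V" "i < d" for E' i
 using kder_of_derivation[OF frame_mem[OF that]] .
 have nzt: "ev g ~= 0 & dt d (%i l. ev (E' i (t l))) ~= 0"
 if "E' : derivation_frames k V" "g : carrier K" "ALL l<d. t l : carrier K" "pluri_form k V m g t E' ~= \<zero>\<^bsub>K\<^esub>" for E' g t
 proof -
 have "ev (pluri_form k V m g t E') ~= 0" using pluri_form_eval[OF that(1-3), of m] that(4) ev_eqI K_zero by metis
 thus ?thesis using pluri_form_eval[OF that(1-3), of m] m1 by auto
 qed
 obtain g0 t0 where gt0: "g0 : carrier K" "ALL l<d. t0 l : carrier K" "et 0 = pluri_form k V m g0 t0"
 using local_rep[OF eta(1)[OF d0] x] by blast
 have nt0: "dt d (%i l. ev (E i (t0 l))) ~= 0" using nzt[OF E(1) gt0(1,2)] E(2) gt0(3) by simp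
 have T2: "finite (q ` {..<d})" "card (q ` {..<d}) = d" using qT(2) by (auto simp: card_image)
 have nq: "dt d (%i l. ev (E i (q l))) ~= 0"
 proof
 assume "dt d (%i l. ev (E i (q l))) = 0"
 then obtain c where c: "EX i<d. c i ~= 0" "ALL l<d. (SUM i<d. c i * ev (E i (q l))) = 0" using dt_zero_kernel by blast
 have "(SUM i:{..<d}. c i * ev (E i r)) = 0" if "r : carrier K" for r
 by (rule kder_zero[OF qK T2(1) qi T2(2) kder_lincomb _ that]) (use c kE[OF E(1)] in auto)
 hence "!!l. l < d ==> (SUM i<d. c i * ev (E i (t0 l))) = 0" using gt0(2) by simp
 hence "dt d (%i l. ev (E i (t0 l))) = 0" using c(1) dt_kernel_zero[of _ d c "%i l. ev (E i (t0 l))"] by blast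
 thus False using nt0 by blast
 qed
 have rd: "ring_det K d (%i l. E i (q l)) ~= \<zero>\<^bsub>K\<^esub>"
 proof
 assume "ring_det K d (%i l. E i (q l)) = \<zero>\<^bsub>K\<^esub>"
 moreover have "ev (ring_det K d (%i l. E i (q l))) = dt d (%i l. ev (E i (q l)))"
 using ev_ring_det[of d "%i l. E i (q l)"] qK frame_mem[OF E(1)] derivation_carrier by blast
 ultimately show False using nq K_zero by simp
 qed
 have etaE: "et l E ~= \<zero>\<^bsub>K\<^esub>" if l: "l < d" for l
 proof -
 obtain g t where gt: "g : carrier K" "ALL l<d. t l : carrier K" "et l = pluri_form k V m g t"
 using local_rep[OF eta(1)[OF l] x] by blast
 obtain E' where E': "E' : derivation_frames k V" "et l E' ~= \<zero>\<^bsub>K\<^esub>" using eta(2)[OF l] by blast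
 have n: "ev g ~= 0" "dt d (%i l. ev (E' i (t l))) ~= 0" using nzt[OF E'(1) gt(1,2)] E'(2) gt(3) by auto
 obtain c where "ALL t. (ALL l<d. t l : carrier K) --> dt d (%i l. ev (E' i (t l))) = dt d c * dt d (%i l. ev (E i (t l)))"
 using kder_frame[OF qK qi qT(2), of "%i r. ev (E i r)" "%i r. ev (E' i r)"] kE[OF E(1)] kE[OF E'(1)] nq by blast
 hence "dt d (%i l. ev (E i (t l))) ~= 0" using n(2) gt(2) by auto
 hence "ev (et l E) ~= 0" using pluri_form_eval[OF E(1) gt(1,2), of m] n(1) gt(3) by simp
 thus ?thesis using K_zero by auto
 qed
 have "gt_data k V m q E om et" unfolding gt_data_def Let_def using qK qi qT(2) E(1) rd oe eta(1) etaE by auto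
 thus ?thesis by blast
qed

text \<open>The coefficient of the form \<open>om\<close> relative to the m-th power of dq_0 ...
  dq_(d-1), read off on the frame \<open>E\<close>.\<close>

definition wv :: "nat => (nat => 'v ratfun) => (nat => 'v ratfun => 'v ratfun) => ((nat => 'v ratfun => 'v ratfun) => 'v ratfun) => 'a" where
 "wv m q E om = ev (om E) / dt d (%i l. ev (E i (q l))) ^ m"

lemma gt_dataD:
 assumes "gt_data k V m q E om et"
 shows "q ` {..<d} \<subseteq> carrier K" "alg_independent k V (q ` {..<d})" "inj_on q {..<d}" "E : derivation_frames k V"
 "ring_det K d (%i l. E i (q l)) ~= \<zero>\<^bsub>K\<^esub>" "l < d ==> om l : psec k V m"
 "l < d ==> et l : psec k V m" "l < d ==> et l E ~= \<zero>\<^bsub>K\<^esub>" "l < d ==> om l E = q l \<otimes>\<^bsub>K\<^esub> et l E"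
 using assms unfolding gt_data_def Let_def by blast+

lemma gt_dt_nonzero:
 assumes "gt_data k V m q E om et" shows "dt d (%i l. ev (E i (q l))) ~= 0"
proof
 note D = gt_dataD[OF assms]
 assume a: "dt d (%i l. ev (E i (q l))) = 0"
 have "ring_det K d (%i l. E i (q l)) : carrier K & ev (ring_det K d (%i l. E i (q l))) = dt d (%i l. ev (E i (q l)))"
 by (rule ev_ring_det) (use D(1) frame_mem[OF D(4)] derivation_carrier in blast)
 hence "ring_det K d (%i l. E i (q l)) = \<zero>\<^bsub>K\<^esub>" using a K_zero by (intro ev_eqI) auto
 thus False using D(5) by blast
qed

text \<open>The value of a form on derivations of the ambient field may be computed from its
  coefficient relative to q or from any expression by g and t. Passing from E to \<open>dl\<close>
  multiplies both by the same power of a determinant.\<close>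

lemma gt_transform:
 assumes G: "gt_data k V m q E om et" and s: "s = pluri_form k V m g t" "g : carrier K" "ALL l<d. t l : carrier K"
 and dl: "!!i. i < d ==> lder (dl i)"
 shows "wv m q E s * dt d (%i l. dl i (ev (q l))) ^ m = ev g * dt d (%i l. dl i (ev (t l))) ^ m"
proof -
 note D = gt_dataD[OF G] and nz = gt_dt_nonzero[OF G]
 obtain c where c: "ALL t. (ALL l<d. t l : carrier K) --> dt d (%i l. dl i (ev (t l))) = dt d c * dt d (%i l. ev (E i (t l)))"
 using kder_frame[OF D(1-3), of "%i r. ev (E i r)" "%i r. dl i (ev r)"] nz kder_of_derivation[OF frame_mem[OF D(4)]] kder_of_der[OF dl] by blast
 have q: "ALL l<d. q l : carrier K" using D(1) by auto
 have "ev (s E) = ev g * dt d (%i l. ev (E i (t l))) ^ m" using pluri_form_eval[OF D(4) s(2,3), of m] s(1) by simp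
 thus ?thesis using c[rule_format, of t] c[rule_format, of q] q s(3) nz
 by (simp add: wv_def power_mult_distrib)
qed

lemma gt_quotient:
 assumes G: "gt_data k V m q E om et" and l: "l < d" and x: "x : hv k V"
 shows "wv m q E (et l) ~= 0" "ev (q l) = wv m q E (om l) / wv m q E (et l)"
proof -
 note D = gt_dataD[OF G] and nz = gt_dt_nonzero[OF G]
 obtain g t where gt: "g : carrier K" "ALL l<d. t l : carrier K" "et l = pluri_form k V m g t"
 using local_rep[OF D(7)[OF l] x] by blast
 have eK: "et l E : carrier K" using pluri_form_eval[OF D(4) gt(1,2), of m] gt(3) by simp
 hence ne: "ev (et l E) ~= 0" using D(8)[OF l] ev_eqI K_zero by metis
 thus "wv m q E (et l) ~= 0" using nz by (simp add: wv_def)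
 have "ev (om l E) = ev (q l) * ev (et l E)" using D(9)[OF l] K_mult[of "q l" "et l E"] D(1) l eK by auto
 thus "ev (q l) = wv m q E (om l) / wv m q E (et l)" using nz ne by (simp add: wv_def)
qed

end

section \<open>Families with bounded poles span a finite-dimensional space\<close>

text \<open>Independent variables \<open>z\<close> over the constants, dual derivations
  \<open>D\<close> on the whole ambient field, and an element \<open>y\<close> generating an
  algebraic extension. Each \<open>D t\<close> has a constant field \<open>E t\<close> that contains
  the other variables and over which \<open>z t\<close> is transcendental.\<close>

locale tbasis =
 fixes ka :: "complex set" and h :: "complex => 'a::{field_char_0,alg_closed_field}"
 and T :: "'t set" and z :: "'t => 'a" and D :: "'t => 'a => 'a" and y :: 'a and m :: "'a poly"
 assumes acl: "acl ka" and ch: "chom h" and finT: "finite T"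
 and derT: "!!t. t : T ==> der (D t)" and Dk: "!!t c. t : T ==> c : ka ==> D t (h c) = 0"
 and Dz: "!!t s. t : T ==> s : T ==> D t (z s) = (if s = t then 1 else 0)"
 and min: "minp (sfg (h ` ka Un z ` T)) y m"
begin

abbreviation "F0 \<equiv> sfg (h ` ka Un z ` T)"
abbreviation "R0 \<equiv> srgn (h ` ka Un z ` T)"
abbreviation "L \<equiv> sfg (F0 Un {y})"
definition "E t = {x. D t x = 0}"

text \<open>Conjugations of \<open>L\<close> over \<open>F0\<close>. Denominators have to serve all
  of them, since the coordinates of an element in powers of \<open>y\<close> are combinations of its
  conjugates.\<close>

definition emb :: "('a => 'a) => bool" where "emb ta \<longleftrightarrow> phom L ta & (ALL x:F0. ta x = x)"

text \<open>Specializations of \<open>z t\<close> to finite values with \<open>E t\<close> fixed,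
  extended to the ambient field. Only one variable moves at a time, which keeps the theory of poles
  one-dimensional.\<close>

definition pfin :: "'t => 'a set => ('a => 'a) => bool" where
 "pfin t A ph \<longleftrightarrow> place UNIV A ph & (ALL x:E t. x : A & ph x = x) & z t : A"

definition pinf :: "'t => 'a set => ('a => 'a) => bool" where
 "pinf t A ph \<longleftrightarrow> place UNIV A ph & (ALL x:E t. x : A & ph x = x) & inverse (z t) : A & ph (inverse (z t)) = 0"

lemma F0s: "sfd F0" "srg F0" by (rule sfd_sfg, rule srg_sfg)

lemma Ls: "sfd L" "srg L" by (rule sfd_sfg, rule srg_sfg)

lemma F0L: "F0 \<subseteq> L" using sfg_super[of "F0 Un {y}"] by blast

lemma R0F0: "R0 \<subseteq> F0" by (rule srgn_sfg)

lemma zF0: "t : T ==> z t : F0" using sfg_super[of "h ` ka Un z ` T"] by blast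

lemma hF0: "c : ka ==> h c : F0" using sfg_super[of "h ` ka Un z ` T"] by blast

lemma yalg: "algb F0 y" unfolding algb_def using minpD(1-3)[OF min] by (intro bexI[of _ m]) auto

lemma L_eq: "L = {poly p y |p. p : PA F0}" by (rule simple_extension[OF F0s(1) yalg])

lemma L_algb: "x : L ==> algb F0 x" using L_eq algb_poly[OF F0s(2) yalg] by auto

lemma sfd_E: "t : T ==> sfd (E t)" unfolding E_def by (rule sfd_der_ker[OF derT])

lemma D_algb_E: assumes t: "t : T" and a: "algb (E t) x" shows "D t x = 0"
 by (rule der_algb_zero[OF sfdD(1)[OF sfd_E[OF t]] derT[OF t] _ a]) (simp add: E_def)

lemma E_acl: assumes t: "t : T" shows "acl (E t)"
 unfolding acl_def
proof (intro conjI ballI impI)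
 show "sfd (E t)" by (rule sfd_E[OF t])
 fix p assume p: "p : PA (E t)" "0 < degree p"
 obtain x where x: "poly p x = 0" using alg_closed_imp_poly_has_root[OF p(2)] by blast
 have "algb (E t) x" unfolding algb_def using p x by (intro bexI[of _ p]) auto
 hence "D t x = 0" using D_algb_E[OF t] by blast
 thus "EX x:E t. poly p x = 0" using x by (auto simp: E_def)
qed

lemma z_trans: assumes t: "t : T" and p: "p : PA (E t)" "poly p (z t) = 0" shows "p = 0"
proof (rule ccontr)
 assume "p ~= 0"
 hence "algb (E t) (z t)" unfolding algb_def using p by blast
 hence "D t (z t) = 0" using D_algb_E[OF t] by blast
 thus False using Dz[OF t t] by simp
qed

lemma z_nonzero: "t : T ==> z t ~= 0" using Dz[of t t] derD(3)[OF derT, of t] by auto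

lemma acl_UNIV: "acl (UNIV :: 'a set)"
 unfolding acl_def
proof (intro conjI ballI impI)
 show "sfd (UNIV :: 'a set)" by (simp add: sfd_def srg_def)
 fix p :: "'a poly" assume "0 < degree p"
 thus "EX x:UNIV. poly p x = 0" using alg_closed_imp_poly_has_root by blast
qed

lemma hgraph_eval:
 assumes S: "srg S" and tr: "!!p. p : PA S ==> poly p x = 0 ==> poly p a = 0"
 shows "hgraph UNIV {(poly p x, poly p a) |p. p : PA S}"
proof (rule hgraphI)
 let ?G = "{(poly p x, poly p a) |p. p : PA S}"
 have "(poly 1 x, poly 1 a) : ?G" using PA_1[OF S] by blast
 thus "(1, 1) : ?G" by simp
 fix x' u y' v assume "(x', u) : ?G" "(y', v) : ?G"
 then obtain p q where pq: "p : PA S" "q : PA S" "x' = poly p x" "u = poly p a" "y' = poly q x" "v = poly q a" by auto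
 have "(poly (p + q) x, poly (p + q) a) : ?G" "(poly (p * q) x, poly (p * q) a) : ?G"
 using PA_ops(1,4)[OF S pq(1,2)] by blast+
 thus "(x' + y', u + v) : ?G & (x' * y', u * v) : ?G" using pq by simp
next
 let ?G = "{(poly p x, poly p a) |p. p : PA S}"
 fix x' u assume "(x', u) : ?G"
 then obtain p where p: "p : PA S" "x' = poly p x" "u = poly p a" by auto
 have "(poly (- p) x, poly (- p) a) : ?G" using PA_ops(3)[OF S p(1)] by blast
 thus "(- x', - u) : ?G" using p by simp
qed (use tr in auto)

lemma PA_E_const: assumes "t : T" "x : E t" shows "[:x:] : PA (E t)"
 using PA_pCons[OF sfdD(1)[OF sfd_E[OF assms(1)]]] assms(2) PA_0[OF sfdD(1)[OF sfd_E[OF assms(1)]]] by blast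

lemma PA_E_var: assumes "t : T" shows "[:0, 1:] : PA (E t)"
 using PA_pCons[OF sfdD(1)[OF sfd_E[OF assms]]] PA_E_const[OF assms] srgD(1,2)[OF sfdD(1)[OF sfd_E[OF assms]]] by blast

lemma pfin_ex: assumes t: "t : T" shows "EX A ph. pfin t A ph & ph (z t) = a"
proof -
 note S = sfdD(1)[OF sfd_E[OF t]]
 let ?G = "{(poly p (z t), poly p a) |p. p : PA (E t)}"
 have "poly p a = 0" if "p : PA (E t)" "poly p (z t) = 0" for p
 unfolding z_trans[OF t that] by simp
 hence "hgraph UNIV ?G" by (rule hgraph_eval[OF S])
 then obtain A ph where A: "place UNIV A ph" "ALL x u. (x, u) : ?G --> x : A & ph x = u" by (rule place_extension[OF _ acl_UNIV])
 have c: "(x, x) : ?G" if "x : E t" for x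
 proof -
 have "(poly [:x:] (z t), poly [:x:] a) : ?G" using PA_E_const[OF t that] by blast
 thus ?thesis by simp
 qed
 have "(poly [:0, 1:] (z t), poly [:0, 1:] a) : ?G" using PA_E_var[OF t] by blast
 hence "(z t, a) : ?G" by simp
 thus ?thesis using A c unfolding pfin_def by blast
qed

lemma pinf_ex: assumes t: "t : T" shows "EX A ph. pinf t A ph"
proof -
 note S = sfdD(1)[OF sfd_E[OF t]]
 let ?u = "inverse (z t)"
 let ?G = "{(poly p ?u, poly p 0) |p. p : PA (E t)}"
 have "p = 0" if p: "p : PA (E t)" "poly p ?u = 0" for p
 proof (rule ccontr)
 assume "p ~= 0"
 hence "algb (E t) ?u" unfolding algb_def using p by blast
 hence "D t ?u = 0" using D_algb_E[OF t] by blast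
 thus False using der_inverse[OF derT[OF t], of "z t"] Dz[OF t t] z_nonzero[OF t] by simp
 qed
 hence "poly p 0 = 0" if "p : PA (E t)" "poly p ?u = 0" for p
 using that by force
 hence "hgraph UNIV ?G" by (rule hgraph_eval[OF S])
 then obtain A ph where A: "place UNIV A ph" "ALL x u. (x, u) : ?G --> x : A & ph x = u" by (rule place_extension[OF _ acl_UNIV])
 have c: "(x, x) : ?G" if "x : E t" for x
 proof -
 have "(poly [:x:] ?u, poly [:x:] 0) : ?G" using PA_E_const[OF t that] by blast
 thus ?thesis by simp
 qed
 have "(poly [:0, 1:] ?u, poly [:0, 1:] 0) : ?G" using PA_E_var[OF t] by blast
 hence "(?u, 0) : ?G" by simp
 thus ?thesis using A c unfolding pinf_def by blast
qed

lemma gens_E: assumes t: "t : T" "s : h ` ka Un z ` (T - {t})" shows "s : E t"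
proof (cases "s : h ` ka")
 case True
 thus ?thesis using Dk[OF t(1)] by (auto simp: E_def)
next
 case False
 then obtain x where "s = z x" "x : T" "x ~= t" using t(2) by blast
 thus ?thesis using Dz[OF t(1), of x] by (simp add: E_def)
qed

lemma hE: "t : T ==> c : ka ==> h c : E t" by (rule gens_E) auto

lemma R0_poly: assumes t: "t : T" and x: "x : R0" shows "EX P:PA (E t). x = poly P (z t)"
proof -
 note S = sfdD(1)[OF sfd_E[OF t]]
 let ?B = "{poly P (z t) |P. P : PA (E t)}"
 have c: "x : ?B" if "x : E t" for x
 proof -
 have "poly [:x:] (z t) : ?B" using PA_E_const[OF t that] by blast
 thus ?thesis by simp
 qed
 have "poly [:0, 1:] (z t) : ?B" using PA_E_var[OF t] by blast
 hence "z t : ?B" by simp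
 hence "h ` ka Un z ` T <= ?B" using c gens_E[OF t] by blast
 thus ?thesis using srgn_least[OF srg_poly_image[OF S]] x by blast
qed

lemma F0_frac: assumes t: "t : T" and x: "x : F0"
 shows "EX P:PA (E t). EX Q:PA (E t). Q ~= 0 & x = poly P (z t) / poly Q (z t)"
proof -
 obtain a b where ab: "a : R0" "b : R0" "b ~= 0" "x = a / b" using sfg_frac[OF x] by blast
 obtain P where P: "P : PA (E t)" "a = poly P (z t)" using R0_poly[OF t ab(1)] by blast
 obtain Q where Q: "Q : PA (E t)" "b = poly Q (z t)" using R0_poly[OF t ab(2)] by blast
 have "Q ~= 0" using Q(2) ab(3) by auto
 thus ?thesis using P Q ab(4) by blast
qed

lemma pfin_R0: "t : T ==> pfin t A ph ==> R0 \<subseteq> A"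
proof (rule srgn_least)
 assume a: "t : T" "pfin t A ph"
 thus "srg A" by (auto simp: pfin_def placeD)
 show "h ` ka Un z ` T <= A" using a gens_E[OF a(1)] unfolding pfin_def by blast
qed

text \<open>Q(z) divided by z to the degree of Q: a unit at infinity whose residue is the leading
  coefficient.\<close>

definition unit_inf :: "'t => 'a poly => 'a" where "unit_inf t Q = inverse (z t) ^ degree Q * poly Q (z t)"

lemma pinf_unit:
 assumes t: "t : T" and A: "pinf t A ph" and Q: "Q : PA (E t)"
 shows "unit_inf t Q : A" "ph (unit_inf t Q) = lead_coeff Q"
proof -
 let ?u = "inverse (z t)" and ?n = "degree Q"
 have P: "place UNIV A ph" and u: "?u : A" "ph ?u = 0" and e: "!!x. x : E t ==> x : A & ph x = x"
 using A unfolding pinf_def by auto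
 note Asr = placeD(1)[OF P]
 have s: "unit_inf t Q = (SUM i<=?n. cof Q i * ?u ^ (?n - i))"
 unfolding unit_inf_def poly_altdef sum_distrib_left
 by (intro sum.cong refl) (simp add: power_diff z_nonzero[OF t] field_simps)
 have mem: "cof Q i * ?u ^ (?n - i) : A" for i using e[OF PA_D[OF Q]] srgD(4,7)[OF Asr] u(1) by blast
 show "unit_inf t Q : A" unfolding s by (rule srg_sum[OF Asr mem])
 have "ph (unit_inf t Q) = (SUM i<=?n. ph (cof Q i * ?u ^ (?n - i)))" unfolding s by (rule place_sum[OF P mem])
 also have "\<dots> = (SUM i<=?n. if i = ?n then lead_coeff Q else 0)"
 proof (rule sum.cong[OF refl])
 fix i assume "i : {..?n}"
 thus "ph (cof Q i * ?u ^ (?n - i)) = (if i = ?n then lead_coeff Q else 0)"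
 using placeD(4)[OF P, of "cof Q i" "?u ^ (?n - i)"] e[OF PA_D[OF Q]] srgD(7)[OF Asr u(1)] place_power[OF P u(1)] u(2) placeD(2)[OF P]
 by auto
 qed
 finally show "ph (unit_inf t Q) = lead_coeff Q" by simp
qed

text \<open>The common interface of finite places, with denominators polynomial in all variables,
  and of places at infinity, with arbitrary nonzero denominators in \<open>F0\<close>. Polynomial
  denominators for one variable are finite at the finite places of every other variable.\<close>

definition dclass :: "('a set => ('a => 'a) => bool) => 'a set => bool" where
 "dclass PP RR \<longleftrightarrow> (ALL A ph. PP A ph --> place UNIV A ph & (ALL c:ka. h c : A & ph (h c) = h c)) & RR \<subseteq> F0 & 1 : RR & (ALL a:RR. ALL b:RR. a * b : RR) & 0 ~: RR &
 (ALL c:F0. EX Dl:RR. ALL A ph. PP A ph --> Dl : A & Dl * c : A)"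

lemma dclassD:
 assumes "dclass PP RR"
 shows "PP A ph ==> place UNIV A ph" "RR \<subseteq> F0" "1 : RR" "a : RR ==> b : RR ==> a * b : RR" "0 ~: RR"
 "c : F0 ==> EX Dl:RR. ALL A ph. PP A ph --> Dl : A & Dl * c : A" "PP A ph ==> srg A"
 "PP A ph ==> c' : ka ==> h c' : A & ph (h c') = h c'"
 using assms placeD(1) unfolding dclass_def by blast+

lemma dclass_fin: assumes t: "t : T" shows "dclass (pfin t) (R0 - {0})"
 unfolding dclass_def
proof (intro conjI)
 note R = srg_srgn[of "h ` ka Un z ` T"]
 show "ALL A ph. pfin t A ph --> place UNIV A ph & (ALL c:ka. h c : A & ph (h c) = h c)"
 using hE[OF t] by (simp add: pfin_def)
 show "R0 - {0} <= F0" using R0F0 by blast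
 show "1 : R0 - {0}" using srgD(1)[OF R] by simp
 show "ALL a:R0 - {0}. ALL b:R0 - {0}. a * b : R0 - {0}" using srgD(4)[OF R] by simp
 show "ALL c:F0. EX Dl:R0 - {0}. ALL A ph. pfin t A ph --> Dl : A & Dl * c : A"
 proof
 fix c assume "c : F0"
 then obtain a b where ab: "a : R0" "b : R0" "b ~= 0" "c = a / b" using sfg_frac by blast
 hence "b * c = a" by simp
 hence "ALL A ph. pfin t A ph --> b : A & b * c : A" using pfin_R0[OF t] ab(1,2) by auto
 thus "EX Dl:R0 - {0}. ALL A ph. pfin t A ph --> Dl : A & Dl * c : A" using ab(2,3) by blast
 qed
qed simp

lemma dclass_inf: assumes t: "t : T" shows "dclass (pinf t) (F0 - {0})"
 unfolding dclass_def
proof (intro conjI)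
 show "ALL A ph. pinf t A ph --> place UNIV A ph & (ALL c:ka. h c : A & ph (h c) = h c)"
 using hE[OF t] by (simp add: pinf_def)
 show "F0 - {0} <= F0" by blast
 show "1 : F0 - {0}" using srgD(1)[OF F0s(2)] by simp
 show "ALL a:F0 - {0}. ALL b:F0 - {0}. a * b : F0 - {0}" using srgD(4)[OF F0s(2)] by simp
 show "ALL c:F0. EX Dl:F0 - {0}. ALL A ph. pinf t A ph --> Dl : A & Dl * c : A"
 proof
 fix c assume c: "c : F0"
 let ?u = "inverse (z t)"
 obtain P Q where PQ: "P : PA (E t)" "Q : PA (E t)" "Q ~= 0" "c = poly P (z t) / poly Q (z t)" using F0_frac[OF t c] by blast
 define Dl where "Dl = ?u ^ degree P"
 have z0: "z t ~= 0" using z_nonzero[OF t] .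
 have Qz: "poly Q (z t) ~= 0" using z_trans[OF t PQ(2)] PQ(3) by blast
 have "Dl : A & Dl * c : A" if A: "pinf t A ph" for A ph
 proof
 have P: "place UNIV A ph" and u: "?u : A" using A unfolding pinf_def by auto
 note Asr = placeD(1)[OF P]
 show "Dl : A" unfolding Dl_def by (rule srgD(7)[OF Asr u])
 have "ph (unit_inf t Q) ~= 0" using pinf_unit(2)[OF t A PQ(2)] PQ(3) by simp
 hence "inverse (unit_inf t Q) : A" using placeD(10)[OF P] pinf_unit(1)[OF t A PQ(2)] by blast
 hence "unit_inf t P * (inverse (unit_inf t Q) * ?u ^ degree Q) : A"
 using srgD(4,7)[OF Asr] pinf_unit(1)[OF t A PQ(1)] u by blast
 moreover have "unit_inf t P * (inverse (unit_inf t Q) * ?u ^ degree Q) = Dl * c"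
 using z0 Qz by (simp add: unit_inf_def Dl_def PQ(4) field_simps)
 ultimately show "Dl * c : A" by simp
 qed
 moreover have "Dl : F0 - {0}" unfolding Dl_def
 using sfdD(2)[OF F0s(1) zF0[OF t]] srgD(7)[OF F0s(2)] z0 by simp
 ultimately show "EX Dl:F0 - {0}. ALL A ph. pinf t A ph --> Dl : A & Dl * c : A" by blast
 qed
qed simp

lemma common_delta:
 assumes C: "dclass PP RR" and I: "finite I"
 and ex: "!!i. i : I ==> EX Dl:RR. ALL A ph. PP A ph --> Dl : A & (ALL x:S i A ph. Dl * x : A)"
 shows "EX Dl:RR. ALL A ph. PP A ph --> Dl : A & (ALL i:I. ALL x:S i A ph. Dl * x : A)"
 using I ex
proof (induct I rule: finite_induct)
 case empty
 have "1 : RR" "!!A ph. PP A ph ==> 1 : A" using dclassD(3)[OF C] srgD(1)[OF dclassD(7)[OF C]] by auto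
 thus ?case by blast
next
 case (insert j I)
 have "EX Dl:RR. ALL A ph. PP A ph --> Dl : A & (ALL i:I. ALL x:S i A ph. Dl * x : A)"
 by (rule insert(3)) (simp add: insert(4))
 then obtain a where a: "a : RR" "ALL A ph. PP A ph --> a : A & (ALL i:I. ALL x:S i A ph. a * x : A)" by blast
 have "EX Dl:RR. ALL A ph. PP A ph --> Dl : A & (ALL x:S j A ph. Dl * x : A)" by (simp add: insert(4))
 then obtain b where b: "b : RR" "ALL A ph. PP A ph --> b : A & (ALL x:S j A ph. b * x : A)" by blast
 have "a * b : A & (ALL i:insert j I. ALL x:S i A ph. a * b * x : A)" if P: "PP A ph" for A ph
 proof
 note Asr = dclassD(7)[OF C P]
 have aA: "a : A" and bA: "b : A" using a(2) b(2) P by blast+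
 show "a * b : A" using srgD(4)[OF Asr aA bA] .
 show "ALL i:insert j I. ALL x:S i A ph. a * b * x : A"
 proof (intro ballI)
 fix i x assume "i : insert j I" and x: "x : S i A ph"
 then consider "i = j" | "i : I" by blast
 thus "a * b * x : A"
 proof cases
 case 1
 hence "b * x : A" using b(2) P x by blast
 thus ?thesis using srgD(4)[OF Asr aA] by (simp add: mult.assoc)
 next
 case 2
 hence "a * x : A" using a(2) P x by blast
 hence "b * (a * x) : A" using srgD(4)[OF Asr bA] by blast
 thus ?thesis by (simp add: mult_ac)
 qed
 qed
 qed
 thus ?case using dclassD(4)[OF C a(1) b(1)] by blast
qed

text \<open>If a clears the coefficients of a monic polynomial, then a times a root is integral over
  A and hence lies in A. The same a serves all roots, that is, all conjugates.\<close>

lemma alg_den: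
 assumes C: "dclass PP RR" and p: "p : PA F0" "lead_coeff p = 1"
 shows "EX Dl:RR. ALL A ph. PP A ph --> Dl : A & (ALL w. poly p w = 0 --> Dl * w : A)"
proof -
 have "EX Dl:RR. ALL A ph. PP A ph --> Dl : A & (ALL i:{..degree p}. ALL x:{cof p i}. Dl * x : A)"
 by (rule common_delta[OF C]) (use dclassD(6)[OF C PA_D[OF p(1)]] in auto)
 then obtain a where a: "a : RR" "ALL A ph. PP A ph --> a : A & (ALL i:{..degree p}. a * cof p i : A)" by auto
 let ?n = "degree p"
 have "a * w : A" if P: "PP A ph" and w: "poly p w = 0" for A ph w
 proof (rule place_integral[OF dclassD(1)[OF C P]])
 note Asr = dclassD(7)[OF C P]
 \<comment> \<open>The monic polynomial with the roots \<open>a * w\<close>: the coefficient of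
   index i is scaled by \<open>a ^ (?n - i)\<close>, and for i below \<open>?n\<close> this contains
   the factor that makes it integral.\<close>
 define q where "q = (SUM i<=?n. Polynomial.monom (a ^ (?n - i) * cof p i) i)"
 have cq: "cof q i = (if i <= ?n then a ^ (?n - i) * cof p i else 0)" for i
 by (auto simp: q_def coeff_sum coeff_monom)
 have dq: "degree q <= ?n" by (rule degree_le) (simp add: cq)
 moreover have "cof q ?n = 1" by (simp add: cq p(2))
 ultimately have dn: "degree q = ?n" using le_degree[of q ?n] by simp
 thus "lead_coeff q = 1" by (simp add: cq p(2))
 have "cof q i : A" for i
 proof (cases "i < ?n")
 case True
 define j where "j = ?n - Suc i"
 have "?n - i = Suc j" using True by (simp add: j_def)
 hence "a ^ (?n - i) * cof p i = a ^ j * (a * cof p i)" by (simp add: mult_ac)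
 moreover have "a : A" using a(2) P by blast
 hence "a ^ j : A" by (rule srgD(7)[OF Asr])
 moreover have "a * cof p i : A" using a(2) P True by auto
 ultimately have "a ^ (?n - i) * cof p i : A" by (simp only: srgD(4)[OF Asr])
 thus ?thesis using True by (simp add: cq)
 next
 case False
 thus ?thesis using srgD(1,2)[OF Asr] p(2) by (cases "i = ?n") (simp_all add: cq)
 qed
 thus "q : PA A" by (simp add: PA_def)
 have "poly q (a * w) = (SUM i<=?n. (a ^ (?n - i) * cof p i) * (a * w) ^ i)"
 by (simp add: q_def poly_sum poly_monom)
 also have "\<dots> = (SUM i<=?n. a ^ ?n * (cof p i * w ^ i))"
 proof (rule sum.cong[OF refl])
 fix i assume "i : {..?n}"
 hence "a ^ ?n = a ^ (?n - i) * a ^ i" by (simp flip: power_add)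
 thus "(a ^ (?n - i) * cof p i) * (a * w) ^ i = a ^ ?n * (cof p i * w ^ i)" by (simp add: power_mult_distrib mult_ac)
 qed
 also have "\<dots> = a ^ ?n * poly p w" by (simp add: poly_altdef sum_distrib_left)
 finally show "poly q (a * w) = 0" using w by simp
 qed
 thus ?thesis using a by blast
qed

section \<open>Sequences with one denominator for all members and all conjugates\<close>

definition bdd :: "('a set => ('a => 'a) => bool) => 'a set => ('n => 'a) => bool" where
 "bdd PP RR B \<longleftrightarrow> (ALL n. B n : L) & (EX Dl:RR. ALL A ph. PP A ph --> Dl : A & (ALL ta. emb ta --> (ALL n. Dl * ta (B n) : A)))"

lemma embD:
 assumes "emb ta"
 shows "x : L ==> w : L ==> ta (x + w) = ta x + ta w" "x : L ==> w : L ==> ta (x * w) = ta x * ta w" "x : F0 ==> ta x = x"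
 "phom L ta"
 using assms phomD(3,4) unfolding emb_def by blast+

lemma emb_poly: assumes e: "emb ta" and x: "x : L" and p: "p : PA F0" shows "ta (poly p x) = poly p (ta x)"
proof -
 have c: "cof p i : L" for i using PA_D[OF p] F0L by blast
 have "ta (poly p x) = (SUM i<=degree p. ta (cof p i * x ^ i))"
 unfolding poly_altdef by (rule phom_sum[OF embD(4)[OF e]]) (intro srgD(4)[OF Ls(2)] srgD(7)[OF Ls(2)] x c)
 also have "\<dots> = poly p (ta x)" unfolding poly_altdef
 by (intro sum.cong refl) (simp add: embD(2)[OF e c srgD(7)[OF Ls(2) x]] embD(3)[OF e PA_D[OF p]] phomD(8)[OF embD(4)[OF e] x])
 finally show ?thesis .
qed

lemma bdd_single: assumes C: "dclass PP RR" and x: "x : L" shows "bdd PP RR (%_. x)"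
proof -
 obtain p where "minp F0 x p" using algb_monic[OF F0s(1) L_algb[OF x]] by blast
 note p = minpD(1-3)[OF this]
 obtain a where a: "a : RR" "ALL A ph. PP A ph --> a : A & (ALL w. poly p w = 0 --> a * w : A)" using alg_den[OF C p(1,2)] by blast
 have "poly p (ta x) = 0" if "emb ta" for ta
 using emb_poly[OF that x p(1)] p(3) embD(3)[OF that srgD(2)[OF F0s(2)]] by simp
 thus ?thesis unfolding bdd_def using a x by blast
qed

lemma bdd_ops:
 assumes C: "dclass PP RR" and a: "bdd PP RR f" and b: "bdd PP RR g"
 shows "bdd PP RR (%n. f n + g n)" "bdd PP RR (%n. f n * g n)"
proof -
 obtain a where a': "a : RR" "ALL A ph. PP A ph --> a : A & (ALL ta. emb ta --> (ALL n. a * ta (f n) : A))" using a unfolding bdd_def by blast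
 obtain b where b': "b : RR" "ALL A ph. PP A ph --> b : A & (ALL ta. emb ta --> (ALL n. b * ta (g n) : A))" using b unfolding bdd_def by blast
 have fL: "f n : L" "g n : L" for n using a assms(3) unfolding bdd_def by auto
 have ab: "a * b : RR" using dclassD(4)[OF C a'(1) b'(1)] .
 have key: "a * b : A & (ALL ta. emb ta --> (ALL n. a * b * ta (f n + g n) : A)) & (ALL ta. emb ta --> (ALL n. a * b * ta (f n * g n) : A))" if P: "PP A ph" for A ph
 proof (intro conjI allI impI)
 note Asr = dclassD(7)[OF C P]
 have aA: "a : A" "b : A" using a'(2) b'(2) P by blast+
 show "a * b : A" using srgD(4)[OF Asr aA] .
 fix ta n assume e: "emb ta"
 have f: "a * ta (f n) : A" "b * ta (g n) : A" using a'(2) b'(2) P e by blast+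
 have "a * b * ta (f n + g n) = b * (a * ta (f n)) + a * (b * ta (g n))" using embD(1)[OF e fL] by (simp add: algebra_simps)
 thus "a * b * ta (f n + g n) : A" using srgD(3)[OF Asr srgD(4)[OF Asr aA(2) f(1)] srgD(4)[OF Asr aA(1) f(2)]] by simp
 have "a * b * ta (f n * g n) = (a * ta (f n)) * (b * ta (g n))" using embD(2)[OF e fL] by (simp add: algebra_simps)
 thus "a * b * ta (f n * g n) : A" using srgD(4)[OF Asr f] by (simp only:)
 qed
 have "f n + g n : L" "f n * g n : L" for n using srgD(3,4)[OF Ls(2) fL] by auto
 thus "bdd PP RR (%n. f n + g n)" "bdd PP RR (%n. f n * g n)"
 unfolding bdd_def by (intro conjI allI bexI[OF _ ab] impI; use key in simp)+
qed

text \<open>The degree s is fixed while the coefficients vary with n. One denominator for the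
  coefficients therefore works for all solutions, by the scaling used in
  \<open>alg_den\<close>.\<close>

lemma bdd_integral:
 assumes C: "dclass PP RR" and c: "!!i. i < s ==> bdd PP RR (c i)" and x: "!!n. x n : L"
 and e: "!!n. x n ^ s + (SUM i<s. c i n * x n ^ i) = 0"
 shows "bdd PP RR x"
proof -
 have "EX Dl:RR. ALL A ph. PP A ph --> Dl : A & (ALL i:{..<s}. ALL w:{ta (c i n) |ta n. emb ta}. Dl * w : A)"
 by (rule common_delta[OF C]) (use c in \<open>fastforce simp: bdd_def\<close>)+
 then obtain a where a: "a : RR" "ALL A ph. PP A ph --> a : A & (ALL i:{..<s}. ALL w:{ta (c i n) |ta n. emb ta}. a * w : A)" by blast
 have cL: "c i n : L" if "i < s" for i n using c[OF that] unfolding bdd_def by blast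
 have "a * ta (x n) : A" if P: "PP A ph" and em: "emb ta" for A ph ta n
 proof (rule place_integral[OF dclassD(1)[OF C P]])
 note Asr = dclassD(7)[OF C P]
 define q where "q = Polynomial.monom 1 s + (SUM i<s. Polynomial.monom (a ^ (s - i) * ta (c i n)) i)"
 have cq: "cof q i = (if i = s then 1 else if i < s then a ^ (s - i) * ta (c i n) else 0)" for i
 by (auto simp: q_def coeff_sum coeff_monom)
 have "degree q <= s" by (rule degree_le) (simp add: cq)
 moreover have "cof q s = 1" by (simp add: cq)
 ultimately have "degree q = s" using le_degree[of q s] by simp
 thus "lead_coeff q = 1" by (simp add: cq)
 have "cof q i : A" for i
 proof (cases "i < s")
 case True
 define j where "j = s - Suc i"
 have "s - i = Suc j" using True by (simp add: j_def)
 hence "a ^ (s - i) * ta (c i n) = a ^ j * (a * ta (c i n))" by (simp add: mult_ac)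
 moreover have "a : A" using a(2) P by blast
 hence "a ^ j : A" by (rule srgD(7)[OF Asr])
 moreover have "a * ta (c i n) : A" using a(2) P True em by blast
 ultimately have "a ^ (s - i) * ta (c i n) : A" by (simp only: srgD(4)[OF Asr])
 thus ?thesis using True by (simp add: cq)
 next
 case False
 thus ?thesis using srgD(1,2)[OF Asr] by (simp add: cq)
 qed
 thus "q : PA A" by (simp add: PA_def)
 have t0: "ta 0 = 0" using phomD(5)[OF embD(4)[OF em]] .
 have pw: "x n ^ i : L" for i using srgD(7)[OF Ls(2) x] .
 have sm: "(SUM i<s. c i n * x n ^ i) : L" by (intro srg_sum[OF Ls(2)] srgD(4)[OF Ls(2)] cL pw) auto
 have "0 = ta (x n ^ s + (SUM i<s. c i n * x n ^ i))" using e[of n] t0 by simp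
 also have "\<dots> = ta (x n ^ s) + (SUM i<s. ta (c i n * x n ^ i))"
 using embD(1)[OF em pw sm] phom_sum[OF embD(4)[OF em], of "{..<s}" "%i. c i n * x n ^ i"] srgD(4)[OF Ls(2) cL pw] by simp
 also have "\<dots> = ta (x n) ^ s + (SUM i<s. ta (c i n) * ta (x n) ^ i)"
 using embD(2)[OF em cL pw] phomD(8)[OF embD(4)[OF em] x] by simp
 finally have z: "ta (x n) ^ s + (SUM i<s. ta (c i n) * ta (x n) ^ i) = 0" by simp
 have "poly q (a * ta (x n)) = (a * ta (x n)) ^ s + (SUM i<s. (a ^ (s - i) * ta (c i n)) * (a * ta (x n)) ^ i)"
 by (simp add: q_def poly_sum poly_monom)
 also have "(SUM i<s. (a ^ (s - i) * ta (c i n)) * (a * ta (x n)) ^ i) = (SUM i<s. a ^ s * (ta (c i n) * ta (x n) ^ i))"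
 proof (rule sum.cong[OF refl])
 fix i assume "i : {..<s}"
 hence "a ^ s = a ^ (s - i) * a ^ i" by (simp flip: power_add)
 thus "(a ^ (s - i) * ta (c i n)) * (a * ta (x n)) ^ i = a ^ s * (ta (c i n) * ta (x n) ^ i)" by (simp add: power_mult_distrib mult_ac)
 qed
 also have "(a * ta (x n)) ^ s + (SUM i<s. a ^ s * (ta (c i n) * ta (x n) ^ i)) = a ^ s * (ta (x n) ^ s + (SUM i<s. ta (c i n) * ta (x n) ^ i))"
 by (simp add: power_mult_distrib sum_distrib_left distrib_left)
 finally show "poly q (a * ta (x n)) = 0" using z by simp
 qed
 thus ?thesis unfolding bdd_def using a x by blast
qed

end

section \<open>Algebraically closed subfields and iterated derivations\<close>

lemma PA_root_quot:
 fixes p :: "'a::field poly"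
 assumes S: "srg S" and p: "p : PA S" "p ~= 0" and a: "a : S" "poly p a = 0"
 shows "EX q:PA S. p = [:- a, 1:] * q & degree p = Suc (degree q)"
proof -
 have m: "[:- a, 1:] : PA S" using PA_pCons[OF S] PA_0[OF S] srgD(1)[OF S] srgD(5)[OF S a(1)] by simp
 obtain n Q R where QR: "Q : PA S" "R : PA S" "smult (lead_coeff [:- a, 1:] ^ n) p = Q * [:- a, 1:] + R" "R = 0 \<or> degree R < degree [:- a, 1:]"
 using pseudo_division[OF S m p(1)] by auto
 have e: "p = Q * [:- a, 1:] + R" using QR(3) by simp
 hence "poly p a = poly Q a * poly [:- a, 1:] a + poly R a" by (simp only: poly_add poly_mult)
 hence "poly R a = 0" using a(2) by simp
 moreover have "degree R = 0" using QR(4) by auto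
 then obtain c where "R = [:c:]" by (metis degree_eq_zeroE)
 ultimately have "R = 0" by simp
 hence e: "p = [:- a, 1:] * Q" using e by (simp only: add_0_right mult.commute)
 hence "Q ~= 0" using p(2) by auto
 hence "degree p = Suc (degree Q)" unfolding e by (subst degree_mult_eq) auto
 thus ?thesis using e QR(1) by blast
qed

lemma acl_algb:
 fixes K :: "'a::field set"
 assumes K: "acl K" and x: "algb K x" shows "x : K"
proof -
 have Ks: "srg K" using K by (simp add: acl_def sfd_def)
 have "ALL p:PA K. p ~= 0 --> poly p x = 0 --> degree p = n --> x : K" for n
 proof (induct n)
 case 0
 show ?case
 proof (intro ballI impI)
 fix p assume "p ~= 0" "poly p x = 0" "degree p = 0"
 then obtain c where "p = [:c:]" by (metis degree_eq_zeroE)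
 thus "x : K" using \<open>p ~= 0\<close> \<open>poly p x = 0\<close> by simp
 qed
 next
 case (Suc n)
 show ?case
 proof (intro ballI impI)
 fix p assume p: "p : PA K" "p ~= 0" "poly p x = 0" "degree p = Suc n"
 then obtain a where a: "a : K" "poly p a = 0" using K by (auto simp: acl_def)
 obtain q where q: "q : PA K" "p = [:- a, 1:] * q" "degree p = Suc (degree q)" using PA_root_quot[OF Ks p(1,2) a] by blast
 have "poly [:- a, 1:] x * poly q x = 0" using p(3) q(2) by (simp only: poly_mult)
 hence "x = a \<or> poly q x = 0" by auto
 moreover have "q ~= 0" using q(2) p(2) by auto
 ultimately show "x : K" using Suc q p(4) a(1) by auto
 qed
 qed
 thus ?thesis using x unfolding algb_def by blast
qed

lemma chom_inj: assumes "chom h" shows "h a = h b \<longleftrightarrow> a = (b :: complex)"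
proof
 assume e: "h a = h b"
 have "h (a - b) = h a - h b" by (rule phomD(7)[OF assms]) auto
 hence z: "h (a - b) = 0" using e by simp
 show "a = b"
 proof (rule ccontr)
 assume "a ~= b"
 hence "h ((a - b) * inverse (a - b)) = 1" using phomD(2)[OF assms] by simp
 thus False using phomD(4)[OF assms, of "a - b" "inverse (a - b)"] z by simp
 qed
qed simp

lemma acl_image:
 fixes h :: "complex => 'a::field"
 assumes h: "chom h" and K: "acl K" shows "acl (h ` K)"
proof -
 have Ks: "sfd K" "srg K" using K by (auto simp: acl_def sfd_def)
 have h0: "h 0 = 0" using phomD(5)[OF h] .
 have ops: "h (a + b) = h a + h b" "h (a * b) = h a * h b" "h 1 = 1" "h (- a) = - h a" for a b
 using phomD(2,3,4,6)[OF h] by auto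
 have inv: "h (inverse a) = inverse (h a)" for a
 proof (cases "a = 0")
 case False
 hence "h a * h (inverse a) = 1" using ops(2)[of a "inverse a"] ops(3) by simp
 thus ?thesis by (metis inverse_unique)
 qed (simp add: h0)
 have "1 : h ` K" using srgD(1)[OF Ks(2)] ops(3) by (metis imageI)
 moreover have "x + y : h ` K & x * y : h ` K & - x : h ` K & inverse x : h ` K" if "x : h ` K" "y : h ` K" for x y
 proof -
 from that obtain a b where ab: "x = h a" "y = h b" "a : K" "b : K" by blast
 thus ?thesis using srgD(3,4)[OF Ks(2) ab(3,4)] srgD(5)[OF Ks(2) ab(3)] sfdD(2)[OF Ks(1) ab(3)]
 ops(1,2,4)[symmetric] inv[symmetric] by simp
 qed
 ultimately have S: "sfd (h ` K)" unfolding sfd_def srg_def by (intro conjI ballI) blast+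
 show ?thesis unfolding acl_def
 proof (intro conjI ballI impI S)
 fix p assume p: "p : PA (h ` K)" "0 < degree p"
 define q where "q = map_poly (inv_into K h) p"
 have "inj_on h K" using chom_inj[OF h] by (simp add: inj_on_def)
 hence i0: "inv_into K h 0 = 0" using inv_into_f_f[of h K 0] h0 srgD(2)[OF Ks(2)] by simp
 have cq: "cof q i : K & h (cof q i) = cof p i" for i
 using inv_into_into[OF PA_D[OF p(1), of i]] f_inv_into_f[OF PA_D[OF p(1), of i]] by (simp add: q_def coeff_map_poly i0)
 have "cof q (degree p) ~= 0" 
 proof
 assume "cof q (degree p) = 0"
 hence "lead_coeff p = 0" using cq[of "degree p"] h0 by simp
 thus False using p(2) by auto
 qed
 hence "degree p <= degree q" by (rule le_degree)
 hence "degree q > 0" using p(2) by linarith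
 moreover have "q : PA K" using cq by (simp add: PA_def)
 ultimately obtain x where x: "x : K" "poly q x = 0" using K by (auto simp: acl_def)
 have hs: "h (sum f I) = (SUM i:I. h (f i))" for f :: "nat => complex" and I by (rule phom_sum[OF h]) simp
 have hp: "h (a ^ n) = h a ^ n" for a n using phomD(8)[OF h] by blast
 have "cof q i = 0" if "i > degree p" for i using cq[of i] chom_inj[OF h, of "cof q i" 0] h0 coeff_eq_0[OF that] by simp
 hence "degree q <= degree p" by (intro degree_le) blast
 hence "h (poly q x) = poly p (h x)"
 by (simp add: poly_sum_le[of q "degree p"] poly_altdef[of p] hs ops(2) hp cq)
 hence "poly p (h x) = 0" using x(2) h0 by simp
 thus "EX x:h ` K. poly p x = 0" using x(1) by blast
 qed
qed

lemma place_poly: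
 assumes P: "place K A ph" and S: "!!s. s : S ==> s : A & ph s = s" and p: "p : PA S" and x: "x : A"
 shows "poly p x : A" "ph (poly p x) = poly p (ph x)"
proof -
 note Asr = placeD(1)[OF P]
 have m: "cof p i * x ^ i : A" for i using S[OF PA_D[OF p]] srgD(4)[OF Asr] srgD(7)[OF Asr x] by blast
 show "poly p x : A" unfolding poly_altdef by (rule srg_sum[OF Asr m])
 have "ph (poly p x) = (SUM i<=degree p. ph (cof p i * x ^ i))" unfolding poly_altdef by (rule place_sum[OF P m])
 also have "\<dots> = poly p (ph x)" unfolding poly_altdef
 proof (rule sum.cong[OF refl])
 fix i
 have "ph (cof p i * x ^ i) = ph (cof p i) * ph (x ^ i)" using placeD(4)[OF P] S[OF PA_D[OF p]] srgD(7)[OF Asr x] by blast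
 thus "ph (cof p i * x ^ i) = cof p i * ph x ^ i" using S[OF PA_D[OF p]] place_power[OF P x] by simp
 qed
 finally show "ph (poly p x) = poly p (ph x)" .
qed

lemma der_funpow_const:
 assumes "der D" "D a = 0" shows "(D ^^ j) (a * w) = a * (D ^^ j) w"
 by (induct j) (simp_all add: derD(2)[OF assms(1)] assms(2))

lemma der_funpow_add: assumes "der D" shows "(D ^^ j) (a + b) = (D ^^ j) a + (D ^^ j) b"
 by (induct j) (simp_all add: derD(1)[OF assms])

lemma der_of_nat: "der D ==> D (of_nat n) = 0"
 by (induct n) (simp_all add: derD)

lemma der_power_fact:
 assumes D: "der D" and z: "D z = 1" shows "(D ^^ n) (z ^ n) = of_nat (fact n)"
proof (induct n)
 case (Suc n)
 have "(D ^^ Suc n) (z ^ Suc n) = (D ^^ n) (D (z ^ Suc n))" by (simp only: funpow_Suc_right o_apply)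
 also have "D (z ^ Suc n) = of_nat (Suc n) * z ^ n" using der_power[OF D, of z "Suc n"] z by simp
 also have "(D ^^ n) (of_nat (Suc n) * z ^ n) = of_nat (Suc n) * of_nat (fact n)"
 unfolding der_funpow_const[OF D der_of_nat[OF D]] Suc ..
 also have "\<dots> = of_nat (fact (Suc n))" by (simp only: fact_Suc of_nat_mult of_nat_id)
 finally show ?case .
qed simp

section \<open>Bounded degree expressed by nilpotent derivations\<close>

context tbasis
begin

lemma hk_acl: "acl (h ` ka)" by (rule acl_image[OF ch acl])

lemma D_F0: assumes t: "t : T" and x: "x : F0" shows "D t x : F0"
proof -
 let ?S = "{x : F0. D t x : F0}"
 note d = derD[OF derT[OF t]]
 have "sfd ?S" unfolding sfd_def srg_def
 proof (intro conjI ballI)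
 show "1 : ?S" using srgD(1,2)[OF F0s(2)] d(4) by simp
 fix a b assume a: "a : ?S" and b: "b : ?S"
 show "a + b : ?S" "a * b : ?S" using a b srgD(3,4)[OF F0s(2)] d(1,2) by simp_all
 next
 fix a assume a: "a : ?S"
 show "- a : ?S" using a srgD(5)[OF F0s(2)] d(5) by simp
 have "- D t a / a\<^sup>2 : F0" using a sfdD(3)[OF F0s(1)] srgD(5,7)[OF F0s(2)] by blast
 thus "inverse a : ?S" using a sfdD(2)[OF F0s(1)] der_inverse[OF derT[OF t]] by simp
 qed
 moreover have "h ` ka Un z ` T <= ?S"
 using hF0 zF0 Dk[OF t] Dz[OF t] srgD(1,2)[OF F0s(2)] by auto
 ultimately have "F0 <= ?S" by (rule sfg_least)
 thus ?thesis using x by blast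
qed

lemma D_comm: assumes "t : T" "s : T" "x : F0" shows "D t (D s x) = D s (D t x)"
proof -
 have "D t (D s x) - D s (D t x) = 0"
 proof (rule der_zero_sfg[OF der_bracket[OF derT[OF assms(1)] derT[OF assms(2)]] _ assms(3)])
 fix u assume "u : h ` ka Un z ` T"
 thus "D t (D s u) - D s (D t u) = 0"
 using Dk[OF assms(1)] Dk[OF assms(2)] Dz[OF assms(1)] Dz[OF assms(2)] derD(3,4)[OF derT[OF assms(1)]] derD(3,4)[OF derT[OF assms(2)]]
 by auto
 qed
 thus ?thesis by simp
qed

lemma Dn_F0: "t : T ==> x : F0 ==> (D t ^^ i) x : F0" by (induct i) (simp_all add: D_F0)

lemma Dn_comm1: "t : T ==> s : T ==> x : F0 ==> D t ((D s ^^ i) x) = (D s ^^ i) (D t x)"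
 by (induct i) (simp_all add: D_comm Dn_F0)

lemma Dn_comm: "t : T ==> s : T ==> x : F0 ==> (D t ^^ j) ((D s ^^ i) x) = (D s ^^ i) ((D t ^^ j) x)"
 by (induct j) (simp_all add: Dn_comm1 Dn_F0)

text \<open>The chain rule. The difference of the two sides is a derivation that kills the
  generators of \<open>F0\<close>, hence also every element algebraic over
  \<open>F0\<close>.\<close>

lemma der_expand:
 assumes dl: "der dl" "ALL c:ka. dl (h c) = 0" and x: "x : L"
 shows "dl x = (SUM t:T. dl (z t) * D t x)"
proof -
 let ?ep = "%x. 1 * dl x + (- 1) * (SUM t:T. dl (z t) * D t x)"
 have d: "der ?ep" by (rule der_comb[OF dl(1) der_lincomb[OF finT derT]])
 have F: "?ep u = 0" if u: "u : F0" for u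
 proof (rule der_zero_sfg[OF d _ u])
 fix s assume "s : h ` ka Un z ` T"
 then consider c where "c : ka" "s = h c" | v where "v : T" "s = z v" by blast
 thus "?ep s = 0"
 proof cases
 case 1
 thus ?thesis using dl(2) Dk by simp
 next
 case 2
 have "(SUM t:T. dl (z t) * D t (z v)) = (SUM t:T. if t = v then dl (z t) else 0)" by (rule sum.cong) (use Dz 2 in auto)
 thus ?thesis using 2 finT by simp
 qed
 qed
 have "?ep x = 0" by (rule der_algb_zero[OF F0s(2) d F L_algb[OF x]])
 thus ?thesis by simp
qed

lemma const_F0: assumes x: "x : L" and z: "ALL t:T. D t x = 0" shows "x : h ` ka"
proof (rule acl_algb[OF hk_acl])
 have "srg (h ` ka)" using hk_acl by (simp add: acl_def sfd_def)
 thus "algb (h ` ka) x" using der_expand[OF _ _ x] z by (subst algb_iff_der) auto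
qed

text \<open>The elements in question are polynomials in the variables with degree below
  \<open>e t\<close> in \<open>z t\<close>, but they are never expanded. Subtracting the top Taylor
  term at one variable \<open>t0\<close> lowers the exponent there, and the coefficient of that term
  is constant in \<open>t0\<close>, so the induction on the sum of the exponents covers both
  pieces.\<close>

lemma nilp_span:
 "EX XX. finite XX & (ALL x:F0. (ALL t:T. (D t ^^ e t) x = 0) --> x : lspan (h ` ka) XX)"
proof (induct "SUM t:T. e t" arbitrary: e rule: less_induct)
 case less
 have ks: "srg (h ` ka)" using hk_acl by (simp add: acl_def sfd_def)
 show ?case
 proof (cases "EX t:T. e t > 1")
 case False
 have "x : lspan (h ` ka) {1}" if x: "x : F0" "ALL t:T. (D t ^^ e t) x = 0" for x
 proof -
 have "D t x = 0" if t: "t : T" for t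
 proof -
 consider "e t = 0" | "e t = 1" using False t by (metis less_one linorder_neqE_nat)
 thus ?thesis using x(2) t derD(3)[OF derT[OF t]] by cases force+
 qed
 hence "x : h ` ka" using const_F0 F0L x(1) by blast
 hence "x * 1 : lspan (h ` ka) {1}" by (intro lspan_scale[OF ks] lspan_self[OF ks]) auto
 thus ?thesis by simp
 qed
 thus ?thesis by (intro exI[of _ "{1}"]) simp
 next
 case True
 then obtain t0 where t0: "t0 : T" "e t0 > 1" by blast
 define n where "n = e t0 - 1"
 have n: "e t0 = Suc n" "n >= 1" using t0(2) by (auto simp: n_def)
 have "(SUM t:T. (e(t0 := n)) t) < (SUM t:T. e t)" "(SUM t:T. (e(t0 := 1)) t) < (SUM t:T. e t)"
 by (rule sum_strict_mono_ex1[OF finT]; use n t0 in auto)+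
 note less[OF this(1)] less[OF this(2)]
 then obtain X1 X2 where X1: "finite X1" "ALL x:F0. (ALL t:T. (D t ^^ (e(t0 := n)) t) x = 0) --> x : lspan (h ` ka) X1"
 and X2: "finite X2" "ALL x:F0. (ALL t:T. (D t ^^ (e(t0 := 1)) t) x = 0) --> x : lspan (h ` ka) X2" by blast
 let ?XX = "X1 Un (%w. z t0 ^ n * w) ` X2"
 have fin: "finite ?XX" using X1(1) X2(1) by blast
 have sub: "lspan (h ` ka) X1 <= lspan (h ` ka) ?XX" 
 by (rule lspan_trans[OF ks fin]) (use lspan_self[OF ks fin] in blast)
 have "x : lspan (h ` ka) ?XX" if x: "x : F0" "ALL t:T. (D t ^^ e t) x = 0" for x
 proof -
 \<comment> \<open>The Taylor coefficient of \<open>z t0 ^ n\<close>; it is killed by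
   \<open>D t0\<close> because \<open>e t0 = Suc n\<close>.\<close>
 define a where "a = inverse (of_nat (fact n)) * (D t0 ^^ n) x"
 note d0 = derT[OF t0(1)]
 have f0: "of_nat (fact n) : F0" by (rule srg_of_nat[OF F0s(2)])
 have fi: "D t (inverse (of_nat (fact n))) = 0" if "t : T" for t
 unfolding der_inverse[OF derT[OF that]] der_of_nat[OF derT[OF that]] by simp
 have aF: "a : F0" unfolding a_def by (rule srgD(4)[OF F0s(2) sfdD(2)[OF F0s(1) f0] Dn_F0[OF t0(1) x(1)]])
 have Da: "D t0 a = 0"
 proof -
 have "D t0 a = inverse (of_nat (fact n)) * (D t0 ^^ Suc n) x" unfolding a_def derD(2)[OF d0] fi[OF t0(1)] by simp
 also have "(D t0 ^^ Suc n) x = 0" using x(2) t0(1) n(1) by metis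
 finally show ?thesis by simp
 qed
 have Ds: "(D s ^^ e s) a = 0" if s: "s : T" "s ~= t0" for s
 proof -
 have "(D s ^^ e s) a = inverse (of_nat (fact n)) * (D s ^^ e s) ((D t0 ^^ n) x)" unfolding a_def
 by (rule der_funpow_const[OF derT[OF s(1)] fi[OF s(1)]])
 also have "(D s ^^ e s) ((D t0 ^^ n) x) = (D t0 ^^ n) ((D s ^^ e s) x)" by (rule Dn_comm[OF s(1) t0(1) x(1)])
 also have "(D s ^^ e s) x = 0" using x(2) s(1) by blast
 also have "(D t0 ^^ n) 0 = 0" using der_funpow_const[OF d0 derD(3)[OF d0], of n 0] by simp
 finally show ?thesis by simp
 qed
 have "(D t ^^ (e(t0 := 1)) t) a = 0" if "t : T" for t using that Da Ds by (cases "t = t0") auto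
 hence a2: "a : lspan (h ` ka) X2" using X2(2) aF by blast
 define x' where "x' = x + (- (z t0 ^ n * a))"
 have zF: "z t0 ^ n : F0" by (rule srgD(7)[OF F0s(2) zF0[OF t0(1)]])
 have x'F: "x' : F0" unfolding x'_def by (rule srgD(3)[OF F0s(2) x(1) srgD(5)[OF F0s(2) srgD(4)[OF F0s(2) zF aF]]])
 have "(D t0 ^^ n) x' = 0"
 proof -
 have Dma: "D t0 (- a) = 0" using derD(5)[OF d0, of a] Da by simp
 have "x' = x + ((- a) * z t0 ^ n)" by (simp add: x'_def mult.commute)
 hence "(D t0 ^^ n) x' = (D t0 ^^ n) x + (- a) * (D t0 ^^ n) (z t0 ^ n)"
 using der_funpow_add[OF d0, of n x "(- a) * z t0 ^ n"] der_funpow_const[OF d0 Dma, of n "z t0 ^ n"] by (simp only:)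
 also have "(D t0 ^^ n) (z t0 ^ n) = of_nat (fact n)" by (rule der_power_fact[OF d0]) (simp add: Dz t0(1))
 finally show ?thesis by (simp add: a_def)
 qed
 moreover have "(D s ^^ e s) x' = 0" if s: "s : T" "s ~= t0" for s
 proof -
 have z0: "D s (- (z t0 ^ n)) = 0" using derD(5)[OF derT[OF s(1)], of "z t0 ^ n"] der_power[OF derT[OF s(1)], of "z t0" n] Dz[OF s(1) t0(1)] s(2) by simp
 have "x' = x + ((- (z t0 ^ n)) * a)" by (simp add: x'_def)
 hence "(D s ^^ e s) x' = (D s ^^ e s) x + (- (z t0 ^ n)) * (D s ^^ e s) a"
 using der_funpow_add[OF derT[OF s(1)], of "e s" x "(- (z t0 ^ n)) * a"] der_funpow_const[OF derT[OF s(1)] z0, of "e s" a] by (simp only:)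
 thus ?thesis using Ds[OF s] x(2) s(1) by simp
 qed
 ultimately have "(D t ^^ (e(t0 := n)) t) x' = 0" if "t : T" for t using that by (cases "t = t0") auto
 hence "x' : lspan (h ` ka) X1" using X1(2) x'F by blast
 hence 1: "x' : lspan (h ` ka) ?XX" using sub by blast
 obtain c where c: "ALL b:X2. c b : h ` ka" "a = (SUM b:X2. c b * b)" using a2 unfolding lspan_def by blast
 have "z t0 ^ n * a = (SUM b:X2. c b * (z t0 ^ n * b))" by (simp add: c(2) sum_distrib_left mult_ac)
 also have "\<dots> : lspan (h ` ka) ?XX"
 by (rule lspan_sum[OF ks], rule lspan_scale[OF ks]) (use c(1) lspan_self[OF ks fin] in auto)
 finally have "x' + z t0 ^ n * a : lspan (h ` ka) ?XX" using lspan_add[OF ks 1] by blast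
 thus ?thesis by (simp add: x'_def)
 qed
 thus ?thesis using fin by blast
 qed
qed

lemma poly_nilp:
 assumes t: "t : T" and P: "P : PA (E t)" "degree P <= N"
 shows "(D t ^^ Suc N) (poly P (z t)) = 0"
proof -
 note S = sfdD(1)[OF sfd_E[OF t]]
 have 1: "(pderiv ^^ i) P : PA (E t) & (D t ^^ i) (poly P (z t)) = poly ((pderiv ^^ i) P) (z t)" for i
 proof (induct i)
 case (Suc i)
 have "D t (poly ((pderiv ^^ i) P) (z t)) = poly (pderiv ((pderiv ^^ i) P)) (z t) * D t (z t)"
 by (rule der_poly_const[OF derT[OF t], of "E t"]) (use Suc in \<open>auto simp: E_def\<close>)
 thus ?case using Suc PA_pderiv[OF S] Dz[OF t t] by simp
 qed (use P(1) in simp)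
 have "degree ((pderiv ^^ i) P) <= N - i" for i
 by (induct i) (use P(2) in \<open>auto simp: degree_pderiv\<close>)
 hence "degree ((pderiv ^^ N) P) = 0" by (metis diff_self_eq_0 le_zero_eq)
 hence "(pderiv ^^ Suc N) P = 0" by (simp add: pderiv_eq_0_iff)
 thus ?thesis using 1[of "Suc N"] by simp
qed

text \<open>A root a of the denominator gives a finite place with z equal to a. Finiteness of c
  there forces the numerator to vanish at a as well, and cancelling the common factor lowers the
  degree of the denominator.\<close>

lemma fin_poly:
 assumes t: "t : T" and c: "c : F0" and A: "ALL A ph. pfin t A ph --> c : A"
 shows "EX P:PA (E t). c = poly P (z t)"
proof -
 note S = sfdD(1)[OF sfd_E[OF t]]
 let ?G = "EX P:PA (E t). c = poly P (z t)"
 have "ALL P:PA (E t). ALL Q:PA (E t). Q ~= 0 --> degree Q = n --> c = poly P (z t) / poly Q (z t) --> ?G" for n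
 proof (induct n)
 case 0
 show ?case
 proof (intro ballI impI)
 fix P Q assume PQ: "P : PA (E t)" "Q : PA (E t)" "Q ~= 0" "degree Q = 0" "c = poly P (z t) / poly Q (z t)"
 then obtain b where b: "Q = [:b:]" by (metis degree_eq_zeroE)
 hence "b : E t" using PA_D[OF PQ(2), of 0] by simp
 hence "smult (inverse b) P : PA (E t)" using PA_ops(5)[OF S sfdD(2)[OF sfd_E[OF t]] PQ(1)] by blast
 moreover have "c = poly (smult (inverse b) P) (z t)" using PQ(5) b by (simp add: field_simps)
 ultimately show ?G by blast
 qed
 next
 case (Suc n)
 show ?case
 proof (intro ballI impI)
 fix P Q assume PQ: "P : PA (E t)" "Q : PA (E t)" "Q ~= 0" "degree Q = Suc n" "c = poly P (z t) / poly Q (z t)"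
 show ?G
 proof (cases "P = 0")
 case True
 hence "c = poly 0 (z t)" using PQ(5) by simp
 thus ?G using PA_0[OF S] by blast
 next
 case False
 obtain a where a: "a : E t" "poly Q a = 0" using E_acl[OF t] PQ(2,4) by (auto simp: acl_def)
 obtain A' ph where p: "pfin t A' ph" "ph (z t) = a" using pfin_ex[OF t, of a] by blast
 have pl: "place UNIV A' ph" "!!s. s : E t ==> s : A' & ph s = s" "z t : A'" using p(1) unfolding pfin_def by auto
 have cA: "c : A'" using A p(1) by blast
 have zQ: "poly Q (z t) ~= 0" using z_trans[OF t PQ(2)] PQ(3) by blast
 have "poly P (z t) = c * poly Q (z t)" using PQ(5) zQ by simp
 hence "ph (poly P (z t)) = ph c * ph (poly Q (z t))"
 using placeD(4)[OF pl(1) cA place_poly(1)[OF pl(1,2) PQ(2) pl(3)]] by simp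
 hence "poly P a = 0" using place_poly(2)[OF pl(1,2) PQ(2) pl(3)] place_poly(2)[OF pl(1,2) PQ(1) pl(3)] p(2) a(2) by simp
 then obtain P' where P': "P' : PA (E t)" "P = [:- a, 1:] * P'" using PA_root_quot[OF S PQ(1) False a(1)] by blast
 obtain Q' where Q': "Q' : PA (E t)" "Q = [:- a, 1:] * Q'" "degree Q = Suc (degree Q')" using PA_root_quot[OF S PQ(2,3) a] by blast
 have "poly [:- a, 1:] (z t) ~= 0" using zQ Q'(2) by auto
 hence "c = poly P' (z t) / poly Q' (z t)" unfolding PQ(5) P'(2) Q'(2) poly_mult by simp
 moreover have "Q' ~= 0" using Q'(2) PQ(3) by auto
 moreover have "degree Q' = n" using Q'(3) PQ(4) by simp
 ultimately show ?G using Suc P'(1) Q'(1) by blast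
 qed
 qed
 qed
 thus ?thesis using F0_frac[OF t c] by blast
qed

text \<open>At a place at infinity the degree of a polynomial measures its pole, and the fixed
  factor Dl can absorb at most the degree of its own denominator Q. A single place is enough to see
  this.\<close>

lemma inf_deg:
 assumes t: "t : T" and Dl: "Dl : F0" "Dl ~= 0"
 shows "EX N. ALL P:PA (E t). (ALL A ph. pinf t A ph --> Dl * poly P (z t) : A) --> degree P <= N"
proof -
 note S = sfdD(1)[OF sfd_E[OF t]]
 obtain P1 Q where PQ: "P1 : PA (E t)" "Q : PA (E t)" "Q ~= 0" "Dl = poly P1 (z t) / poly Q (z t)" using F0_frac[OF t Dl(1)] by blast
 have P1: "P1 ~= 0" using PQ(4) Dl(2) by auto
 obtain A ph where A: "pinf t A ph" using pinf_ex[OF t] by blast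
 let ?u = "inverse (z t)"
 have P: "place UNIV A ph" and u: "?u : A" "ph ?u = 0" using A unfolding pinf_def by auto
 note Asr = placeD(1)[OF P]
 have "degree R <= degree Q" if R: "R : PA (E t)" "Dl * poly R (z t) : A" for R
 proof (rule ccontr)
 assume "\<not> degree R <= degree Q"
 hence dR: "degree R > degree Q" by simp
 hence R0: "R ~= 0" by auto
 define H where "H = P1 * R"
 have H: "H : PA (E t)" "H ~= 0" using PA_ops(4)[OF S PQ(1) R(1)] P1 R0 by (auto simp: H_def)
 have dH: "degree H > degree Q" using dR P1 R0 by (simp add: H_def degree_mult_eq)
 have zQ: "poly Q (z t) ~= 0" "poly H (z t) ~= 0" using z_trans[OF t PQ(2)] PQ(3) z_trans[OF t H(1)] H(2) by blast+
 define j where "j = degree H - Suc (degree Q)"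
 have dj: "degree H = degree Q + Suc j" using dH by (simp add: j_def)
 have "ph (unit_inf t H) ~= 0" using pinf_unit(2)[OF t A H(1)] H(2) by simp
 hence iH: "inverse (unit_inf t H) : A" using placeD(10)[OF P] pinf_unit(1)[OF t A H(1)] by blast
 define w where "w = unit_inf t Q * inverse (unit_inf t H) * ?u ^ j"
 have w: "w : A" unfolding w_def using srgD(4)[OF Asr srgD(4)[OF Asr pinf_unit(1)[OF t A PQ(2)] iH] srgD(7)[OF Asr u(1)]] .
 have z0: "z t ~= 0" using z_nonzero[OF t] .
 have "Dl * poly R (z t) = poly H (z t) / poly Q (z t)" by (simp add: PQ(4) H_def)
 moreover have "w * ?u = poly Q (z t) / poly H (z t)"
 unfolding w_def unit_inf_def dj using z0 zQ by (simp add: field_simps power_add)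
 ultimately have "Dl * poly R (z t) * (w * ?u) = 1" using zQ by simp
 moreover have "ph (w * ?u) = 0" using placeD(4)[OF P w u(1)] u(2) by simp
 ultimately have "ph 1 = 0" using placeD(4)[OF P R(2) srgD(4)[OF Asr w u(1)]] by simp
 thus False using placeD(2)[OF P] by simp
 qed
 thus ?thesis using A by blast
qed

section \<open>Conjugates and coordinates in powers of the primitive element\<close>

definition rts where "rts = {r. poly m r = 0}"

lemma rts: "finite rts" "card rts = degree m" "ALL r:rts. algb F0 r"
proof -
 note mD = minpD[OF min]
 have m0: "m ~= 0" using mD(2) by auto
 thus "finite rts" unfolding rts_def by (rule poly_roots_finite)
 have "poly (pderiv m) r ~= 0" if "poly m r = 0" for r
 by (rule minpoly_separable[OF F0s(1) mD(1-4)]) (use mD(5,6) that in blast)+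
 thus "card rts = degree m" unfolding rts_def by (rule card_roots_minpoly[OF m0])
 show "ALL r:rts. algb F0 r" using mD(1) m0 by (auto simp: rts_def algb_def)
qed

lemma emb_root: assumes r: "r : rts" shows "EX ta. emb ta & (ALL p:PA F0. ta (poly p y) = poly p r)"
proof -
 define ta where "ta x = poly (SOME p. p : PA F0 & poly p y = x) r" for x
 have t: "ta (poly p y) = poly p r" if p: "p : PA F0" for p
 proof -
 define q where "q = (SOME q. q : PA F0 & poly q y = poly p y)"
 have q: "q : PA F0 & poly q y = poly p y" unfolding q_def by (rule someI[of _ p]) (use p in simp)
 have "q - p : PA F0" "poly (q - p) y = 0" using PA_ops(2)[OF F0s(2)] p q by auto
 then obtain s where "q - p = s * m" using minpD(6)[OF min] by blast
 hence "poly (q - p) r = 0" using r by (simp add: rts_def)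
 thus ?thesis by (simp add: ta_def q_def)
 qed
 have c: "ta x = x" if x: "x : F0" for x
 proof -
 have "[:x:] : PA F0" using PA_pCons[OF F0s(2)] PA_0[OF F0s(2)] x by blast
 from t[OF this] show ?thesis by simp
 qed
 have "phom L ta" unfolding phom_def
 proof (intro conjI ballI)
 show "ta 1 = 1" using c srgD(1)[OF F0s(2)] by blast
 fix a b assume "a : L" "b : L"
 then obtain p q where pq: "p : PA F0" "q : PA F0" "a = poly p y" "b = poly q y" unfolding L_eq by blast
 have "ta (poly (p + q) y) = poly (p + q) r" "ta (poly (p * q) y) = poly (p * q) r" using t PA_ops(1,4)[OF F0s(2) pq(1,2)] by blast+
 thus "ta (a + b) = ta a + ta b" "ta (a * b) = ta a * ta b" using pq t by simp_all
 qed (rule Ls(2))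
 thus ?thesis using t c unfolding emb_def by blast
qed

definition cf :: "'a => nat => 'a" where "cf x l = cof (SOME p. p : PA F0 & degree p < degree m & poly p y = x) l"

lemma cf:
 assumes x: "x : L"
 shows "cf x l : F0" "x = (SUM l<degree m. cf x l * y ^ l)"
 "EX p:PA F0. degree p < degree m & poly p y = x & (ALL l. cf x l = cof p l)"
proof -
 define q where "q = (SOME p. p : PA F0 & degree p < degree m & poly p y = x)"
 obtain p where "p : PA F0" "poly p y = x" using x unfolding L_eq by blast
 then obtain p' where "p' : PA F0 & degree p' < degree m & poly p' y = x" using minpD(7)[OF min] by metis
 hence q: "q : PA F0 & degree q < degree m & poly q y = x" unfolding q_def by (rule someI)
 have c: "cf x l = cof q l" for l by (simp add: cf_def q_def)
 show "cf x l : F0" using c q PA_D by metis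
 have "x = (SUM i<=degree m - 1. cof q i * y ^ i)" using poly_sum_le[of q "degree m - 1" y] q by force
 moreover have "{..degree m - 1} = {..<degree m}" using minpD(4)[OF min] by auto
 ultimately show "x = (SUM l<degree m. cf x l * y ^ l)" unfolding c by argo
 show "EX p:PA F0. degree p < degree m & poly p y = x & (ALL l. cf x l = cof p l)" using q c by blast
qed

text \<open>Interpolating the representing polynomial at all roots of m recovers its coefficients
  from the conjugates of x. The interpolation constants do not depend on x and are algebraic over
  F0, so they have denominators of their own.\<close>

lemma cf_trace:
 obtains lam where "ALL r:rts. ALL l. algb F0 (lam r l)"
 "ALL x:L. ALL l. EX ta. (ALL r:rts. emb (ta r)) & cf x l = (SUM r:rts. ta r x * lam r l)"
proof -
 obtain lam where lam: "ALL p. degree p < card rts --> (ALL l. cof p l = (SUM r:rts. poly p r * lam r l))"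
 by (rule lagrange_coeff[OF rts(1)])
 let ?F = "{x. algb F0 x}"
 have F: "sfd ?F" by (rule sfd_algb[OF F0s(2)])
 have F: "sfd ?F" "srg ?F" by (rule F, rule sfdD(1)[OF F])
 have "algb F0 (lam r l)" if r: "r : rts" for r l
 proof -
 \<comment> \<open>Testing the interpolation formula on the product of the other linear factors
   isolates \<open>lam r l\<close> as a quotient of elements algebraic over F0.\<close>
 define p where "p = (PROD s:rts - {r}. [:- s, 1:])"
 define v where "v = poly p r"
 have v: "v ~= 0" using rts(1) by (simp add: v_def p_def poly_prod)
 have "p : PA ?F" unfolding p_def
 proof -
 have "srg (PA ?F)" unfolding srg_def
 by (intro conjI ballI PA_1[OF F(2)] PA_ops(1,3,4)[OF F(2)])
 moreover have "[:- s, 1:] : PA ?F" if "s : rts - {r}" for s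
 using PA_pCons[OF F(2)] PA_0[OF F(2)] srgD(1)[OF F(2)] srgD(5)[OF F(2), of s] rts(3) that by simp
 ultimately show "(PROD s:rts - {r}. [:- s, 1:]) : PA ?F" by (rule srg_prod)
 qed
 moreover have "v : ?F" unfolding v_def by (rule poly_in_srg[OF F(2) \<open>p : PA ?F\<close>]) (use rts(3) r in blast)
 ultimately have mem: "cof p l / v : ?F" using sfdD(3)[OF F(1) PA_D] by blast
 have "degree p = card (rts - {r})" unfolding p_def by (subst degree_prod_eq_sum_degree) auto
 also have "\<dots> < card rts" using r rts(1) by (intro psubset_card_mono) auto
 finally have "cof p l = (SUM s:rts. poly p s * lam s l)" using lam by blast
 also have "\<dots> = (SUM s:rts. if s = r then v * lam r l else 0)"
 proof (rule sum.cong[OF refl])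
 fix s assume s: "s : rts"
 have "poly p s = 0" if "s ~= r" unfolding p_def poly_prod using that s rts(1) by (intro prod_zero) auto
 thus "poly p s * lam s l = (if s = r then v * lam r l else 0)" by (simp add: v_def)
 qed
 also have "\<dots> = v * lam r l" using r rts(1) by simp
 finally show ?thesis using mem v by simp
 qed
 moreover have "EX ta. (ALL r:rts. emb (ta r)) & cf x l = (SUM r:rts. ta r x * lam r l)" if x: "x : L" for x l
 proof -
 obtain p where p: "p : PA F0" "degree p < degree m" "poly p y = x" "ALL l. cf x l = cof p l" using cf(3)[OF x] by blast
 obtain ta where t: "ALL r:rts. emb (ta r) & (ALL p:PA F0. ta r (poly p y) = poly p r)" using bchoice[of rts "%r ta. emb ta & (ALL p:PA F0. ta (poly p y) = poly p r)"] emb_root by blast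
 have "cf x l = (SUM r:rts. poly p r * lam r l)" using p(2,4) lam rts(2) by simp
 also have "\<dots> = (SUM r:rts. ta r x * lam r l)" by (rule sum.cong) (use t p(1,3) in auto)
 finally show ?thesis using t by blast
 qed
 ultimately show ?thesis by (intro that[of lam] ballI allI)
qed

lemma bdd_cf:
 assumes C: "dclass PP RR" and B: "bdd PP RR B"
 shows "EX Dl:RR. ALL A ph. PP A ph --> (ALL n. ALL l<degree m. Dl * cf (B n) l : A)"
proof -
 obtain lam where lam: "ALL r:rts. ALL l. algb F0 (lam r l)"
 "ALL x:L. ALL l. EX ta. (ALL r:rts. emb (ta r)) & cf x l = (SUM r:rts. ta r x * lam r l)" by (rule cf_trace)
 obtain a where a: "a : RR" "ALL A ph. PP A ph --> a : A & (ALL ta. emb ta --> (ALL n. a * ta (B n) : A))" and BL: "ALL n. B n : L"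
 using B unfolding bdd_def by blast
 have "EX Dl:RR. ALL A ph. PP A ph --> Dl : A & (ALL i:rts \<times> {..<degree m}. ALL x:{lam (fst i) (snd i)}. Dl * x : A)"
 proof (rule common_delta[OF C])
 show "finite (rts \<times> {..<degree m})" using rts(1) by simp
 fix i assume "i : rts \<times> {..<degree m}"
 hence "algb F0 (lam (fst i) (snd i))" using lam(1) by auto
 then obtain p where "minp F0 (lam (fst i) (snd i)) p" using algb_monic[OF F0s(1)] by blast
 note p = minpD(1-3)[OF this]
 show "EX Dl:RR. ALL A ph. PP A ph --> Dl : A & (ALL x:{lam (fst i) (snd i)}. Dl * x : A)"
 using alg_den[OF C p(1,2)] p(3) by fastforce
 qed
 then obtain b where b: "b : RR" "ALL A ph. PP A ph --> b : A & (ALL r:rts. ALL l<degree m. b * lam r l : A)" by auto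
 have "a * b * cf (B n) l : A" if P: "PP A ph" and l: "l < degree m" for A ph n l
 proof -
 note Asr = dclassD(7)[OF C P]
 obtain ta where t: "ALL r:rts. emb (ta r)" "cf (B n) l = (SUM r:rts. ta r (B n) * lam r l)" using lam(2) BL by blast
 have "a * b * cf (B n) l = (SUM r:rts. (a * ta r (B n)) * (b * lam r l))" unfolding t(2) sum_distrib_left by (simp add: mult_ac)
 also have "\<dots> : A"
 proof (rule srg_sum[OF Asr])
 fix r assume "r : rts"
 thus "(a * ta r (B n)) * (b * lam r l) : A" using srgD(4)[OF Asr] a(2) b(2) P l t(1) by blast
 qed
 finally show ?thesis .
 qed
 thus ?thesis using dclassD(4)[OF C a(1) b(1)] by blast
qed

text \<open>After multiplication by one polynomial G the coordinates of all B n are regular at every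
  finite place, hence polynomial in each variable separately. The places at infinity bound their
  degrees, so fixed powers of the D t annihilate all of them.\<close>

theorem finite_span:
 assumes fin: "!!t. t : T ==> bdd (pfin t) (R0 - {0}) B" and inf: "!!t. t : T ==> bdd (pinf t) (F0 - {0}) B" and BL: "!!n. B n : L"
 shows "EX XX. finite XX & (ALL n. B n : lspan (h ` ka) XX)"
proof -
 have ks: "srg (h ` ka)" using hk_acl by (simp add: acl_def sfd_def)
 have "ALL t:T. EX Dl:R0 - {0}. ALL A ph. pfin t A ph --> (ALL n. ALL l<degree m. Dl * cf (B n) l : A)"
 using bdd_cf[OF dclass_fin fin] by blast
 then obtain Dl where Dl: "ALL t:T. Dl t : R0 - {0} & (ALL A ph. pfin t A ph --> (ALL n. ALL l<degree m. Dl t * cf (B n) l : A))" by metis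
 define G where "G = prod Dl T"
 have GR: "G : R0" unfolding G_def by (rule srg_prod[OF srg_srgn]) (use Dl in blast)
 hence GF: "G : F0" using R0F0 by blast
 have G0: "G ~= 0" using Dl finT by (auto simp: G_def)
 have c: "cf (B n) l : F0" for n l by (rule cf(1)[OF BL])
 have GcF: "G * cf (B n) l : F0" for n l by (rule srgD(4)[OF F0s(2) GF c])
 have P: "EX P:PA (E t). G * cf (B n) l = poly P (z t)" if t: "t : T" and l: "l < degree m" for t n l
 proof (rule fin_poly[OF t GcF], intro allI impI)
 fix A ph assume p: "pfin t A ph"
 note Asr = placeD(1)[OF p[unfolded pfin_def, THEN conjunct1]]
 \<comment> \<open>The denominators chosen for the other variables are polynomials in all the z s
   and so stay finite at this place.\<close>
 have "prod Dl (T - {t}) : A"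
 by (rule srg_prod[OF Asr]) (use pfin_R0[OF t p] Dl in blast)
 hence "prod Dl (T - {t}) * (Dl t * cf (B n) l) : A" using Dl t p l srgD(4)[OF Asr] by blast
 moreover have "G = Dl t * prod Dl (T - {t})" unfolding G_def by (rule prod.remove[OF finT t])
 ultimately show "G * cf (B n) l : A" by (simp add: mult_ac)
 qed
 have "EX N. ALL n. ALL l<degree m. (D t ^^ N) (G * cf (B n) l) = 0" if t: "t : T" for t
 proof -
 obtain a where a: "a : F0 - {0}" "ALL A ph. pinf t A ph --> (ALL n. ALL l<degree m. a * cf (B n) l : A)"
 using bdd_cf[OF dclass_inf[OF t] inf[OF t]] by blast
 \<comment> \<open>The bound at infinity is known for the coordinates themselves; dividing by G
   adapts it to their multiples by G.\<close>
 have "a / G : F0" "a / G ~= 0" using a(1) G0 sfdD(3)[OF F0s(1) _ GF] by auto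
 then obtain N where N: "ALL P:PA (E t). (ALL A ph. pinf t A ph --> a / G * poly P (z t) : A) --> degree P <= N" using inf_deg[OF t] by blast
 have "(D t ^^ Suc N) (G * cf (B n) l) = 0" if l: "l < degree m" for n l
 proof -
 obtain Q where Q: "Q : PA (E t)" "G * cf (B n) l = poly Q (z t)" using P[OF t l] by blast
 have "a / G * poly Q (z t) = a * cf (B n) l" unfolding Q(2)[symmetric] using G0 by simp
 hence "degree Q <= N" using N Q(1) a(2) l by auto
 thus ?thesis unfolding Q(2) by (rule poly_nilp[OF t Q(1)])
 qed
 thus ?thesis by blast
 qed
 then obtain e where e: "ALL t:T. ALL n. ALL l<degree m. (D t ^^ e t) (G * cf (B n) l) = 0" by metis
 obtain X0 where X0: "finite X0" "ALL x:F0. (ALL t:T. (D t ^^ e t) x = 0) --> x : lspan (h ` ka) X0" using nilp_span by blast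
 have sp: "G * cf (B n) l : lspan (h ` ka) X0" if "l < degree m" for n l using X0(2) GcF e that by blast
 let ?XX = "(%(x, l). x * y ^ l / G) ` (X0 \<times> {..<degree m})"
 have fX: "finite ?XX" using X0(1) by simp
 have "B n : lspan (h ` ka) ?XX" for n
 proof -
 have "cf (B n) l * y ^ l : lspan (h ` ka) ?XX" if l: "l < degree m" for l
 proof -
 obtain u where u: "ALL b:X0. u b : h ` ka" "G * cf (B n) l = (SUM b:X0. u b * b)" using sp[OF l] unfolding lspan_def by blast
 have "cf (B n) l * y ^ l = (G * cf (B n) l) * y ^ l / G" using G0 by simp
 also have "\<dots> = (SUM b:X0. u b * (b * y ^ l / G))" unfolding u(2) sum_distrib_right sum_divide_distrib by (simp add: mult_ac)
 also have "\<dots> : lspan (h ` ka) ?XX"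
 by (rule lspan_sum[OF ks], rule lspan_scale[OF ks]) (use u(1) l lspan_self[OF ks fX] in auto)
 finally show ?thesis .
 qed
 hence "(SUM l<degree m. cf (B n) l * y ^ l) : lspan (h ` ka) ?XX" by (intro lspan_sum[OF ks]) auto
 thus ?thesis using cf(2)[OF BL] by simp
 qed
 thus ?thesis using fX by blast
qed

end

section \<open>Algebraic closure and specialization\<close>

lemma alg_closure_algb: "kbar k = {z. algb k z}"
 unfolding alg_closure_in_C_def algb_def PA_def by auto

lemma alg_closure_acl:
 assumes "sfd k" shows "acl (kbar k)" "k \<subseteq> kbar k"
proof -
 have k: "srg k" using assms by (simp add: sfd_def)
 let ?K = "{z. algb k z}"
 have K: "sfd ?K" by (rule sfd_algb[OF k])
 have "EX x:?K. poly p x = 0" if p: "p : PA ?K" "degree p > 0" for p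
 proof -
 obtain x where x: "poly p x = 0" using alg_closed_imp_poly_has_root[OF p(2)] by blast
 have "p ~= 0" using p(2) by auto
 hence a: "algb ?K x" using p(1) x algb_def[of ?K x] by blast
 have "algb k x" by (rule algb_trans[OF k sfdD(1)[OF K] _ a]) simp
 thus ?thesis using x by blast
 qed
 thus "acl (kbar k)" unfolding acl_def alg_closure_algb using K by blast
 show "k <= kbar k" unfolding alg_closure_algb using algb_self[OF k] by blast
qed

text \<open>The polynomials over K that vanish at a form a prime ideal; a K-point of it outside the
  zero locus of G satisfies all relations of a.\<close>

lemma specialization:
 fixes h :: "complex => 'a::field"
 assumes K: "acl K" and h: "chom h" and N: "finite N" and G: "G : MP K N" "ins h a G ~= 0"
 obtains x where "ALL v. x v : K" "ALL v. v ~: N --> x v = 0" "ALL F:MP K N. ins h a F = 0 --> meval x F = 0" "meval x G ~= 0"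
proof -
 have Ks: "srg K" using K by (simp add: acl_def sfd_def)
 let ?I = "{F : MP K N. ins h a F = 0}"
 have prm: "prm (MP K N) ?I" unfolding prm_def
 proof (intro conjI ballI impI)
 show "?I <= MP K N" "0 : ?I" "1 ~: ?I" by (auto simp: srgD(2)[OF MP_srg[OF Ks, of N]] ins_1[OF h])
 fix F G assume "F : ?I" "G : ?I"
 thus "F + G : ?I" by (simp add: MP_add[OF Ks] ins_add[OF h])
 next
 fix F G assume "F : MP K N" "G : ?I"
 thus "F * G : ?I" by (simp add: MP_mult[OF Ks] ins_mult[OF h])
 next
 fix F G assume "F : MP K N" "G : MP K N" "F * G : ?I"
 thus "F : ?I \<or> G : ?I" by (simp add: ins_mult[OF h])
 qed
 have "G ~: ?I" using G(2) by simp
 then obtain x where x: "ALL v. x v : K" "ALL F:?I. meval x F = 0" "meval x G ~= 0"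
 by (rule nullstellensatz[OF K N prm G(1)])
 define x' where "x' v = (if v : N then x v else 0)" for v
 have e: "meval x' F = meval x F" if "F : MP K N" for F unfolding meval_ins by (rule ins_cong[OF that]) (auto simp: x'_def)
 show ?thesis
 proof (rule that[of x'])
 show "ALL v. x' v : K" using x(1) srgD(2)[OF Ks] by (simp add: x'_def)
 show "ALL v. v ~: N --> x' v = 0" by (simp add: x'_def)
 show "ALL F:MP K N. ins h a F = 0 --> meval x' F = 0" using e x(2) by auto
 show "meval x' G ~= 0" using e[OF G(1)] x(3) by simp
 qed
qed

text \<open>The polynomial to be kept nonzero is a coordinate that is nonzero at a, which keeps the
  specialized vector away from the origin.\<close>

lemma point_spec:
 fixes h :: "complex => 'a::field"
 assumes k: "sfd k" and h: "chom h" and N: "finite (coords Z)" and I: "hom_ideal Z \<subseteq> MP k (coords Z)"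
 and a: "ALL F:hom_ideal Z. ins h a F = 0" "v : coords Z" "a v ~= 0"
 obtains x where "x : hv k Z" "ALL F:MP (kbar k) (coords Z). ins h a F = 0 --> meval x F = 0"
proof -
 let ?K = "kbar k"
 have K: "acl ?K" "k <= ?K" using alg_closure_acl[OF k] by auto
 have Ks: "srg ?K" using K(1) by (simp add: acl_def sfd_def)
 have v: "mvar v : MP ?K (coords Z)" "ins h a (mvar v) ~= 0" using a(3) by (simp_all add: MP_var[OF Ks a(2)] ins_var[OF h])
 obtain x where x: "ALL v. x v : ?K" "ALL v. v ~: coords Z --> x v = 0" "ALL F:MP ?K (coords Z). ins h a F = 0 --> meval x F = 0" "meval x (mvar v) ~= 0"
 by (rule specialization[OF K(1) h N v])
 have "x v ~= 0" using x(4) by (simp add: meval_ins ins_var[OF chom_id])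
 moreover have "hom_ideal Z <= MP ?K (coords Z)" using I MP_mono[OF K(2) order_refl] by blast
 ultimately have "x : hv k Z" unfolding hom_vectors_def using x(1-3) a(1) by blast
 thus ?thesis using that x(3) by blast
qed

section \<open>Integrality of pulled back pluricanonical forms\<close>

lemma dt_scale: "dt d (%i j. c * a i j) = c ^ d * dt d a"
proof -
 have "(PROD i<d. c * a i (p i)) = c ^ d * (PROD i<d. a i (p i))" for p by (simp add: prod.distrib)
 thus ?thesis by (simp add: dt_def sum_distrib_left mult_ac)
qed

lemma dt_in: assumes A: "srg A" and a: "!!i j. i < d ==> j < d ==> a i j : A" shows "dt d a : A"
 unfolding dt_def
proof (intro srg_sum[OF A] srgD(4)[OF A] srg_prod[OF A])
 fix p i assume "p : {p. p permutes {..<d}}" "i : {..<d}"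
 hence "p i : {..<d}" using permutes_in_image by fastforce
 thus "a i (p i) : A" using a \<open>i : {..<d}\<close> by simp
qed (use srgD(1)[OF A] srgD(5)[OF A srgD(1)[OF A]] in simp)

text \<open>The product rule differentiates one factor at a time. Hence a denominator for the
  derivatives of generators serves every polynomial in them, without being raised to a
  power.\<close>

lemma good_srg:
 assumes A: "srg A" and dl: "!!i. i < d ==> der (dl i)" and Dl: "Dl : A"
 shows "srg {x : A. ALL i<d. Dl * dl i x : A}"
 unfolding srg_def
proof (intro conjI ballI)
 let ?S = "{x : A. ALL i<d. Dl * dl i x : A}"
 show "1 : ?S" using srgD(1,2)[OF A] derD(4)[OF dl] by simp
 fix x y assume x: "x : ?S" and y: "y : ?S"
 have "Dl * dl i (x + y) : A" "Dl * dl i (x * y) : A" if i: "i < d" for i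
 proof -
 have m: "Dl * dl i x : A" "Dl * dl i y : A" "x : A" "y : A" using x y i by auto
 have "Dl * dl i (x + y) = Dl * dl i x + Dl * dl i y" by (simp add: derD(1)[OF dl[OF i]] algebra_simps)
 thus "Dl * dl i (x + y) : A" using srgD(3)[OF A m(1,2)] by simp
 have "Dl * dl i (x * y) = x * (Dl * dl i y) + y * (Dl * dl i x)" by (simp add: derD(2)[OF dl[OF i]] algebra_simps)
 thus "Dl * dl i (x * y) : A" using srgD(3)[OF A srgD(4)[OF A m(3,2)] srgD(4)[OF A m(4,1)]] by (simp only:)
 qed
 thus "x + y : ?S" "x * y : ?S" using x y srgD(3,4)[OF A] by simp_all
next
 let ?S = "{x : A. ALL i<d. Dl * dl i x : A}"
 fix x assume x: "x : ?S"
 thus "- x : ?S" using srgD(5)[OF A] derD(5)[OF dl] by simp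
qed

lemma good_inverse:
 assumes A: "srg A" and dl: "!!i. i < d ==> der (dl i)" and x: "x : {x : A. ALL i<d. Dl * dl i x : A}" "inverse x : A"
 shows "inverse x : {x : A. ALL i<d. Dl * dl i x : A}"
proof -
 have "Dl * dl i (inverse x) : A" if i: "i < d" for i
 proof -
 have "Dl * dl i (inverse x) = - ((Dl * dl i x) * (inverse x * inverse x))"
 by (simp add: der_inverse[OF dl[OF i]] power2_eq_square divide_inverse mult_ac)
 moreover have "Dl * dl i x : A" using x(1) i by blast
 ultimately show ?thesis using srgD(5)[OF A srgD(4)[OF A _ srgD(4)[OF A x(2) x(2)]]] by (simp only:)
 qed
 thus ?thesis using x(2) by blast
qed

context gpoint
begin

text \<open>The pullback of the form \<open>s\<close> to the ambient field along the generic point,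
  evaluated on the \<open>d\<close> derivations \<open>dl\<close>.\<close>

definition bv where "bv m q E s dl = wv m q E s * dt d (%i l. dl i (ev (q l))) ^ m"

text \<open>The reduction of the coordinates by Ph specializes further to a geometric point x, and
  there s has an expression by some g and t from the local ring. A denominator that is nonzero at x
  cannot reduce to 0, so it is invertible in A. The only loss is the factor Dl in each of the d rows
  of the Jacobian, to the power m.\<close>

lemma section_bound:
 fixes Ph :: "'a => 'b::field" and h2 :: "complex => 'b"
 assumes I: "hom_ideal V \<subseteq> MP k (coords V)" "ALL F:hom_ideal V. ALL e. hpt e F : hom_ideal V"
 and h2: "chom h2" and Ph: "phom A Ph" "ALL x:A. Ph x ~= 0 --> inverse x : A"
 and hA: "ALL c:k. h c : A & Ph (h c) = h2 c"
 and xA: "ALL v:coords V. xi v : A" and v: "v : coords V" "Ph (xi v) ~= 0"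
 and dl: "!!i. i < d ==> lder (dl i)" and Dl: "Dl : A" "ALL i<d. ALL v:coords V. Dl * dl i (xi v) : A"
 and G: "gt_data k V m q E om et" and s: "s : psec k V m"
 shows "Dl ^ (d * m) * bv m q E s dl : A"
proof -
 note A = phomD(1)[OF Ph(1)]
 have dld: "der (dl i)" if "i < d" for i using dl[OF that] by blast
 let ?S = "{x : A. ALL i<d. Dl * dl i x : A}"
 have S: "srg ?S" by (rule good_srg[OF A dld Dl(1)])
 have vS: "vl F : ?S" if F: "F : MP k (coords V)" for F
 proof (rule ins_in[OF S F])
 fix c assume "c : k"
 thus "h c : ?S" using hA dl srgD(2)[OF A] by simp
 qed (use xA Dl(2) in blast)
 define a where "a v = Ph (xi v)" for v
 have Phv: "Ph (vl F) = ins h2 a F" if F: "F : MP k (coords V)" for F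
 proof -
 have "Ph (vl F) = ins (%c. Ph (h c)) a F" unfolding a_def by (rule phom_ins[OF Ph(1) F]) (use hA xA in auto)
 also have "\<dots> = ins h2 a F" by (rule ins_cong[OF F]) (use hA in auto)
 finally show ?thesis .
 qed
 have van: "ins h2 a F = 0" if F: "F : hom_ideal V" for F
 proof -
 have FM: "F : MP k (coords V)" using I(1) F by blast
 have "vl F = (SUM e:mdeg ` kys F. vl (hpt e F))" by (subst sum_hparts[of F]) (rule ins_sum[OF ch])
 also have "\<dots> = 0" by (rule sum.neutral) (use gen[OF MP_hpart[OF FM] hmg_hpart] I(2) F in blast)
 finally show ?thesis using Phv[OF FM] phomD(5)[OF Ph(1)] by simp
 qed
 have av: "a v ~= 0" using v(2) by (simp add: a_def)
 have va: "ALL F:hom_ideal V. ins h2 a F = 0" using van by blast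
 obtain x where x: "x : hv k V" "ALL F:MP (kbar k) (coords V). ins h2 a F = 0 --> meval x F = 0"
 by (rule point_spec[OF kf h2 finN I(1) va v(1) av])
 obtain g t where gt: "g : local_ring_at k V x" "ALL l<d. t l : local_ring_at k V x" "g : carrier K" "ALL l<d. t l : carrier K" "s = pluri_form k V m g t"
 using local_rep[OF s x(1)] by blast
 have eS: "ev r : ?S" if r: "r : local_ring_at k V x" for r
 proof -
 obtain P Q where PQ: "r : carrier K" "(P, Q) : r" "meval x Q ~= 0" using r unfolding local_ring_at_def by blast
 have f: "(P, Q) : fr" "ev r = vl P / vl Q" using ev_rep[OF PQ(1,2)] by auto
 have M: "P : MP k (coords V)" "Q : MP k (coords V)" using f(1) fr_iff by blast+
 hence "Q : MP (kbar k) (coords V)" using MP_mono[OF alg_closure_acl(2)[OF kf] order_refl] by blast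
 hence "Ph (vl Q) ~= 0" using x(2) PQ(3) Phv[OF M(2)] by auto
 moreover have "vl Q : A" using vS[OF M(2)] by blast
 ultimately have iA: "inverse (vl Q) : A" using Ph(2) by blast
 have "inverse (vl Q) : ?S" by (rule good_inverse[OF A _ vS[OF M(2)] iA]) (rule dld)
 thus ?thesis unfolding f(2) divide_inverse by (rule srgD(4)[OF S vS[OF M(1)]])
 qed
 have "bv m q E s dl = ev g * dt d (%i l. dl i (ev (t l))) ^ m" unfolding bv_def by (rule gt_transform[OF G gt(5,3,4) dl])
 hence "Dl ^ (d * m) * bv m q E s dl = ev g * (Dl ^ d * dt d (%i l. dl i (ev (t l)))) ^ m"
 by (simp add: power_mult_distrib mult_ac flip: power_mult)
 also have "\<dots> = ev g * dt d (%i l. Dl * dl i (ev (t l))) ^ m" by (simp only: dt_scale)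
 also have "\<dots> : A"
 proof (rule srgD(4)[OF A _ srgD(7)[OF A dt_in[OF A]]])
 show "ev g : A" using eS[OF gt(1)] by blast
 fix i j assume ij: "i < d" "j < d"
 have "ev (t j) : ?S" using gt(2) ij(2) eS by blast
 thus "Dl * dl i (ev (t j)) : A" using ij(1) by blast
 qed
 finally show ?thesis .
qed

lemma scale:
 assumes c: "c ~= 0" and x': "ALL v:coords V. x' v = c * xi v"
 shows "gpoint k V h x'" "r : carrier K ==> gpoint.ev h x' r = ev r"
proof -
 have e: "ins h x' F = c ^ e * vl F" if "F : MP k (coords V)" "hmg e F" for F e
 proof -
 have "ins h x' F = ins h (%v. c * xi v) F" by (rule ins_cong[OF that(1)]) (use x' in auto)
 thus ?thesis using ins_hmg[OF that(2)] by simp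
 qed
 show g: "gpoint k V h x'" by unfold_locales (use kf ch finN gen e c in auto)
 interpret g: gpoint k V h x' by (rule g)
 assume r: "r : carrier K"
 obtain A B where AB: "(A, B) : fr" "r = cls (A, B)" "ev r = vl A / vl B" by (rule carrierE[OF r])
 have "(A, B) : r" using AB(1,2) cls_eq by blast
 hence 1: "g.ev r = ins h x' A / ins h x' B" using g.ev_rep[OF r] by blast
 obtain e' where "hmg e' A" "hmg e' B" "A : MP k (coords V)" "B : MP k (coords V)" using AB(1) fr_iff by blast
 hence "ins h x' A = c ^ e' * vl A" "ins h x' B = c ^ e' * vl B" using e by auto
 thus "g.ev r = ev r" using 1 AB(3) c by simp
qed

lemma section_carrier:
 assumes G: "gt_data k V m q E om et" and s: "s : psec k V m" and x: "x : hv k V"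
 shows "s E : carrier K"
proof -
 obtain g t where gt: "g : carrier K" "ALL l<d. t l : carrier K" "s = pluri_form k V m g t" using local_rep[OF s x] by blast
 show ?thesis unfolding gt(3) using pluri_form_eval[OF gt_dataD(4)[OF G] gt(1,2)] by blast
qed

lemma bv_scale:
 assumes c: "c ~= 0" and x': "ALL v:coords V. x' v = c * xi v"
 and G: "gt_data k V m q E om et" and s: "s : psec k V m" and x: "x : hv k V"
 shows "gpoint.bv k V h x' m q E s dl = bv m q E s dl"
proof -
 interpret g: gpoint k V h x' by (rule scale(1)[OF c x'])
 note e = scale(2)[OF c x']
 have q: "q l : carrier K" if "l < d" for l using gt_dataD(1)[OF G] that by blast
 have 1: "g.ev (s E) = ev (s E)" by (rule e[OF section_carrier[OF G s x]])
 have 2: "g.ev (E i (q l)) = ev (E i (q l))" if "i < d" "l < d" for i l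
 by (rule e[OF derivation_carrier[OF frame_mem[OF gt_dataD(4)[OF G] that(1)] q[OF that(2)]]])
 have 3: "dt d (%i l. g.ev (E i (q l))) = dt d (%i l. ev (E i (q l)))" by (rule dt_cong[OF 2])
 have 4: "dt d (%i l. dl i (g.ev (q l))) = dt d (%i l. dl i (ev (q l)))" by (rule dt_cong) (simp add: e[OF q])
 show ?thesis unfolding g.bv_def bv_def g.wv_def wv_def 1 3 4 ..
qed

end

section \<open>Ultrapowers of generic points\<close>

lemma dt_uabs: "dt d (%i l. uabs (a i l)) = uabs (%S. dt d (%i l. a i l S))"
proof -
 have s: "(if evenperm p then 1 else - 1) = uabs (%_. if evenperm p then 1 else - 1 :: 'b)" for p :: "nat => nat"
 by (simp add: uabs_01 uabs_ops)
 show ?thesis unfolding dt_def s by (simp only: uabs_prod uabs_ops uabs_sum)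
qed

lemma ins_uabs: "ins (%c. ucn (h c)) (%v. uabs (x v)) F = uabs (%S. ins h (%v. x v S) F)"
 unfolding ins_def mval_def ucn_def by (simp add: uabs_power uabs_prod uabs_ops uabs_sum)

text \<open>Whether a homogeneous polynomial vanishes at the point does not depend on the index S,
  so genericity passes to the ultraproduct. Values, determinants and forms are computed index by
  index.\<close>

lemma gpoint_ultra:
 fixes h :: "complex => 'a::{field_char_0,alg_closed_field}" and xe :: "'i set => 'v => 'a"
 assumes g: "!!S. gpoint k V h (xe S)"
 shows "gpoint k V (%c. ucn (h c)) (%v. uabs (%S. xe S v))"
 "gpoint.bv k V (%c. ucn (h c)) (%v. uabs (%S. xe S v)) m q E s (%i. umap (dl i)) = uabs (%S. gpoint.bv k V h (xe S) m q E s dl)"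
proof -
 interpret g0: gpoint k V h "xe undefined" by (rule g)
 have h: "chom h" by (rule g0.ch)
 have ch: "chom (%c. ucn (h c))" unfolding phom_def using phomD(2,3,4)[OF h] by (simp add: srg_UNIV ucn_hom)
 show G: "gpoint k V (%c. ucn (h c)) (%v. uabs (%S. xe S v))"
 proof (unfold_locales)
 fix e A assume A: "A : MP k (coords V)" "hmg e A"
 have "ins h (%v. xe S v) A = 0 \<longleftrightarrow> A : hom_ideal V" for S using gpoint.gen[OF g A] .
 thus "ins (%c. ucn (h c)) (%v. uabs (%S. xe S v)) A = 0 \<longleftrightarrow> A : hom_ideal V"
 unfolding ins_uabs uabs_01 uabs_eq by simp
 qed (use g0.kf g0.finN ch in auto)
 interpret G: gpoint k V "%c. ucn (h c)" "%v. uabs (%S. xe S v)" by (rule G)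
 have e: "G.ev r = uabs (%S. gpoint.ev h (xe S) r)" for r
 unfolding G.ev_def G.rat_def ins_uabs uabs_ops
 by (simp add: gpoint.ev_def[OF g] gpoint.rat_def[OF g])
 show "G.bv m q E s (%i. umap (dl i)) = uabs (%S. gpoint.bv k V h (xe S) m q E s dl)"
 unfolding G.bv_def G.wv_def e umap_uabs dt_uabs uabs_power uabs_ops
 by (simp add: gpoint.bv_def[OF g] gpoint.wv_def[OF g])
qed

lemma umap_der: assumes "der D" shows "der (umap D)"
 unfolding der_def
proof (intro allI conjI)
 fix x y :: "('b, 'a) ultra"
 obtain f g where "x = uabs f" "y = uabs g" using uabs_ex by blast
 thus "umap D (x + y) = umap D x + umap D y" "umap D (x * y) = x * umap D y + y * umap D x"
 by (simp_all add: uabs_ops umap_uabs derD(1,2)[OF assms])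
qed

section \<open>Existence of a separating transcendence basis\<close>

text \<open>A smallest set of coordinates over which all coordinates are algebraic is independent,
  which yields the dual derivations; y is a primitive element for all coordinates together.\<close>

lemma tbasis_exists:
 fixes h :: "complex => 'a::{field_char_0,alg_closed_field}" and ze :: "'z => 'a"
 assumes K: "acl K" and h: "chom h" and N: "finite N"
 obtains T D y m where "tbasis K h T ze D y m" "ze ` N \<subseteq> sfg (sfg (h ` K Un ze ` T) Un {y})"
proof -
 define Q where "Q T \<longleftrightarrow> T \<subseteq> N & (ALL v:N. algb (sfg (h ` K Un ze ` T)) (ze v))" for T
 have "Q N" unfolding Q_def
 proof (intro conjI ballI order_refl)
 fix v assume "v : N"
 hence "ze v : sfg (h ` K Un ze ` N)" using sfg_super[of "h ` K Un ze ` N"] by blast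
 thus "algb (sfg (h ` K Un ze ` N)) (ze v)" by (rule algb_self[OF srg_sfg])
 qed
 then obtain T where T: "Q T" "ALL T'. Q T' --> card T <= card T'" using ex_has_least_nat[of Q N card] by blast
 have finT: "finite T" using T(1) N finite_subset unfolding Q_def by blast
 have "\<not> algb (sfg (h ` K Un ze ` (T - {t}))) (ze t)" if t: "t : T" for t
 proof
 let ?S = "sfg (h ` K Un ze ` (T - {t}))"
 assume a: "algb ?S (ze t)"
 have "h ` K Un ze ` (T - {t}) <= ?S" by (rule sfg_super)
 hence sub: "h ` K Un ze ` T <= ?S Un {ze t}" by blast
 have "algb ?S u" if "u : sfg (h ` K Un ze ` T)" for u
 proof (rule algb_sfg[OF srg_sfg, of "{ze t}"])
 show "u : sfg (?S Un {ze t})" using that sfg_mono[OF sub] by blast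
 qed (use a in blast)
 hence "algb ?S (ze v)" if "v : N" for v
 using algb_trans[OF srg_sfg srg_sfg] T(1) that unfolding Q_def by blast
 hence "Q (T - {t})" using T(1) unfolding Q_def by blast
 thus False using T(2) t finT by (metis card_Diff1_less linorder_not_le)
 qed
 hence "EX D. der D & (ALL s:sfg (h ` K Un ze ` (T - {t})). D s = 0) & D (ze t) = 1" if t: "t : T" for t
 using derivation_exists[OF srg_sfg] t by metis
 then obtain D where D: "ALL t:T. der (D t) & (ALL s:sfg (h ` K Un ze ` (T - {t})). D t s = 0) & D t (ze t) = 1"
 by (metis (no_types))
 let ?F = "sfg (h ` K Un ze ` T)"
 have "EX y:sfg (?F Un ze ` N). ze ` N <= sfg (?F Un {y})"
 by (rule primitive_element[OF sfd_sfg]) (use N T(1) in \<open>auto simp: Q_def\<close>)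
 then obtain y where y: "y : sfg (?F Un ze ` N)" "ze ` N \<subseteq> sfg (?F Un {y})" by blast
 have "algb ?F y" by (rule algb_sfg[OF srg_sfg _ y(1)]) (use T(1) in \<open>auto simp: Q_def\<close>)
 then obtain m where m: "minp ?F y m" using algb_monic[OF sfd_sfg] by blast
 have sup: "h ` K Un ze ` (T - {t}) \<subseteq> sfg (h ` K Un ze ` (T - {t}))" for t by (rule sfg_super)
 have "tbasis K h T ze D y m"
 proof (unfold_locales)
 fix t assume t: "t : T"
 show "der (D t)" using D t by blast
 show "D t (h c) = 0" if "c : K" for c using D t sup[of t] that by blast
 show "D t (ze s) = (if s = t then 1 else 0)" if s: "s : T" for s
 proof (cases "s = t")
 case False
 hence "ze s : sfg (h ` K Un ze ` (T - {t}))" using sup[of t] s by blast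
 thus ?thesis using D t False by simp
 qed (use D t in simp)
 qed (rule K h finT m)+
 thus ?thesis using that y(2) by blast
qed

section \<open>Rigidity\<close>

text \<open>As g is transcendental over the constants, evaluating polynomials in 1/g at 0 is well
  defined. Any place extending this evaluation fixes K and sends g to infinity.\<close>

lemma place_trans:
 fixes j :: "'b::field_char_0 => 'a::field" and g :: 'a
 assumes K: "acl K" and j: "phom UNIV j" and g: "g ~: j ` K" "!!x. algb (j ` K) x ==> x : j ` K"
 obtains A ph where "place K A ph" "ALL c:K. j c : A & ph (j c) = c" "inverse g : A" "ph (inverse g) = 0"
proof -
 have Ks: "srg K" "sfd K" using K by (auto simp: acl_def sfd_def)
 let ?u = "inverse g"
 let ?G = "{(poly (map_poly j p) ?u, cof p 0) |p. p : PA K}"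
 have j0: "j 0 = 0" and jinj: "j c = 0 ==> c = 0" for c
 proof -
 show j0: "j 0 = 0" using phomD(5)[OF j] .
 show "c = 0" if "j c = 0"
 proof (rule ccontr)
 assume "c ~= 0"
 hence "j c * j (inverse c) = 1" using phomD(4)[OF j, of c "inverse c"] phomD(2)[OF j] by simp
 thus False using that by simp
 qed
 qed
 have inv: "inverse (j c) = j (inverse c)" for c
 proof (cases "c = 0")
 case False
 hence "j c * j (inverse c) = 1" using phomD(4)[OF j, of c "inverse c"] phomD(2)[OF j] by simp
 thus ?thesis by (metis inverse_unique)
 qed (simp add: j0)
 have pU: "p : PA UNIV" for p :: "'b poly" by (simp add: PA_def)
 note mp = map_poly_phom[OF j pU pU]
 have nz: "p = 0" if p: "p : PA K" "poly (map_poly j p) ?u = 0" for p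
 proof (rule ccontr)
 assume "p ~= 0"
 hence "map_poly j p ~= 0" using jinj by (metis coeff_map_poly j0 leading_coeff_0_iff coeff_0)
 moreover have "map_poly j p : PA (j ` K)" using p(1) by (auto simp: PA_def coeff_map_poly j0)
 ultimately have "algb (j ` K) ?u" using p(2) unfolding algb_def by blast
 hence "?u : j ` K" by (rule g(2))
 then obtain c where "c : K" "?u = j c" by blast
 hence "g = j (inverse c)" "inverse c : K" using inv[of c] sfdD(2)[OF Ks(2)] by (metis inverse_inverse_eq)+
 thus False using g(1) by blast
 qed
 have "hgraph K ?G"
 proof (rule hgraphI)
 have "(poly (map_poly j 1) ?u, cof 1 0) : ?G" using PA_1[OF Ks(1)] by blast
 thus "(1, 1) : ?G" using phomD(2)[OF j] by (simp add: map_poly_1')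
 fix x u y v assume "(x, u) : ?G" "(y, v) : ?G"
 then obtain p q where pq: "p : PA K" "q : PA K" "x = poly (map_poly j p) ?u" "u = cof p 0" "y = poly (map_poly j q) ?u" "v = cof q 0" by blast
 have "(poly (map_poly j (p + q)) ?u, cof (p + q) 0) : ?G" "(poly (map_poly j (p * q)) ?u, cof (p * q) 0) : ?G"
 using PA_ops(1,4)[OF Ks(1) pq(1,2)] by blast+
 thus "(x + y, u + v) : ?G & (x * y, u * v) : ?G" using pq(3-6) by (simp add: mp coeff_mult)
 next
 fix x u assume "(x, u) : ?G"
 then obtain p where p: "p : PA K" "x = poly (map_poly j p) ?u" "u = cof p 0" by blast
 have m: "map_poly j (- p) = - map_poly j p" using mp(3)[of 0 p] by simp
 have "(poly (map_poly j (- p)) ?u, cof (- p) 0) : ?G" using PA_ops(3)[OF Ks(1) p(1)] by blast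
 thus "(- x, - u) : ?G" unfolding m p(2,3) by simp
 next
 fix u assume "(0, u) : ?G"
 then obtain p where p: "p : PA K" "poly (map_poly j p) ?u = 0" "u = cof p 0" by auto
 have "p = 0" by (rule nz[OF p(1,2)])
 thus "u = 0" using p(3) by simp
 next
 fix x u assume "(x, u) : ?G"
 then obtain p where "p : PA K" "u = cof p 0" by auto
 thus "u : K" by (simp add: PA_D)
 qed
 then obtain A ph where A: "place K A ph" "ALL x u. (x, u) : ?G --> x : A & ph x = u" by (rule place_extension[OF _ K])
 have "(j c, c) : ?G" if "c : K" for c
 proof -
 have "(poly (map_poly j [:c:]) ?u, cof [:c:] 0) : ?G" using PA_pCons[OF Ks(1)] PA_0[OF Ks(1)] that by blast
 thus ?thesis by (simp add: map_poly_pCons j0)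
 qed
 moreover have "(?u, 0) : ?G"
 proof -
 have "(poly (map_poly j [:0, 1:]) ?u, cof [:0, 1:] 0) : ?G"
 using PA_pCons[OF Ks(1)] PA_0[OF Ks(1)] srgD(1,2)[OF Ks(1)] by blast
 thus ?thesis using phomD(2)[OF j] by (simp add: map_poly_pCons j0)
 qed
 ultimately show ?thesis by (intro that[OF A(1)]) (use A(2) in blast)+
qed

text \<open>The nonstandard constants: classes of families of elements of \<open>K\<close>. The
  standard constants are the image of \<open>K\<close> under \<open>ucn\<close>.\<close>

definition cstar :: "'a set => ('i, 'a) ultra set" where "cstar K = {uabs c |c. ALL S. c S : K}"

lemma cstar_ops:
 fixes K :: "'a::field set"
 assumes K: "sfd K"
 shows "sfd (cstar K :: ('i, 'a) ultra set)" "c : K ==> ucn c : (cstar K :: ('i, 'a) ultra set)"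
proof -
 have Ks: "srg K" using K by (simp add: sfd_def)
 show "sfd (cstar K :: ('i, 'a) ultra set)" unfolding sfd_def srg_def
 proof (intro conjI ballI)
 show "1 : (cstar K :: ('i, 'a) ultra set)" unfolding cstar_def uabs_01 using srgD(1)[OF Ks] by blast
 fix x y :: "('i, 'a) ultra" assume "x : cstar K" "y : cstar K"
 then obtain a b where ab: "ALL S. a S : K" "ALL S. b S : K" "x = uabs a" "y = uabs b" unfolding cstar_def by blast
 have "ALL S. a S + b S : K" "ALL S. a S * b S : K" using srgD(3,4)[OF Ks] ab by blast+
 thus "x + y : cstar K" "x * y : cstar K" unfolding cstar_def ab uabs_ops by blast+
 next
 fix x :: "('i, 'a) ultra" assume "x : cstar K"
 then obtain a where a: "ALL S. a S : K" "x = uabs a" unfolding cstar_def by blast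
 have "ALL S. - a S : K" "ALL S. inverse (a S) : K" using srgD(5)[OF Ks] sfdD(2)[OF K] a by blast+
 thus "- x : cstar K" "inverse x : cstar K" unfolding cstar_def a uabs_ops by blast+
 qed
 show "ucn c : (cstar K :: ('i, 'a) ultra set)" if "c : K" unfolding cstar_def ucn_def using that by blast
qed

definition crd where "crd K B x = (SOME c. (ALL b:B. c b : K) & x = (SUM b:B. c b * b))"

lemma crd: "x : lspan K B ==> (ALL b:B. crd K B x b : K) & x = (SUM b:B. crd K B x b * b)"
 unfolding lspan_def crd_def
 using someI_ex[of "%c. (ALL b:B. c b : K) & x = (SUM b:B. c b * b)"] by blast

lemma lindD: "lind K B ==> ALL b:B. c b : K ==> (SUM b:B. c b * b) = 0 ==> b : B ==> c b = 0"
 unfolding lind_def by blast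

text \<open>Linear disjointness of the nonstandard constants and the standard ambient field over K.
  A relation holds at almost every index, and at each of these all its coefficients vanish.\<close>

lemma cstar_lind:
 assumes B: "finite B" "lind K B" and c: "ALL b:B. c b : cstar K" "(SUM b:B. c b * ucn b) = 0"
 shows "ALL b:B. c b = 0"
proof -
 have "ALL b:B. EX f. (ALL S. f S : K) & c b = uabs f" using c(1) unfolding cstar_def by blast
 then obtain f where f: "ALL b:B. (ALL S. f b S : K) & c b = uabs (f b)" by metis
 have "(SUM b:B. c b * ucn b) = (SUM b:B. uabs (%S. f b S * b))"
 by (rule sum.cong) (use f in \<open>auto simp: ucn_def uabs_ops\<close>)
 hence "uabs (%S. SUM b:B. f b S * b) = uabs (%_. 0)" using c(2) by (simp add: uabs_sum uabs_01)
 hence u: "uev (%S. (SUM b:B. f b S * b) = 0)" by (simp add: uabs_eq)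
 show ?thesis
 proof
 fix b assume b: "b : B"
 have "f b S = 0" if z: "(SUM b:B. f b S * b) = 0" for S
 by (rule lindD[OF B(2) _ z b]) (use f in blast)
 hence "uev (%S. f b S = 0)" by (rule uev_mono[OF u])
 thus "c b = 0" using f b by (simp add: uabs_01 uabs_eq)
 qed
qed

text \<open>The Gauss extension of a place of the nonstandard constants, trivial on the standard field.\<close>

lemma gauss_place:
 fixes K :: "'a::alg_closed_field set" and A1 :: "('i, 'a) ultra set"
 assumes K: "sfd K" and P: "place K A1 ph1" "ALL c:K. ucn c : A1 & ph1 (ucn c) = c"
 obtains A Ph where "place UNIV A Ph" "ALL c:A1 Int cstar K. c : A & Ph c = ph1 c" "ALL e. ucn e : A & Ph (ucn e) = e"
proof -
 have Ks: "srg K" using K by (simp add: sfd_def)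
 let ?O = "A1 Int cstar K"
 note A1 = placeD(1)[OF P(1)]
 have cs: "srg (cstar K :: ('i, 'a) ultra set)" by (rule sfdD(1)[OF cstar_ops(1)[OF K]])
 have uKO: "ucn c : ?O" if "c : K" for c using that P(2) cstar_ops(2)[OF K that] by blast
 have O: "x + y : ?O" "x * y : ?O" "- x : ?O" if "x : ?O" "y : ?O" for x y
 using that srgD(3,4,5)[OF A1] srgD(3,4,5)[OF cs] by auto
 have O1: "1 : ?O" using srgD(1)[OF A1] srgD(1)[OF cs] by blast
 \<comment> \<open>A list stands for a formal sum of tensors of a constant c and a standard element
   e. \<open>L1\<close> evaluates it in the ultrapower, \<open>L2\<close> under the intended residue
   map.\<close>
 define L1 where "L1 l = sum_list (map (%(c, e). c * ucn e) l)" for l :: "(('i, 'a) ultra \<times> 'a) list"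
 define L2 where "L2 l = sum_list (map (%(c, e). ph1 c * e) l)" for l :: "(('i, 'a) ultra \<times> 'a) list"
 define W where "W = {l :: (('i, 'a) ultra \<times> 'a) list. fst ` set l \<subseteq> ?O}"
 let ?G = "{(L1 l, L2 l) |l. l : W}"
 have app: "L1 (l @ l') = L1 l + L1 l'" "L2 (l @ l') = L2 l + L2 l'" for l l' by (simp_all add: L1_def L2_def)
 have mul1: "EX l':W. L1 l' = c * ucn e * L1 l & L2 l' = ph1 c * e * L2 l" if "l : W" "c : ?O" for c e l
 using that(1)
 proof (induct l)
 case Nil
 thus ?case by (intro bexI[of _ "[]"]) (auto simp: L1_def L2_def W_def)
 next
 case (Cons p l)
 obtain c' e' where p: "p = (c', e')" by (cases p)
 have "l : W" "c' : ?O" using Cons(2) by (auto simp: W_def p)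
 then obtain l' where l': "l' : W" "L1 l' = c * ucn e * L1 l" "L2 l' = ph1 c * e * L2 l" using Cons(1) by blast
 have cc: "c * c' : ?O" by (rule O(2)[OF that(2) \<open>c' : ?O\<close>])
 have ph: "ph1 (c * c') = ph1 c * ph1 c'" using placeD(4)[OF P(1)] that(2) \<open>c' : ?O\<close> by blast
 have "(c * c', e * e') # l' : W" using l'(1) cc by (simp add: W_def)
 moreover have "L1 ((c * c', e * e') # l') = c * ucn e * L1 (p # l)"
 using l'(2) by (simp add: L1_def p ucn_hom algebra_simps)
 moreover have "L2 ((c * c', e * e') # l') = ph1 c * e * L2 (p # l)"
 using l'(3) ph by (simp add: L2_def p algebra_simps)
 ultimately show ?case by blast
 qed
 have mul: "EX l'':W. L1 l'' = L1 l' * L1 l & L2 l'' = L2 l' * L2 l" if lW: "l : W" and l'W: "l' : W" for l l'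
 using l'W
 proof (induct l')
 case Nil
 thus ?case by (intro bexI[of _ "[]"]) (auto simp: L1_def L2_def W_def)
 next
 case (Cons p l')
 obtain c e where p: "p = (c, e)" by (cases p)
 have "l' : W" "c : ?O" using Cons(2) by (auto simp: W_def p)
 then obtain l1 l2 where l: "l1 : W" "L1 l1 = L1 l' * L1 l" "L2 l1 = L2 l' * L2 l" "l2 : W" "L1 l2 = c * ucn e * L1 l" "L2 l2 = ph1 c * e * L2 l"
 using Cons(1) mul1[OF lW \<open>c : ?O\<close>, of e] by blast
 have "l1 @ l2 : W" using l(1,4) by (auto simp: W_def)
 moreover have "L1 (l1 @ l2) = L1 (p # l') * L1 l" "L2 (l1 @ l2) = L2 (p # l') * L2 l"
 unfolding app l(2,3,5,6) by (simp_all add: L1_def L2_def p algebra_simps)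
 ultimately show ?case by blast
 qed
 \<comment> \<open>Expanding the elements e in a basis B over K turns a vanishing sum into a
   relation with coefficients in \<open>cstar K\<close>. By linear disjointness all these
   coefficients are 0, so the residue is 0 as well.\<close>
 have wd: "L2 l = 0" if l: "l : W" "L1 l = 0" for l
 proof -
 obtain B where B: "B \<subseteq> snd ` set l" "lind K B" "snd ` set l \<subseteq> lspan K B" using lbasis[OF K, of "snd ` set l"] by auto
 have fB: "finite B" using B(1) finite_subset by blast
 have "ALL e:snd ` set l. EX u. (ALL b:B. u b : K) & e = (SUM b:B. u b * b)" using B(3) unfolding lspan_def by blast
 then obtain u where u: "ALL e:snd ` set l. (ALL b:B. u e b : K) & e = (SUM b:B. u e b * b)" by metis
 define C where "C l b = sum_list (map (%(c, e). c * ucn (u e b)) l)" for l :: "(('i, 'a) ultra \<times> 'a) list" and b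
 have "L1 l' = (SUM b:B. C l' b * ucn b) & L2 l' = (SUM b:B. ph1 (C l' b) * b) & (ALL b:B. C l' b : ?O)"
 if "l' : W" "snd ` set l' \<subseteq> snd ` set l" for l'
 using that
 proof (induct l')
 case Nil
 thus ?case using srgD(2)[OF A1] srgD(2)[OF cs] placeD(8)[OF P(1)] by (simp add: L1_def L2_def C_def)
 next
 case (Cons p l')
 obtain c e where p: "p = (c, e)" by (cases p)
 have c: "l' : W" "c : ?O" "e : snd ` set l" "snd ` set l' <= snd ` set l" using Cons(2,3) unfolding W_def p by simp_all
 have IH: "L1 l' = (SUM b:B. C l' b * ucn b)" "L2 l' = (SUM b:B. ph1 (C l' b) * b)" "ALL b:B. C l' b : ?O" using Cons(1)[OF c(1,4)] by auto
 have e: "e = (SUM b:B. u e b * b)" and uK: "ALL b:B. u e b : K" using u c(3) by blast+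
 have uO: "ucn (u e b) : ?O" if "b : B" for b using uKO uK that by blast
 have uc: "ucn (SUM b:B. f b) = (SUM b:B. ucn (f b) :: ('i, 'a) ultra)" for f by (simp add: ucn_def uabs_sum)
 have C: "C (p # l') b = c * ucn (u e b) + C l' b" for b by (simp add: C_def p)
 have "ucn e = (ucn (SUM b:B. u e b * b) :: ('i, 'a) ultra)" using e by simp
 hence "ucn e = (SUM b:B. ucn (u e b) * ucn b :: ('i, 'a) ultra)" unfolding uc ucn_hom(2) .
 hence ce: "c * ucn e = (SUM b:B. c * ucn (u e b) * ucn b)" by (simp add: sum_distrib_left mult.assoc)
 have "L1 (p # l') = c * ucn e + L1 l'" by (simp add: L1_def p)
 hence 1: "L1 (p # l') = (SUM b:B. C (p # l') b * ucn b)" unfolding IH(1) ce C distrib_right sum.distrib .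
 have ph: "ph1 (C (p # l') b) = ph1 c * u e b + ph1 (C l' b)" if b: "b : B" for b
 proof -
 have m: "c * ucn (u e b) : ?O" by (rule O(2)[OF c(2) uO[OF b]])
 have "ph1 (C (p # l') b) = ph1 (c * ucn (u e b)) + ph1 (C l' b)" unfolding C by (rule placeD(3)[OF P(1) IntD1[OF m] IntD1[OF bspec[OF IH(3) b]]])
 also have "ph1 (c * ucn (u e b)) = ph1 c * ph1 (ucn (u e b))" by (rule placeD(4)[OF P(1) IntD1[OF c(2)] IntD1[OF uO[OF b]]])
 also have "ph1 (ucn (u e b)) = u e b" using P(2) uK b by blast
 finally show ?thesis .
 qed
 have "ph1 c * e = ph1 c * (SUM b:B. u e b * b)" using e by simp
 hence pe: "ph1 c * e = (SUM b:B. ph1 c * u e b * b)" unfolding sum_distrib_left mult.assoc .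
 have "L2 (p # l') = ph1 c * e + L2 l'" by (simp add: L2_def p)
 also have "\<dots> = (SUM b:B. (ph1 c * u e b + ph1 (C l' b)) * b)" unfolding IH(2) pe distrib_right sum.distrib ..
 also have "\<dots> = (SUM b:B. ph1 (C (p # l') b) * b)" by (rule sum.cong[OF refl]) (simp only: ph)
 finally have 2: "L2 (p # l') = (SUM b:B. ph1 (C (p # l') b) * b)" .
 have "ALL b:B. C (p # l') b : ?O"
 proof
 fix b assume b: "b : B"
 show "C (p # l') b : ?O" unfolding C by (rule O(1)[OF O(2)[OF c(2) uO[OF b]] bspec[OF IH(3) b]])
 qed
 thus ?case using 1 2 by blast
 qed
 note this[OF l(1) order_refl]
 hence r: "L1 l = (SUM b:B. C l b * ucn b)" "L2 l = (SUM b:B. ph1 (C l b) * b)" "ALL b:B. C l b : ?O" by auto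
 have "ALL b:B. C l b : cstar K" using r(3) by blast
 hence "ALL b:B. C l b = 0" using cstar_lind[OF fB B(2)] r(1) l(2) by metis
 thus ?thesis using r(2) placeD(8)[OF P(1)] by simp
 qed
 have "hgraph UNIV ?G"
 proof (rule hgraphI)
 have "[(1, 1)] : W" "L1 [(1, 1)] = 1" "L2 [(1, 1)] = 1" using O1 placeD(2)[OF P(1)] by (auto simp: W_def L1_def L2_def ucn_hom)
 thus "(1, 1) : ?G" by force
 fix x u y v assume "(x, u) : ?G" "(y, v) : ?G"
 then obtain l l' where l: "l : W" "l' : W" "x = L1 l" "u = L2 l" "y = L1 l'" "v = L2 l'" by blast
 have "l @ l' : W" using l(1,2) by (auto simp: W_def)
 hence "(L1 (l @ l'), L2 (l @ l')) : ?G" by blast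
 moreover obtain l'' where "l'' : W" "L1 l'' = L1 l * L1 l'" "L2 l'' = L2 l * L2 l'" using mul[OF l(2,1)] by blast
 hence "(L1 l * L1 l', L2 l * L2 l') : ?G" by force
 ultimately show "(x + y, u + v) : ?G & (x * y, u * v) : ?G" unfolding l(3-6) app by blast
 next
 fix x u assume "(x, u) : ?G"
 then obtain l where l: "l : W" "x = L1 l" "u = L2 l" by blast
 have "- 1 : ?O" "ph1 (- 1) = - 1" using O(3)[OF O1 O1] placeD(9)[OF P(1) srgD(1)[OF A1]] placeD(2)[OF P(1)] by auto
 then obtain l' where "l' : W" "L1 l' = - L1 l" "L2 l' = - L2 l" using mul1[OF l(1), of "- 1" 1] by (auto simp: ucn_hom)
 thus "(- x, - u) : ?G" using l by force
 qed (use wd in auto)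
 moreover have "acl (UNIV :: 'a set)" unfolding acl_def
 proof (intro conjI ballI impI)
 show "sfd (UNIV :: 'a set)" by (simp add: sfd_def srg_def)
 fix p :: "'a poly" assume "0 < degree p"
 thus "EX x:UNIV. poly p x = 0" using alg_closed_imp_poly_has_root by blast
 qed
 ultimately obtain A Ph where A: "place UNIV A Ph" "ALL x u. (x, u) : ?G --> x : A & Ph x = u" by (rule place_extension)
 have "(c, ph1 c) : ?G" if "c : ?O" for c
 proof -
 have "[(c, 1)] : W" "L1 [(c, 1)] = c" "L2 [(c, 1)] = ph1 c" using that by (auto simp: W_def L1_def L2_def ucn_hom)
 thus ?thesis by force
 qed
 moreover have "(ucn e, e) : ?G" for e
 proof -
 have "[(1, e)] : W" "L1 [(1, e)] = ucn e" "L2 [(1, e)] = e" using O1 placeD(2)[OF P(1)] by (auto simp: W_def L1_def L2_def)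
 thus ?thesis by force
 qed
 ultimately show ?thesis using that A by blast
qed

text \<open>c0 is a coefficient of largest pole among all of them. After division one coefficient
  reduces to 1, and the independence of B over K prevents the reduced combination from
  cancelling.\<close>

lemma gauss_max:
 fixes K :: "'a::alg_closed_field set" and A1 :: "('i, 'a) ultra set"
 assumes K: "sfd K" and P: "place K A1 ph1" "place UNIV A Ph" "ALL c:A1 Int cstar K. c : A & Ph c = ph1 c" "ALL e. ucn e : A & Ph (ucn e) = e"
 and B: "finite B" "lind K B" and c: "ALL v:J. ALL b:B. c v b : cstar K" and J: "finite J" "EX v:J. (SUM b:B. c v b * ucn b) ~= 0"
 obtains c0 where "c0 ~= 0" "ALL v:J. ALL b:B. c v b / c0 : A1 Int cstar K" "EX v:J. Ph (SUM b:B. c v b / c0 * ucn b) ~= 0"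
proof -
 have "EX i:J \<times> B. (%(v, b). c v b) i ~= 0"
 proof (rule ccontr)
 assume "\<not> ?thesis"
 hence "ALL v:J. (SUM b:B. c v b * ucn b) = 0" by (auto intro!: sum.neutral)
 thus False using J(2) by blast
 qed
 then obtain i where i: "i : J \<times> B" "(%(v, b). c v b) i ~= 0" "ALL j:J \<times> B. (%(v, b). c v b) j / (%(v, b). c v b) i : A1"
 using place_max[OF P(1), of "J \<times> B" "%(v, b). c v b"] J(1) B(1) by blast
 obtain v0 b0 where vb: "i = (v0, b0)" "v0 : J" "b0 : B" using i(1) by blast
 define c0 where "c0 = c v0 b0"
 have c0: "c0 ~= 0" "c0 : cstar K" using i(2) vb c by (auto simp: c0_def)
 have O: "c v b / c0 : A1 Int cstar K" if "v : J" "b : B" for v b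
 using i(3) that c c0(2) sfdD(3)[OF cstar_ops(1)[OF K]] by (force simp: vb c0_def)
 have mem: "c v0 b / c0 * ucn b : A" if "b : B" for b using O[OF vb(2) that] P(3,4) srgD(4)[OF placeD(1)[OF P(2)]] by blast
 have "Ph (SUM b:B. c v0 b / c0 * ucn b) = (SUM b:B. Ph (c v0 b / c0 * ucn b))" by (rule place_sum[OF P(2) mem])
 also have "\<dots> = (SUM b:B. ph1 (c v0 b / c0) * b)"
 proof (rule sum.cong[OF refl])
 fix b assume "b : B"
 hence o: "c v0 b / c0 : A1 Int cstar K" using O[OF vb(2)] by blast
 thus "Ph (c v0 b / c0 * ucn b) = ph1 (c v0 b / c0) * b" using placeD(4)[OF P(2), of "c v0 b / c0" "ucn b"] P(3,4) by metis
 qed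
 finally have e: "Ph (SUM b:B. c v0 b / c0 * ucn b) = (SUM b:B. ph1 (c v0 b / c0) * b)" .
 have "Ph (SUM b:B. c v0 b / c0 * ucn b) ~= 0"
 proof
 assume "Ph (SUM b:B. c v0 b / c0 * ucn b) = 0"
 hence z: "(SUM b:B. ph1 (c v0 b / c0) * b) = 0" using e by simp
 have "ALL b:B. ph1 (c v0 b / c0) : K" using O[OF vb(2)] placeD(5)[OF P(1)] by blast
 hence "ph1 (c v0 b0 / c0) = 0" by (rule lindD[OF B(2) _ z vb(3)])
 thus False using c0(1) placeD(2)[OF P(1)] by (simp add: c0_def)
 qed
 thus ?thesis using that[OF c0(1)] O vb(2) by blast
qed

text \<open>Rescaling the coordinates of a point does not change a pulled back form. The coordinates
  can thus be normalized to have a limit at any place of the nonstandard constants, whereas a form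
  with a nonstandard coefficient would keep its pole.\<close>

theorem rigidity:
 fixes h :: "complex => 'a::{field_char_0,alg_closed_field}" and xe :: "nat => 'v => 'a"
 assumes g: "!!n. gpoint k V h (xe n)" and I: "hom_ideal V \<subseteq> MP k (coords V)" "ALL F:hom_ideal V. ALL e. hpt e F : hom_ideal V"
 and G: "gt_data k V m q E om et" and s: "ALL s:SS. s : psec k V m" "finite SS"
 and dl: "ALL i<variety_dim k V. der (dl i) & (ALL c:alg_closure_in_C k. dl i (h c) = 0)"
 and B: "finite B" "lind (h ` kbar k) B"
 and x: "ALL n. ALL v:coords V. xe n v : lspan (h ` kbar k) B" and nz: "ALL n. EX v:coords V. xe n v ~= 0"
 and b: "ALL n. ALL s:SS. gpoint.bv k V h (xe n) m q E s dl : lspan (h ` kbar k) B"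
 and hv: "y : hv k V"
 shows "EX n n'. n < n' & (ALL s:SS. gpoint.bv k V h (xe n) m q E s dl = gpoint.bv k V h (xe n') m q E s dl)"
proof -
 let ?ka = "kbar k" let ?d = "variety_dim k V"
 interpret g0: gpoint k V h "xe 0" by (rule g)
 have kk: "acl ?ka" "k <= ?ka" using alg_closure_acl[OF g0.kf] by auto
 have K: "acl (h ` ?ka)" by (rule acl_image[OF g0.ch kk(1)])
 have Ks: "sfd (h ` ?ka)" using K by (simp add: acl_def)
 \<comment> \<open>The index S carries the member of the sequence with number \<open>Max S\<close>.
   Since almost every S is finite and contains any given number, almost all indices lie beyond any
   bound.\<close>
 define sg :: "nat set => nat" where "sg S = Max S" for S
 define be where "be n s = gpoint.bv k V h (xe n) m q E s dl" for n s
 define ga where "ga n s = crd (h ` ?ka) B (be n s)" for n s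
 define c where "c n v = crd (h ` ?ka) B (xe n v)" for n v
 have ga: "ALL b:B. ga n s b : h ` ?ka" "be n s = (SUM b:B. ga n s b * b)" if "s : SS" for n s
 using crd[of "be n s" "h ` ?ka" B] b that unfolding ga_def be_def by blast+
 have c: "ALL b:B. c n v b : h ` ?ka" "xe n v = (SUM b:B. c n v b * b)" if "v : coords V" for n v
 using crd[of "xe n v" "h ` ?ka" B] x that unfolding c_def by blast+
 define gas where "gas s b = uabs (%S. ga (sg S) s b)" for s b
 define cs where "cs v b = uabs (%S. c (sg S) v b)" for v b
 have gasK: "gas s b : cstar (h ` ?ka)" if "s : SS" "b : B" for s b using ga(1)[OF that(1)] that(2) unfolding gas_def cstar_def by blast
 have csK: "cs v b : cstar (h ` ?ka)" if "v : coords V" "b : B" for v b using c(1)[OF that(1)] that(2) unfolding cs_def cstar_def by blast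
 define xes where "xes v = uabs (%S. xe (sg S) v)" for v
 define bes where "bes s = uabs (%S. be (sg S) s)" for s
 have bes: "bes s = (SUM b:B. gas s b * ucn b)" if "s : SS" for s
 unfolding bes_def gas_def ucn_def uabs_ops uabs_sum using ga(2)[OF that] by simp
 have xes: "xes v = (SUM b:B. cs v b * ucn b)" if "v : coords V" for v
 unfolding xes_def cs_def ucn_def uabs_ops uabs_sum using c(2)[OF that] by simp
 have gs: "gpoint k V (%c. ucn (h c)) xes" "gpoint.bv k V (%c. ucn (h c)) xes m q E s (%i. umap (dl i)) = bes s" for s
 using gpoint_ultra(1)[of k V h "%S. xe (sg S)", OF g] gpoint_ultra(2)[of k V h "%S. xe (sg S)", OF g]
 unfolding xes_def bes_def be_def by simp_all
 have const: "gas s b : ucn ` h ` ?ka" if sb: "s : SS" "b : B" for s b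
 proof (rule ccontr)
 assume no: "gas s b ~: ucn ` h ` ?ka"
 have ucnh: "phom UNIV (ucn :: 'a => (nat, 'a) ultra)" by (simp add: phom_def srg_UNIV ucn_hom)
 have chu: "chom (%c. ucn (h c) :: (nat, 'a) ultra)" by (rule gpoint.ch[OF gs(1)])
 have "acl ((%c. ucn (h c) :: (nat, 'a) ultra) ` ?ka)" by (rule acl_image[OF chu kk(1)])
 hence acu: "acl ((ucn :: 'a => (nat, 'a) ultra) ` h ` ?ka)" by (simp add: image_image)
 obtain A1 ph1 where P1: "place (h ` ?ka) A1 ph1" "ALL c:h ` ?ka. ucn c : A1 & ph1 (ucn c) = c" "inverse (gas s b) : A1" "ph1 (inverse (gas s b)) = 0"
 by (rule place_trans[OF K ucnh no acl_algb[OF acu]])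
 obtain A Ph where P: "place UNIV A Ph" "ALL c:A1 Int cstar (h ` ?ka). c : A & Ph c = ph1 c" "ALL e. ucn e : A & Ph (ucn e) = e"
 by (rule gauss_place[OF Ks P1(1,2)])
 note A = placeD(1)[OF P(1)]
 have uK: "ucn e : cstar (h ` ?ka)" if "e : h ` ?ka" for e using cstar_ops(2)[OF Ks that] .
 have udl: "der (umap (dl i) :: (nat, 'a) ultra => _)" "e : cstar (h ` ?ka) ==> umap (dl i) (e :: (nat, 'a) ultra) = 0" if i: "i < ?d" for i e
 proof -
 show "der (umap (dl i) :: (nat, 'a) ultra => _)" using umap_der dl i by blast
 assume "e : cstar (h ` ?ka)"
 then obtain f where f: "ALL S. f S : h ` ?ka" "e = uabs f" unfolding cstar_def by blast
 have "dl i (f S) = 0" for S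
 proof -
 have "f S : h ` ?ka" using f(1) by blast
 then obtain e where "e : ?ka" "f S = h e" by blast
 thus ?thesis using dl i by simp
 qed
 thus "umap (dl i) e = 0" by (simp add: f(2) umap_uabs uabs_01)
 qed
 have "EX v:coords V. xes v ~= 0"
 proof (rule ccontr)
 assume "\<not> ?thesis"
 hence "uev (%S. xe (sg S) v = 0)" if "v : coords V" for v using that by (simp add: xes_def uabs_01 uabs_eq)
 hence "uev (%S. ALL v:coords V. xe (sg S) v = 0)" by (rule uev_ball[OF g0.finN])
 moreover have "uev (%S. \<not> (ALL v:coords V. xe (sg S) v = 0))" by (rule uev_True) (use nz in blast)
 ultimately show False using uev_not by blast
 qed
 hence nz2: "EX v:coords V. (SUM b:B. cs v b * ucn b) ~= 0" using xes by auto
 have csJ: "ALL v:coords V. ALL b:B. cs v b : cstar (h ` ?ka)" using csK by blast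
 obtain c1 where c1: "c1 ~= 0" "ALL v:coords V. ALL b:B. cs v b / c1 : A1 Int cstar (h ` ?ka)" "EX v:coords V. Ph (SUM b:B. cs v b / c1 * ucn b) ~= 0"
 by (rule gauss_max[OF Ks P1(1) P B csJ g0.finN nz2])
 define th where "th v = inverse c1 * xes v" for v
 have th: "th v = (SUM b:B. cs v b / c1 * ucn b)" if "v : coords V" for v
 unfolding th_def xes[OF that] sum_distrib_left by (simp add: divide_inverse mult_ac)
 obtain v where v: "v : coords V" "Ph (th v) ~= 0" using c1(3) th by auto
 have i0: "inverse c1 ~= 0" using c1(1) by simp
 have thc: "ALL v:coords V. th v = inverse c1 * xes v" by (simp add: th_def)
 note gt = gpoint.scale(1)[OF gs(1) i0 thc]
 have bt: "gpoint.bv k V (%c. ucn (h c)) th m q E s (%i. umap (dl i)) = bes s"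
 using gpoint.bv_scale[OF gs(1) i0 thc G _ hv, of s "%i. umap (dl i)"] s(1) sb(1) gs(2) by simp
 have mem: "cs v b / c1 * ucn b : A" if "v : coords V" "b : B" for v b using c1(2) that P(2,3) srgD(4)[OF A] by blast
 have thA: "ALL v:coords V. th v : A"
 proof
 fix v assume v: "v : coords V"
 show "th v : A" unfolding th[OF v] by (rule srg_sum[OF A mem[OF v]])
 qed
 \<comment> \<open>The extended derivations kill the nonstandard constants and so act only on the
   standard basis vectors. No pole arises from differentiation, and \<open>section_bound\<close>
   applies with denominator 1.\<close>
 have thD: "1 * umap (dl i) (th v) : A" if i: "i < ?d" and v: "v : coords V" for i v
 proof -
 have u: "umap (dl i) (ucn b :: (nat, 'a) ultra) = ucn (dl i b)" for b by (simp add: ucn_def umap_uabs)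
 have "umap (dl i) (th v) = (SUM b:B. umap (dl i) (cs v b / c1 * ucn b))" unfolding th[OF v] by (rule der_sum[OF udl(1)[OF i]])
 also have "\<dots> = (SUM b:B. cs v b / c1 * ucn (dl i b))"
 proof (rule sum.cong[OF refl])
 fix b assume "b : B"
 hence "umap (dl i) (cs v b / c1) = 0" using udl(2)[OF i] c1(2) v by blast
 thus "umap (dl i) (cs v b / c1 * ucn b) = cs v b / c1 * ucn (dl i b)" unfolding derD(2)[OF udl(1)[OF i]] u by simp
 qed
 also have "\<dots> : A" by (rule srg_sum[OF A]) (use c1(2) v P(2,3) srgD(4)[OF A] in blast)
 finally show ?thesis by simp
 qed
 have "1 ^ (?d * m) * gpoint.bv k V (%c. ucn (h c)) th m q E s (%i. umap (dl i)) : A"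
 proof (rule gpoint.section_bound[OF gt I g0.ch place_phom[OF P(1)] _ _ thA v _ srgD(1)[OF A] _ G])
 show "ALL x:A. Ph x ~= 0 --> inverse x : A" using placeD(10)[OF P(1)] by blast
 show "ALL c:k. ucn (h c) : A & Ph (ucn (h c)) = h c" using P(3) by blast
 show "der (umap (dl i) :: (nat, 'a) ultra => _) & (ALL c:k. umap (dl i) (ucn (h c) :: (nat, 'a) ultra) = 0)" if "i < ?d" for i
 using udl[OF that] uK kk(2) by blast
 show "ALL i<?d. ALL v:coords V. 1 * umap (dl i) (th v) : A" using thD by blast
 show "s : psec k V m" using s(1) sb(1) by blast
 qed
 hence bA: "bes s : A" using bt by simp
 have "gas s b ~= 0" using no ucn_hom(3) srgD(2)[OF sfdD(1)[OF Ks]] by (metis imageI)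
 hence "EX v:{()}. (SUM b:B. gas s b * ucn b) ~= 0" using cstar_lind[OF B, of "gas s"] gasK[OF sb(1)] sb(2) by blast
 have "ALL v:{()}. ALL b:B. gas s b : cstar (h ` ?ka)" using gasK[OF sb(1)] by blast
 have nz3: "EX v:{()}. (SUM b:B. gas s b * ucn b) ~= 0" by fact
 have K3: "ALL v:{()}. ALL b:B. gas s b : cstar (h ` ?ka)" by fact
 have f3: "finite {()}" by simp
 obtain c2 where c2: "c2 ~= 0" "ALL v:{()}. ALL b:B. gas s b / c2 : A1 Int cstar (h ` ?ka)" "EX v:{()}. Ph (SUM b:B. gas s b / c2 * ucn b) ~= 0"
 by (rule gauss_max[OF Ks P1(1) P B K3 f3 nz3])
 have g2: "gas s b / c2 : A1 Int cstar (h ` ?ka)" using c2(2) sb(2) by blast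
 \<comment> \<open>The normalizing factor c2 has at least the pole of the coefficient
   \<open>gas s b\<close>, so its inverse reduces to 0. Regularity of \<open>bes s\<close> would
   then force the normalized sum to reduce to 0.\<close>
 have e1: "inverse c2 = inverse (gas s b) * (gas s b / c2)" using \<open>gas s b ~= 0\<close> by (simp add: field_simps)
 have ic: "inverse c2 : A1" "ph1 (inverse c2) = 0" unfolding e1
 using placeD(4)[OF P1(1,3) IntD1[OF g2]] srgD(4)[OF placeD(1)[OF P1(1)] P1(3) IntD1[OF g2]] P1(4) by (simp_all only: mult_zero_left)
 have "inverse c2 : cstar (h ` ?ka)" unfolding e1
 using srgD(4)[OF sfdD(1)[OF cstar_ops(1)[OF Ks]]] sfdD(2)[OF cstar_ops(1)[OF Ks] gasK[OF sb]] g2 by blast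
 hence i2: "inverse c2 : A" "Ph (inverse c2) = 0" using P(2) ic by auto
 have "(SUM b:B. gas s b / c2 * ucn b) = bes s * inverse c2" unfolding bes[OF sb(1)] sum_distrib_right by (simp add: divide_inverse mult_ac)
 hence "Ph (SUM b:B. gas s b / c2 * ucn b) = 0" using placeD(4)[OF P(1) bA i2(1)] i2(2) by simp
 thus False using c2(3) by blast
 qed
 have "EX e. uev (%S. be (sg S) s = e)" if s: "s : SS" for s
 proof -
 have "ALL b:B. EX e. gas s b = ucn e" using const[OF s] by blast
 then obtain f where f: "ALL b:B. gas s b = ucn (f b)" using bchoice[of B "%b e. gas s b = ucn e"] by blast
 have "bes s = (SUM b:B. ucn (f b) * ucn b)" unfolding bes[OF s] by (rule sum.cong) (use f in auto)
 hence "bes s = uabs (%_. SUM b:B. f b * b)" by (simp add: ucn_def uabs_ops uabs_sum)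
 hence "uev (%S. be (sg S) s = (SUM b:B. f b * b))" unfolding bes_def uabs_eq .
 thus ?thesis by blast
 qed
 then obtain f where "ALL s:SS. uev (%S. be (sg S) s = f s)" using bchoice[of SS "%s e. uev (%S. be (sg S) s = e)"] by blast
 hence u: "uev (%S. ALL s:SS. be (sg S) s = f s)" by (intro uev_ball[OF s(2)]) blast
 have ne: "EX S. Q S" if "uev Q" for Q :: "nat set => bool" using uev_mono[OF that, of "%_. False"] by auto
 obtain S1 where S1: "ALL s:SS. be (sg S1) s = f s" using ne[OF u] by blast
 \<comment> \<open>Demanding that \<open>Suc (sg S1)\<close> belongs to the new index makes its
   maximum larger than \<open>sg S1\<close>.\<close>
 have "uev (%S. ((ALL s:SS. be (sg S) s = f s) & Suc (sg S1) : S) & finite S)" by (intro uev_conj u uev_mem uev_finite)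
 from ne[OF this] obtain S2 where S2: "ALL s:SS. be (sg S2) s = f s" "Suc (sg S1) : S2" "finite S2" by blast
 have "sg S1 < sg S2" using Max_ge[OF S2(3,2)] by (simp add: sg_def)
 thus ?thesis using S1 S2(1) unfolding be_def by (intro exI[of _ "sg S1"] exI[of _ "sg S2"]) simp
qed

section \<open>Dominant morphisms and generic points\<close>

text \<open>One polynomial representation of a morphism on the locus where it is defined; nothing is
  demanded at points where all \<open>F w\<close> vanish.\<close>

definition mrep :: "complex set => 'z proj_subscheme => 'u proj_subscheme => (('z => complex) set => ('u => complex) set) => nat =>
 ('u => 'z mpoly) => bool" where
 "mrep k Z U g e F \<longleftrightarrow> (ALL w:coords U. F w : MP k (coords Z) & hmg e (F w)) &
 (ALL y:hom_vectors k Z. (EX w:coords U. meval y (F w) ~= 0) -->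
 g (ppt k y) = ppt k (%w. if w : coords U then meval y (F w) else 0))"

lemma morphism_mrep:
 "morphism_over k Z U g \<longleftrightarrow> g : points k Z \<rightarrow> points k U &
 (ALL x:hom_vectors k Z. EX e F. mrep k Z U g e F & (EX w:coords U. meval x (F w) ~= 0))"
 unfolding morphism_over_def mrep_def by (simp only: conj_ac)

lemma proj_point_self: "sfd k ==> x : ppt k x"
 using srgD(1)[OF sfdD(1)] alg_closure_acl(2)[of k] unfolding proj_point_def by (intro CollectI exI[of _ 1]) force

lemma mrep_point:
 assumes k: "sfd k" and g: "g : points k Z \<rightarrow> points k U" and F: "mrep k Z U g e F"
 and y: "y : hv k Z" "w : coords U" "meval y (F w) ~= 0"
 shows "EX u:hom_vectors k U. EX c. c ~= 0 & (ALL w:coords U. meval y (F w) = c * u w) & g (ppt k y) = ppt k u"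
proof -
 let ?f = "%w. if w : coords U then meval y (F w) else 0"
 have e: "g (ppt k y) = ppt k ?f" using F y unfolding mrep_def by blast
 have "ppt k y : points k Z" using y(1) unfolding points_def by blast
 hence "g (ppt k y) : points k U" using g by blast
 then obtain u where u: "u : hv k U" "g (ppt k y) = ppt k u" unfolding points_def by blast
 have "?f : ppt k u" using proj_point_self[OF k, of ?f] e u(2) by simp
 then obtain c where c: "c ~= 0" "?f = (%v. c * u v)" unfolding proj_point_def by blast
 have "ALL w:coords U. meval y (F w) = c * u w" using fun_cong[OF c(2)] by metis
 thus ?thesis using u c(1) by blast
qed

lemma meval_msubst: "meval y (msubst F A) = meval (%w. meval y (F w)) A"
 unfolding meval_ins by (rule ins_msubst[OF chom_id])

lemma meval_scale:
 assumes "A : MP k N" "hmg e A" "ALL w:N. y w = c * u w" shows "meval y A = c ^ e * meval u A"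
proof -
 have "meval y A = meval (%w. c * u w) A" unfolding meval_ins by (rule ins_cong[OF assms(1)]) (use assms(3) in auto)
 thus ?thesis unfolding meval_ins using ins_hmg[OF assms(2)] by metis
qed

text \<open>The point \<open>ze\<close> is generic for all polynomials over the algebraic closure,
  homogeneous or not, so it is generic on the affine cone. For the ideal of \<open>Z\<close> only
  the vanishing of homogeneous parts at points is assumed, because \<open>Z\<close> will be a Segre
  product whose ideal is given as a kernel.\<close>

locale kod =
 fixes k :: "complex set" and Z :: "'z proj_subscheme" and U :: "'u proj_subscheme"
 and h :: "complex => 'a::{field_char_0,alg_closed_field}" and ze :: "'z => 'a"
 assumes kf: "sfd k" and ch: "chom h" and finZ: "finite (coords Z)" and IZ: "hom_ideal Z \<subseteq> MP k (coords Z)"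
 and hZ: "!!F e x. F : hom_ideal Z ==> x : hv k Z ==> meval x (hpt e F) = 0"
 and gen: "!!F. F : MP (kbar k) (coords Z) ==> ins h ze F = 0 \<longleftrightarrow> (ALL x:hom_vectors k Z. meval x F = 0)"
 and finU: "finite (coords U)" and IU: "hom_ideal U \<subseteq> MP k (coords U)"
 and hU: "ALL F:hom_ideal U. ALL e. hpt e F : hom_ideal U"
begin

abbreviation "ka \<equiv> kbar k"
abbreviation "xi F \<equiv> (%w. ins h ze (F w))"

lemma ks: "srg k" using kf by (rule sfdD)
lemma kka: "k \<subseteq> ka" by (rule alg_closure_acl(2)[OF kf])
lemma kaacl: "acl ka" by (rule alg_closure_acl(1)[OF kf])
lemma kas: "srg ka" using kaacl by (simp add: acl_def sfd_def)
lemma MPka: "F : MP k N ==> F : MP ka N" using MP_mono[OF kka order_refl] by blast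

lemma gen_k: "F : MP k (coords Z) ==> ins h ze F = 0 \<longleftrightarrow> (ALL x:hom_vectors k Z. meval x F = 0)"
 by (rule gen[OF MPka])

lemma mrepD: "mrep k Z U g e F ==> w : coords U ==> F w : MP k (coords Z)" "mrep k Z U g e F ==> w : coords U ==> hmg e (F w)"
 unfolding mrep_def by auto

text \<open>Where both representations are defined they give the same point, so the minor vanishes;
  at all other points it vanishes because one of the two is 0.\<close>

lemma xi_ratio:
 assumes g: "g : points k Z \<rightarrow> points k U" and F: "mrep k Z U g e F" "mrep k Z U g e' F'" and w: "w : coords U" "w' : coords U"
 shows "xi F w * xi F' w' = xi F w' * xi F' w"
proof -
 let ?P = "F w * F' w' - F w' * F' w"
 have P: "?P : MP k (coords Z)"
 by (intro srgD(4,6)[OF MP_srg[OF ks]] mrepD(1)[OF F(1)] mrepD(1)[OF F(2)] w)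
 have "meval x ?P = 0" if x: "x : hv k Z" for x
 proof (cases "(EX w:coords U. meval x (F w) ~= 0) & (EX w:coords U. meval x (F' w) ~= 0)")
 case True
 then obtain w1 w2 where ww: "w1 : coords U" "meval x (F w1) ~= 0" "w2 : coords U" "meval x (F' w2) ~= 0" by blast
 obtain u c where u: "c ~= 0" "ALL w:coords U. meval x (F w) = c * u w" "g (ppt k x) = ppt k u"
 using mrep_point[OF kf g F(1) x ww(1,2)] by blast
 obtain u' c' where u': "c' ~= 0" "ALL w:coords U. meval x (F' w) = c' * u' w" "g (ppt k x) = ppt k u'"
 using mrep_point[OF kf g F(2) x ww(3,4)] by blast
 have "u : ppt k u'" using proj_point_self[OF kf, of u] u(3) u'(3) by simp
 then obtain b where "u = (%v. b * u' v)" unfolding proj_point_def by blast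
 thus ?thesis using u(2) u'(2) w by (simp add: meval_ins ins_ops(1)[OF chom_id] ins_mult[OF chom_id])
 next
 case False
 hence "(ALL w:coords U. meval x (F w) = 0) \<or> (ALL w:coords U. meval x (F' w) = 0)" by blast
 thus ?thesis using w by (auto simp: meval_ins ins_ops(1)[OF chom_id] ins_mult[OF chom_id])
 qed
 hence "ins h ze ?P = 0" using gen_k[OF P] by blast
 thus ?thesis by (simp add: ins_ops(1)[OF ch] ins_mult[OF ch])
qed

lemma xi_proportional:
 assumes g: "g : points k Z \<rightarrow> points k U" and F: "mrep k Z U g e F" "mrep k Z U g e' F'"
 and w: "w : coords U" "xi F w ~= 0" "w' : coords U" "xi F' w' ~= 0"
 shows "EX c. c ~= 0 & (ALL v:coords U. xi F' v = c * xi F v)"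
proof -
 have "xi F w * xi F' w' = xi F w' * xi F' w" by (rule xi_ratio[OF g F w(1,3)])
 hence n: "xi F' w ~= 0" using w(2,4) by auto
 have "xi F' v = (xi F' w / xi F w) * xi F v" if "v : coords U" for v
 using xi_ratio[OF g F w(1) that] w(2) by (simp add: field_simps)
 moreover have "xi F' w / xi F w ~= 0" using n w(2) by simp
 ultimately show ?thesis by blast
qed

text \<open>Density of the image in terms of equations: no homogeneous polynomial outside the ideal
  of \<open>U\<close> vanishes on the whole image.\<close>

definition dominant where "dominant g \<longleftrightarrow> (ALL A e. A : MP k (coords U) --> hmg e A --> A ~: hom_ideal U -->
 (EX x:hom_vectors k Z. EX y:g (ppt k x). meval y A ~= 0))"

lemma MP_msub: "mrep k Z U g e F ==> A : MP k (coords U) ==> msubst F A : MP k (coords Z)"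
 by (rule MP_msubst[OF ks]) (use mrepD(1) in auto)

lemma ins_msub: "ins h (xi F) A = ins h ze (msubst F A)" by (rule ins_msubst[OF ch, symmetric])

text \<open>The representation F may be undefined at the point that witnesses dominance for A.
  Another representation is defined there, and the two are proportional at the generic
  point.\<close>

lemma gpoint_xi:
 assumes g: "morphism_over k Z U g" "dominant g" and F: "mrep k Z U g e F" and w: "w : coords U" "xi F w ~= 0"
 shows "gpoint k U h (xi F)"
proof (unfold_locales)
 have gp: "g : points k Z \<rightarrow> points k U" using g(1) by (simp add: morphism_mrep)
 fix e' A assume A: "A : MP k (coords U)" "hmg e' A"
 note FM = mrepD(1)[OF F w(1)] and AM = MP_msub[OF F A(1)]
 show "ins h (xi F) A = 0 \<longleftrightarrow> A : hom_ideal U"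
 proof
 assume AI: "A : hom_ideal U"
 \<comment> \<open>The factor \<open>F w\<close> takes care of points where the representation gives
   no information; it is cancelled at the generic point.\<close>
 have "meval x (msubst F A * F w) = 0" if x: "x : hv k Z" for x
 proof (cases "meval x (F w) = 0")
 case False
 obtain u c where u: "u : hv k U" "ALL w:coords U. meval x (F w) = c * u w" using mrep_point[OF kf gp F x w(1) False] by blast
 have "meval (%w. meval x (F w)) A = c ^ e' * meval u A" by (rule meval_scale[OF A u(2)])
 moreover have "meval u A = 0" using u(1) AI unfolding hom_vectors_def by blast
 ultimately have "meval x (msubst F A) = 0" unfolding meval_msubst by simp
 thus ?thesis by (simp add: meval_ins ins_mult[OF chom_id])
 qed (simp add: meval_ins ins_mult[OF chom_id])
 hence "ins h ze (msubst F A * F w) = 0" using gen_k[OF MP_mult[OF ks AM FM]] by blast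
 thus "ins h (xi F) A = 0" using w(2) by (simp add: ins_mult[OF ch] ins_msub)
 next
 assume z: "ins h (xi F) A = 0"
 show "A : hom_ideal U"
 proof (rule ccontr)
 assume "A ~: hom_ideal U"
 then obtain x y where x: "x : hv k Z" "y : g (ppt k x)" "meval y A ~= 0" using g(2) A unfolding dominant_def by blast
 obtain e1 F' w' where F': "mrep k Z U g e1 F'" "w' : coords U" "meval x (F' w') ~= 0" using g(1) x(1) unfolding morphism_mrep by blast
 have "g (ppt k x) = ppt k (%w. if w : coords U then meval x (F' w) else 0)" using F' x(1) unfolding mrep_def by blast
 then obtain c where "y = (%v. c * (if v : coords U then meval x (F' v) else 0))" using x(2) unfolding proj_point_def by blast
 hence "ALL w:coords U. y w = c * meval x (F' w)" by simp
 hence "meval y A = c ^ e' * meval (%w. meval x (F' w)) A" by (rule meval_scale[OF A])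
 hence nz: "meval x (msubst F' A) ~= 0" using x(3) unfolding meval_msubst by auto
 note AM' = MP_msub[OF F'(1) A(1)] and FM' = mrepD(1)[OF F'(1,2)]
 have "ins h ze (msubst F' A) ~= 0" "ins h ze (F' w') ~= 0" using gen_k[OF AM'] gen_k[OF FM'] nz F'(3) x(1) by blast+
 then obtain c' where c': "c' ~= 0" "ALL v:coords U. xi F' v = c' * xi F v" using xi_proportional[OF gp F F'(1) w F'(2)] by blast
 have "ins h (xi F') A = ins h (%v. c' * xi F v) A" by (rule ins_cong[OF A(1)]) (use c'(2) in auto)
 hence "ins h (xi F') A = 0" using z ins_hmg[OF A(2), of h c' "xi F"] by simp
 thus False using \<open>ins h ze (msubst F' A) ~= 0\<close> by (simp add: ins_msub)
 qed
 qed
qed (rule kf ch finU)+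

end

section \<open>Relations between coordinates and independent functions\<close>

context gpoint
begin

lemma eval_zero_iff:
 assumes "TT \<subseteq> carrier K" "P : MP k TT" shows "ins h ev P = 0 \<longleftrightarrow> ff_eval k V P = \<zero>\<^bsub>K\<^esub>"
proof -
 note e = ev_ff_eval[OF assms]
 show ?thesis using e ev_inj[of "ff_eval k V P" "\<zero>\<^bsub>K\<^esub>"] K_zero by auto
qed

text \<open>The coefficients are polynomials in T rather than field elements, so that the same
  relation can be read at every other generic point.\<close>

lemma alg_relation:
 assumes T: "T \<subseteq> carrier K" "finite T" "alg_independent k V T" "card T = d" and r: "r : carrier K"
 shows "EX s F. s > 0 & (ALL i<=s. F i : MP k T) & (SUM i<=s. ins h ev (F i) * ev r ^ i) = 0 & ins h ev (F s) ~= 0"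
proof -
 have "algb (srgn (h ` k Un ev ` T)) (ev r)" by (rule algb_clear[OF max_indep_algb[OF T r]])
 then obtain p where p: "p : PA (srgn (h ` k Un ev ` T))" "p ~= 0" "poly p (ev r) = 0" unfolding algb_def by blast
 have "ALL i. EX F. F : MP k T & cof p i = ins h ev F" using PA_D[OF p(1)] evT_srgn[of T] by blast
 then obtain F where F: "ALL i. F i : MP k T & cof p i = ins h ev (F i)" using choice[of "%i F. F : MP k T & cof p i = ins h ev F"] by blast
 have "degree p > 0"
 proof (rule ccontr)
 assume "\<not> degree p > 0"
 then obtain c where "p = [:c:]" by (metis degree_eq_zeroE gr0I)
 thus False using p(2,3) by simp
 qed
 moreover have "(SUM i<=degree p. ins h ev (F i) * ev r ^ i) = 0" using p(3) F by (simp add: poly_altdef)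
 moreover have "ins h ev (F (degree p)) ~= 0" using F p(2) by (metis leading_coeff_0_iff)
 ultimately show ?thesis using F by blast
qed

end

context tbasis
begin

lemma sep_y: "poly (pderiv m) y ~= 0"
 by (rule minpoly_separable[OF F0s(1) minpD(1-4)[OF min]]) (use minpD(3,5,6)[OF min] in blast)+

text \<open>Differentiating the minimal equation of y expresses the derivative of y rationally in y,
  with the nonzero denominator \<open>poly (pderiv m) y\<close>.\<close>

lemma D_L: assumes t: "t : T" and x: "x : L" shows "D t x : L"
proof -
 let ?S = "{x : L. D t x : L}"
 note d = derD[OF derT[OF t]]
 have S: "sfd ?S" unfolding sfd_def srg_def
 proof (intro conjI ballI)
 show "1 : ?S" using srgD(1,2)[OF Ls(2)] d(4) by simp
 fix a b assume a: "a : ?S" and b: "b : ?S"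
 show "a + b : ?S" "a * b : ?S" using a b srgD(3,4)[OF Ls(2)] d(1,2) by simp_all
 next
 fix a assume a: "a : ?S"
 show "- a : ?S" using a srgD(5)[OF Ls(2)] d(5) by simp
 have "- D t a / a\<^sup>2 : L" using a sfdD(3)[OF Ls(1)] srgD(5,7)[OF Ls(2)] by blast
 thus "inverse a : ?S" using a sfdD(2)[OF Ls(1)] der_inverse[OF derT[OF t]] by simp
 qed
 have F0S: "F0 <= ?S" using D_F0[OF t] F0L by blast
 have yL: "y : L" using sfg_super[of "F0 Un {y}"] by blast
 have mp: "m : PA L" using minpD(1)[OF min] PA_mono[OF F0L] by blast
 have "map_poly (D t) m : PA L" using D_F0[OF t PA_D[OF minpD(1)[OF min]]] F0L by (auto simp: PA_def coeff_map_poly d(3))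
 hence 1: "poly (map_poly (D t) m) y : L" by (rule poly_in_srg[OF Ls(2) _ yL])
 have 2: "poly (pderiv m) y : L" by (rule poly_in_srg[OF Ls(2) PA_pderiv[OF Ls(2) mp] yL])
 have "0 = poly (map_poly (D t) m) y + poly (pderiv m) y * D t y" using der_poly[OF derT[OF t], of m y] minpD(3)[OF min] d(3) by simp
 hence "poly (pderiv m) y * D t y = - poly (map_poly (D t) m) y" by (simp add: eq_neg_iff_add_eq_0 add.commute)
 hence "D t y = (- poly (map_poly (D t) m) y) / poly (pderiv m) y" using sep_y by (simp add: field_simps)
 hence "D t y : L" using sfdD(3)[OF Ls(1) srgD(5)[OF Ls(2) 1] 2] by simp
 hence "F0 Un {y} <= ?S" using F0S yL by blast
 thus ?thesis using sfg_least[OF S] x by blast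
qed

definition bddA :: "(nat => 'a) => bool" where "bddA B \<longleftrightarrow> (ALL PP RR. dclass PP RR --> bdd PP RR B) & (ALL n. B n : L)"

lemma bddA_single: "x : L ==> bddA (%_. x)" unfolding bddA_def using bdd_single by blast

lemma bddA_ops: assumes "bddA f" "bddA g" shows "bddA (%n. f n + g n)" "bddA (%n. f n * g n)"
proof -
 have f: "f n : L" "g n : L" for n using assms unfolding bddA_def by blast+
 show "bddA (%n. f n + g n)" "bddA (%n. f n * g n)" unfolding bddA_def
 proof (safe intro!: srgD(3,4)[OF Ls(2)] f)
 fix PP RR assume C: "dclass PP RR"
 hence "bdd PP RR f" "bdd PP RR g" using assms unfolding bddA_def by blast+
 thus "bdd PP RR (%n. f n + g n)" "bdd PP RR (%n. f n * g n)" by (rule bdd_ops[OF C])+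
 qed
qed

lemma bddA_prod: assumes "finite I" "!!i. i : I ==> bddA (f i)" shows "bddA (%n. PROD i:I. f i n)"
 using assms
proof (induct I rule: finite_induct)
 case empty
 thus ?case using bddA_single[OF srgD(1)[OF Ls(2)]] by simp
next
 case (insert a I)
 have "bddA (%n. f a n * (PROD i:I. f i n))" by (rule bddA_ops(2)) (use insert in auto)
 thus ?case using insert(1,2) by simp
qed

lemma bddA_power: assumes "bddA f" shows "bddA (%n. f n ^ e)"
proof (induct e)
 case 0
 thus ?case using bddA_single[OF srgD(1)[OF Ls(2)]] by simp
next
 case (Suc e)
 show ?case using bddA_ops(2)[OF assms Suc] by simp
qed

lemma bddA_integral:
 assumes c: "!!i. i < s ==> bddA (c i)" and x: "!!n. x n : L" and e: "!!n. x n ^ s + (SUM i<s. c i n * x n ^ i) = 0"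
 shows "bddA x"
 unfolding bddA_def
proof (intro conjI allI impI x)
 fix PP RR assume C: "dclass PP RR"
 show "bdd PP RR x" by (rule bdd_integral[OF C _ x e]) (use c C in \<open>auto simp: bddA_def\<close>)
qed

text \<open>Multiplying the relation by \<open>c s n ^ (s - 1)\<close> turns it into a monic
  equation for \<open>c s n * x n\<close> of the same degree for all n.\<close>

lemma bddA_root:
 assumes s: "s > 0" and c: "!!i. i <= s ==> bddA (c i)" and x: "!!n. x n : L" and e: "!!n. (SUM i<=s. c i n * x n ^ i) = 0"
 shows "bddA (%n. c s n * x n)"
proof (rule bddA_integral)
 fix i assume "i < s"
 show "bddA (%n. c i n * c s n ^ (s - 1 - i))" by (rule bddA_ops(2)[OF c bddA_power[OF c]]) (use \<open>i < s\<close> in auto)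
next
 fix n
 have "c s n : L" using c[OF order_refl] unfolding bddA_def by blast
 thus "c s n * x n : L" by (rule srgD(4)[OF Ls(2) _ x])
 have p: "c s n ^ s = c s n ^ (s - 1) * c s n" using s by (metis power_minus_mult)
 have "(SUM i<s. (c i n * c s n ^ (s - 1 - i)) * (c s n * x n) ^ i) = (SUM i<s. c s n ^ (s - 1) * (c i n * x n ^ i))"
 proof (rule sum.cong[OF refl])
 fix i assume "i : {..<s}"
 hence "c s n ^ (s - 1) = c s n ^ (s - 1 - i) * c s n ^ i" by (simp flip: power_add)
 thus "(c i n * c s n ^ (s - 1 - i)) * (c s n * x n) ^ i = c s n ^ (s - 1) * (c i n * x n ^ i)" by (simp add: power_mult_distrib mult_ac)
 qed
 also have "\<dots> = c s n ^ (s - 1) * (SUM i<s. c i n * x n ^ i)" by (simp add: sum_distrib_left)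
 finally have 1: "(SUM i<s. (c i n * c s n ^ (s - 1 - i)) * (c s n * x n) ^ i) = c s n ^ (s - 1) * (SUM i<s. c i n * x n ^ i)" .
 have "(SUM i<=s. c i n * x n ^ i) = (SUM i<s. c i n * x n ^ i) + c s n * x n ^ s" by (simp flip: lessThan_Suc_atMost)
 hence 2: "(SUM i<s. c i n * x n ^ i) = - (c s n * x n ^ s)" using e[of n] by (simp add: eq_neg_iff_add_eq_0)
 show "(c s n * x n) ^ s + (SUM i<s. (c i n * c s n ^ (s - 1 - i)) * (c s n * x n) ^ i) = 0"
 unfolding 1 unfolding 2 power_mult_distrib p by (simp add: mult_ac)
qed

lemma bddA_span: "bddA B ==> EX XX. finite XX & (ALL n. B n : lspan (h ` ka) XX)"
 by (rule finite_span) (auto simp: bddA_def dclass_fin dclass_inf)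

lemma emb_inj: assumes e: "emb ta" and x: "x : L" "x ~= 0" shows "ta x ~= 0" "ta (inverse x) = inverse (ta x)"
proof -
 show "ta (inverse x) = inverse (ta x)" by (rule phom_inverse[OF embD(4)[OF e] x(1) sfdD(2)[OF Ls(1) x(1)]])
 have "ta x * ta (inverse x) = 1" using embD(2)[OF e x(1) sfdD(2)[OF Ls(1) x(1)]] x(2) phomD(2)[OF embD(4)[OF e]] by simp
 thus "ta x ~= 0" by auto
qed

end

section \<open>Boundedness of pulled back forms\<close>

text \<open>All morphisms \<open>g n\<close> are evaluated at the one generic point of
  \<open>Z\<close>, so their coordinates lie in one field. \<open>I\<close> selects the test
  derivations among the \<open>D t\<close>, the same for every n.\<close>

locale kofam = kod k Z U h ze + tb: tbasis "kbar k" h T ze D y mm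
 for k :: "complex set" and Z :: "'z proj_subscheme" and U :: "'u proj_subscheme"
 and h :: "complex => 'a::{field_char_0,alg_closed_field}" and ze :: "'z => 'a" and T D y mm +
 fixes g :: "nat => ('z => complex) set => ('u => complex) set" and ee :: "nat => nat" and FF :: "nat => 'u => 'z mpoly"
 and m q E om et and y0 :: "'u => complex" and I :: "nat => 'z"
 assumes zL: "ze ` coords Z \<subseteq> tb.L" and hvZ: "hv k Z ~= {}"
 and mor: "!!n. morphism_over k Z U (g n)" and dom: "!!n. dominant (g n)"
 and FF: "!!n. mrep k Z U (g n) (ee n) (FF n)" and FFnz: "!!n. EX w:coords U. xi (FF n) w ~= 0"
 and G: "gt_data k U m q E om et" and y0: "y0 : hv k U" and IT: "!!i. i < variety_dim k U ==> I i : T"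
begin

abbreviation "d \<equiv> variety_dim k U"
abbreviation "xe n \<equiv> xi (FF n)"
abbreviation "evn n \<equiv> gpoint.ev h (xe n)"
abbreviation "KU \<equiv> function_field k U"
abbreviation "dl \<equiv> (%i. D (I i))"
abbreviation "b s n \<equiv> gpoint.bv k U h (xe n) m q E s dl"

lemma gp: "gpoint k U h (xe n)" using FFnz[of n] gpoint_xi[OF mor dom FF] by blast

lemma gpts: "g n : points k Z \<rightarrow> points k U" using mor[of n] by (simp add: morphism_mrep)

lemma kL: "c : k ==> h c : tb.L" using tb.hF0 tb.F0L kka by blast

lemma insL: "F : MP k (coords Z) ==> ins h ze F : tb.L"
 by (rule ins_in[OF tb.Ls(2)]) (use kL zL in auto)

lemma evL: assumes r: "r : carrier KU" shows "evn n r : tb.L"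
proof -
 have "h ` k Un xe n ` coords U <= tb.L" using kL insL mrepD(1)[OF FF] by blast
 thus ?thesis using gpoint.ev_in_sfg[OF gp r] sfg_least[OF tb.Ls(1)] by blast
qed

lemma lderD: assumes i: "i < d" shows "der (dl i) & (ALL c:k. dl i (h c) = 0)"
 using tb.derT[OF IT[OF i]] tb.Dk[OF IT[OF i]] kka by blast

lemma qK: "l < d ==> q l : carrier KU" using gpoint.gt_dataD(1)[OF gp G] by blast

lemma bL: assumes s: "s : psec k U m" shows "b s n : tb.L"
proof -
 interpret gq: gpoint k U h "xe n" by (rule gp)
 have 1: "evn n (s E) : tb.L" by (rule evL[OF gq.section_carrier[OF G s y0]])
 have "dt d (%i l. evn n (E i (q l))) : tb.L"
 by (rule dt_in[OF tb.Ls(2)], rule evL, rule gq.derivation_carrier[OF gq.frame_mem[OF gq.gt_dataD(4)[OF G]] qK])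
 moreover have "dt d (%i l. dl i (evn n (q l))) : tb.L"
 by (rule dt_in[OF tb.Ls(2)]) (rule tb.D_L[OF IT evL[OF qK]])
 ultimately show ?thesis unfolding gq.bv_def gq.wv_def
 using srgD(4)[OF tb.Ls(2) sfdD(3)[OF tb.Ls(1) 1 srgD(7)[OF tb.Ls(2)]] srgD(7)[OF tb.Ls(2)]] by blast
qed

lemma zeta_nz: "EX v:coords Z. ze v ~= 0"
proof -
 obtain x where x: "x : hv k Z" using hvZ by blast
 then obtain v where v: "x v ~= 0" "v : coords Z" unfolding hom_vectors_def by blast
 have "meval x (mvar v) ~= 0" using v(1) by (simp add: meval_ins ins_var[OF chom_id])
 hence "ins h ze (mvar v) ~= 0" using gen_k[OF MP_var[OF ks v(2)]] x by blast
 thus ?thesis using v(2) by (auto simp: ins_var[OF ch])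
qed

text \<open>Divided by one of largest pole, the coordinates of Z reduce to a point and further to a
  geometric point x of Z. A representation F' of \<open>g n\<close> defined at x supplies
  coordinates in the valuation ring, not all reducing to 0. The polynomials in F' have coefficients
  in k, so the denominator Dl for the ratios of coordinates of Z suffices for every n.\<close>

lemma bound_at_place:
 assumes P: "place UNIV A ph" "ALL c:ka. h c : A & ph (h c) = h c" and e: "tb.emb ta" and s: "s : psec k U m"
 and Dl: "Dl : tb.F0" "Dl : A" "ALL v:coords Z. ALL v':coords Z. ALL i<d. Dl * ta (dl i (ze v / ze v')) : A"
 shows "Dl ^ (d * m) * ta (b s n) : A"
proof -
 note A = placeD(1)[OF P(1)] and Lf = tb.Ls
 define A' where "A' = {x : tb.L. ta x : A}"
 define Ph where "Ph x = ph (ta x)" for x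
 note tD = tb.embD[OF e] and tp = phomD[OF tb.embD(4)[OF e]]
 have ph: "phom A' Ph" unfolding phom_def srg_def
 proof (intro conjI ballI)
 show "1 : A'" using srgD(1)[OF Lf(2)] srgD(1)[OF A] tp(2) by (simp add: A'_def)
 show "Ph 1 = 1" using tp(2) placeD(2)[OF P(1)] by (simp add: Ph_def)
 fix x z assume x: "x : A'" and z: "z : A'"
 show "x + z : A'" "x * z : A'" using x z tD(1,2)[of x z] srgD(3,4)[OF Lf(2)] srgD(3,4)[OF A] by (auto simp: A'_def)
 show "Ph (x + z) = Ph x + Ph z" "Ph (x * z) = Ph x * Ph z" using x z tD(1,2)[of x z] placeD(3,4)[OF P(1)] by (auto simp: A'_def Ph_def)
 next
 fix x assume x: "x : A'"
 thus "- x : A'" using tp(6)[of x] srgD(5)[OF Lf(2)] srgD(5)[OF A] by (simp add: A'_def)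
 qed
 note A's = phomD(1)[OF ph]
 have inv: "ALL x:A'. Ph x ~= 0 --> inverse x : A'"
 proof (intro ballI impI)
 fix x assume x: "x : A'" "Ph x ~= 0"
 have "x ~= 0" using x(2) tp(5) placeD(8)[OF P(1)] by (auto simp: Ph_def)
 hence "ta (inverse x) = inverse (ta x)" using tb.emb_inj(2)[OF e] x(1) by (simp add: A'_def)
 moreover have "inverse (ta x) : A" using placeD(10)[OF P(1)] x by (simp add: A'_def Ph_def)
 ultimately show "inverse x : A'" using x(1) sfdD(2)[OF Lf(1)] by (simp add: A'_def)
 qed
 have hA: "h c : A' & Ph (h c) = h c" if "c : ka" for c
 using P(2) that tD(3)[OF tb.hF0[OF that]] tb.hF0[OF that] tb.F0L by (auto simp: A'_def Ph_def)
 have zv: "ze v : tb.L" if "v : coords Z" for v using zL that by blast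
 have "EX v:coords Z. ta (ze v) ~= 0" using zeta_nz tb.emb_inj(1)[OF e zv] by blast
 then obtain v1 where v1: "v1 : coords Z" "ta (ze v1) ~= 0" "ALL v:coords Z. ta (ze v) / ta (ze v1) : A"
 using place_max[OF P(1) finZ, of "%v. ta (ze v)"] by blast
 have z1: "ze v1 ~= 0" using v1(2) tp(5) by auto
 define ze1 where "ze1 v = ze v / ze v1" for v
 have z1L: "ze1 v : tb.L" "ta (ze1 v) = ta (ze v) / ta (ze v1)" if "v : coords Z" for v
 proof -
 show "ze1 v : tb.L" unfolding ze1_def by (rule sfdD(3)[OF Lf(1) zv[OF that] zv[OF v1(1)]])
 show "ta (ze1 v) = ta (ze v) / ta (ze v1)" unfolding ze1_def divide_inverse
 using tD(2)[OF zv[OF that] sfdD(2)[OF Lf(1) zv[OF v1(1)]]] tb.emb_inj(2)[OF e zv[OF v1(1)] z1] by simp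
 qed
 have z1A: "ze1 v : A'" if "v : coords Z" for v using z1L[OF that] v1(3) that by (simp add: A'_def)
 define a where "a v = Ph (ze1 v)" for v
 have Phi: "Ph (ins h ze1 F) = ins h a F" if F: "F : MP ka (coords Z)" for F
 proof -
 have "Ph (ins h ze1 F) = ins (%c. Ph (h c)) a F" unfolding a_def by (rule phom_ins[OF ph F]) (use hA z1A in auto)
 also have "\<dots> = ins h a F" by (rule ins_cong[OF F]) (use hA in auto)
 finally show ?thesis .
 qed
 have z1h: "ins h ze1 F = inverse (ze v1) ^ e' * ins h ze F" if "hmg e' F" for e' F
 proof -
 have "ze1 = (%v. inverse (ze v1) * ze v)" by (simp add: ze1_def fun_eq_iff divide_inverse mult.commute)
 thus ?thesis using ins_hmg[OF that] by metis
 qed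
 have va: "ALL F:hom_ideal Z. ins h a F = 0"
 proof
 fix F assume F: "F : hom_ideal Z"
 have FM: "F : MP k (coords Z)" using IZ F by blast
 have "ins h ze1 F = (SUM e:mdeg ` kys F. ins h ze1 (hpt e F))" by (subst sum_hparts[of F]) (rule ins_sum[OF ch])
 also have "\<dots> = 0"
 proof (rule sum.neutral, rule ballI)
 fix e' have "ins h ze (hpt e' F) = 0" using gen_k[OF MP_hpart[OF FM]] hZ[OF F] by blast
 thus "ins h ze1 (hpt e' F) = 0" using z1h[OF hmg_hpart] by simp
 qed
 finally show "ins h a F = 0" using Phi[OF MPka[OF FM]] phomD(5)[OF ph] by simp
 qed
 have "ze1 v1 = 1" using z1 by (simp add: ze1_def)
 hence a1: "a v1 ~= 0" using phomD(2)[OF ph] by (simp add: a_def)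
 obtain x where x: "x : hv k Z" "ALL F:MP ka (coords Z). ins h a F = 0 --> meval x F = 0"
 by (rule point_spec[OF kf ch finZ IZ va v1(1) a1])
 obtain e' F' w' where F': "mrep k Z U (g n) e' F'" "w' : coords U" "meval x (F' w') ~= 0" using mor[of n] x(1) unfolding morphism_mrep by blast
 note F'M = mrepD(1)[OF F'(1)]
 define th where "th w = ins h ze1 (F' w)" for w
 have Phw: "Ph (th w') ~= 0" using x(2) F'(3) MPka[OF F'M[OF F'(2)]] Phi unfolding th_def by auto
 hence "th w' ~= 0" using phomD(5)[OF ph] by auto
 hence xw': "xi F' w' ~= 0" using z1h[OF mrepD(2)[OF F'(1,2)]] by (auto simp: th_def)
 obtain w0 where w0: "w0 : coords U" "xe n w0 ~= 0" using FFnz by blast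
 obtain c where c: "c ~= 0" "ALL v:coords U. xi F' v = c * xe n v" using xi_proportional[OF gpts FF F'(1) w0 F'(2) xw'] by blast
 define c' where "c' = inverse (ze v1) ^ e' * c"
 have c': "c' ~= 0" using c(1) z1 by (simp add: c'_def)
 have thc: "ALL v:coords U. th v = c' * xe n v" using z1h[OF mrepD(2)[OF F'(1)]] c(2) by (simp add: th_def c'_def)
 note gth = gpoint.scale(1)[OF gp c' thc]
 have DlA: "Dl : A'" using Dl(1,2) tD(3)[OF Dl(1)] tb.F0L by (auto simp: A'_def)
 have der: "der (dl i)" if "i < d" for i using lderD[OF that] by blast
 let ?S = "{x : A'. ALL i<d. Dl * dl i x : A'}"
 have S: "srg ?S" by (rule good_srg[OF A's der DlA])
 have thS: "th w : ?S" if w: "w : coords U" for w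
 unfolding th_def
 proof (rule ins_in[OF S F'M[OF w]])
 fix c assume c: "c : k"
 thus "h c : ?S" using hA kka lderD srgD(2)[OF A's] by auto
 next
 fix v assume v: "v : coords Z"
 have "Dl * dl i (ze1 v) : A'" if i: "i < d" for i
 proof -
 have L: "dl i (ze1 v) : tb.L" by (rule tb.D_L[OF IT[OF i] z1L(1)[OF v]])
 have dL: "Dl : tb.L" using Dl(1) tb.F0L by blast
 have "ta (Dl * dl i (ze1 v)) = Dl * ta (dl i (ze1 v))" using tD(2)[OF dL L] tD(3)[OF Dl(1)] by simp
 thus ?thesis using Dl(3) v v1(1) i srgD(4)[OF Lf(2) dL L] by (simp add: A'_def ze1_def)
 qed
 thus "ze1 v : ?S" using z1A[OF v] by blast
 qed
 have "Dl ^ (d * m) * gpoint.bv k U h th m q E s dl : A'"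
 proof (rule gpoint.section_bound[OF gth IU hU ch ph inv _ _ F'(2) Phw lderD DlA _ G s])
 show "ALL c:k. h c : A' & Ph (h c) = h c" using hA kka by blast
 show "ALL v:coords U. th v : A'" "ALL i<d. ALL v:coords U. Dl * dl i (th v) : A'" using thS by blast+
 qed
 moreover have "gpoint.bv k U h th m q E s dl = b s n" by (rule gpoint.bv_scale[OF gp c' thc G s y0])
 ultimately have m1: "ta (Dl ^ (d * m) * b s n) : A" by (simp add: A'_def)
 have pw: "Dl ^ (d * m) : tb.F0" by (rule srgD(7)[OF tb.F0s(2) Dl(1)])
 hence "Dl ^ (d * m) : tb.L" using tb.F0L by blast
 hence "ta (Dl ^ (d * m) * b s n) = Dl ^ (d * m) * ta (b s n)" using tD(2)[OF _ bL[OF s]] tD(3)[OF pw] by simp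
 thus ?thesis using m1 by simp
qed

text \<open>Only finitely many derivatives of coordinate ratios occur; the power d m of a common
  denominator of their conjugates bounds the whole sequence.\<close>

lemma bddA_b: assumes s: "s : psec k U m" shows "tb.bddA (b s)"
 unfolding tb.bddA_def
proof (intro conjI allI impI bL[OF s])
 fix PP RR assume C: "tb.dclass PP RR"
 let ?J = "coords Z \<times> coords Z \<times> {..<d}"
 have "EX Dl:RR. ALL A ph. PP A ph --> Dl : A & (ALL j:?J. ALL x:{ta (dl (snd (snd j)) (ze (fst j) / ze (fst (snd j)))) |ta. tb.emb ta}. Dl * x : A)"
 proof (rule tb.common_delta[OF C])
 show "finite ?J" using finZ by simp
 fix j assume j: "j : ?J"
 let ?x = "dl (snd (snd j)) (ze (fst j) / ze (fst (snd j)))"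
 have "ze (fst j) / ze (fst (snd j)) : tb.L" using sfdD(3)[OF tb.Ls(1)] zL j by (auto simp: mem_Times_iff)
 hence xL: "?x : tb.L" using tb.D_L[OF IT] j by (auto simp: mem_Times_iff)
 have "tb.bdd PP RR (%_::nat. ?x)" by (rule tb.bdd_single[OF C xL])
 then obtain a where a: "a : RR" "ALL A ph. PP A ph --> a : A & (ALL ta. tb.emb ta --> a * ta ?x : A)" unfolding tb.bdd_def by auto
 thus "EX Dl:RR. ALL A ph. PP A ph --> Dl : A & (ALL x:{ta ?x |ta. tb.emb ta}. Dl * x : A)" by (intro bexI[OF _ a(1)]) auto
 qed
 then obtain a where a: "a : RR" "ALL A ph. PP A ph --> a : A & (ALL j:?J. ALL x:{ta (dl (snd (snd j)) (ze (fst j) / ze (fst (snd j)))) |ta. tb.emb ta}. a * x : A)" by blast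
 have "a ^ i : RR" for i by (induct i) (simp_all add: tb.dclassD(3)[OF C] tb.dclassD(4)[OF C a(1)])
 hence aR: "a ^ (d * m) : RR" .
 have key: "a ^ (d * m) : A & (ALL ta. tb.emb ta --> (ALL n. a ^ (d * m) * ta (b s n) : A))" if p: "PP A ph" for A ph
 proof (intro conjI allI impI)
 have aA: "a : A" using a(2) p by blast
 show "a ^ (d * m) : A" by (rule srgD(7)[OF tb.dclassD(7)[OF C p] aA])
 fix ta n assume e: "tb.emb ta"
 show "a ^ (d * m) * ta (b s n) : A"
 proof (rule bound_at_place[OF tb.dclassD(1)[OF C p] _ e s _ aA])
 show "ALL c:ka. h c : A & ph (h c) = h c" using tb.dclassD(8)[OF C p] by blast
 show "a : tb.F0" using tb.dclassD(2)[OF C] a(1) by blast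
 show "ALL v:coords Z. ALL v':coords Z. ALL i<d. a * ta (dl i (ze v / ze v')) : A"
 proof (intro ballI allI impI)
 fix v v' i assume "v : coords Z" "v' : coords Z" "i < d"
 hence vJ: "(v, v', i) : ?J" by simp
 have aj: "ALL j:?J. ALL x:{ta (dl (snd (snd j)) (ze (fst j) / ze (fst (snd j)))) |ta. tb.emb ta}. a * x : A" using a(2) p by blast
 have "ALL x:{ta (dl i (ze v / ze v')) |ta. tb.emb ta}. a * x : A" using bspec[OF aj vJ] unfolding fst_conv snd_conv .
 thus "a * ta (dl i (ze v / ze v')) : A" by (rule bspec) (use e in blast)
 qed
 qed
 qed
 show "tb.bdd PP RR (b s)" unfolding tb.bdd_def
 proof (intro conjI allI bL[OF s] bexI[OF _ aR] impI)
 fix A ph assume p: "PP A ph"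
 show "a ^ (d * m) : A" using key[OF p] by (rule conjunct1)
 fix ta n assume "tb.emb ta"
 thus "a ^ (d * m) * ta (b s n) : A" using key[OF p] by simp
 qed
qed

end

section \<open>Finiteness of the values of a rational function\<close>

context kofam
begin

text \<open>The Jacobian factor contained in \<open>b\<close> is nonzero for every n, so that the
  functions \<open>q l\<close> can be recovered as quotients of pulled back forms.\<close>

definition frame_nz where "frame_nz \<longleftrightarrow> (ALL n. dt d (%i l. dl i (evn n (q l))) ~= 0)"

lemma q_quot:
 assumes nz: frame_nz and l: "l < d"
 shows "b (et l) n ~= 0" "evn n (q l) = b (om l) n / b (et l) n"
proof -
 interpret gq: gpoint k U h "xe n" by (rule gp)
 have "dt d (%i l. dl i (evn n (q l))) ~= 0" using nz unfolding frame_nz_def by blast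
 thus "b (et l) n ~= 0" "evn n (q l) = b (om l) n / b (et l) n"
 using gq.gt_quotient[OF G l y0] by (simp_all add: gq.bv_def)
qed

lemma b_section: "l < d ==> tb.bddA (b (om l))" "l < d ==> tb.bddA (b (et l))"
 using bddA_b gpoint.gt_dataD(6,7)[OF gp G] by blast+

definition Bn where "Bn n = (PROD l<d. b (et l) n)"

lemma Bn: "tb.bddA Bn" "frame_nz ==> Bn n ~= 0"
proof -
 show "tb.bddA Bn" unfolding Bn_def by (rule tb.bddA_prod) (use b_section(2) in auto)
 show "Bn n ~= 0" if frame_nz unfolding Bn_def using q_quot(1)[OF that] by simp
qed

text \<open>All sufficiently large exponents are required to work. The set of good polynomials is
  then closed under sums and products and becomes a ring that contains the variables.\<close>

lemma clear_denominators:
 assumes nz: frame_nz and F: "F : MP k (q ` {..<d})"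
 shows "EX e0. ALL e>=e0. tb.bddA (%n. Bn n ^ e * ins h (evn n) F)"
proof -
 let ?Y = "{F. EX e0. ALL e>=e0. tb.bddA (%n. Bn n ^ e * ins h (evn n) F)}"
 have YI: "F : ?Y" if "ALL e>=e0. tb.bddA (%n. Bn n ^ e * ins h (evn n) F)" for F e0 using that by blast
 have cst: "mconst c : ?Y" if c: "c : k" for c
 proof (rule YI[of 0], intro allI impI)
 fix e show "tb.bddA (%n. Bn n ^ e * ins h (evn n) (mconst c))"
 unfolding ins_const[OF ch] by (rule tb.bddA_ops(2)[OF tb.bddA_power[OF Bn(1)] tb.bddA_single[OF kL[OF c]]])
 qed
 have one: "(1 :: _ mpoly) = mconst 1" by (simp add: mconst_def)
 have Y: "srg ?Y" unfolding srg_def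
 proof (intro conjI ballI)
 show "1 : ?Y" unfolding one by (rule cst[OF srgD(1)[OF ks]])
 fix P Q assume "P : ?Y" "Q : ?Y"
 then obtain e1 e2 where e: "ALL e>=e1. tb.bddA (%n. Bn n ^ e * ins h (evn n) P)" "ALL e>=e2. tb.bddA (%n. Bn n ^ e * ins h (evn n) Q)" by blast
 show "P + Q : ?Y"
 proof (rule YI[of "e1 + e2"], intro allI impI)
 fix e assume "e1 + e2 <= e"
 hence "tb.bddA (%n. Bn n ^ e * ins h (evn n) P + Bn n ^ e * ins h (evn n) Q)" using e by (intro tb.bddA_ops(1)) auto
 thus "tb.bddA (%n. Bn n ^ e * ins h (evn n) (P + Q))" by (simp add: ins_add[OF ch] distrib_left)
 qed
 show "P * Q : ?Y"
 proof (rule YI[of "e1 + e2"], intro allI impI)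
 fix e assume le: "e1 + e2 <= e"
 hence "e - e1 >= e2" by simp
 hence "tb.bddA (%n. (Bn n ^ e1 * ins h (evn n) P) * (Bn n ^ (e - e1) * ins h (evn n) Q))"
 by (rule tb.bddA_ops(2)[OF e(1)[rule_format, OF order_refl] e(2)[rule_format]])
 moreover have "(Bn n ^ e1 * ins h (evn n) P) * (Bn n ^ (e - e1) * ins h (evn n) Q) = Bn n ^ e * ins h (evn n) (P * Q)" for n
 proof -
 have "Bn n ^ e = Bn n ^ e1 * Bn n ^ (e - e1)" using le by (simp flip: power_add)
 thus ?thesis by (simp add: ins_mult[OF ch] mult_ac)
 qed
 ultimately show "tb.bddA (%n. Bn n ^ e * ins h (evn n) (P * Q))" by simp
 qed
 next
 fix P assume "P : ?Y"
 then obtain e1 where e: "ALL e>=e1. tb.bddA (%n. Bn n ^ e * ins h (evn n) P)" by blast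
 show "- P : ?Y"
 proof (rule YI[of e1], intro allI impI)
 fix e assume "e1 <= e"
 hence "tb.bddA (%n. (- 1) * (Bn n ^ e * ins h (evn n) P))"
 by (rule tb.bddA_ops(2)[OF tb.bddA_single[OF srgD(5)[OF tb.Ls(2) srgD(1)[OF tb.Ls(2)]]] e[rule_format]])
 thus "tb.bddA (%n. Bn n ^ e * ins h (evn n) (- P))" by (simp add: ins_ops(2)[OF ch])
 qed
 qed
 have var: "mvar r : ?Y" if r: "r : q ` {..<d}" for r
 proof -
 obtain l where l: "l < d" "r = q l" using r by (auto elim!: imageE)
 have e1: "Bn n * evn n r = b (om l) n * (PROD j:{..<d} - {l}. b (et j) n)" for n
 proof -
 have "Bn n = b (et l) n * (PROD j:{..<d} - {l}. b (et j) n)" unfolding Bn_def by (rule prod.remove) (use l(1) in auto)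
 thus ?thesis unfolding l(2) q_quot(2)[OF nz l(1)] using q_quot(1)[OF nz l(1), of n] by simp
 qed
 have b1: "tb.bddA (%n. Bn n * evn n r)" unfolding e1
 proof (rule tb.bddA_ops(2)[OF b_section(1)[OF l(1)] tb.bddA_prod])
 show "tb.bddA (b (et j))" if "j : {..<d} - {l}" for j by (rule b_section(2)) (use that in simp)
 qed simp
 show ?thesis
 proof (rule YI[of 1], intro allI impI)
 fix e :: nat assume "1 <= e"
 then obtain e' where "e = Suc e'" by (cases e) auto
 hence "Bn n ^ e = Bn n ^ (e - 1) * Bn n" for n by (simp add: mult.commute)
 thus "tb.bddA (%n. Bn n ^ e * ins h (evn n) (mvar r))"
 using tb.bddA_ops(2)[OF tb.bddA_power[OF Bn(1), of "e - 1"] b1] by (simp add: ins_var[OF ch] mult.assoc)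
 qed
 qed
 have "ins mconst mvar F : ?Y" by (rule ins_in[OF Y F cst var])
 thus ?thesis unfolding ins_mvar by blast
qed

text \<open>r is algebraic over the functions q l by a relation in the function field, which
  therefore holds at every n with the same degree. Once a power of \<open>Bn\<close> has cleared its
  coefficients, the leading coefficient times r is bounded, and that coefficient vanishes at no
  n.\<close>

lemma coordinate_bounded:
 assumes nz: frame_nz and r: "r : carrier KU"
 shows "EX M. (ALL n. M n ~= 0) & tb.bddA M & tb.bddA (%n. M n * evn n r)"
proof -
 interpret g0: gpoint k U h "xe 0" by (rule gp)
 let ?T = "q ` {..<d}"
 note gD = g0.gt_dataD[OF G]
 have cT: "card ?T = d" using gD(3) by (simp add: card_image)
 obtain s F where sF: "s > 0" "ALL i<=s. F i : MP k ?T" "(SUM i<=s. ins h (evn 0) (F i) * evn 0 r ^ i) = 0" "ins h (evn 0) (F s) ~= 0"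
 using g0.alg_relation[OF gD(1) _ gD(2) cT r] by auto
 let ?P = "SUM i<=s. F i * mvar r ^ i" let ?TT = "insert r ?T"
 have TT: "?TT <= carrier KU" using gD(1) r by blast
 have sub: "F i : MP k ?TT" if "i <= s" for i using sF(2) that MP_mono[of k k ?T ?TT] by blast
 have P: "?P : MP k ?TT"
 by (intro MP_sum[OF ks] srgD(4,7)[OF MP_srg[OF ks]] MP_var[OF ks] sub) auto
 have insP: "ins h x ?P = (SUM i<=s. ins h x (F i) * x r ^ i)" for x
 by (simp add: ins_sum[OF ch] ins_mult[OF ch] ins_ops(3)[OF ch] ins_var[OF ch])
 have "ff_eval k U ?P = \<zero>\<^bsub>KU\<^esub>" using g0.eval_zero_iff[OF TT P] sF(3) insP[of "evn 0"] by simp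
 hence rel: "(SUM i<=s. ins h (evn n) (F i) * evn n r ^ i) = 0" for n using gpoint.eval_zero_iff[OF gp TT P, of n] insP[of "evn n"] by simp
 have "ff_eval k U (F s) ~= \<zero>\<^bsub>KU\<^esub>" using g0.eval_zero_iff[OF TT sub[OF order_refl]] sF(4) by simp
 hence lead: "ins h (evn n) (F s) ~= 0" for n using gpoint.eval_zero_iff[OF gp TT sub[OF order_refl], of n] by simp
 have "ALL i:{..s}. EX e0. ALL e>=e0. tb.bddA (%n. Bn n ^ e * ins h (evn n) (F i))" using clear_denominators[OF nz] sF(2) by blast
 then obtain e0 where e0: "ALL i:{..s}. ALL e>=e0 i. tb.bddA (%n. Bn n ^ e * ins h (evn n) (F i))"
 using bchoice[of "{..s}" "%i e0. ALL e>=e0. tb.bddA (%n. Bn n ^ e * ins h (evn n) (F i))"] by blast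
 define e where "e = Max (e0 ` {..s})"
 define c where "c i n = Bn n ^ e * ins h (evn n) (F i)" for i n
 have cb: "tb.bddA (c i)" if "i <= s" for i
 proof -
 have "e0 i <= e" unfolding e_def by (rule Max_ge) (use that in auto)
 thus ?thesis unfolding c_def using e0 that by blast
 qed
 have "(SUM i<=s. c i n * evn n r ^ i) = Bn n ^ e * (SUM i<=s. ins h (evn n) (F i) * evn n r ^ i)" for n
 by (simp add: c_def sum_distrib_left mult.assoc)
 hence cz: "(SUM i<=s. c i n * evn n r ^ i) = 0" for n using rel by simp
 have "tb.bddA (%n. c s n * evn n r)" by (rule tb.bddA_root[OF sF(1) cb evL[OF r] cz])
 moreover have "c s n ~= 0" for n using lead Bn(2)[OF nz] by (simp add: c_def)
 ultimately show ?thesis using cb[OF order_refl] by blast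
qed

theorem values_repeat:
 assumes nz: frame_nz and d0: "d > 0"
 shows "EX n n'. n < n' & evn n (q 0) = evn n' (q 0)"
proof -
 obtain v0 where v0: "v0 : coords U" "y0 v0 ~= 0" using y0 unfolding hom_vectors_def by blast
 have v0I: "mvar v0 ~: hom_ideal U"
 proof
 assume "mvar v0 : hom_ideal U"
 hence "meval y0 (mvar v0) = 0" using y0 unfolding hom_vectors_def by blast
 thus False using v0(2) by (simp add: meval_ins ins_var[OF chom_id])
 qed
 have x0: "xe n v0 ~= 0" for n
 using gpoint.gen[OF gp MP_var[OF ks v0(1)] hmg_var, of n] v0I by (simp add: ins_var[OF ch])
 define r where "r v = fraction_rel k U `` {(mvar v, mvar v0)}" for v
 have r: "r v : carrier KU" "evn n (r v) = xe n v / xe n v0" if v: "v : coords U" for v n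
 proof -
 interpret gq: gpoint k U h "xe n" by (rule gp)
 have "EX e. hmg e (mvar v) & hmg e (mvar v0)" by (intro exI[of _ 1] conjI hmg_var)
 hence f: "(mvar v, mvar v0) : fractions k U" unfolding gq.fr_iff
 using MP_var[OF ks v] MP_var[OF ks v0(1)] x0 by (auto simp: ins_var[OF ch])
 show "r v : carrier KU" unfolding r_def gq.carrier_K gq.cls_def[symmetric] using f by (rule imageI)
 show "evn n (r v) = xe n v / xe n v0" unfolding r_def using gq.ev_cls[OF f] by (simp add: gq.cls_def gq.rat_def ins_var[OF ch])
 qed
 have "ALL v:coords U. EX M. (ALL n. M n ~= 0) & tb.bddA M & tb.bddA (%n. M n * evn n (r v))" using coordinate_bounded[OF nz r(1)] by blast
 then obtain M where M: "ALL v:coords U. (ALL n. M v n ~= 0) & tb.bddA (M v) & tb.bddA (%n. M v n * evn n (r v))"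
 using bchoice[of "coords U" "%v M. (ALL n. M n ~= 0) & tb.bddA M & tb.bddA (%n. M n * evn n (r v))"] by blast
 define MM where "MM n = (PROD v:coords U. M v n)" for n
 \<comment> \<open>One scalar for each n makes all homogeneous coordinates bounded simultaneously.
   The point is normalized at \<open>v0\<close>, and the pulled back forms are not affected.\<close>
 define x' where "x' n v = (MM n / xe n v0) * xe n v" for n v
 have MM0: "MM n ~= 0" for n unfolding MM_def using M finU by simp
 have xb: "tb.bddA (%n. x' n v)" if v: "v : coords U" for v
 proof -
 have "x' n v = (M v n * evn n (r v)) * (PROD u:coords U - {v}. M u n)" for n
 using prod.remove[OF finU v, of "%v. M v n"] by (simp add: x'_def MM_def r(2)[OF v])
 moreover have "tb.bddA (%n. (M v n * evn n (r v)) * (PROD u:coords U - {v}. M u n))"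
 by (rule tb.bddA_ops(2)[OF _ tb.bddA_prod]) (use M v finU in auto)
 ultimately show ?thesis by simp
 qed
 let ?K = "h ` ka" let ?SS = "{om 0, et 0}"
 have Ksf: "sfd ?K" "srg ?K" using tb.hk_acl by (auto simp: acl_def sfd_def)
 have "ALL v:coords U. EX XX. finite XX & (ALL n. x' n v : lspan ?K XX)" using tb.bddA_span[OF xb] by blast
 then obtain XX where XX: "ALL v:coords U. finite (XX v) & (ALL n. x' n v : lspan ?K (XX v))"
 using bchoice[of "coords U" "%v XX. finite XX & (ALL n. x' n v : lspan ?K XX)"] by blast
 obtain Y1 where Y1: "finite Y1" "ALL n. b (om 0) n : lspan ?K Y1" using tb.bddA_span[OF b_section(1)[OF d0]] by blast
 obtain Y2 where Y2: "finite Y2" "ALL n. b (et 0) n : lspan ?K Y2" using tb.bddA_span[OF b_section(2)[OF d0]] by blast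
 let ?A = "(UN v:coords U. XX v) Un Y1 Un Y2"
 have fA: "finite ?A" using XX finU Y1(1) Y2(1) by blast
 obtain B where B: "B \<subseteq> ?A" "lind ?K B" "?A \<subseteq> lspan ?K B" using lbasis[OF Ksf(1) fA] by blast
 have fB: "finite B" using B(1) fA finite_subset by blast
 have sp: "lspan ?K S \<subseteq> lspan ?K B" if "S \<subseteq> ?A" for S by (rule lspan_trans[OF Ksf(2) fB]) (use that B(3) in blast)
 have xB: "ALL n. ALL v:coords U. x' n v : lspan ?K B"
 proof (intro allI ballI)
 fix n v assume v: "v : coords U"
 have "lspan ?K (XX v) <= lspan ?K B" by (rule sp) (use v in blast)
 thus "x' n v : lspan ?K B" using XX v by blast
 qed
 have c0: "MM n / xe n v0 ~= 0" for n using MM0 x0 by simp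
 have xc: "ALL v:coords U. x' n v = MM n / xe n v0 * xe n v" for n by (simp add: x'_def)
 have g': "gpoint k U h (x' n)" for n by (rule gpoint.scale(1)[OF gp c0 xc])
 have sec: "ALL s:?SS. s : psec k U m" using gpoint.gt_dataD(6,7)[OF gp G d0] by blast
 have bx: "gpoint.bv k U h (x' n) m q E s dl = b s n" if "s : ?SS" for s n
 by (rule gpoint.bv_scale[OF gp c0 xc G _ y0]) (use sec that in blast)
 have sp1: "lspan ?K Y1 <= lspan ?K B" "lspan ?K Y2 <= lspan ?K B" by (rule sp, blast)+
 have bB: "ALL n. ALL s:?SS. gpoint.bv k U h (x' n) m q E s dl : lspan ?K B"
 using bx sp1 Y1(2) Y2(2) by auto
 have dk: "ALL i<d. der (dl i) & (ALL c:ka. dl i (h c) = 0)" using tb.derT[OF IT] tb.Dk[OF IT] by blast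
 have xnz: "ALL n. EX v:coords U. x' n v ~= 0" using v0(1) x0 MM0 by (auto simp: x'_def)
 obtain n n' where n: "n < n'" "ALL s:?SS. gpoint.bv k U h (x' n) m q E s dl = gpoint.bv k U h (x' n') m q E s dl"
 using rigidity[OF g' IU hU G sec _ dk fB B(2) xB xnz bB y0] by blast
 hence "b (om 0) n = b (om 0) n'" "b (et 0) n = b (et 0) n'" using bx by auto
 hence "evn n (q 0) = evn n' (q 0)" using q_quot(2)[OF nz d0] by simp
 thus ?thesis using n(1) by blast
qed

end

section \<open>Choice of the test derivations and transcendental fractions\<close>

lemma algb_image:
 fixes h :: "complex => 'a::field"
 assumes h: "chom h" and c: "algb k c" shows "algb (h ` k) (h c)"
proof -
 obtain p where p: "p : PA k" "p ~= 0" "poly p c = 0" using c unfolding algb_def by blast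
 have h0: "h 0 = 0" using phomD(5)[OF h] .
 have nz: "h a ~= 0" if "a ~= 0" for a using chom_inj[OF h, of a 0] h0 that by simp
 have hp: "h (a ^ n) = h a ^ n" "h (a * b) = h a * h b" for a b n using phomD(4,8)[OF h] by auto
 have cf: "cof (map_poly h p) i = h (cof p i)" for i by (simp add: coeff_map_poly h0)
 have "degree (map_poly h p) = degree p" by (rule map_poly_degree_eq) (use nz p(2) in simp)
 hence "poly (map_poly h p) (h c) = (SUM i<=degree p. h (cof p i * c ^ i))" by (simp add: poly_altdef cf hp)
 also have "\<dots> = h (poly p c)" unfolding poly_altdef by (rule phom_sum[OF h, symmetric]) simp
 finally have "poly (map_poly h p) (h c) = 0" using p(3) h0 by simp
 moreover have "map_poly h p : PA (h ` k)" using p(1) by (simp add: PA_def cf)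
 moreover have "map_poly h p ~= 0" using nz p(2) cf by (metis coeff_0 leading_coeff_0_iff)
 ultimately show ?thesis unfolding algb_def by blast
qed

text \<open>Derivations dual to q have the identity as Jacobian matrix. Row by row they are
  exchanged for some D t: the old row is a combination of the D t by \<open>der_expand\<close>, so
  the determinant, being linear in that row, stays nonzero for at least one choice of t.\<close>

lemma frame_exists:
 fixes h :: "complex => 'a::{field_char_0,alg_closed_field}"
 assumes tb: "tbasis (kbar k) h T z D y mm" and g: "gpoint k U h x" and G: "gt_data k U m q E om et"
 and L: "ALL l<variety_dim k U. gpoint.ev h x (q l) : sfg (sfg (h ` kbar k Un z ` T) Un {y})"
 shows "EX I:{..<variety_dim k U} \<rightarrow>\<^sub>E T. dt (variety_dim k U) (%i l. D (I i) (gpoint.ev h x (q l))) ~= 0"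
proof -
 interpret tb: tbasis "kbar k" h T z D y mm by (rule tb)
 interpret gq: gpoint k U h x by (rule g)
 note gD = gq.gt_dataD[OF G]
 let ?d = "variety_dim k U" let ?ka = "kbar k"
 have dual: "EX dl. der dl & (ALL c:?ka. dl (h c) = 0) & (ALL l<?d. dl (gq.ev (q l)) = (if i = l then 1 else 0))" if i: "i < ?d" for i
 proof -
 obtain dl where dl: "der dl" "ALL c:k. dl (h c) = 0" "dl (gq.ev (q i)) = 1" "ALL s:q ` {..<?d} - {q i}. dl (gq.ev s) = 0"
 using gq.dual_derivation[OF gD(1,2), of "q i"] i by blast
 have "dl (h c) = 0" if "c : ?ka" for c
 proof (rule der_algb_zero[OF sfdD(1)[OF gq.sfd_hk] dl(1)])
 show "algb (h ` k) (h c)" using algb_image[OF gq.ch] that unfolding alg_closure_algb by blast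
 qed (use dl(2) in blast)
 moreover have "dl (gq.ev (q l)) = (if i = l then 1 else 0)" if l: "l < ?d" for l
 proof (cases "i = l")
 case False
 hence "q l : q ` {..<?d} - {q i}" using gD(3) i l unfolding inj_on_def by blast
 thus ?thesis using dl(4) False by simp
 qed (use dl(3) in simp)
 ultimately show ?thesis using dl(1) by blast
 qed
 have "EX I. (ALL i<s. I i : T) & dt ?d (%i l. if i < s then D (I i) (gq.ev (q l)) else if i = l then 1 else 0) ~= 0" if "s <= ?d" for s
 using that
 proof (induct s)
 case 0
 thus ?case by (simp add: dt_one)
 next
 case (Suc s)
 then obtain I where I: "ALL i<s. I i : T" "dt ?d (%i l. if i < s then D (I i) (gq.ev (q l)) else if i = l then 1 else 0) ~= 0" by auto
 have s: "s < ?d" using Suc(2) by simp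
 obtain dl where dl: "der dl" "ALL c:?ka. dl (h c) = 0" "ALL l<?d. dl (gq.ev (q l)) = (if s = l then 1 else 0)" using dual[OF s] by blast
 let ?a = "%i l. if i < s then D (I i) (gq.ev (q l)) else if i = l then 1 else 0"
 have "dt ?d ?a = dt ?d (%i l. if i = s then (SUM t:T. dl (z t) * D t (gq.ev (q l))) else ?a i l)"
 proof (rule dt_cong)
 fix i l assume il: "i < ?d" "l < ?d"
 have "dl (gq.ev (q l)) = (SUM t:T. dl (z t) * D t (gq.ev (q l)))" by (rule tb.der_expand[OF dl(1,2)]) (use L il(2) in blast)
 thus "?a i l = (if i = s then (SUM t:T. dl (z t) * D t (gq.ev (q l))) else ?a i l)" using dl(3) il(2) by simp
 qed
 also have "\<dots> = (SUM t:T. dl (z t) * dt ?d (%i l. if i = s then D t (gq.ev (q l)) else ?a i l))" by (rule dt_row_sum[OF s tb.finT])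
 finally have "(SUM t:T. dl (z t) * dt ?d (%i l. if i = s then D t (gq.ev (q l)) else ?a i l)) ~= 0" using I(2) by simp
 then obtain t where t: "t : T" "dt ?d (%i l. if i = s then D t (gq.ev (q l)) else ?a i l) ~= 0" by (metis (no_types, lifting) mult_zero_right sum.neutral)
 have e: "(%i l. if i = s then D t (gq.ev (q l)) else ?a i l) = (%i l. if i < Suc s then D ((I(s := t)) i) (gq.ev (q l)) else if i = l then 1 else 0)"
 by (auto simp: fun_eq_iff less_Suc_eq)
 have "ALL i<Suc s. (I(s := t)) i : T" using I(1) t(1) by (auto simp: less_Suc_eq)
 thus ?case using t(2) unfolding e by blast
 qed
 from this[OF order_refl] obtain I where I: "ALL i<?d. I i : T" "dt ?d (%i l. if i < ?d then D (I i) (gq.ev (q l)) else if i = l then 1 else 0) ~= 0" by blast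
 have "dt ?d (%i l. if i < ?d then D (I i) (gq.ev (q l)) else if i = l then 1 else 0) = dt ?d (%i l. D (restrict I {..<?d} i) (gq.ev (q l)))"
 by (rule dt_cong) simp
 hence "dt ?d (%i l. D (restrict I {..<?d} i) (gq.ev (q l))) ~= 0" using I(2) by simp
 moreover have "restrict I {..<?d} : {..<?d} \<rightarrow>\<^sub>E T" using I(1) by simp
 ultimately show ?thesis by blast
qed

context gpoint
begin

text \<open>The sum is p(A / B) with denominators cleared, a homogeneous polynomial. In the ideal it
  would make A / B algebraic over k, against independence.\<close>

lemma transc_fraction:
 assumes T: "T \<subseteq> carrier K" "alg_independent k V T" and t: "t : T" and AB: "(A, B) : t"
 shows "ALL p:PA k. p ~= 0 --> (SUM i<=degree p. mconst (cof p i) * A ^ i * B ^ (degree p - i)) ~: hom_ideal V"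
proof (intro ballI impI)
 have tK: "t : carrier K" using T(1) t by blast
 have f: "(A, B) : fr" "ev t = vl A / vl B" using ev_rep[OF tK AB] by auto
 obtain e where fr: "A : MP k (coords V)" "B : MP k (coords V)" "hmg e A" "hmg e B" "vl B ~= 0" using f(1) fr_iff by blast
 fix p assume p: "p : PA k" "p ~= 0"
 let ?H = "SUM i<=degree p. mconst (cof p i) * A ^ i * B ^ (degree p - i)"
 show "?H ~: hom_ideal V"
 proof
 assume H: "?H : hom_ideal V"
 have HM: "?H : MP k (coords V)" by (intro MP_sum[OF ks] srgD(4,7)[OF MP_srg[OF ks]] MP_const PA_D[OF p(1)] fr)
 have "hmg (0 + e * i + e * (degree p - i)) (mconst (cof p i) * A ^ i * B ^ (degree p - i))" for i
 by (intro hmg_mult hmg_const hmg_power fr)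
 moreover have "0 + e * i + e * (degree p - i) = e * degree p" if "i : {..degree p}" for i using that by (simp flip: distrib_left)
 ultimately have "hmg (e * degree p) ?H" by (intro hmg_sum) metis
 hence "vl ?H = 0" using gen[OF HM] H by blast
 moreover have "vl ?H = (SUM i<=degree p. h (cof p i) * vl A ^ i * vl B ^ (degree p - i))"
 by (simp add: ins_sum[OF ch] ins_mult[OF ch] ins_ops(3)[OF ch] ins_const[OF ch])
 moreover have "\<dots> = (SUM i<=degree p. vl B ^ degree p * (h (cof p i) * (vl A / vl B) ^ i))"
 proof (rule sum.cong[OF refl])
 fix i assume "i : {..degree p}"
 hence "vl B ^ degree p = vl B ^ i * vl B ^ (degree p - i)" by (simp flip: power_add)
 thus "h (cof p i) * vl A ^ i * vl B ^ (degree p - i) = vl B ^ degree p * (h (cof p i) * (vl A / vl B) ^ i)"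
 using fr(5) by (simp add: power_divide)
 qed
 ultimately have "(SUM i<=degree p. h (cof p i) * (vl A / vl B) ^ i) = 0" using fr(5) by (simp flip: sum_distrib_left)
 moreover have h0: "h 0 = 0" using phomD(5)[OF ch] .
 have nz: "h (lead_coeff p) ~= 0" using chom_inj[OF ch, of "lead_coeff p" 0] h0 p(2) by simp
 hence "degree (map_poly h p) = degree p" by (rule map_poly_degree_eq)
 ultimately have "poly (map_poly h p) (vl A / vl B) = 0" by (simp add: poly_altdef coeff_map_poly h0)
 moreover have "map_poly h p : PA (h ` k)" using p(1) by (simp add: PA_def coeff_map_poly h0)
 moreover have "map_poly h p ~= 0" using nz by (metis coeff_map_poly coeff_0 h0)
 ultimately have "algb (h ` k) (ev t)" unfolding algb_def f(2) by blast
 hence "algb (sfg (h ` k Un ev ` (T - {t}))) (ev t)"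
 using algb_mono[of "h ` k" "sfg (h ` k Un ev ` (T - {t}))"] sfg_super[of "h ` k Un ev ` (T - {t})"] by blast
 thus False using indep_not_algb[OF T t] by blast
 qed
qed

end

context kod
begin

text \<open>A suitable frame exists for each n and may depend on n, but there are only finitely many
  choices. Infinitely many values belonging to one frame would give a subsequence with pairwise
  distinct values, which \<open>values_repeat\<close> forbids.\<close>

theorem finite_values:
 assumes gt: "general_type k U" "variety_dim k U >= 1" and hvZ: "hv k Z ~= {}" and y0: "y0 : hv k U"
 and mor: "!!n::nat. morphism_over k Z U (g n)" and dom: "!!n. dominant (g n)"
 and FF: "!!n. mrep k Z U (g n) (ee n) (FF n)" and FFnz: "!!n. EX w:coords U. xi (FF n) w ~= 0"
 shows "EX A B e. A : MP k (coords U) & B : MP k (coords U) & hmg e A & hmg e B & B ~: hom_ideal U &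
 (ALL p:PA k. p ~= 0 --> (SUM i<=degree p. mconst (cof p i) * A ^ i * B ^ (degree p - i)) ~: hom_ideal U) &
 finite (range (%n. ins h (xi (FF n)) A / ins h (xi (FF n)) B))"
proof -
 have gp: "gpoint k U h (xi (FF n))" for n using FFnz[of n] gpoint_xi[OF mor dom FF] by blast
 interpret g0: gpoint k U h "xi (FF 0)" by (rule gp)
 let ?d = "variety_dim k U"
 obtain m q E om et where G: "gt_data k U m q E om et" using g0.general_type_data[OF gt y0] by blast
 note gD = g0.gt_dataD[OF G]
 have d0: "0 < ?d" using gt(2) by simp
 have q0: "q 0 : carrier (function_field k U)" "q 0 : q ` {..<?d}" using gD(1) d0 by auto
 obtain A B where AB: "(A, B) : fractions k U" "q 0 = g0.cls (A, B)" by (rule g0.carrierE[OF q0(1)])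
 have mem: "(A, B) : q 0" using AB g0.cls_eq by blast
 have ev: "gpoint.ev h (xi (FF n)) (q 0) = ins h (xi (FF n)) A / ins h (xi (FF n)) B" for n
 using gpoint.ev_rep[OF gp q0(1) mem] by blast
 obtain e where fr: "A : MP k (coords U)" "B : MP k (coords U)" "hmg e A" "hmg e B" "ins h (xi (FF 0)) B ~= 0" using AB(1) g0.fr_iff by blast
 have BI: "B ~: hom_ideal U" using g0.gen[OF fr(2,4)] fr(5) by blast
 have tr: "ALL p:PA k. p ~= 0 --> (SUM i<=degree p. mconst (cof p i) * A ^ i * B ^ (degree p - i)) ~: hom_ideal U"
 by (rule g0.transc_fraction[OF gD(1,2) q0(2) mem])
 obtain T D y mm where tb: "tbasis ka h T ze D y mm" "ze ` coords Z \<subseteq> sfg (sfg (h ` ka Un ze ` T) Un {y})"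
 by (rule tbasis_exists[OF kaacl ch finZ])
 interpret tb: tbasis ka h T ze D y mm by (rule tb(1))
 let ?f = "%n. gpoint.ev h (xi (FF n)) (q 0)"
 let ?PI = "{..<?d} \<rightarrow>\<^sub>E T"
 have evL: "gpoint.ev h (xi (FF n)) r : tb.L" if r: "r : carrier (function_field k U)" for n r
 proof -
 have kL: "h c : tb.L" if "c : k" for c using tb.hF0 tb.F0L kka that by blast
 have "ins h ze (FF n w) : tb.L" if "w : coords U" for w
 by (rule ins_in[OF tb.Ls(2) mrepD(1)[OF FF that]]) (use kL tb(2) in auto)
 hence "h ` k Un xi (FF n) ` coords U <= tb.L" using kL by blast
 thus ?thesis using gpoint.ev_in_sfg[OF gp r] sfg_least[OF tb.Ls(1)] by blast
 qed
 have "ALL n. EX I. I : ?PI & dt ?d (%i l. D (I i) (gpoint.ev h (xi (FF n)) (q l))) ~= 0"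
 proof
 fix n
 have "ALL l<?d. gpoint.ev h (xi (FF n)) (q l) : tb.L" using evL gD(1) by blast
 thus "EX I. I : ?PI & dt ?d (%i l. D (I i) (gpoint.ev h (xi (FF n)) (q l))) ~= 0" using frame_exists[OF tb(1) gp G] by blast
 qed
 then obtain I where I: "ALL n. I n : ?PI & dt ?d (%i l. D (I n i) (gpoint.ev h (xi (FF n)) (q l))) ~= 0"
 using choice[of "%n I. I : ?PI & dt ?d (%i l. D (I i) (gpoint.ev h (xi (FF n)) (q l))) ~= 0"] by blast
 have "finite (?f ` {n. I n = J})" if J: "J : ?PI" for J
 proof (rule ccontr)
 assume inf: "infinite (?f ` {n. I n = J})"
 then obtain c :: "nat => _" where c: "inj c" "range c \<subseteq> ?f ` {n. I n = J}" using infinite_countable_subset by blast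
 have "ALL i. EX n. I n = J & c i = ?f n" using c(2) by blast
 then obtain sg where sg: "ALL i. I (sg i) = J & c i = ?f (sg i)" using choice[of "%i n. I n = J & c i = ?f n"] by blast
 interpret kf: kofam k Z U h ze T D y mm "%i. g (sg i)" "%i. ee (sg i)" "%i. FF (sg i)" m q E om et y0 J
 proof (unfold_locales)
 show "J i : T" if "i < ?d" for i using J that by (auto simp: PiE_def)
 qed (rule tb(2) hvZ mor dom FF FFnz G y0)+
 have "kf.frame_nz" unfolding kf.frame_nz_def using I sg by metis
 then obtain n n' where n: "n < n'" "?f (sg n) = ?f (sg n')" using kf.values_repeat[OF _ d0] by blast
 hence "c n = c n'" using sg by simp
 thus False using c(1) n(1) unfolding inj_def by blast
 qed
 moreover have "finite ?PI" using tb.finT by (intro finite_PiE) auto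
 ultimately have "finite (UN J:?PI. ?f ` {n. I n = J})" by (intro finite_UN_I)
 moreover have "range ?f <= (UN J:?PI. ?f ` {n. I n = J})" using I by blast
 ultimately have "finite (range ?f)" using finite_subset by blast
 thus ?thesis unfolding ev using fr(1-4) BI tr by blast
qed

end

section \<open>Ideals of polynomials\<close>

lemma subfield_sfd:
 assumes "subfield k (ring_of_type_algebra :: complex ring)" shows "sfd k"
proof -
 let ?R = "ring_of_type_algebra :: complex ring"
 interpret R: field ?R by (rule field_from_type_algebra)
 have s: "subring k ?R" using subfieldE(1)[OF assms] .
 note sE = subringE[OF s]
 have ops: "x \<oplus>\<^bsub>?R\<^esub> y = x + y" "x \<otimes>\<^bsub>?R\<^esub> y = x * y" "\<one>\<^bsub>?R\<^esub> = 1" "\<zero>\<^bsub>?R\<^esub> = 0" "carrier ?R = UNIV" for x y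
 by (simp_all add: ring_of_type_algebra_def)
 have neg: "\<ominus>\<^bsub>?R\<^esub> x = - x" for x
 using R.minus_equality[of "- x" x] by (simp add: ops)
 have inv: "inverse x : k" if x: "x : k" "x ~= 0" for x
 proof -
 have "inv\<^bsub>?R\<^esub> x : k" "x \<otimes>\<^bsub>?R\<^esub> inv\<^bsub>?R\<^esub> x = \<one>\<^bsub>?R\<^esub>" using R.subfield_m_inv(1,2)[OF assms, of x] x by (auto simp: ops)
 thus ?thesis using inverse_unique[of x "inv\<^bsub>?R\<^esub> x"] by (simp add: ops)
 qed
 show ?thesis unfolding sfd_def srg_def
 proof (intro conjI ballI)
 show "1 : k" using sE(3) by (simp add: ops)
 fix x y assume "x : k" "y : k"
 thus "x + y : k" "x * y : k" using sE(6,7)[of x y] by (simp_all add: ops)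
 next
 fix x assume "x : k"
 thus "- x : k" "inverse x : k" using sE(5)[of x] inv[of x] sE(2) by (simp add: neg, cases "x = 0", auto simp: ops)
 qed
qed

lemma mpoly_ring_ops:
 "\<zero>\<^bsub>mpoly_ring k N\<^esub> = 0" "\<one>\<^bsub>mpoly_ring k N\<^esub> = 1" "F \<oplus>\<^bsub>mpoly_ring k N\<^esub> G = F + G" "F \<otimes>\<^bsub>mpoly_ring k N\<^esub> G = F * G"
 by (simp_all add: mpoly_ring_def)

lemma mpoly_ring_ring:
 assumes k: "srg k" shows "ring (mpoly_ring k N)"
proof (rule ringI)
 note M = MP_srg[OF k, of N]
 show "abelian_group (mpoly_ring k N)"
 proof (rule abelian_groupI)
 fix F assume "F : MP k N"
 thus "EX G:MP k N. G \<oplus>\<^bsub>mpoly_ring k N\<^esub> F = \<zero>\<^bsub>mpoly_ring k N\<^esub>"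
 using srgD(5)[OF M] by (intro bexI[of _ "- F"]) (auto simp: mpoly_ring_ops)
 qed (auto simp: mpoly_ring_ops srgD(2,3)[OF M] add_ac)
 show "Group.monoid (mpoly_ring k N)"
 by (rule monoidI) (auto simp: mpoly_ring_ops srgD(1,4)[OF M] mult_ac)
qed (simp_all add: mpoly_ring_ops algebra_simps)

lemma mpoly_idealI:
 assumes k: "srg k" and I: "I \<subseteq> MP k N" "0 : I" "!!F G. F : I ==> G : I ==> F + G : I" "!!F G. F : MP k N ==> G : I ==> F * G : I"
 shows "ideal I (mpoly_ring k N)"
proof (rule idealI[OF mpoly_ring_ring[OF k]])
 interpret R: ring "mpoly_ring k N" by (rule mpoly_ring_ring[OF k])
 note M = MP_srg[OF k, of N]
 have neg: "- F : I" if "F : I" for F using I(4)[OF srgD(5)[OF M srgD(1)[OF M]] that] by simp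
 have inv: "\<ominus>\<^bsub>mpoly_ring k N\<^esub> F = - F" if "F : I" for F
 by (rule R.minus_equality) (use that neg I(1) in \<open>auto simp: mpoly_ring_ops\<close>)
 show "subgroup I (add_monoid (mpoly_ring k N))"
 by (rule R.add.subgroupI) (use I neg inv in \<open>auto simp: mpoly_ring_ops\<close>)
 fix F G assume "F : I" "G : MP k N"
 thus "G \<otimes>\<^bsub>mpoly_ring k N\<^esub> F : I" "F \<otimes>\<^bsub>mpoly_ring k N\<^esub> G : I" using I(4)[of G F] by (simp_all add: mpoly_ring_ops mult.commute)
qed

lemma mpoly_idealD:
 assumes "ideal I (mpoly_ring k N)"
 shows "I \<subseteq> MP k N" "0 : I" "F : I ==> G : I ==> F + G : I" "F : MP k N ==> G : I ==> F * G : I"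
proof -
 interpret ideal I "mpoly_ring k N" by (rule assms)
 show "I <= MP k N" using a_subset by blast
 show "0 : I" using additive_subgroup.zero_closed[OF ideal.axioms(1)[OF assms]] by (simp add: mpoly_ring_ops)
 show "F : I ==> G : I ==> F + G : I" using additive_subgroup.a_closed[OF ideal.axioms(1)[OF assms], of F G] by (simp add: mpoly_ring_ops)
 show "F : MP k N ==> G : I ==> F * G : I" using I_l_closed[of G F] by (simp add: mpoly_ring_ops)
qed

lemma genidealD: "F : genideal R S ==> ideal I R ==> S \<subseteq> I ==> F : I"
 unfolding genideal_def by blast

lemma sum_closed_induct: assumes "!!i. i : I ==> f i : J" "0 : J" "!!F G. F : J ==> G : J ==> F + G : J"
 shows "sum f I : J"
 using assms by (induct I rule: infinite_finite_induct) auto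

lemma meval_hom: "meval x (F + G) = meval x F + meval x G" "meval x (F * G) = meval x F * meval x G" "meval x 0 = 0" "meval x 1 = 1"
 "meval x (mvar v) = x v" "meval x (mconst c) = c" "meval x (F - G) = meval x F - meval x G" "meval x (F ^ n) = meval x F ^ n"
 "meval x (prod f I) = (PROD i:I. meval x (f i))" "meval x (sum f I) = (SUM i:I. meval x (f i))"
 by (simp_all add: meval_ins ins_add[OF chom_id] ins_mult[OF chom_id] ins_1[OF chom_id] ins_var[OF chom_id] ins_const[OF chom_id]
 ins_ops[OF chom_id] ins_sum[OF chom_id])

lemma vanishing_ideal: "srg k ==> ideal {F : MP k N. meval x F = 0} (mpoly_ring k N)"
 by (rule mpoly_idealI) (auto simp: meval_hom MP_add MP_mult srgD(2)[OF MP_srg])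

lemma meval_in: assumes "srg K" "F : MP K N" "ALL v. x v : K" shows "meval x F : K"
 unfolding meval_ins by (rule ins_in[OF assms(1,2)]) (use assms(3) in auto)

lemma hvD:
 assumes "x : hv k V"
 shows "x v : kbar k" "v ~: coords V ==> x v = 0" "EX v:coords V. x v ~= 0" "F : hom_ideal V ==> meval x F = 0"
 using assms unfolding hom_vectors_def by blast+

section \<open>Points of projective varieties\<close>

locale pvariety =
 fixes k :: "complex set" and V :: "'v proj_subscheme"
 assumes kf: "sfd k" and pv: "projective_variety k V"
begin

abbreviation "ka \<equiv> kbar k"
abbreviation "N \<equiv> coords V"
abbreviation "Ik \<equiv> genideal (mpoly_ring ka N) (hom_ideal V)"

lemma ks: "srg k" using kf by (rule sfdD)
lemma kka: "k \<subseteq> ka" by (rule alg_closure_acl(2)[OF kf])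
lemma kaacl: "acl ka" by (rule alg_closure_acl(1)[OF kf])
lemma kas: "srg ka" "sfd ka" using kaacl by (auto simp: acl_def sfd_def)
lemma MPka: "F : MP k M ==> F : MP ka M" using MP_mono[OF kka order_refl] by blast

lemma finN: "finite N" and Iideal: "ideal (hom_ideal V) (mpoly_ring k N)" and Ihom: "ALL F:hom_ideal V. ALL e. hpt e F : hom_ideal V"
 and Iprime: "primeideal Ik (mpoly_ring ka N)"
 using pv unfolding projective_variety_def by blast+

lemma IM: "hom_ideal V \<subseteq> MP k N" by (rule mpoly_idealD(1)[OF Iideal])

lemma Ik_vanish: assumes "F : Ik" "x : hv k V" shows "meval x F = 0"
proof -
 have "hom_ideal V <= {F : MP ka N. meval x F = 0}" using IM MPka hvD(4)[OF assms(2)] by blast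
 thus ?thesis using genidealD[OF assms(1) vanishing_ideal[OF kas(1)]] by blast
qed

lemma Ik_ideal: "ideal Ik (mpoly_ring ka N)" using Iprime by (rule primeideal.axioms(1))

lemma I_Ik: "hom_ideal V \<subseteq> Ik" unfolding genideal_def by blast

lemma Ik_prm: "prm (MP ka N) Ik"
proof -
 note D = mpoly_idealD[OF Ik_ideal]
 interpret primeideal Ik "mpoly_ring ka N" by (rule Iprime)
 have "1 ~: Ik"
 proof
 assume "1 : Ik"
 hence "MP ka N <= Ik" using D(4)[of _ 1] by auto
 thus False using I_notcarr D(1) by blast
 qed
 thus ?thesis unfolding prm_def using D I_prime by (auto simp: mpoly_ring_ops)
qed

lemma vanish_Ik:
 assumes F: "F : MP ka N" and z: "ALL x:hom_vectors k V. meval x F = 0" and ne: "hv k V ~= {}"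
 shows "F : Ik"
proof (rule ccontr)
 assume no: "F ~: Ik"
 obtain x0 v where x0: "x0 : hv k V" "v : N" "x0 v ~= 0" using ne hvD(3) by blast
 have "mvar v ~: Ik" using Ik_vanish[OF _ x0(1), of "mvar v"] x0(3) by (auto simp: meval_hom)
 moreover have vM: "mvar v : MP ka N" by (rule MP_var[OF kas(1) x0(2)])
 \<comment> \<open>Multiplying by a coordinate keeps the Nullstellensatz from returning the zero
   vector, which is not a point of projective space.\<close>
 ultimately have "F * mvar v ~: Ik" using prmD(6)[OF Ik_prm F vM] no by blast
 then obtain x where x: "ALL v. x v : ka" "ALL F:Ik. meval x F = 0" "meval x (F * mvar v) ~= 0"
 by (rule nullstellensatz[OF kaacl finN Ik_prm MP_mult[OF kas(1) F vM]])
 define x' where "x' u = (if u : N then x u else 0)" for u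
 have e: "meval x' G = meval x G" if "G : MP ka N" for G unfolding meval_ins by (rule ins_cong[OF that]) (auto simp: x'_def)
 have "x' v ~= 0" "meval x' F ~= 0" using x(3) e[OF F] x0(2) by (auto simp: meval_hom x'_def)
 moreover have "x' : hv k V" unfolding hom_vectors_def
 proof (intro CollectI conjI allI impI ballI)
 show "x' u : ka" for u using x(1) srgD(2)[OF kas(1)] by (simp add: x'_def)
 show "x' u = 0" if "u ~: N" for u using that by (simp add: x'_def)
 show "EX u. x' u ~= 0" using \<open>x' v ~= 0\<close> by blast
 show "meval x' P = 0" if P: "P : hom_ideal V" for P
 proof -
 have "P : MP ka N" "P : Ik" using P IM MPka I_Ik by blast+
 thus ?thesis using e x(2) by simp
 qed
 qed
 ultimately show False using z by blast
qed

lemma irreducible: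
 assumes F: "F : MP ka N" "x1 : hv k V" "meval x1 F ~= 0" and G: "G : MP ka N" "x2 : hv k V" "meval x2 G ~= 0"
 shows "EX x:hom_vectors k V. meval x F ~= 0 & meval x G ~= 0"
proof (rule ccontr)
 assume "\<not> ?thesis"
 hence "ALL x:hom_vectors k V. meval x (F * G) = 0" by (auto simp: meval_hom)
 hence "F * G : Ik" using vanish_Ik[OF MP_mult[OF kas(1) F(1) G(1)]] F(2) by blast
 hence "F : Ik \<or> G : Ik" by (rule prmD(6)[OF Ik_prm F(1) G(1)])
 thus False using Ik_vanish F(2,3) G(2,3) by blast
qed

lemma mconst_add: "mconst (a + b) = mconst a + mconst b" and mconst_mult: "mconst (a * b) = mconst a * mconst b"
 using phomD(3,4)[OF chom_mconst] by auto

text \<open>The extended ideal consists of combinations of elements of the ideal over k with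
  constants from the algebraic closure: such sums are already closed under multiplication. This
  explicit form is what the descent to k compares coefficients in.\<close>

lemma Ik_span:
 assumes "F : Ik" shows "EX B H. finite B & B \<subseteq> ka & (ALL b:B. H b : hom_ideal V) & F = (SUM b:B. mconst b * H b)"
proof -
 note D = mpoly_idealD[OF Iideal]
 let ?J = "{F. EX B H. finite B & B \<subseteq> ka & (ALL b:B. H b : hom_ideal V) & F = (SUM b:B. mconst b * H b)}"
 have JI: "F : ?J" if "finite B" "B \<subseteq> ka" "ALL b:B. H b : hom_ideal V" "F = (SUM b:B. mconst b * H b)" for F B H using that by blast
 have JM: "?J <= MP ka N"
 proof
 fix F assume "F : ?J"
 then obtain B H where B: "B \<subseteq> ka" "ALL b:B. H b : hom_ideal V" "F = (SUM b:B. mconst b * H b)" by blast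
 show "F : MP ka N" unfolding B(3) by (intro MP_sum[OF kas(1)] MP_mult[OF kas(1)] MP_const MPka) (use B(1,2) IM in auto)
 qed
 have J0: "0 : ?J" by (rule JI[of "{}"]) auto
 have Jadd: "F + G : ?J" if FJ: "F : ?J" and GJ: "G : ?J" for F G
 proof -
 obtain B H where B: "finite B" "B \<subseteq> ka" "ALL b:B. H b : hom_ideal V" "F = (SUM b:B. mconst b * H b)" using FJ by blast
 obtain B' H' where B': "finite B'" "B' \<subseteq> ka" "ALL b:B'. H' b : hom_ideal V" "G = (SUM b:B'. mconst b * H' b)" using GJ by blast
 let ?H = "%b. (if b : B then H b else 0) + (if b : B' then H' b else 0)"
 have "F = (SUM b:B Un B'. if b : B then mconst b * H b else 0)" unfolding B(4) by (rule sum.mono_neutral_cong_left) (use B(1) B'(1) in auto)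
 moreover have "G = (SUM b:B Un B'. if b : B' then mconst b * H' b else 0)" unfolding B'(4) by (rule sum.mono_neutral_cong_left) (use B(1) B'(1) in auto)
 ultimately have "F + G = (SUM b:B Un B'. (if b : B then mconst b * H b else 0) + (if b : B' then mconst b * H' b else 0))" by (simp add: sum.distrib)
 also have "\<dots> = (SUM b:B Un B'. mconst b * ?H b)" by (rule sum.cong) (auto simp: distrib_left)
 finally show ?thesis using D(2,3) B B' by (intro JI[of "B Un B'" ?H]) auto
 qed
 have Jsgl: "mconst a * P * G : ?J" if a: "a : ka" "P : MP k N" "G : ?J" for a P G
 proof (cases "a = 0")
 case True
 thus ?thesis using J0 by (simp add: mconst_def)
 next
 case False
 obtain B H where B: "finite B" "B \<subseteq> ka" "ALL b:B. H b : hom_ideal V" "G = (SUM b:B. mconst b * H b)" using a(3) by blast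
 have inj: "inj_on ((*) a) B" using False by (auto simp: inj_on_def)
 have "mconst a * P * G = (SUM b:B. mconst (a * b) * (P * H b))" unfolding B(4) sum_distrib_left by (simp add: mconst_mult mult_ac)
 also have "\<dots> = (SUM b:(*) a ` B. mconst b * (P * H (b / a)))" using sum.reindex[OF inj, of "%b. mconst b * (P * H (b / a))"] False by simp
 finally show ?thesis using B(1-3) a False srgD(4)[OF kas(1)] D(4) by (intro JI[of "(*) a ` B" "%b. P * H (b / a)"]) auto
 qed
 have Jmul: "F * G : ?J" if F: "F : MP ka N" and G: "G : ?J" for F G
 proof -
 have "F * G = (SUM m:kys F. mconst (lkp F m) * mval mvar m * G)"
 by (subst mpoly_sum_single[of F]) (simp add: single_eq sum_distrib_right)
 also have "\<dots> : ?J"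
 proof (rule sum_closed_induct)
 fix m assume m: "m : kys F"
 have mm: "mval mvar m : MP k N"
 proof (rule mval_in[OF MP_srg[OF ks] MP_var[OF ks]])
 fix v assume "v : kys m"
 thus "v : N" using m F unfolding MP_iff by blast
 qed
 have "lkp F m : ka" using m F unfolding MP_iff by blast
 thus "mconst (lkp F m) * mval mvar m * G : ?J" by (rule Jsgl[OF _ mm G])
 qed (rule J0, rule Jadd)
 finally show ?thesis .
 qed
 have "ideal ?J (mpoly_ring ka N)" by (rule mpoly_idealI[OF kas(1) JM J0 Jadd Jmul])
 moreover have "hom_ideal V <= ?J"
 proof
 fix F assume "F : hom_ideal V"
 thus "F : ?J" using srgD(1)[OF kas(1)] by (intro JI[of "{1}" "%_. F"]) (simp_all add: mconst_def)
 qed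
 ultimately have "F : ?J" by (rule genidealD[OF assms])
 thus ?thesis by blast
qed

lemma lkp_mconst_mult: "lkp (mconst c * F) m = c * lkp F m"
proof -
 have "mconst c * F = (SUM m:kys F. sgl m (c * lkp F m))"
 by (subst mpoly_sum_single[of F]) (simp add: mconst_def sum_distrib_left mult_single)
 thus ?thesis by (simp add: lookup_sum lookup_single when_def in_keys_iff)
qed

text \<open>The constants in a representation of H, and also 1, are expanded in elements C
  independent over k. Comparing coefficients at e in C shows that the e-coordinate of 1 times H lies
  in the ideal over k, and some coordinate of 1 is nonzero.\<close>

lemma descent:
 assumes H: "H : MP k N" "H : Ik" shows "H : hom_ideal V"
proof -
 note D = mpoly_idealD[OF Iideal]
 obtain B P where B: "finite B" "B \<subseteq> ka" "ALL b:B. P b : hom_ideal V" "H = (SUM b:B. mconst b * P b)" using Ik_span[OF H(2)] by blast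
 obtain C where C: "C \<subseteq> insert 1 B" "lind k C" "insert 1 B \<subseteq> lspan k C" using lbasis[OF kf, of "insert 1 B"] B(1) by auto
 have fC: "finite C" using C(1) B(1) finite_subset by blast
 have u: "ALL e:C. crd k C b e : k" "b = (SUM e:C. crd k C b e * e)" if "b : insert 1 B" for b using crd[of b k C] C(3) that by blast+
 let ?Q = "%e. SUM b:B. mconst (crd k C b e) * P b"
 have QI: "?Q e : hom_ideal V" if "e : C" for e
 proof (rule sum_closed_induct)
 fix b assume "b : B"
 thus "mconst (crd k C b e) * P b : hom_ideal V" using D(4)[OF MP_const] u(1) B(3) that by blast
 qed (rule D(2), rule D(3))
 have QM: "?Q e : MP k N" if "e : C" for e using QI[OF that] IM by blast
 have eq: "(SUM e:C. (crd k C 1 e * lkp H m - lkp (?Q e) m) * e) = 0" for m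
 proof -
 have "lkp H m = (SUM b:B. b * lkp (P b) m)" unfolding B(4) by (simp add: lookup_sum lkp_mconst_mult)
 also have "\<dots> = (SUM b:B. SUM e:C. crd k C b e * e * lkp (P b) m)"
 by (rule sum.cong[OF refl]) (use u(2) in \<open>metis insertI2 sum_distrib_right\<close>)
 also have "\<dots> = (SUM e:C. SUM b:B. crd k C b e * e * lkp (P b) m)" by (rule sum.swap)
 also have "\<dots> = (SUM e:C. lkp (?Q e) m * e)" unfolding lookup_sum lkp_mconst_mult sum_distrib_right by (simp add: mult_ac)
 finally have 1: "lkp H m = (SUM e:C. lkp (?Q e) m * e)" .
 have "lkp H m = (SUM e:C. crd k C 1 e * e) * lkp H m" using u(2)[of 1] by simp
 hence "lkp H m = (SUM e:C. crd k C 1 e * e * lkp H m)" unfolding sum_distrib_right .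
 also have "\<dots> = (SUM e:C. crd k C 1 e * lkp H m * e)" by (simp add: mult_ac)
 finally have 2: "(SUM e:C. crd k C 1 e * lkp H m * e) = lkp H m" by (rule sym)
 show ?thesis unfolding left_diff_distrib sum_subtractf 2 1[symmetric] by simp
 qed
 have co: "lkp F m : k" if "F : MP k N" for F m using that srgD(2)[OF ks] by (cases "m : kys F") (auto simp: MP_iff in_keys_iff)
 have e0: "crd k C 1 e * lkp H m = lkp (?Q e) m" if e: "e : C" for e m
 proof -
 have "ALL e:C. crd k C 1 e * lkp H m - lkp (?Q e) m : k"
 using u(1)[of 1] co[OF H(1)] co[OF QM] srgD(4,6)[OF ks] by blast
 hence "crd k C 1 e * lkp H m - lkp (?Q e) m = 0" by (rule lindD[OF C(2) _ eq e])
 thus ?thesis by simp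
 qed
 obtain e where e: "e : C" "crd k C 1 e ~= 0"
 proof -
 have "EX e:C. crd k C 1 e ~= 0"
 proof (rule ccontr)
 assume "\<not> ?thesis"
 hence "(SUM e:C. crd k C 1 e * e) = 0" by simp
 thus False using u(2)[of 1] by simp
 qed
 thus ?thesis using that by blast
 qed
 have "H = mconst (inverse (crd k C 1 e)) * ?Q e"
 proof (rule poly_mapping_eqI)
 fix m show "lkp H m = lkp (mconst (inverse (crd k C 1 e)) * ?Q e) m"
 unfolding lkp_mconst_mult e0[OF e(1), symmetric] using e(2) by simp
 qed
 moreover have "inverse (crd k C 1 e) : k" using sfdD(2)[OF kf] u(1)[of 1] e(1) by blast
 ultimately show ?thesis using D(4)[OF MP_const QI[OF e(1)], of "inverse (crd k C 1 e)"] by simp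
qed

lemma vanish_ideal: "H : MP k N ==> ALL x:hom_vectors k V. meval x H = 0 ==> hv k V ~= {} ==> H : hom_ideal V"
 using descent vanish_Ik MPka by blast

lemma hpart_vanish: "F : hom_ideal V ==> x : hv k V ==> meval x (hpt e F) = 0"
 using Ihom hvD(4) by blast

end

section \<open>Generic points\<close>

text \<open>At a finite index S the chosen point avoids the zero loci of those members of S that do
  not vanish identically; irreducibility provides such a point. Every polynomial belongs to almost
  every S, so the ultralimit avoids all these loci.\<close>

lemma generic_point:
 fixes Z :: "'z proj_subscheme"
 assumes ne: "hv k Z ~= {}"
 and irr: "!!F G x1 x2. F : MP K N ==> G : MP K N ==> x1 : hv k Z ==> x2 : hv k Z ==> meval x1 F ~= 0 ==> meval x2 G ~= 0 ==>
 EX x:hom_vectors k Z. meval x F ~= 0 & meval x G ~= 0" and Ks: "srg K"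
 obtains ze :: "'z => ('z mpoly, complex) ultra" where "!!F. F : MP K N ==> ins ucn ze F = 0 \<longleftrightarrow> (ALL x:hom_vectors k Z. meval x F = 0)"
proof -
 let ?H = "hv k Z"
 let ?nv = "{F : MP K N. EX x:?H. meval x F ~= 0}"
 have ex: "EX x:?H. ALL F:S Int ?nv. meval x F ~= 0" if fin: "finite S" for S
 proof -
 have pr: "(PROD F:S'. F) : ?nv" if "finite S'" "S' \<subseteq> ?nv" for S'
 using that
 proof (induct S' rule: finite_induct)
 case empty
 thus ?case using ne srgD(1)[OF MP_srg[OF Ks]] by (auto simp: meval_hom)
 next
 case (insert F S')
 hence F: "F : ?nv" and P: "\<Prod>S' : ?nv" by auto
 then obtain x1 x2 where "x1 : ?H" "meval x1 F ~= 0" "x2 : ?H" "meval x2 (\<Prod>S') ~= 0" by blast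
 then obtain x where "x : ?H" "meval x F ~= 0" "meval x (\<Prod>S') ~= 0" using irr[of F "\<Prod>S'" x1 x2] F P by blast
 hence "EX x:?H. meval x (F * \<Prod>S') ~= 0" by (auto simp: meval_hom)
 moreover have "F * \<Prod>S' : MP K N" using F P MP_mult[OF Ks] by blast
 ultimately show ?case using insert(1,2) by simp
 qed
 have "(PROD F:S Int ?nv. F) : ?nv" by (rule pr) (use fin in auto)
 then obtain x where "x : ?H" "meval x (PROD F:S Int ?nv. F) ~= 0" by blast
 thus ?thesis using fin unfolding meval_hom by (intro bexI[of _ x]) auto
 qed
 define x where "x S = (SOME x. x : ?H & (finite S --> (ALL F:S Int ?nv. meval x F ~= 0)))" for S :: "'z mpoly set"
 have x: "x S : ?H & (finite S --> (ALL F:S Int ?nv. meval (x S) F ~= 0))" for S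
 proof -
 have "EX x. x : ?H & (finite S --> (ALL F:S Int ?nv. meval x F ~= 0))" using ex[of S] ne by blast
 thus ?thesis unfolding x_def by (rule someI_ex)
 qed
 show ?thesis
 proof (rule that[of "%v. uabs (%S. x S v)"])
 fix F assume F: "F : MP K N"
 have e: "ins ucn (%v. uabs (%S. x S v)) F = uabs (%S. meval (x S) F)"
 using ins_uabs[of "%c. c" "%v S. x S v" F] by (simp add: meval_ins)
 show "ins ucn (%v. uabs (%S. x S v)) F = 0 \<longleftrightarrow> (ALL x:?H. meval x F = 0)"
 proof
 assume z: "ALL x:?H. meval x F = 0"
 have "meval (x S) F = 0" for S using x[of S] z by blast
 thus "ins ucn (%v. uabs (%S. x S v)) F = 0" unfolding e by (simp add: uabs_01)
 next
 assume i: "ins ucn (%v. uabs (%S. x S v)) F = 0"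
 show "ALL x:?H. meval x F = 0"
 proof (rule ccontr)
 assume "\<not> (ALL x:?H. meval x F = 0)"
 hence nv: "F : ?nv" using F by blast
 have 1: "uev (%S. meval (x S) F = 0)" using i unfolding e by (simp add: uabs_01 uabs_eq)
 have 2: "uev (%S. meval (x S) F ~= 0)" by (rule uev_mp2[OF uev_finite uev_mem[of F]]) (use x nv in blast)
 show False using 1 2 uev_not[of "%S. meval (x S) F = 0"] by blast
 qed
 qed
 qed
qed

section \<open>Composition of morphisms\<close>

lemma proj_point_scale:
 assumes k: "sfd k" and c: "c : kbar k" "c ~= 0" shows "ppt k (%v. c * x v) = ppt k x"
proof -
 have K: "sfd (kbar k)" using alg_closure_acl(1)[OF k] by (simp add: acl_def)
 note Ks = sfdD(1)[OF K]
 show ?thesis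
 proof
 show "ppt k (%v. c * x v) <= ppt k x"
 proof
 fix y assume "y : ppt k (%v. c * x v)"
 then obtain a where a: "a : kbar k" "a ~= 0" "y = (%v. a * (c * x v))" unfolding proj_point_def by blast
 have "y = (%v. (a * c) * x v)" using a(3) by (simp add: mult.assoc)
 thus "y : ppt k x" unfolding proj_point_def using srgD(4)[OF Ks a(1) c(1)] a(2) c(2) by force
 qed
 show "ppt k x <= ppt k (%v. c * x v)"
 proof
 fix y assume "y : ppt k x"
 then obtain a where a: "a : kbar k" "a ~= 0" "y = (%v. a * x v)" unfolding proj_point_def by blast
 have "y = (%v. (a / c) * (c * x v))" using a(3) c(2) by simp
 thus "y : ppt k (%v. c * x v)" unfolding proj_point_def using sfdD(3)[OF K a(1) c(1)] a(2) c(2) by force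
 qed
 qed
qed

lemma proj_point_eqD:
 assumes k: "sfd k" and e: "ppt k x = ppt k y"
 obtains c where "c : kbar k" "c ~= 0" "x = (%v. c * y v)"
proof -
 have "x : ppt k y" using proj_point_self[OF k, of x] e by simp
 thus ?thesis using that unfolding proj_point_def by blast
qed

lemma proj_point_prop:
 assumes k: "sfd k" and x: "x : hv k U" "x' : hv k U" and c: "ALL v:coords U. x v = c * x' v"
 shows "ppt k x = ppt k x'"
proof -
 have K: "sfd (kbar k)" using alg_closure_acl(1)[OF k] by (simp add: acl_def)
 obtain v where v: "v : coords U" "x v ~= 0" using hvD(3)[OF x(1)] by blast
 have c0: "c ~= 0" "x' v ~= 0" using v c by auto
 hence "c = x v / x' v" using c v(1) by simp
 hence cK: "c : kbar k" using sfdD(3)[OF K hvD(1)[OF x(1)] hvD(1)[OF x(2)]] by simp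
 have "x = (%v. c * x' v)"
 proof
 fix u show "x u = c * x' u" using c hvD(2)[OF x(1), of u] hvD(2)[OF x(2), of u] by (cases "u : coords U") auto
 qed
 thus ?thesis using proj_point_scale[OF k cK c0(1)] by metis
qed

lemma mrep_scalar:
 assumes k: "sfd k" and g: "g : points k Z \<rightarrow> points k U" and F: "mrep k Z U g e F"
 and y: "y : hv k Z" "w : coords U" "meval y (F w) ~= 0"
 obtains u c where "u : hv k U" "c : kbar k" "c ~= 0" "ALL w:coords U. meval y (F w) = c * u w" "g (ppt k y) = ppt k u"
proof -
 obtain u c where u: "u : hv k U" "c ~= 0" "ALL w:coords U. meval y (F w) = c * u w" "g (ppt k y) = ppt k u"
 using mrep_point[OF k g F y] by blast
 have K: "acl (kbar k)" "k <= kbar k" using alg_closure_acl[OF k] by auto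
 hence Ks: "sfd (kbar k)" "srg (kbar k)" by (auto simp: acl_def sfd_def)
 have "F w : MP k (coords Z)" using F y(2) unfolding mrep_def by blast
 hence "F w : MP (kbar k) (coords Z)" using MP_mono[OF K(2) order_refl] by blast
 hence m: "meval y (F w) : kbar k" by (rule meval_in[OF Ks(2)]) (use hvD(1)[OF y(1)] in blast)
 have "meval y (F w) = c * u w" using u(3) y(2) by blast
 hence "c = meval y (F w) / u w" using y(3) by auto
 hence "c : kbar k" using sfdD(3)[OF Ks(1) m hvD(1)[OF u(1)]] by simp
 thus ?thesis using that u by blast
qed

lemma mrep_scaleI:
 assumes k: "sfd k" and F: "ALL w:coords U. F w : MP k (coords Z) & hmg e (F w)"
 and s: "!!y w. y : hv k Z ==> w : coords U ==> meval y (F w) ~= 0 ==>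
 EX u c. u : hv k U & c : kbar k & (ALL w:coords U. meval y (F w) = c * u w) & g (ppt k y) = ppt k u"
 shows "mrep k Z U g e F"
 unfolding mrep_def
proof (intro conjI F ballI impI)
 fix y assume y: "y : hv k Z" "EX w:coords U. meval y (F w) ~= 0"
 then obtain w where w: "w : coords U" "meval y (F w) ~= 0" by blast
 obtain u c where u: "u : hv k U" "c : kbar k" "ALL w:coords U. meval y (F w) = c * u w" "g (ppt k y) = ppt k u"
 using s[OF y(1) w] by blast
 have c0: "c ~= 0" using u(3) w by auto
 have "(%w. if w : coords U then meval y (F w) else 0) = (%w. c * u w)"
 using u(3) hvD(2)[OF u(1)] by (auto simp: fun_eq_iff)
 thus "g (ppt k y) = ppt k (%w. if w : coords U then meval y (F w) else 0)"
 using u(4) proj_point_scale[OF k u(2) c0, of u] by simp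
qed

lemma morphism_id: assumes k: "sfd k" shows "morphism_over k Z Z (%Q. Q)"
 unfolding morphism_mrep
proof (intro conjI ballI)
 have ks: "srg k" using k by (rule sfdD)
 fix x assume x: "x : hv k Z"
 have "mrep k Z Z (%Q. Q) 1 mvar"
 proof (rule mrep_scaleI[OF k])
 show "ALL w:coords Z. mvar w : MP k (coords Z) & hmg 1 (mvar w)" by (intro ballI conjI MP_var[OF ks] hmg_var)
 fix y w assume y: "y : hv k Z"
 have k1: "1 : kbar k" using srgD(1)[OF ks] alg_closure_acl(2)[OF k] by blast
 show "EX u c. u : hv k Z & c : kbar k & (ALL w:coords Z. meval y (mvar w) = c * u w) & ppt k y = ppt k u"
 by (rule exI[of _ y], rule exI[of _ 1]) (simp add: meval_hom y k1)
 qed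
 moreover have "EX w:coords Z. meval x (mvar w) ~= 0" using hvD(3)[OF x] by (simp add: meval_hom)
 ultimately show "EX e F. mrep k Z Z (%Q. Q) e F & (EX w:coords Z. meval x (F w) ~= 0)"
 by (intro exI[of _ 1] exI[of _ mvar] conjI)
qed simp

lemma morphism_comp:
 assumes k: "sfd k" and g1: "morphism_over k Z Y g1" and g2: "morphism_over k Y U g2"
 shows "morphism_over k Z U (%Q. g2 (g1 Q))"
 unfolding morphism_mrep
proof (intro conjI ballI)
 have ks: "srg k" using k by (rule sfdD)
 let ?ka = "kbar k"
 have kas: "srg ?ka" "k <= ?ka" using alg_closure_acl[OF k] by (auto simp: acl_def sfd_def)
 have p: "g1 : points k Z \<rightarrow> points k Y" "g2 : points k Y \<rightarrow> points k U" using g1 g2 by (auto simp: morphism_mrep)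
 thus "(%Q. g2 (g1 Q)) : points k Z \<rightarrow> points k U" by auto
 fix x assume x: "x : hv k Z"
 obtain e F w where F: "mrep k Z Y g1 e F" "w : coords Y" "meval x (F w) ~= 0" using g1 x unfolding morphism_mrep by blast
 obtain x' a where x': "x' : hv k Y" "a : ?ka" "a ~= 0" "ALL w:coords Y. meval x (F w) = a * x' w" "g1 (ppt k x) = ppt k x'"
 by (rule mrep_scalar[OF k p(1) F(1) x F(2,3)])
 obtain e' G w' where G: "mrep k Y U g2 e' G" "w' : coords U" "meval x' (G w') ~= 0" using g2 x'(1) unfolding morphism_mrep by blast
 obtain v where v: "v : coords Y" "x' v ~= 0" using hvD(3)[OF x'(1)] by blast
 have FM: "F w : MP k (coords Z)" "hmg e (F w)" if "w : coords Y" for w using F(1) that unfolding mrep_def by auto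
 have GM: "G w : MP k (coords Y)" "hmg e' (G w)" if "w : coords U" for w using G(1) that unfolding mrep_def by auto
 \<comment> \<open>The extra factor \<open>mvar v\<close> makes the composite vanish wherever
   \<open>F v\<close> does. Otherwise a representation \<open>G\<close> of degree 0 would be nonzero
   even where \<open>F\<close> is undefined.\<close>
 let ?G = "%w. G w * mvar v"
 have G2: "?G w : MP k (coords Y)" "hmg (e' + 1) (?G w)" if "w : coords U" for w
 using MP_mult[OF ks GM(1)[OF that] MP_var[OF ks v(1)]] hmg_mult[OF GM(2)[OF that] hmg_var] by auto
 let ?H = "%w. msubst F (?G w)"
 have val: "meval y (?H w) = c ^ (e' + 1) * (meval u (G w) * u v)" if "w : coords U" "ALL w:coords Y. meval y (F w) = c * u w" for y c u w
 unfolding meval_msubst using meval_scale[OF G2[OF that(1)] that(2)] by (simp add: meval_hom)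
 have "mrep k Z U (%Q. g2 (g1 Q)) (e * (e' + 1)) ?H"
 proof (rule mrep_scaleI[OF k], intro ballI conjI)
 fix w assume w: "w : coords U"
 show "?H w : MP k (coords Z)" by (rule MP_msubst[OF ks G2(1)[OF w] FM(1)])
 show "hmg (e * (e' + 1)) (?H w)" by (rule hmg_msubst[OF G2(2)[OF w] G2(1)[OF w] FM(2)])
 next
 fix y w assume y: "y : hv k Z" and w: "w : coords U" "meval y (?H w) ~= 0"
 have "meval y (F v) ~= 0" using w(2) unfolding meval_msubst by (auto simp: meval_hom)
 then obtain u c where u: "u : hv k Y" "c : ?ka" "c ~= 0" "ALL w:coords Y. meval y (F w) = c * u w" "g1 (ppt k y) = ppt k u"
 by (rule mrep_scalar[OF k p(1) F(1) y v(1)])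
 have "meval u (G w) ~= 0" using w(2) unfolding val[OF w(1) u(4)] by auto
 then obtain u' c' where u': "u' : hv k U" "c' : ?ka" "c' ~= 0" "ALL w:coords U. meval u (G w) = c' * u' w" "g2 (ppt k u) = ppt k u'"
 by (rule mrep_scalar[OF k p(2) G(1) u(1) w(1)])
 have "ALL w:coords U. meval y (?H w) = (c ^ (e' + 1) * (c' * u v)) * u' w" using val[OF _ u(4)] u'(4) by (simp add: mult_ac)
 moreover have "c ^ (e' + 1) * (c' * u v) : ?ka" by (intro srgD(4,7)[OF kas(1)] u(2) u'(2) hvD(1)[OF u(1)])
 ultimately show "EX u c. u : hv k U & c : ?ka & (ALL w:coords U. meval y (?H w) = c * u w) & g2 (g1 (ppt k y)) = ppt k u"
 using u'(1,5) u(5) by metis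
 qed
 moreover have "meval x (?H w') ~= 0" unfolding val[OF G(2) x'(4)] using x'(3) G(3) v(2) by simp
 ultimately show "EX e F. mrep k Z U (%Q. g2 (g1 Q)) e F & (EX w:coords U. meval x (F w) ~= 0)" using G(2) by blast
qed

lemma morphism_funpow: assumes k: "sfd k" and f: "morphism_over k Z Z f" shows "morphism_over k Z Z (f ^^ n)"
proof (induct n)
 case 0
 thus ?case using morphism_id[OF k, of Z] by (simp add: id_def)
next
 case (Suc n)
 show ?case using morphism_comp[OF k Suc f] by (simp add: comp_def)
qed

section \<open>Coordinate projections and orbits\<close>

text \<open>In a Segre product the projection to a factor is given, on each chart, by a subset of the coordinates.\<close>

locale cproj =
 fixes k :: "complex set" and Z :: "'z proj_subscheme" and U :: "'u proj_subscheme" and C :: "'c set" and io :: "'c => 'u => 'z"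
 and \<pi> :: "('z => complex) => 'u => complex"
 assumes pvU: "pvariety k U" and finZ: "finite (coords Z)" and IZ: "hom_ideal Z \<subseteq> MP k (coords Z)"
 and hZ: "!!F e x. F : hom_ideal Z ==> x : hv k Z ==> meval x (hpt e F) = 0"
 and irr: "!!F G x1 x2. F : MP (kbar k) (coords Z) ==> G : MP (kbar k) (coords Z) ==> x1 : hv k Z ==> x2 : hv k Z ==>
 meval x1 F ~= 0 ==> meval x2 G ~= 0 ==> EX x:hom_vectors k Z. meval x F ~= 0 & meval x G ~= 0"
 and io: "!!c u. c : C ==> u : coords U ==> io c u : coords Z"
 and \<pi>1: "!!z. z : hv k Z ==> \<pi> z : hv k U"
 and \<pi>2: "!!z c. z : hv k Z ==> c : C ==> EX a:alg_closure_in_C k. ALL u:coords U. z (io c u) = a * \<pi> z u"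
 and \<pi>3: "!!z. z : hv k Z ==> EX c:C. EX u:coords U. z (io c u) ~= 0"
 and \<pi>4: "!!x. x : hv k U ==> EX z:hom_vectors k Z. EX a. ALL u:coords U. x u = a * \<pi> z u"
begin

interpretation U: pvariety k U by (rule pvU)

definition pr :: "('z => complex) set => ('u => complex) set" where
 "pr Q = ppt k (\<pi> (SOME z. z : hv k Z & ppt k z = Q))"

lemma pr: assumes z: "z : hv k Z" shows "pr (ppt k z) = ppt k (\<pi> z)"
proof -
 define z' where "z' = (SOME z'. z' : hv k Z & ppt k z' = ppt k z)"
 have z': "z' : hv k Z & ppt k z' = ppt k z" unfolding z'_def by (rule someI[of _ z]) (use z in simp)
 obtain b where b: "b ~= 0" "z' = (%v. b * z v)" by (rule proj_point_eqD[OF U.kf z'[THEN conjunct2]])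
 obtain c u where c: "c : C" "u : coords U" "z' (io c u) ~= 0" using \<pi>3[OF z'[THEN conjunct1]] by blast
 obtain a a' where a: "ALL u:coords U. z' (io c u) = a' * \<pi> z' u" "ALL u:coords U. z (io c u) = a * \<pi> z u" using \<pi>2[OF _ c(1)] z' z by metis
 have "a' ~= 0" using a(1) c(2,3) by auto
 hence "\<pi> z' u = (b * a / a') * \<pi> z u" if "u : coords U" for u
 proof -
 have "a' * \<pi> z' u = b * (a * \<pi> z u)" using a that b(2) by simp
 thus ?thesis using \<open>a' ~= 0\<close> by (simp add: field_simps)
 qed
 hence all: "ALL v:coords U. \<pi> z' v = (b * a / a') * \<pi> z v" by blast
 have "ppt k (\<pi> z') = ppt k (\<pi> z)" by (rule proj_point_prop[OF U.kf \<pi>1[OF z'[THEN conjunct1]] \<pi>1[OF z] all])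
 thus ?thesis unfolding pr_def z'_def .
qed

lemma pr_morphism: assumes f: "morphism_over k Z Z f" shows "morphism_over k Z U (%Q. pr (f Q))"
 unfolding morphism_mrep
proof (intro conjI ballI)
 let ?ka = "kbar k"
 have p: "f : points k Z \<rightarrow> points k Z" using f by (auto simp: morphism_mrep)
 show "(%Q. pr (f Q)) : points k Z \<rightarrow> points k U"
 proof
 fix Q assume "Q : points k Z"
 hence "f Q : points k Z" using p by blast
 then obtain z where "z : hv k Z" "f Q = ppt k z" unfolding points_def by blast
 thus "pr (f Q) : points k U" using pr \<pi>1 unfolding points_def by simp
 qed
 fix x assume x: "x : hv k Z"
 obtain e F w where F: "mrep k Z Z f e F" "w : coords Z" "meval x (F w) ~= 0" using f x unfolding morphism_mrep by blast
 have FM: "F w : MP k (coords Z) & hmg e (F w)" if "w : coords Z" for w using F(1) that unfolding mrep_def by auto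
 obtain x' a where x': "x' : hv k Z" "a ~= 0" "ALL w:coords Z. meval x (F w) = a * x' w"
 by (rule mrep_scalar[OF U.kf p F(1) x F(2,3)])
 obtain c u where c: "c : C" "u : coords U" "x' (io c u) ~= 0" using \<pi>3[OF x'(1)] by blast
 have "mrep k Z U (%Q. pr (f Q)) e (%u. F (io c u))"
 proof (rule mrep_scaleI[OF U.kf])
 show "ALL u:coords U. F (io c u) : MP k (coords Z) & hmg e (F (io c u))" using FM io[OF c(1)] by blast
 fix y w assume y: "y : hv k Z" and w: "w : coords U" "meval y (F (io c w)) ~= 0"
 obtain z b where z: "z : hv k Z" "b : ?ka" "b ~= 0" "ALL w:coords Z. meval y (F w) = b * z w" "f (ppt k y) = ppt k z"
 by (rule mrep_scalar[OF U.kf p F(1) y io[OF c(1) w(1)] w(2)])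
 obtain a' where a': "a' : ?ka" "ALL u:coords U. z (io c u) = a' * \<pi> z u" using \<pi>2[OF z(1) c(1)] by blast
 have "ALL w:coords U. meval y (F (io c w)) = (b * a') * \<pi> z w" using z(4) a'(2) io[OF c(1)] by simp
 moreover have "b * a' : ?ka" by (rule srgD(4)[OF U.kas(1) z(2) a'(1)])
 ultimately show "EX u b. u : hv k U & b : ?ka & (ALL w:coords U. meval y (F (io c w)) = b * u w) & pr (f (ppt k y)) = ppt k u"
 using \<pi>1[OF z(1)] z(5) pr[OF z(1)] by metis
 qed
 moreover have "meval x (F (io c u)) ~= 0" using x'(2,3) c io by simp
 ultimately show "EX e F. mrep k Z U (%Q. pr (f Q)) e F & (EX w:coords U. meval x (F w) ~= 0)" using c(2) by (intro exI[of _ e] exI[of _ "%u. F (io c u)"]) blast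
qed

lemma prod_not_ideal:
 assumes "finite J" "!!j. j : J ==> H j : MP k (coords U) & (EX e. hmg e (H j)) & H j ~: hom_ideal U" and ne: "hv k U ~= {}"
 shows "prod H J : MP k (coords U) & (EX e. hmg e (prod H J)) & prod H J ~: hom_ideal U"
 using assms(1,2)
proof (induct J rule: finite_induct)
 case empty
 obtain u where "u : hv k U" using ne by blast
 hence "1 ~: hom_ideal U" using hvD(4)[of u k U 1] by (auto simp: meval_hom)
 thus ?case using hmg_1 srgD(1)[OF MP_srg[OF U.ks]] by auto
next
 case (insert a J)
 have H: "H a : MP k (coords U)" "H a ~: hom_ideal U" "prod H J : MP k (coords U)" "prod H J ~: hom_ideal U" using insert by auto
 obtain e e' where e: "hmg e (H a)" "hmg e' (prod H J)" using insert by (metis insertI1 insertI2)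
 obtain x1 x2 where x: "x1 : hv k U" "meval x1 (H a) ~= 0" "x2 : hv k U" "meval x2 (prod H J) ~= 0"
 using U.vanish_ideal[OF H(1) _ ne] U.vanish_ideal[OF H(3) _ ne] H(2,4) by blast
 obtain x where "x : hv k U" "meval x (H a) ~= 0" "meval x (prod H J) ~= 0"
 using U.irreducible[OF U.MPka[OF H(1)] x(1,2) U.MPka[OF H(3)] x(3,4)] by blast
 hence "H a * prod H J ~: hom_ideal U" using hvD(4)[of x k U "H a * prod H J"] by (auto simp: meval_hom)
 thus ?case using MP_mult[OF U.ks H(1,3)] hmg_mult[OF e] insert(1,2) by auto
qed

definition transc where "transc A B \<longleftrightarrow> A : MP k (coords U) & B : MP k (coords U) & (EX e. hmg e A & hmg e B) & B ~: hom_ideal U &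
 (ALL p:PA k. p ~= 0 --> (SUM i<=degree p. mconst (cof p i) * A ^ i * B ^ (degree p - i)) ~: hom_ideal U)"

text \<open>Points on which the transcendental function \<open>A / B\<close> takes one value in the algebraic closure lie on a divisor over \<open>k\<close>;
  points of the base locus lie on \<open>B = 0\<close>.\<close>

lemma class_divisor:
 assumes AB: "transc A B" and S: "S \<subseteq> hv k U" "ALL u:S. ALL u':S. meval u A * meval u' B = meval u' A * meval u B"
 shows "EX H. H : MP k (coords U) & (EX e. hmg e H) & H ~: hom_ideal U & (ALL u:S. meval u H = 0)"
proof (cases "EX u:S. meval u B ~= 0")
 case False
 thus ?thesis using AB unfolding transc_def by blast
next
 case True
 then obtain u where u: "u : S" "meval u B ~= 0" by blast
 have uv: "u : hv k U" using S(1) u(1) by blast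
 obtain e where ABM: "A : MP k (coords U)" "B : MP k (coords U)" "hmg e A" "hmg e B" using AB unfolding transc_def by blast
 define al where "al = meval u A / meval u B"
 have x: "ALL v. u v : kbar k" using hvD(1)[OF uv] by blast
 have "al : kbar k" unfolding al_def
 by (rule sfdD(3)[OF U.kas(2) meval_in[OF U.kas(1) U.MPka[OF ABM(1)] x] meval_in[OF U.kas(1) U.MPka[OF ABM(2)] x]])
 then obtain p where p: "p : PA k" "p ~= 0" "poly p al = 0" unfolding alg_closure_algb algb_def by blast
 let ?H = "SUM i<=degree p. mconst (cof p i) * A ^ i * B ^ (degree p - i)"
 have HM: "?H : MP k (coords U)" by (intro MP_sum[OF U.ks] srgD(4,7)[OF MP_srg[OF U.ks]] MP_const PA_D[OF p(1)] ABM)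
 have "hmg (0 + e * i + e * (degree p - i)) (mconst (cof p i) * A ^ i * B ^ (degree p - i))" for i
 by (intro hmg_mult hmg_const hmg_power ABM)
 moreover have "0 + e * i + e * (degree p - i) = e * degree p" if "i : {..degree p}" for i using that by (simp flip: distrib_left)
 ultimately have hm: "hmg (e * degree p) ?H" by (intro hmg_sum) metis
 have "meval w ?H = 0" if w: "w : S" for w
 proof -
 have eq: "meval w A = al * meval w B" using S(2) w u by (simp add: field_simps al_def)
 have "meval w ?H = (SUM i<=degree p. cof p i * (al * meval w B) ^ i * meval w B ^ (degree p - i))" by (simp only: meval_hom eq)
 also have "\<dots> = (SUM i<=degree p. meval w B ^ degree p * (cof p i * al ^ i))"
 proof (rule sum.cong[OF refl])
 fix i assume "i : {..degree p}"
 hence "meval w B ^ degree p = meval w B ^ i * meval w B ^ (degree p - i)" by (simp flip: power_add)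
 thus "cof p i * (al * meval w B) ^ i * meval w B ^ (degree p - i) = meval w B ^ degree p * (cof p i * al ^ i)"
 by (simp add: power_mult_distrib mult_ac)
 qed
 also have "\<dots> = meval w B ^ degree p * poly p al" by (simp add: poly_altdef sum_distrib_left)
 finally show ?thesis using p(3) by simp
 qed
 moreover have "?H ~: hom_ideal U" using AB p(1,2) unfolding transc_def by blast
 ultimately show ?thesis using HM hm by blast
qed

text \<open>Positive dimension enters here. By \<open>class_divisor\<close>, a transcendental
  fraction puts each single geometric point on a proper divisor defined over k.\<close>

lemma transc_exists:
 assumes d: "variety_dim k U >= 1" and ne: "hv k U ~= {}" shows "EX A B. transc A B"
proof -
 obtain ze :: "'u => ('u mpoly, complex) ultra" where ze: "!!F. F : MP (kbar k) (coords U) ==> ins ucn ze F = 0 \<longleftrightarrow> (ALL x:hom_vectors k U. meval x F = 0)"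
 proof (rule generic_point[OF ne _ U.kas(1), of "coords U"])
 fix F G x1 x2 assume "F : MP (kbar k) (coords U)" "G : MP (kbar k) (coords U)" "x1 : hv k U" "x2 : hv k U" "meval x1 F ~= 0" "meval x2 G ~= 0"
 thus "EX x:hom_vectors k U. meval x F ~= 0 & meval x G ~= 0" using U.irreducible by blast
 qed blast
 have ch: "chom (ucn :: complex => ('u mpoly, complex) ultra)" by (simp add: phom_def srg_UNIV ucn_hom)
 interpret g: gpoint k U "ucn :: complex => ('u mpoly, complex) ultra" ze
 proof (unfold_locales)
 fix e A assume A: "A : MP k (coords U)" "hmg e A"
 show "ins ucn ze A = 0 \<longleftrightarrow> A : hom_ideal U" using ze[OF U.MPka[OF A(1)]] U.vanish_ideal[OF A(1) _ ne] hvD(4) by blast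
 qed (rule U.kf ch U.finN)+
 obtain T where T: "T \<subseteq> carrier (function_field k U)" "finite T" "alg_independent k U T" "card T = variety_dim k U"
 using g.trans_degree_props(1)[of "carrier (function_field k U)"] unfolding variety_dim_def by blast
 then obtain t where t: "t : T" using d by fastforce
 then obtain A B where AB: "(A, B) : fractions k U" "t = g.cls (A, B)" using g.carrierE[of t] T(1) by blast
 have mem: "(A, B) : t" using AB g.cls_eq by blast
 have "transc A B" unfolding transc_def using g.transc_fraction[OF T(1,3) t mem] AB(1) unfolding fractions_def by blast
 thus ?thesis by blast
qed

text \<open>Density means that no finite family of divisors of U over k covers the projected orbit
  (\<open>nodiv\<close>). Both the dominance of the projections and the final contradiction come
  from exhibiting such a family.\<close>

theorem orbit_not_dense:
 assumes gt: "general_type k U" "variety_dim k U >= 1" and f: "morphism_over k Z Z f" and P: "P : points k Z"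
 shows "zariski k Z closure_of (forward_orbit f P) ~= points k Z"
proof
 assume dense: "zariski k Z closure_of (forward_orbit f P) = points k Z"
 let ?ka = "kbar k"
 obtain p0 where p0: "p0 : hv k Z" "P = ppt k p0" using P unfolding points_def by blast
 have neU: "hv k U ~= {}" and neZ: "hv k Z ~= {}" using \<pi>1[OF p0(1)] p0(1) by auto
 note fn = morphism_funpow[OF U.kf f]
 have "(f ^^ n) P : points k Z" for n using fn[of n] P unfolding morphism_mrep by blast
 hence "ALL n. EX z. z : hv k Z & (f ^^ n) P = ppt k z" unfolding points_def by blast
 then obtain pn where pn: "ALL n. pn n : hv k Z & (f ^^ n) P = ppt k (pn n)" using choice[of "%n z. z : hv k Z & (f ^^ n) P = ppt k z"] by blast
 define u where "u n = \<pi> (pn n)" for n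
 have u: "u n : hv k U" "pr ((f ^^ n) P) = ppt k (u n)" for n using pn \<pi>1 pr by (simp_all add: u_def)
 \<comment> \<open>The polynomial A is pulled back to Z through a chart c in which the projection is
   defined at z. Its nonvanishing locus is a nonempty open set, so the dense orbit meets it.\<close>
 have meet: "EX n. meval (u n) A ~= 0" if A: "A : MP k (coords U)" "hmg e A" "A ~: hom_ideal U" for A e
 proof -
 obtain x where x: "x : hv k U" "meval x A ~= 0" using U.vanish_ideal[OF A(1) _ neU] A(3) by blast
 obtain z a where z: "z : hv k Z" "ALL u:coords U. x u = a * \<pi> z u" using \<pi>4[OF x(1)] by blast
 have Az: "meval (\<pi> z) A ~= 0" using meval_scale[OF A(1,2) z(2)] x(2) by auto
 obtain c w where c: "c : C" "w : coords U" "z (io c w) ~= 0" using \<pi>3[OF z(1)] by blast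
 let ?H = "msubst (%u. mvar (io c u)) A"
 have HM: "?H : MP k (coords Z)" by (rule MP_msubst[OF U.ks A(1)]) (rule MP_var[OF U.ks io[OF c(1)]])
 have Hh: "hmg (1 * e) ?H" by (rule hmg_msubst[OF A(2,1)]) (rule hmg_var)
 have Hv: "EX b. meval y ?H = b ^ e * meval (\<pi> y) A & (ALL u:coords U. y (io c u) = b * \<pi> y u)" if y: "y : hv k Z" for y
 proof -
 obtain b where b: "ALL u:coords U. y (io c u) = b * \<pi> y u" using \<pi>2[OF y c(1)] by blast
 have "meval y ?H = meval (%u. y (io c u)) A" unfolding meval_msubst by (simp add: meval_hom)
 also have "\<dots> = b ^ e * meval (\<pi> y) A" by (rule meval_scale[OF A(1,2)]) (use b in simp)
 finally show ?thesis using b by blast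
 qed
 obtain b where b: "meval z ?H = b ^ e * meval (\<pi> z) A" "ALL u:coords U. z (io c u) = b * \<pi> z u" using Hv[OF z(1)] by blast
 have "b ~= 0" using b(2) c(2,3) by auto
 hence Hz: "meval z ?H ~= 0" using b(1) Az by simp
 let ?O = "{ppt k x |x. x : hv k Z & meval x ?H ~= 0}"
 have op: "openin (zariski k Z) ?O" unfolding zariski_def by (rule topology_generated_by_Basis) (use HM Hh in blast)
 have "ppt k z : zariski k Z closure_of (forward_orbit f P)" unfolding dense points_def using z(1) by (rule imageI)
 hence "ALL T. ppt k z : T & openin (zariski k Z) T --> (EX y. y : forward_orbit f P & y : T)"
 unfolding in_closure_of by (rule conjunct2)
 moreover have "ppt k z : ?O" using z(1) Hz by blast
 ultimately have "EX y. y : forward_orbit f P & y : ?O" using op by (elim allE[of _ ?O]) simp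
 then obtain y where y: "y : forward_orbit f P" "y : ?O" by (elim exE conjE)
 obtain n where n: "y = (f ^^ n) P" using y(1) unfolding forward_orbit_def by blast
 obtain z' where z': "y = ppt k z'" "z' : hv k Z" "meval z' ?H ~= 0" using y(2) by blast
 have "ppt k z' = ppt k (pn n)" using z'(1) n pn by simp
 then obtain a where "z' = (%v. a * pn n v)" by (rule proj_point_eqD[OF U.kf])
 hence "meval z' ?H = a ^ (1 * e) * meval (pn n) ?H" by (intro meval_scale[OF HM Hh]) simp
 hence "meval (pn n) ?H ~= 0" using z'(3) by auto
 hence "meval (u n) A ~= 0" using Hv[of "pn n"] pn unfolding u_def by auto
 thus ?thesis by blast
 qed
 have nodiv: False if H: "finite J" "!!j. j : J ==> H j : MP k (coords U) & (EX e. hmg e (H j)) & H j ~: hom_ideal U" "!!n. EX j:J. meval (u n) (H j) = 0" for J :: "'j set" and H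
 proof -
 have "prod H J : MP k (coords U) & (EX e. hmg e (prod H J)) & prod H J ~: hom_ideal U" by (rule prod_not_ideal[OF H(1) _ neU]) (rule H(2))
 then obtain e where pe: "hmg e (prod H J)" "prod H J : MP k (coords U)" "prod H J ~: hom_ideal U" by blast
 obtain n where "meval (u n) (prod H J) ~= 0" using meet[OF pe(2,1,3)] by blast
 thus False using H(1,3) by (auto simp: meval_hom)
 qed
 obtain A0 B0 where AB0: "transc A0 B0" using transc_exists[OF gt(2) neU] by blast
 obtain ze :: "'z => ('z mpoly, complex) ultra" where ze: "!!F. F : MP ?ka (coords Z) ==> ins ucn ze F = 0 \<longleftrightarrow> (ALL x:hom_vectors k Z. meval x F = 0)"
 by (rule generic_point[OF neZ irr U.kas(1)]) blast+
 have ch: "chom (ucn :: complex => ('z mpoly, complex) ultra)" by (simp add: phom_def srg_UNIV ucn_hom)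
 interpret kd: kod k Z U "ucn :: complex => ('z mpoly, complex) ultra" ze
 by (unfold_locales) (rule U.kf ch finZ IZ hZ ze U.finN U.IM U.Ihom; assumption)+
 let ?g = "%n Q. pr ((f ^^ n) Q)"
 have mor: "morphism_over k Z U (?g n)" for n by (rule pr_morphism[OF fn])
 \<comment> \<open>A form A vanishing on the image of the n-th projection would contain all orbit
   points from time n on, as that projection is also applied to later starting points; the first n
   points lie on n further divisors.\<close>
 have dom: "kd.dominant (?g n)" for n unfolding kd.dominant_def
 proof (intro allI impI)
 fix A e assume A: "A : MP k (coords U)" "hmg e A" "A ~: hom_ideal U"
 show "EX x:hom_vectors k Z. EX y:?g n (ppt k x). meval y A ~= 0"
 proof (rule ccontr)
 assume no: "\<not> ?thesis"
 have tail: "meval (u (n + j)) A = 0" for j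
 proof -
 have "pr ((f ^^ n) (ppt k (pn j))) = ppt k (u (n + j))" using pn[rule_format, of j] u(2)[of "n + j"] by (simp add: funpow_add)
 hence "u (n + j) : ?g n (ppt k (pn j))" using proj_point_self[OF U.kf] by simp
 thus ?thesis using no pn by blast
 qed
 have "EX H. H : MP k (coords U) & (EX e. hmg e H) & H ~: hom_ideal U & (ALL w:{u j}. meval w H = 0)" for j
 by (rule class_divisor[OF AB0]) (use u(1) in auto)
 then obtain H where H: "!!j. H j : MP k (coords U) & (EX e. hmg e (H j)) & H j ~: hom_ideal U & meval (u j) (H j) = 0"
 using choice[of "%j H. H : MP k (coords U) & (EX e. hmg e H) & H ~: hom_ideal U & (ALL w:{u j}. meval w H = 0)"] by auto
 let ?H = "%j. if j < n then H j else A"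
 show False
 proof (rule nodiv[of "{..n}" ?H])
 fix j assume "j : {..n}"
 show "?H j : MP k (coords U) & (EX e. hmg e (?H j)) & ?H j ~: hom_ideal U" using H[of j] A by auto
 next
 fix i show "EX j:{..n}. meval (u i) (?H j) = 0"
 proof (cases "i < n")
 case True
 thus ?thesis using H[of i] by (intro bexI[of _ i]) auto
 next
 case False
 thus ?thesis using tail[of "i - n"] by (intro bexI[of _ n]) auto
 qed
 qed simp
 qed
 qed
 have "ALL n. EX eF. mrep k Z U (?g n) (fst eF) (snd eF) & (EX w:coords U. meval p0 (snd eF w) ~= 0)"
 proof
 fix n
 obtain e F where "mrep k Z U (?g n) e F" "EX w:coords U. meval p0 (F w) ~= 0" using mor[of n] p0(1) unfolding morphism_mrep by blast
 thus "EX eF. mrep k Z U (?g n) (fst eF) (snd eF) & (EX w:coords U. meval p0 (snd eF w) ~= 0)" by (intro exI[of _ "(e, F)"]) simp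
 qed
 then obtain eF where eF: "ALL n. mrep k Z U (?g n) (fst (eF n)) (snd (eF n)) & (EX w:coords U. meval p0 (snd (eF n) w) ~= 0)"
 using choice[of "%n eF. mrep k Z U (?g n) (fst eF) (snd eF) & (EX w:coords U. meval p0 (snd eF w) ~= 0)"] by blast
 define FF where "FF n = snd (eF n)" for n
 have FF: "mrep k Z U (?g n) (fst (eF n)) (FF n)" "EX w:coords U. meval p0 (FF n w) ~= 0" for n using eF by (auto simp: FF_def)
 have FFnz: "EX w:coords U. kd.xi (FF n) w ~= 0" for n
 proof -
 obtain w where w: "w : coords U" "meval p0 (FF n w) ~= 0" using FF(2) by blast
 thus ?thesis using kd.gen_k[OF kd.mrepD(1)[OF FF(1) w(1)]] p0(1) by blast
 qed
 from kd.finite_values[where g = "?g" and ee = "%n. fst (eF n)" and FF = FF and ?y0.0 = "u 0", OF gt neZ u(1) mor dom FF(1) FFnz]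
 obtain A B e where AB: "A : MP k (coords U)" "B : MP k (coords U)" "hmg e A" "hmg e B" "B ~: hom_ideal U"
 "ALL p:PA k. p ~= 0 --> (SUM i<=degree p. mconst (cof p i) * A ^ i * B ^ (degree p - i)) ~: hom_ideal U"
 "finite (range (%n. ins ucn (kd.xi (FF n)) A / ins ucn (kd.xi (FF n)) B))"
 by (elim exE conjE)
 have tr: "transc A B" unfolding transc_def using AB(1-6) by blast
 let ?c = "%n. ins ucn (kd.xi (FF n)) A / ins ucn (kd.xi (FF n)) B"
 have Bnz: "ins ucn (kd.xi (FF n)) B ~= 0" for n
 proof -
 obtain w where "w : coords U" "kd.xi (FF n) w ~= 0" using FFnz[of n] by blast
 hence "gpoint k U ucn (kd.xi (FF n))" by (rule kd.gpoint_xi[OF mor dom FF(1)])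
 from gpoint.gen[OF this AB(2,4)] show ?thesis using AB(5) by simp
 qed
 have un: "EX b. b ~= 0 & (ALL w:coords U. meval p0 (FF n w) = b * u n w)" for n
 proof -
 obtain w where w: "w : coords U" "meval p0 (FF n w) ~= 0" using FF(2) by blast
 have gp: "?g n : points k Z \<rightarrow> points k U" using mor[of n] by (simp add: morphism_mrep)
 obtain x b where x: "b ~= 0" "ALL w:coords U. meval p0 (FF n w) = b * x w" "?g n (ppt k p0) = ppt k x"
 by (rule mrep_scalar[OF U.kf gp FF(1) p0(1) w])
 have "ppt k x = ppt k (u n)" using x(3) u(2)[of n] p0(2) by simp
 then obtain a where "a ~= 0" "x = (%v. a * u n v)" by (rule proj_point_eqD[OF U.kf])
 thus ?thesis using x(1,2) by (intro exI[of _ "b * a"]) simp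
 qed
 \<comment> \<open>Equal values at the generic point amount to a polynomial identity on all of Z,
   which then holds at the starting point \<open>p0\<close>.\<close>
 have same: "meval (u n) A * meval (u n') B = meval (u n') A * meval (u n) B" if c: "?c n = ?c n'" for n n'
 proof -
 let ?P = "msubst (FF n) A * msubst (FF n') B - msubst (FF n') A * msubst (FF n) B"
 have M: "msubst (FF n) Q : MP k (coords Z)" if "Q : MP k (coords U)" for n Q by (rule kd.MP_msub[OF FF(1) that])
 have PM: "?P : MP k (coords Z)" by (intro srgD(4,6)[OF MP_srg[OF U.ks]] M AB)
 have "ins ucn ze ?P = 0" using c Bnz[of n] Bnz[of n']
 by (simp add: ins_ops(1)[OF ch] ins_mult[OF ch] flip: kd.ins_msub) (simp add: field_simps)
 hence z: "meval p0 ?P = 0" using kd.gen_k[OF PM] p0(1) by blast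
 obtain b where b: "b ~= 0" "ALL w:coords U. meval p0 (FF n w) = b * u n w" using un by blast
 obtain b' where b': "b' ~= 0" "ALL w:coords U. meval p0 (FF n' w) = b' * u n' w" using un by blast
 have v: "meval p0 (msubst (FF n) A) = b ^ e * meval (u n) A" "meval p0 (msubst (FF n) B) = b ^ e * meval (u n) B"
 "meval p0 (msubst (FF n') A) = b' ^ e * meval (u n') A" "meval p0 (msubst (FF n') B) = b' ^ e * meval (u n') B"
 unfolding meval_msubst using meval_scale[OF AB(1,3) b(2)] meval_scale[OF AB(2,4) b(2)] meval_scale[OF AB(1,3) b'(2)] meval_scale[OF AB(2,4) b'(2)] by auto
 have "(b ^ e * b' ^ e) * (meval (u n) A * meval (u n') B - meval (u n') A * meval (u n) B) = 0"
 using z unfolding meval_hom v by (simp add: algebra_simps)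
 thus ?thesis using b(1) b'(1) by simp
 qed
 have "EX H. H : MP k (coords U) & (EX e. hmg e H) & H ~: hom_ideal U & (ALL w:u ` {n. ?c n = c}. meval w H = 0)" for c
 proof (rule class_divisor[OF tr])
 show "u ` {n. ?c n = c} <= hv k U" using u(1) by blast
 show "ALL w:u ` {n. ?c n = c}. ALL w':u ` {n. ?c n = c}. meval w A * meval w' B = meval w' A * meval w B"
 proof (intro ballI)
 fix w w' assume "w : u ` {n. ?c n = c}" "w' : u ` {n. ?c n = c}"
 then obtain n n' where n: "w = u n" "w' = u n'" "?c n = c" "?c n' = c" by blast
 show "meval w A * meval w' B = meval w' A * meval w B" unfolding n(1,2) by (rule same) (simp only: n(3,4))
 qed
 qed
 then obtain H where H: "!!c. H c : MP k (coords U) & (EX e. hmg e (H c)) & H c ~: hom_ideal U & (ALL w:u ` {n. ?c n = c}. meval w (H c) = 0)"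
 using choice[of "%c H. H : MP k (coords U) & (EX e. hmg e H) & H ~: hom_ideal U & (ALL w:u ` {n. ?c n = c}. meval w H = 0)"] by blast
 show False
 proof (rule nodiv[of "range ?c" H, OF AB(7)])
 show "H c : MP k (coords U) & (EX e. hmg e (H c)) & H c ~: hom_ideal U" for c using H by blast
 show "EX c:range ?c. meval (u n) (H c) = 0" for n
 proof (rule bexI[of _ "?c n"])
 show "meval (u n) (H (?c n)) = 0" using H[of "?c n"] by blast
 qed simp
 qed
qed

end

section \<open>Points of a Segre product\<close>

context pvariety
begin

lemma hv_scale: assumes x: "x : hv k V" and c: "c : ka" "c ~= 0" shows "(%v. c * x v) : hv k V"
 unfolding hom_vectors_def
proof (intro CollectI conjI allI impI ballI)
 show "c * x v : ka" for v by (rule srgD(4)[OF kas(1) c(1) hvD(1)[OF x]])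
 show "c * x v = 0" if "v ~: N" for v using hvD(2)[OF x that] by simp
 show "EX v. c * x v ~= 0" using hvD(3)[OF x] c(2) by auto
 fix F assume F: "F : hom_ideal V"
 have "meval (%v. c * x v) F = (SUM e:mdeg ` kys F. meval (%v. c * x v) (hpt e F))" by (subst sum_hparts[of F]) (simp only: meval_hom)
 also have "\<dots> = 0"
 proof (rule sum.neutral, rule ballI)
 fix e
 have "meval (%v. c * x v) (hpt e F) = c ^ e * meval x (hpt e F)" unfolding meval_ins by (rule ins_hmg[OF hmg_hpart])
 thus "meval (%v. c * x v) (hpt e F) = 0" using hpart_vanish[OF F x] by simp
 qed
 finally show "meval (%v. c * x v) F = 0" .
qed

end

locale prodv = V: pvariety k V + W: pvariety k W
 for k :: "complex set" and V :: "'v proj_subscheme" and W :: "'w proj_subscheme" +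
 assumes ne: "hv k (product_variety k V W) ~= {}"
begin

abbreviation "ka \<equiv> kbar k"
abbreviation "Z \<equiv> product_variety k V W"
abbreviation "R \<equiv> mpoly_ring k (Inl ` coords V Un Inr ` coords W)"
abbreviation "S \<equiv> msubst (%v. mvar (Inl v)) ` hom_ideal V Un msubst (%w. mvar (Inr w)) ` hom_ideal W"
definition psi :: "'v \<times> 'w => ('v + 'w) mpoly" where "psi = (%(v, w). mvar (Inl v) * mvar (Inr w))"
definition tens :: "('v => complex) => ('w => complex) => 'v \<times> 'w => complex" where "tens x y = (%(v, w). x v * y w)"

lemma Z_coords: "coords Z = coords V \<times> coords W" by (simp add: product_variety_def)

lemma Z_ideal: "F : hom_ideal Z \<longleftrightarrow> F : MP k (coords V \<times> coords W) & msubst psi F : genideal R S"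
 by (simp add: product_variety_def psi_def)

lemma gen_ideal: "ideal (genideal R S) R" and S_gen: "S \<subseteq> genideal R S"
proof -
 have "S <= carrier R"
 proof (intro Un_least image_subsetI)
 show "msubst (%v. mvar (Inl v)) F : carrier R" if "F : hom_ideal V" for F
 by (rule MP_msubst[OF V.ks subsetD[OF V.IM that] MP_var[OF V.ks]]) blast
 show "msubst (%w. mvar (Inr w)) F : carrier R" if "F : hom_ideal W" for F
 by (rule MP_msubst[OF V.ks subsetD[OF W.IM that] MP_var[OF V.ks]]) blast
 qed
 thus "ideal (genideal R S) R" by (rule ring.genideal_ideal[OF mpoly_ring_ring[OF V.ks]])
 show "S <= genideal R S" unfolding genideal_def by blast
qed

lemma tens_hv: assumes x: "x : hv k V" and y: "y : hv k W" shows "tens x y : hv k Z"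
 unfolding hom_vectors_def
proof (intro CollectI conjI allI impI ballI)
 fix p show "tens x y p : ka" using srgD(4)[OF V.kas(1) hvD(1)[OF x] hvD(1)[OF y]] by (cases p) (simp add: tens_def)
 show "tens x y p = 0" if "p ~: coords Z" using that hvD(2)[OF x] hvD(2)[OF y] by (cases p) (auto simp: tens_def Z_coords)
next
 obtain v w where "x v ~= 0" "y w ~= 0" using hvD(3)[OF x] hvD(3)[OF y] by blast
 thus "EX p. tens x y p ~= 0" by (intro exI[of _ "(v, w)"]) (simp add: tens_def)
next
 fix F assume "F : hom_ideal Z"
 hence F: "F : MP k (coords V \<times> coords W)" "msubst psi F : genideal R S" by (auto simp: Z_ideal)
 let ?xy = "case_sum x y"
 have "S <= {G : carrier R. meval ?xy G = 0}"
 proof (intro Un_least image_subsetI CollectI conjI)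
 show "msubst (%v. mvar (Inl v)) P : carrier R" if "P : hom_ideal V" for P
 by (rule MP_msubst[OF V.ks subsetD[OF V.IM that] MP_var[OF V.ks]]) blast
 show "msubst (%w. mvar (Inr w)) P : carrier R" if "P : hom_ideal W" for P
 by (rule MP_msubst[OF V.ks subsetD[OF W.IM that] MP_var[OF V.ks]]) blast
 show "meval ?xy (msubst (%v. mvar (Inl v)) P) = 0" if "P : hom_ideal V" for P
 unfolding meval_msubst meval_hom using hvD(4)[OF x that] by simp
 show "meval ?xy (msubst (%w. mvar (Inr w)) P) = 0" if "P : hom_ideal W" for P
 unfolding meval_msubst meval_hom using hvD(4)[OF y that] by simp
 qed
 hence "meval ?xy (msubst psi F) = 0" using genidealD[OF F(2) vanishing_ideal[OF V.ks]] by blast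
 moreover have "(%p. meval ?xy (psi p)) = tens x y" by (auto simp: psi_def tens_def meval_hom fun_eq_iff)
 ultimately show "meval (tens x y) F = 0" unfolding meval_msubst by simp
qed

text \<open>The vector z is a matrix whose minors through a nonzero entry vanish. The column and the
  row through that entry give the two factors, the row being divided by the entry.\<close>

lemma hv_tens: assumes z: "z : hv k Z" shows "EX x:hom_vectors k V. EX y:hom_vectors k W. z = tens x y"
proof -
 note gD = mpoly_idealD[OF gen_ideal]
 obtain v0 w0 where vw: "v0 : coords V" "w0 : coords W" "z (v0, w0) ~= 0" using hvD(3)[OF z] by (auto simp: Z_coords)
 have zK: "z p : ka" for p by (rule hvD(1)[OF z])
 have z0: "z (v, w) = 0" if "v ~: coords V \<or> w ~: coords W" for v w by (rule hvD(2)[OF z]) (use that in \<open>auto simp: Z_coords\<close>)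
 have MV: "mvar (v, w) : MP k (coords V \<times> coords W)" if "v : coords V" "w : coords W" for v w by (rule MP_var[OF V.ks]) (use that in blast)
 have minor: "z (v, w) * z (v0, w0) = z (v, w0) * z (v0, w)" if v: "v : coords V" and w: "w : coords W" for v w
 proof -
 let ?P = "mvar (v, w) * mvar (v0, w0) - mvar (v, w0) * mvar (v0, w) :: ('v \<times> 'w) mpoly"
 have "msubst psi ?P = 0"
 unfolding msubst_ins by (simp add: ins_ops(1)[OF chom_mconst] ins_mult[OF chom_mconst] ins_var[OF chom_mconst] psi_def mult_ac)
 moreover have "?P : MP k (coords V \<times> coords W)" by (intro srgD(4,6)[OF MP_srg[OF V.ks]] MV v w vw)
 ultimately have "?P : hom_ideal Z" using gD(2) by (simp add: Z_ideal)
 hence "meval z ?P = 0" by (rule hvD(4)[OF z])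
 thus ?thesis by (simp add: meval_hom)
 qed
 define x where "x v = z (v, w0)" for v
 define y0 where "y0 w = z (v0, w)" for w
 define y where "y w = inverse (z (v0, w0)) * y0 w" for w
 have x: "x : hv k V"
 unfolding hom_vectors_def
 proof (intro CollectI conjI allI impI ballI)
 show "x v : ka" for v unfolding x_def by (rule zK)
 show "x v = 0" if "v ~: coords V" for v using z0 that by (simp add: x_def)
 show "EX v. x v ~= 0" using vw(3) by (auto simp: x_def)
 fix F assume F: "F : hom_ideal V"
 have "meval x (hpt e F) = 0" for e
 proof -
 let ?Q = "hpt e F" let ?F = "msubst (%v. mvar (v, w0)) ?Q"
 have QI: "?Q : hom_ideal V" using V.Ihom F by blast
 have FM: "?F : MP k (coords V \<times> coords W)" by (rule MP_msubst[OF V.ks subsetD[OF V.IM QI] MV[OF _ vw(2)]])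
 have "msubst psi ?F = ins mconst (%v. mvar (Inr w0) * mvar (Inl v)) ?Q"
 unfolding msubst_ins[of psi] ins_msubst[OF chom_mconst] by (simp add: ins_var[OF chom_mconst] psi_def mult.commute)
 also have "\<dots> = mvar (Inr w0) ^ e * msubst (%v. mvar (Inl v)) ?Q" unfolding msubst_ins by (rule ins_hmg[OF hmg_hpart])
 also have "\<dots> : genideal R S"
 by (rule gD(4)[OF srgD(7)[OF MP_srg[OF V.ks] MP_var[OF V.ks]]]) (use vw(2) QI S_gen in blast)+
 finally have "?F : hom_ideal Z" using FM by (simp add: Z_ideal)
 hence "meval z ?F = 0" by (rule hvD(4)[OF z])
 thus ?thesis unfolding meval_msubst meval_hom x_def .
 qed
 thus "meval x F = 0" by (subst sum_hparts[of F]) (simp add: meval_hom)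
 qed
 have y: "y : hv k W"
 unfolding hom_vectors_def
 proof (intro CollectI conjI allI impI ballI)
 show "y w : ka" for w unfolding y_def y0_def by (rule srgD(4)[OF V.kas(1) sfdD(2)[OF V.kas(2) zK] zK])
 show "y w = 0" if "w ~: coords W" for w using z0 that by (simp add: y_def y0_def)
 show "EX w. y w ~= 0" using vw(3) by (intro exI[of _ w0]) (simp add: y_def y0_def)
 fix F assume F: "F : hom_ideal W"
 have "meval y (hpt e F) = 0" for e
 proof -
 let ?Q = "hpt e F" let ?F = "msubst (%w. mvar (v0, w)) ?Q"
 have QI: "?Q : hom_ideal W" using W.Ihom F by blast
 have FM: "?F : MP k (coords V \<times> coords W)" by (rule MP_msubst[OF V.ks subsetD[OF W.IM QI] MV[OF vw(1)]])
 have "msubst psi ?F = ins mconst (%w. mvar (Inl v0) * mvar (Inr w)) ?Q"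
 unfolding msubst_ins[of psi] ins_msubst[OF chom_mconst] by (simp add: ins_var[OF chom_mconst] psi_def)
 also have "\<dots> = mvar (Inl v0) ^ e * msubst (%w. mvar (Inr w)) ?Q" unfolding msubst_ins by (rule ins_hmg[OF hmg_hpart])
 also have "\<dots> : genideal R S"
 by (rule gD(4)[OF srgD(7)[OF MP_srg[OF V.ks] MP_var[OF V.ks]]]) (use vw(1) QI S_gen in blast)+
 finally have "?F : hom_ideal Z" using FM by (simp add: Z_ideal)
 hence "meval z ?F = 0" by (rule hvD(4)[OF z])
 hence 0: "meval y0 ?Q = 0" unfolding meval_msubst meval_hom y0_def .
 have "meval y ?Q = inverse (z (v0, w0)) ^ e * meval y0 ?Q" unfolding meval_ins y_def by (rule ins_hmg[OF hmg_hpart])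
 thus ?thesis using 0 by simp
 qed
 thus "meval y F = 0" by (subst sum_hparts[of F]) (simp add: meval_hom)
 qed
 have "z (v, w) = x v * y w" for v w
 proof (cases "v : coords V & w : coords W")
 case True
 thus ?thesis using minor[of v w] vw(3) by (simp add: x_def y_def y0_def field_simps)
 next
 case False
 thus ?thesis using z0[of v w] z0[of v w0] z0[of v0 w] by (auto simp: x_def y_def y0_def)
 qed
 hence "z = tens x y" by (auto simp: tens_def fun_eq_iff)
 thus ?thesis using x y by blast
qed

text \<open>F vanishes on all scalar multiples of a point, by scaling the first tensor factor. As a
  polynomial in the scalar, whose coefficients are the values of the homogeneous parts, it vanishes
  at all nonzero constants and hence is 0.\<close>

lemma Z_hparts: assumes F: "F : hom_ideal Z" and z: "z : hv k Z" shows "meval z (hpt e F) = 0"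
proof -
 let ?E = "mdeg ` kys F"
 obtain x y where xy: "x : hv k V" "y : hv k W" "z = tens x y" using hv_tens[OF z] by blast
 define p where "p = (SUM e:?E. Polynomial.monom (meval z (hpt e F)) e)"
 have pc: "poly p c = 0" if c: "c : ka" "c ~= 0" for c
 proof -
 have "(%q. c * z q) = tens (%v. c * x v) y" by (auto simp: xy(3) tens_def fun_eq_iff)
 hence "(%q. c * z q) : hv k Z" using tens_hv[OF V.hv_scale[OF xy(1) c] xy(2)] by simp
 hence 0: "meval (%q. c * z q) F = 0" by (rule hvD(4)[OF _ F])
 have "meval (%q. c * z q) F = (SUM e:?E. meval (%q. c * z q) (hpt e F))" by (subst sum_hparts[of F]) (simp only: meval_hom)
 also have "\<dots> = (SUM e:?E. c ^ e * meval z (hpt e F))"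
 by (rule sum.cong[OF refl], unfold meval_ins, rule ins_hmg[OF hmg_hpart])
 also have "\<dots> = poly p c" by (simp add: p_def poly_sum poly_monom mult.commute)
 finally show ?thesis using 0 by simp
 qed
 have "p = 0"
 proof (rule ccontr)
 assume "p ~= 0"
 \<comment> \<open>The factor X excludes the scalar 0, for which the multiple is not a
   point.\<close>
 hence "[:0, 1:] * p ~= 0" by simp
 then obtain c where c: "c : ka" "poly ([:0, 1:] * p) c ~= 0" using acl_infinite[OF V.kaacl] by blast
 hence "c ~= 0" "poly p c ~= 0" by auto
 thus False using pc[OF c(1)] by blast
 qed
 hence 0: "cof p e = 0" by simp
 show ?thesis
 proof (cases "e : ?E")
 case True
 thus ?thesis using 0 by (simp add: p_def coeff_sum coeff_monom)
 next
 case False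
 have "hpt e F = 0"
 by (rule poly_mapping_eqI) (use False in \<open>auto simp: lookup_hpart in_keys_iff\<close>)
 thus ?thesis by (simp add: meval_hom)
 qed
qed

text \<open>With x1 and x2 held fixed, irreducibility of W over the algebraic closure gives one y
  that is good for both polynomials. With this y fixed, irreducibility of V gives a common
  x.\<close>

lemma Z_irreducible:
 assumes F: "F : MP ka (coords Z)" and G: "G : MP ka (coords Z)" and z: "z1 : hv k Z" "z2 : hv k Z"
 and nz: "meval z1 F ~= 0" "meval z2 G ~= 0"
 shows "EX z:hom_vectors k Z. meval z F ~= 0 & meval z G ~= 0"
proof -
 obtain x1 y1 where 1: "x1 : hv k V" "y1 : hv k W" "z1 = tens x1 y1" using hv_tens[OF z(1)] by blast
 obtain x2 y2 where 2: "x2 : hv k V" "y2 : hv k W" "z2 = tens x2 y2" using hv_tens[OF z(2)] by blast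
 define fw where "fw x H = msubst (%(v, w). mconst (x v) * mvar w) H" for x :: "'v => complex" and H :: "('v \<times> 'w) mpoly"
 define fv where "fv y H = msubst (%(v, w). mconst (y w) * mvar v) H" for y :: "'w => complex" and H :: "('v \<times> 'w) mpoly"
 have ew: "meval y (fw x H) = meval (tens x y) H" for x y H
 proof -
 have "(%p. meval y (case p of (v, w) => mconst (x v) * mvar w)) = tens x y" by (auto simp: fun_eq_iff tens_def meval_hom)
 thus ?thesis unfolding fw_def meval_msubst by simp
 qed
 have ev: "meval x (fv y H) = meval (tens x y) H" for x y H
 proof -
 have "(%p. meval x (case p of (v, w) => mconst (y w) * mvar v)) = tens x y" by (auto simp: fun_eq_iff tens_def meval_hom)
 thus ?thesis unfolding fv_def meval_msubst by simp
 qed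
 have Mw: "fw x H : MP ka (coords W)" if "x : hv k V" "H : MP ka (coords Z)" for x H
 unfolding fw_def
 proof (rule MP_msubst[OF V.kas(1) that(2)])
 fix p assume "p : coords Z"
 thus "(case p of (v, w) => mconst (x v) * mvar w) : MP ka (coords W)"
 by (cases p) (simp add: Z_coords MP_mult[OF V.kas(1) MP_const[OF hvD(1)[OF that(1)]] MP_var[OF V.kas(1)]])
 qed
 have Mv: "fv y H : MP ka (coords V)" if "y : hv k W" "H : MP ka (coords Z)" for y H
 unfolding fv_def
 proof (rule MP_msubst[OF V.kas(1) that(2)])
 fix p assume "p : coords Z"
 thus "(case p of (v, w) => mconst (y w) * mvar v) : MP ka (coords V)"
 by (cases p) (simp add: Z_coords MP_mult[OF V.kas(1) MP_const[OF hvD(1)[OF that(1)]] MP_var[OF V.kas(1)]])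
 qed
 have "meval y1 (fw x1 F) ~= 0" "meval y2 (fw x2 G) ~= 0" using nz 1(3) 2(3) by (simp_all add: ew)
 then obtain y where y: "y : hv k W" "meval y (fw x1 F) ~= 0" "meval y (fw x2 G) ~= 0"
 using W.irreducible[OF Mw[OF 1(1) F] 1(2) _ Mw[OF 2(1) G] 2(2)] by blast
 have "meval x1 (fv y F) ~= 0" "meval x2 (fv y G) ~= 0" using y(2,3) by (simp_all add: ew ev)
 then obtain x where x: "x : hv k V" "meval x (fv y F) ~= 0" "meval x (fv y G) ~= 0"
 using V.irreducible[OF Mv[OF y(1) F] 1(1) _ Mv[OF y(1) G] 2(1)] by blast
 hence "meval (tens x y) F ~= 0" "meval (tens x y) G ~= 0" by (simp_all add: ev)
 thus ?thesis using tens_hv[OF x(1) y(1)] by blast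
qed

definition pV where "pV z = (SOME x. x : hv k V & (EX y:hom_vectors k W. z = tens x y))"
definition pW where "pW z = (SOME y. y : hv k W & (EX x:hom_vectors k V. z = tens x y))"

lemma pV: assumes "z : hv k Z" shows "pV z : hv k V & (EX y:hom_vectors k W. z = tens (pV z) y)"
proof -
 have "EX x. x : hv k V & (EX y:hom_vectors k W. z = tens x y)" using hv_tens[OF assms] by blast
 thus ?thesis unfolding pV_def by (rule someI_ex)
qed

lemma pW: assumes "z : hv k Z" shows "pW z : hv k W & (EX x:hom_vectors k V. z = tens x (pW z))"
proof -
 have "EX y. y : hv k W & (EX x:hom_vectors k V. z = tens x y)" using hv_tens[OF assms] by blast
 thus ?thesis unfolding pW_def by (rule someI_ex)
qed

lemma IZ: "hom_ideal Z \<subseteq> MP k (coords Z)" using Z_ideal Z_coords by auto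

lemma finZ: "finite (coords Z)" using V.finN W.finN by (simp add: Z_coords)

lemma neV: "hv k V ~= {}" "hv k W ~= {}" using ne pV pW by blast+

lemma nz_coord: assumes "z : hv k Z" obtains v w where "v : coords V" "w : coords W" "z (v, w) ~= 0"
 using hvD(3)[OF assms] unfolding Z_coords by blast

lemma cprojV: "cproj k Z V (coords W) (%w v. (v, w)) pV"
proof (unfold_locales)
 show "EX z:hom_vectors k Z. meval z F ~= 0 & meval z G ~= 0" if "F : MP ka (coords Z)" "G : MP ka (coords Z)" "z1 : hv k Z" "z2 : hv k Z"
 "meval z1 F ~= 0" "meval z2 G ~= 0" for F G z1 z2 by (rule Z_irreducible[OF that])
 show "(v, w) : coords Z" if "w : coords W" "v : coords V" for v w using that by (simp add: Z_coords)
 fix z assume z: "z : hv k Z"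
 show "pV z : hv k V" using pV[OF z] by blast
 show "EX a:ka. ALL v:coords V. z (v, w) = a * pV z v" for w
 proof -
 obtain y where y: "y : hv k W" "z = tens (pV z) y" using pV[OF z] by blast
 have "z (v, w) = y w * pV z v" for v using fun_cong[OF y(2), of "(v, w)"] by (simp add: tens_def)
 thus ?thesis using hvD(1)[OF y(1)] by blast
 qed
 show "EX w:coords W. EX v:coords V. z (v, w) ~= 0" by (rule nz_coord[OF z]) blast
next
 fix x assume x: "x : hv k V"
 obtain y where y: "y : hv k W" using neV by blast
 let ?z = "tens x y"
 have z: "?z : hv k Z" by (rule tens_hv[OF x y])
 obtain y' where y': "?z = tens (pV ?z) y'" using pV[OF z] by blast
 obtain w where w: "y w ~= 0" using hvD(3)[OF y] by blast
 have "x v = (y' w / y w) * pV ?z v" for v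
 proof -
 have "x v * y w = pV ?z v * y' w" using fun_cong[OF y', of "(v, w)"] by (simp add: tens_def)
 thus ?thesis using w by (simp add: field_simps)
 qed
 thus "EX z:hom_vectors k Z. EX a. ALL v:coords V. x v = a * pV z v" using z by blast
qed (rule finZ IZ Z_hparts; assumption)+

lemma cprojW: "cproj k Z W (coords V) (%v w. (v, w)) pW"
proof (unfold_locales)
 show "EX z:hom_vectors k Z. meval z F ~= 0 & meval z G ~= 0" if "F : MP ka (coords Z)" "G : MP ka (coords Z)" "z1 : hv k Z" "z2 : hv k Z"
 "meval z1 F ~= 0" "meval z2 G ~= 0" for F G z1 z2 by (rule Z_irreducible[OF that])
 show "(v, w) : coords Z" if "v : coords V" "w : coords W" for v w using that by (simp add: Z_coords)
 fix z assume z: "z : hv k Z"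
 show "pW z : hv k W" using pW[OF z] by blast
 show "EX a:ka. ALL w:coords W. z (v, w) = a * pW z w" for v
 proof -
 obtain x where x: "x : hv k V" "z = tens x (pW z)" using pW[OF z] by blast
 have "z (v, w) = x v * pW z w" for w using fun_cong[OF x(2), of "(v, w)"] by (simp add: tens_def)
 thus ?thesis using hvD(1)[OF x(1)] by blast
 qed
 show "EX v:coords V. EX w:coords W. z (v, w) ~= 0" by (rule nz_coord[OF z]) blast
next
 fix y assume y: "y : hv k W"
 obtain x where x: "x : hv k V" using neV by blast
 let ?z = "tens x y"
 have z: "?z : hv k Z" by (rule tens_hv[OF x y])
 obtain x' where x': "?z = tens x' (pW ?z)" using pW[OF z] by blast
 obtain v where v: "x v ~= 0" using hvD(3)[OF x] by blast
 have "y w = (x' v / x v) * pW ?z w" for w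
 proof -
 have "x v * y w = x' v * pW ?z w" using fun_cong[OF x', of "(v, w)"] by (simp add: tens_def)
 thus ?thesis using v by (simp add: field_simps)
 qed
 thus "EX z:hom_vectors k Z. EX a. ALL w:coords W. y w = a * pW z w" using z by blast
qed (rule finZ IZ Z_hparts; assumption)+

end

theorem theorem1p4:
  fixes k :: "complex set"
    and V :: "'v proj_subscheme" and W :: "'w proj_subscheme"
    and f :: "('v \<times> 'w \<Rightarrow> complex) set \<Rightarrow> ('v \<times> 'w \<Rightarrow> complex) set"
    and P :: "('v \<times> 'w \<Rightarrow> complex) set"
  assumes "subfield k (ring_of_type_algebra :: complex ring)"
    and "projective_variety k V" and "smooth_variety k V" and "variety_dim k V \<ge> 1"
    and "projective_variety k W" and "smooth_variety k W" and "variety_dim k W \<ge> 1"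
    and "morphism_over k (product_variety k V W) (product_variety k V W) f"
    and "general_type k V \<or> general_type k W"
    and "P \<in> points k (product_variety k V W)"
  shows "zariski k (product_variety k V W) closure_of (forward_orbit f P)
           \<noteq> points k (product_variety k V W)"
proof -
 have k: "sfd k" by (rule subfield_sfd[OF assms(1)])
 have "hv k (product_variety k V W) ~= {}" using assms(10) unfolding points_def by blast
 then interpret prodv k V W by unfold_locales (rule k assms)+
 from assms(9) show ?thesis
 proof
 assume "general_type k V"
 thus ?thesis by (rule cproj.orbit_not_dense[OF cprojV _ assms(4,8,10)])
 next
 assume "general_type k W"
 thus ?thesis by (rule cproj.orbit_not_dense[OF cprojW _ assms(7,8,10)])
 qed
qed

end
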